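(* Let $\Omega$ be a bounded open subset of $\mathbb{R}^2$ such that $|\partial\Omega|=0$. Let $\omega_n$, $n\in\mathbb{N}$, be a sequence of open subsets of $\Omega$ with characteristic functions $\chi_n$. Assume that $\theta_n:=|\omega_n|$ satisfies $0<\theta_n<1$, that $\theta_n\to 0$, and that $$\frac{\chi_n}{\theta_n}\rightharpoonup a\in L^\infty(\Omega)\quad\text{weakly-}*\text{ in }\mathcal{M}(\Omega).$$ Let $h\in\mathbb{R}$, and consider the conductivity $$\sigma_n(h)=(1-\chi_n)\,\sigma_1(h)+\frac{\chi_n}{\theta_n}\,\sigma_2(h),$$ where, for $j=1,2$, $\sigma_j(h)=\alpha_j I_2+h\beta_j J\in\mathbb{R}^{2\times2}$ with $\alpha_1,\alpha_2>0$ and $(\beta_1,\beta_2)\in\mathbb{R}^2$, $(\beta_1,\beta_2)\neq(0,0)$. Then there exist a subsequence of $n$, still denoted by $n$, and a locally Lipschitz function $$\sigma_*^0:(0,\infty)^2\longrightarrow\mathcal{M}\Big(\min(\alpha_1,\alpha_2),\,2\big(|\sigma_1|+|\sigma_2|\,\|a\|_\infty\big);\Omega\Big),$$ where $|\sigma_j|$ stands for $|\sigma_j(h)|$ and $\sigma_*^0$ is the homogenized conductivity in the absence of a magnetic field (as defined in the context, along this subsequence), such that $$\sigma_n(h)\ \text{ $H(\mathcal{M}(\Omega)^2)$-converges to }\ \sigma_*^0\big(\alpha_1,\ \alpha_2+\alpha_2^{-1}\beta_2^2h^2\big)+h\beta_1 J .$$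
   Context: $I_2$ is the $2\times2$ unit matrix and $J=\begin{pmatrix}0&-1\\1&0\end{pmatrix}$. $|E|$ denotes the Lebesgue measure of a set $E$; for a matrix, $|\cdot|$ denotes the norm subordinate to the Euclidean norm. $\|a\|_\infty$ is the $L^\infty(\Omega)$ norm of $a$. $\mathcal{M}(\Omega)$ is the space of Radon measures on $\Omega$; $L^1$ functions are identified with measures. For $\alpha,\beta>0$, $\mathcal{M}(\alpha,\beta;\Omega)$ is the set of invertible matrix-valued functions $A:\Omega\to\mathbb{R}^{2\times2}$ (not necessarily symmetric) with $A(x)\xi\cdot\xi\ge\alpha|\xi|^2$ and $A^{-1}(x)\xi\cdot\xi\ge\beta^{-1}|\xi|^2$ for all $\xi\in\mathbb{R}^2$, a.e. in $\Omega$. $H(\mathcal{M}(\Omega)^2)$-convergence: let $\alpha_n\le\beta_n$ be two sequences of positive numbers and $A_n\in\mathcal{M}(\alpha_n,\beta_n;\Omega)$. The sequence $A_n$ is said to $H(\mathcal{M}(\Omega)^2)$-converge to the matrix-valued function $A_*$ if for every $f\in H^{-1}(\Omega)$ the solution $u_n$ of $\operatorname{div}(A_n\nabla u_n)=f$ in $\Omega$, $u_n=0$ on $\partial\Omega$, satisfies $u_n\rightharpoonup u$ weakly in $H^1_0(\Omega)$ and $A_n\nabla u_n\rightharpoonup A_*\nabla u$ weakly-$*$ in $\mathcal{M}(\Omega)^2$, where $u$ is the solution of $\operatorname{div}(A_*\nabla u)=f$ in $\Omega$, $u=0$ on $\partial\Omega$. Homogenized conductivity in the absence of a magnetic field: for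 positive sequences $\gamma_{1,n},\gamma_{2,n}$ put $\sigma_n^0(\gamma_{1,n},\gamma_{2,n}):=(1-\chi_n)\gamma_{1,n}I_2+\chi_n\gamma_{2,n}I_2$. If $\gamma_{1,n}\to\gamma_1>0$ and $|\omega_n|\gamma_{2,n}\to\gamma_2>0$, the $H(\mathcal{M}(\Omega)^2)$-limit of $\sigma_n^0(\gamma_{1,n},\gamma_{2,n})$ is denoted by $\sigma_*^0(\gamma_1,\gamma_2)$. The local Lipschitz property of $\sigma_*^0$ is with respect to the $L^1(\Omega)^{2\times2}$ norm on values.
   Formalization: The codomain is read pointwise: at (γ₁,γ₂) the value lies in the displayed class with α_j replaced by γ_j (also in σ_j); one fixed class for all of (0,∞)² is impossible because σ_*^0(tγ)=tσ_*^0(γ). *)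

theory Defs
  imports "HOL-Analysis.Analysis" "HOL-Probability.Essential_Supremum"
begin

type_synonym plane = "real^2"
type_synonym mat2 = "real^2^2"

definition Jmat :: mat2 where
  "Jmat = vector [vector [0, -1], vector [1, 0]]"

text \<open>\<open>sigma_h h \<alpha> \<beta>\<close> is the matrix \<open>\<alpha> I\<^sub>2 + h \<beta> J\<close>.\<close>

definition sigma_h :: "real \<Rightarrow> real \<Rightarrow> real \<Rightarrow> mat2" where
  "sigma_h h \<alpha> \<beta> = \<alpha> *\<^sub>R mat 1 + (h * \<beta>) *\<^sub>R Jmat"

definition mat_norm :: "mat2 \<Rightarrow> real" where
  "mat_norm A = onorm (\<lambda>v. A *v v)"


section \<open>Function spaces on an open subset of the plane\<close>

text \<open>
  All functions are total on the plane; elements of the spaces below only matter through their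
  restriction to \<open>\<Omega>\<close>, up to equality almost everywhere. Test functions are the exception:
  they are genuinely defined on the whole plane, extended by \<open>0\<close> outside \<open>\<Omega>\<close>.
\<close>

definition compact_supp_in :: "plane set \<Rightarrow> (plane \<Rightarrow> real) \<Rightarrow> bool" where
  "compact_supp_in \<Omega> \<phi> \<longleftrightarrow> compact (closure {x. \<phi> x \<noteq> 0}) \<and> closure {x. \<phi> x \<noteq> 0} \<subseteq> \<Omega>"

definition Cc :: "plane set \<Rightarrow> (plane \<Rightarrow> real) set" where
  "Cc \<Omega> = {\<phi>. continuous_on UNIV \<phi> \<and> compact_supp_in \<Omega> \<phi>}"

definition cgrad :: "(plane \<Rightarrow> real) \<Rightarrow> plane \<Rightarrow> plane" where
  "cgrad \<phi> x = (\<chi> i. frechet_derivative \<phi> (at x) (axis i 1))"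

primrec Ck :: "nat \<Rightarrow> (plane \<Rightarrow> real) \<Rightarrow> bool" where
  "Ck 0 \<phi> \<longleftrightarrow> continuous_on UNIV \<phi>"
| "Ck (Suc k) \<phi> \<longleftrightarrow> (\<forall>x. \<phi> differentiable (at x)) \<and> (\<forall>i. Ck k (\<lambda>x. cgrad \<phi> x $ i))"

definition Ccinf :: "plane set \<Rightarrow> (plane \<Rightarrow> real) set" where
  "Ccinf \<Omega> = {\<phi>. (\<forall>k. Ck k \<phi>) \<and> compact_supp_in \<Omega> \<phi>}"

definition L2 :: "plane set \<Rightarrow> (plane \<Rightarrow> 'b::euclidean_space) set" where
  "L2 \<Omega> = {u. u \<in> borel_measurable (lebesgue_on \<Omega>) \<and>
              integrable (lebesgue_on \<Omega>) (\<lambda>x. (norm (u x))\<^sup>2)}"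

definition is_weak_grad :: "plane set \<Rightarrow> (plane \<Rightarrow> real) \<Rightarrow> (plane \<Rightarrow> plane) \<Rightarrow> bool" where
  "is_weak_grad \<Omega> u G \<longleftrightarrow>
     (\<forall>\<phi>\<in>Ccinf \<Omega>. \<forall>i. (\<integral>x. u x * cgrad \<phi> x $ i \<partial>(lebesgue_on \<Omega>))
                        = - (\<integral>x. G x $ i * \<phi> x \<partial>(lebesgue_on \<Omega>)))"

definition H1 :: "plane set \<Rightarrow> (plane \<Rightarrow> real) set" where
  "H1 \<Omega> = {u \<in> L2 \<Omega>. \<exists>G \<in> L2 \<Omega>. is_weak_grad \<Omega> u G}"

text \<open>The square-integrable weak gradient is unique only up to a null set; \<open>wgrad\<close>
  selects one representative.\<close>

definition wgrad :: "plane set \<Rightarrow> (plane \<Rightarrow> real) \<Rightarrow> plane \<Rightarrow> plane" where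
  "wgrad \<Omega> u = (SOME G. G \<in> L2 \<Omega> \<and> is_weak_grad \<Omega> u G)"

definition H1_norm :: "plane set \<Rightarrow> (plane \<Rightarrow> real) \<Rightarrow> real" where
  "H1_norm \<Omega> u = sqrt ((\<integral>x. (u x)\<^sup>2 \<partial>(lebesgue_on \<Omega>))
                      + (\<integral>x. (norm (wgrad \<Omega> u x))\<^sup>2 \<partial>(lebesgue_on \<Omega>)))"

definition H10 :: "plane set \<Rightarrow> (plane \<Rightarrow> real) set" where
  "H10 \<Omega> = {u \<in> H1 \<Omega>. \<exists>\<phi>. (\<forall>k::nat. \<phi> k \<in> Ccinf \<Omega>) \<and>
                       (\<lambda>k. H1_norm \<Omega> (\<lambda>x. u x - \<phi> k x)) \<longlonglongrightarrow> 0}"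

text \<open>The dual of \<open>H10 \<Omega>\<close>. Linearity and boundedness force a functional to take equal values
  on functions that agree almost everywhere.\<close>

definition Hm1 :: "plane set \<Rightarrow> ((plane \<Rightarrow> real) \<Rightarrow> real) set" where
  "Hm1 \<Omega> = {f. (\<forall>u\<in>H10 \<Omega>. \<forall>v\<in>H10 \<Omega>. \<forall>c d. f (\<lambda>x. c * u x + d * v x) = c * f u + d * f v) \<and>
               (\<exists>C. \<forall>v\<in>H10 \<Omega>. \<bar>f v\<bar> \<le> C * H1_norm \<Omega> v)}"

definition weak_conv_H10 :: "plane set \<Rightarrow> (nat \<Rightarrow> plane \<Rightarrow> real) \<Rightarrow> (plane \<Rightarrow> real) \<Rightarrow> bool" where
  "weak_conv_H10 \<Omega> U u \<longleftrightarrow> (\<forall>n. U n \<in> H10 \<Omega>) \<and> u \<in> H10 \<Omega> \<and>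
     (\<forall>f\<in>Hm1 \<Omega>. (\<lambda>n. f (U n)) \<longlonglongrightarrow> f u)"

text \<open>
  Weak-* convergence in the space of Radon measures (the dual of \<open>Cc \<Omega>\<close>), or in its square when
  \<open>'b\<close> is the plane, for measures that have an integrable density with respect to the Lebesgue
  measure; such a measure is identified with its density.
\<close>

definition weakstar_conv_M ::
    "plane set \<Rightarrow> (nat \<Rightarrow> plane \<Rightarrow> 'b::euclidean_space) \<Rightarrow> (plane \<Rightarrow> 'b) \<Rightarrow> bool" where
  "weakstar_conv_M \<Omega> F g \<longleftrightarrow>
     (\<forall>n. integrable (lebesgue_on \<Omega>) (F n)) \<and> integrable (lebesgue_on \<Omega>) g \<and>
     (\<forall>\<phi>\<in>Cc \<Omega>. (\<lambda>n. \<integral>x. \<phi> x *\<^sub>R F n x \<partial>(lebesgue_on \<Omega>))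
                  \<longlonglongrightarrow> (\<integral>x. \<phi> x *\<^sub>R g x \<partial>(lebesgue_on \<Omega>)))"

definition Linf :: "plane set \<Rightarrow> (plane \<Rightarrow> real) set" where
  "Linf \<Omega> = {a. a \<in> borel_measurable (lebesgue_on \<Omega>) \<and>
                esssup (lebesgue_on \<Omega>) (\<lambda>x. ereal \<bar>a x\<bar>) < \<infinity>}"

definition Linf_norm :: "plane set \<Rightarrow> (plane \<Rightarrow> real) \<Rightarrow> real" where
  "Linf_norm \<Omega> a = real_of_ereal (esssup (lebesgue_on \<Omega>) (\<lambda>x. ereal \<bar>a x\<bar>))"


section \<open>Homogenization\<close>

definition M_class :: "real \<Rightarrow> real \<Rightarrow> plane set \<Rightarrow> (plane \<Rightarrow> mat2) set" where
  "M_class \<alpha> \<beta> \<Omega> = {A. A \<in> borel_measurable (lebesgue_on \<Omega>) \<and>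
     (AE x in lebesgue_on \<Omega>. invertible (A x) \<and>
        (\<forall>\<xi>. (A x *v \<xi>) \<bullet> \<xi> \<ge> \<alpha> * (norm \<xi>)\<^sup>2 \<and>
             (matrix_inv (A x) *v \<xi>) \<bullet> \<xi> \<ge> inverse \<beta> * (norm \<xi>)\<^sup>2))}"

text \<open>Weak form of \<open>div (A \<nabla>u) = f\<close> in \<open>\<Omega>\<close>, \<open>u = 0\<close> on the boundary; integration by parts
  accounts for the sign in front of \<open>f\<close>.\<close>

definition solves :: "plane set \<Rightarrow> (plane \<Rightarrow> mat2) \<Rightarrow> ((plane \<Rightarrow> real) \<Rightarrow> real) \<Rightarrow> (plane \<Rightarrow> real) \<Rightarrow> bool"
  where
  "solves \<Omega> A f u \<longleftrightarrow> u \<in> H10 \<Omega> \<and>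
     (\<forall>v\<in>H10 \<Omega>.
        integrable (lebesgue_on \<Omega>) (\<lambda>x. (A x *v wgrad \<Omega> u x) \<bullet> wgrad \<Omega> v x) \<and>
        (\<integral>x. (A x *v wgrad \<Omega> u x) \<bullet> wgrad \<Omega> v x \<partial>(lebesgue_on \<Omega>)) = - f v)"

definition is_the_solution ::
    "plane set \<Rightarrow> (plane \<Rightarrow> mat2) \<Rightarrow> ((plane \<Rightarrow> real) \<Rightarrow> real) \<Rightarrow> (plane \<Rightarrow> real) \<Rightarrow> bool" where
  "is_the_solution \<Omega> A f u \<longleftrightarrow> solves \<Omega> A f u \<and>
     (\<forall>v. solves \<Omega> A f v \<longrightarrow> (AE x in lebesgue_on \<Omega>. v x = u x))"

definition H_converges :: "plane set \<Rightarrow> (nat \<Rightarrow> plane \<Rightarrow> mat2) \<Rightarrow> (plane \<Rightarrow> mat2) \<Rightarrow> bool" where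
  "H_converges \<Omega> A Astar \<longleftrightarrow>
     (\<exists>\<alpha> \<beta> :: nat \<Rightarrow> real. \<forall>n. 0 < \<alpha> n \<and> \<alpha> n \<le> \<beta> n \<and> A n \<in> M_class (\<alpha> n) (\<beta> n) \<Omega>) \<and>
     (\<forall>f\<in>Hm1 \<Omega>. \<exists>U u.
        (\<forall>n. is_the_solution \<Omega> (A n) f (U n)) \<and> is_the_solution \<Omega> Astar f u \<and>
        weak_conv_H10 \<Omega> U u \<and>
        weakstar_conv_M \<Omega> (\<lambda>n x. A n x *v wgrad \<Omega> (U n) x) (\<lambda>x. Astar x *v wgrad \<Omega> u x))"

definition two_phase :: "plane set \<Rightarrow> mat2 \<Rightarrow> mat2 \<Rightarrow> plane \<Rightarrow> mat2" where
  "two_phase w S\<^sub>1 S\<^sub>2 x = (1 - indicator w x) *\<^sub>R S\<^sub>1 + indicator w x *\<^sub>R S\<^sub>2"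

text \<open>\<open>s\<close> is the homogenized conductivity in the absence of a magnetic field associated with
  the whole sequence of inclusions \<open>w\<close>.\<close>

definition homogenized_conductivity_0 ::
    "plane set \<Rightarrow> (nat \<Rightarrow> plane set) \<Rightarrow> (real \<times> real \<Rightarrow> plane \<Rightarrow> mat2) \<Rightarrow> bool" where
  "homogenized_conductivity_0 \<Omega> w s \<longleftrightarrow>
     (\<forall>\<gamma>\<^sub>1 > 0. \<forall>\<gamma>\<^sub>2 > 0. \<forall>g\<^sub>1 g\<^sub>2 :: nat \<Rightarrow> real.
        (\<forall>n. 0 < g\<^sub>1 n \<and> 0 < g\<^sub>2 n) \<and> g\<^sub>1 \<longlonglongrightarrow> \<gamma>\<^sub>1 \<and> (\<lambda>n. measure lebesgue (w n) * g\<^sub>2 n) \<longlonglongrightarrow> \<gamma>\<^sub>2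
        \<longrightarrow> H_converges \<Omega> (\<lambda>n. two_phase (w n) (g\<^sub>1 n *\<^sub>R mat 1) (g\<^sub>2 n *\<^sub>R mat 1)) (s (\<gamma>\<^sub>1, \<gamma>\<^sub>2)))"

definition locally_Lipschitz_L1 :: "plane set \<Rightarrow> (real \<times> real \<Rightarrow> plane \<Rightarrow> mat2) \<Rightarrow> bool" where
  "locally_Lipschitz_L1 \<Omega> s \<longleftrightarrow>
     (\<forall>p \<in> {0<..} \<times> {0<..}. integrable (lebesgue_on \<Omega>) (s p)) \<and>
     (\<forall>p \<in> {0<..} \<times> {0<..}. \<exists>r>0. \<exists>L.
        \<forall>q \<in> ball p r \<inter> ({0<..} \<times> {0<..}). \<forall>q' \<in> ball p r \<inter> ({0<..} \<times> {0<..}).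
          (\<integral>x. mat_norm (s q x - s q' x) \<partial>(lebesgue_on \<Omega>)) \<le> L * dist q q')"

end

theory Submission
  imports Defs "HOL-Library.Diagonal_Subsequence"
begin

text \<open>
Gradients of \<open>H\<^sup>1\<^sub>0\<close> functions form a closed subspace of \<open>L\<^sup>2\<close>, on which the boundary value
problems are solved by Lax-Milgram. In the limit of vanishing inclusions the conductivities are not
bounded in \<open>L\<^sup>\<infinity>\<close>, but they are bounded in \<open>L\<^sup>1\<close> on every small square by its area. Divergence-free
fields whose energy with respect to the inverse conductivity is bounded are therefore bounded in
\<open>L\<^sup>1\<close>; their stream functions satisfy an \<open>L\<^sup>1\<close>-\<open>L\<^sup>2\<close> Poincare inequality on squares, and summation over a
fine grid yields a div-curl lemma for such fields and weakly convergent gradients. Tested with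
correctors, it identifies the limit of the scalar problems, first along a diagonal subsequence for
countably many conductivities and then for all of them by a Lipschitz estimate.

For the magnetic field, the constant \<open>h \<beta>\<^sub>1 J\<close> drops out of the equation, so the host phase may
be taken scalar. If \<open>U\<close> is the gradient of the solution, \<open>D\<close> its flux and \<open>div D = div F\<close>, then
\<open>P = U + t J (D - F)\<close> is again curl-free. With \<open>t\<close> chosen so that the antisymmetric part of the
inclusions cancels, \<open>D\<close> is up to a small error the flux of \<open>P\<close> for the scalar problem in which
\<open>\<alpha>\<^sub>2\<close> is replaced by \<open>\<alpha>\<^sub>2 + \<beta>\<^sub>2\<^sup>2 h\<^sup>2 / \<alpha>\<^sub>2\<close>, and \<open>P - U\<close> tends to zero because \<open>t\<close> does.
\<close>

text \<open>The fluxes are bounded in L^1 only and carry mass on sets of vanishing area, so the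
  classical div-curl lemma is out of reach. What saves it is that \<open>a\<close> is bounded: on a
  fixed square of side t the conductivity has mass at most C t^2 once n is large, so by
  Cauchy-Schwarz the squared L^1 mass of a flux on a cell is at most C t^2 times its energy there.
  Replacing the stream function by a constant on each of N^2 cells costs O(1/N) in total, and the
  finitely many remaining cell averages vanish by weak convergence.

  The value of t comes from inverting the inclusion phase. If D = q U + b J U, then U = (q D - b J
  D) / (q^2 + b^2), so t = b / (q^2 + b^2) gives U + t J D = q / (q^2 + b^2) D: the inclusions act
  like the scalar q + b^2 / q. As \<theta> q tends to \<alpha>2 and \<theta> b to h \<beta>2, this
  scalar is of order 1 / \<theta> with the stated factor, and t = O(\<theta>). The term t J F is
  subtracted because only D - F is divergence-free; that a quarter turn makes such a field curl-free
  is special to dimension two.\<close>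

notation (input) scaleR (infixr "*R" 75)

abbreviation (input) limseq :: "(nat => 'a::topological_space) => 'a => bool" (infix "---->" 60) where
 "x ----> l == (x \<longlongrightarrow> l) sequentially"

lemmas lint_cong = Bochner_Integration.integral_cong and lint_bound = Bochner_Integration.integrable_bound

section \<open>Hilbert spaces\<close>

definition weak_conv :: "(nat => 'a::real_inner) => 'a => bool" where
 "weak_conv x l = (ALL v. (%n. x n \<bullet> v) ----> l \<bullet> v)"

lemma weak_convD: "weak_conv x l ==> (%n. x n \<bullet> v) ----> l \<bullet> v"
 by (simp add: weak_conv_def)

lemma weak_conv_subseq: "weak_conv x l ==> strict_mono r ==> weak_conv (%n. x (r n)) l"
 unfolding weak_conv_def using LIMSEQ_subseq_LIMSEQ[of _ _ r] by (auto simp: o_def)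

lemma weak_conv_add: "weak_conv x l ==> weak_conv y m ==> weak_conv (%n. x n + y n) (l + m)"
 unfolding weak_conv_def by (auto simp: inner_add_left intro!: tendsto_add)

lemma weak_conv_diff: "weak_conv x l ==> weak_conv y m ==> weak_conv (%n. x n - y n) (l - m)"
 unfolding weak_conv_def by (auto simp: inner_diff_left intro!: tendsto_diff)

lemma weak_conv_scaleR: "weak_conv x l ==> weak_conv (%n. c *R x n) (c *R l)"
 unfolding weak_conv_def by (auto intro!: tendsto_mult_left)

lemma weak_conv_const: "weak_conv (%n. l) l"
 unfolding weak_conv_def by auto

lemma weak_conv_strong:
 assumes "(%n. norm (x n - y n)) ----> 0" "weak_conv y l"
 shows "weak_conv x l"
proof -
 have "(%n. x n - y n) ----> 0" using assms(1) by (simp add: tendsto_norm_zero_iff)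
 then have "weak_conv (%n. x n - y n) 0"
  unfolding weak_conv_def using tendsto_inner[OF _ tendsto_const, of _ 0] by auto
 from weak_conv_add[OF this assms(2)] show ?thesis by simp
qed

section \<open>Closed subspaces, the Riesz representation, Lax-Milgram\<close>

lemma subspace_closure_gen:
 fixes S :: "'a::real_normed_vector set"
 assumes "subspace S" shows "subspace (closure S)"
proof -
 have "0 : closure S" using assms closure_subset subspace_0 by blast
 moreover have "x + y : closure S" if xy: "x : closure S" "y : closure S" for x y
 proof -
  obtain f g where "!!n. f n : S" "f ----> x" "!!n. g n : S" "g ----> y"
   using xy unfolding closure_sequential by blast
  then show ?thesis unfolding closure_sequential
   by (intro exI[of _ "%n. f n + g n"]) (auto intro: tendsto_add subspace_add[OF assms])
 qed
 moreover have "c *R x : closure S" if x: "x : closure S" for x c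
 proof -
  obtain f where "!!n. f n : S" "f ----> x"
   using x unfolding closure_sequential by blast
  then show ?thesis unfolding closure_sequential
   by (intro exI[of _ "%n. c *R f n"]) (auto intro: tendsto_intros subspace_scale[OF assms])
 qed
 ultimately show ?thesis unfolding subspace_def by auto
qed

text \<open>The representing vector is the limit of a minimizing sequence of
 \<open>v \<mapsto> |v|\<^sup>2 / 2 - f v\<close>; the subspace need not be closed.\<close>

lemma riesz_subspace:
 fixes f :: "'a::{real_inner,complete_space} => real"
 assumes S: "subspace S"
  and lin: "!!u v c d. u : S ==> v : S ==> f (c *R u + d *R v) = c * f u + d * f v"
  and bd: "!!v. v : S ==> (abs (f v)) <= C * norm v"
 obtains F where "F : closure S" "!!v. v : S ==> f v = F \<bullet> v"
proof -
 define J where "J v = (norm v)^2 / 2 - f v" for v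
 have low: "J v >= - C\<^sup>2 / 2" if "v : S" for v
 proof -
  have "f v <= C * norm v" using bd[OF that] by linarith
  moreover have "(norm v - C)^2 >= 0" by simp
  ultimately show ?thesis unfolding J_def by (simp add: power2_eq_square algebra_simps)
 qed
 define I where "I = Inf (J ` S)"
 have bdd: "bdd_below (J ` S)" using low by (auto intro!: bdd_belowI)
 have ne: "J ` S ~= {}" using subspace_0[OF S] by auto
 have I: "I <= J v" if "v : S" for v unfolding I_def using bdd that by (auto intro: cInf_lower)
 have "EX v:S. J v < I + 1 / (real n + 1)" for n
 proof -
  have "Inf (J ` S) < I + 1 / (real n + 1)" unfolding I_def by simp
  then show ?thesis using cInf_lessD[OF ne] by auto
 qed
 then obtain v where v: "!!n. v n : S" "!!n. J (v n) < I + 1 / (real n + 1)" by metis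
 \<comment> \<open>The parallelogram law, expressed through \<open>J\<close>: since the midpoint
   cannot go below the infimum \<open>I\<close>, two nearly minimal vectors are close.\<close>
 have para: "(norm (x - y))^2 = 4 * (J x + J y - 2 * J ((1/2) *R x + (1/2) *R y))" if "x : S" "y : S" for x y
 proof -
  have "(norm (x - y))^2 + 4 * (norm ((1/2) *R x + (1/2) *R y))^2 = 2 * (norm x)^2 + 2 * (norm y)^2"
   unfolding power2_norm_eq_inner by (simp add: inner_simps inner_commute algebra_simps)
  then show ?thesis unfolding J_def using lin[OF that, of "1/2" "1/2"] by (simp add: field_simps)
 qed
 have close: "(norm (v m - v n))^2 <= 8 / (real N + 1)" if "m >= N" "n >= N" for m n N
 proof -
  have mid: "(1/2) *R v m + (1/2) *R v n : S"
   by (intro subspace_add[OF S] subspace_scale[OF S] v)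
  have "J (v m) <= I + 1 / (real N + 1)" "J (v n) <= I + 1 / (real N + 1)"
   using v(2)[of m] v(2)[of n] that frac_le[of 1 1 "real N + 1" "real m + 1"] frac_le[of 1 1 "real N + 1" "real n + 1"]
   by auto
  then have "(norm (v m - v n))^2 <= 4 * (2 * (1 / (real N + 1)))"
   unfolding para[OF v(1) v(1)] using I[OF mid] by (intro mult_left_mono) linarith+
  then show ?thesis by simp
 qed
 have "Cauchy v"
 proof (rule CauchyI)
  fix e :: real assume "0 < e"
  obtain N where N: "8 / e^2 < real N" using reals_Archimedean2 by blast
  have e2: "0 < e^2" using `0 < e` by simp
  then have "8 < real N * e^2" using N by (simp add: field_simps)
  then have "8 < e^2 * (real N + 1)" unfolding distrib_left using e2 by (simp only: mult.commute mult_1_right)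
  then have "8 / (real N + 1) < e^2" by (simp add: pos_divide_less_eq)
  then have "norm (v m - v n) < e" if "m >= N" "n >= N" for m n
   using close[OF that] `0 < e` by (meson le_less_trans less_eq_real_def power_less_imp_less_base)
  then show "EX M. ALL m>=M. ALL n>=M. norm (v m - v n) < e" by blast
 qed
 then obtain F where F: "v ----> F" using Cauchy_convergent_iff convergent_def by blast
 have "F : closure S" using F v(1) closure_sequential by blast
 moreover have "f w = F \<bullet> w" if w: "w : S" for w
 proof -
  \<comment> \<open>\<open>v n\<close> is minimal up to 1 / (n + 1), so moving it by
    \<open>t *R w\<close> lowers \<open>J\<close> by no more than that; in the limit the expansion
    of \<open>J\<close> in t is nonnegative for every t.\<close>
  have ineq: "t^2 * (norm w)^2 / 2 + t * (F \<bullet> w - f w) >= 0" for t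
  proof (rule LIMSEQ_le_const)
   show "(%n. t^2 * (norm w)^2 / 2 + t * (v n \<bullet> w - f w) + 1 / (real n + 1)) ----> t^2 * (norm w)^2 / 2 + t * (F \<bullet> w - f w)"
   proof -
    have "(%n. 1 / (real n + 1)) ----> 0"
     using LIMSEQ_inverse_real_of_nat by (simp add: inverse_eq_divide add.commute)
    then have "(%n. t^2 * (norm w)^2 / 2 + t * (v n \<bullet> w - f w) + 1 / (real n + 1)) ----> t^2 * (norm w)^2 / 2 + t * (F \<bullet> w - f w) + 0"
     by (intro tendsto_intros F)
    then show ?thesis by simp
   qed
   have "0 <= t^2 * (norm w)^2 / 2 + t * (v n \<bullet> w - f w) + 1 / (real n + 1)" for n
   proof -
    have "v n + t *R w : S" by (intro subspace_add[OF S] subspace_scale[OF S] v w)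
    then have "I <= J (v n + t *R w)" by (rule I)
    also have "J (v n + t *R w) = J (v n) + t^2 * (norm w)^2 / 2 + t * (v n \<bullet> w - f w)"
     unfolding J_def using lin[OF v(1) w, of 1 n t]
     by (simp only: power2_norm_eq_inner) (simp add: inner_simps inner_commute power2_eq_square algebra_simps)
    finally show ?thesis using v(2)[of n] by linarith
   qed
   then show "EX N. ALL n>=N. 0 <= t^2 * (norm w)^2 / 2 + t * (v n \<bullet> w - f w) + 1 / (real n + 1)" by blast
  qed
  define d a where "d = F \<bullet> w - f w" and "a = (norm w)^2"
  have a: "a >= 0" by (simp add: a_def)
  \<comment> \<open>A slightly damped minimizer of the quadratic in t; the denominator
    \<open>a + 1\<close> instead of \<open>a\<close> also covers \<open>w = 0\<close>.\<close>
  have "0 <= (- d / (a + 1))^2 * a / 2 + (- d / (a + 1)) * d" using ineq unfolding d_def a_def .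
  also have "... = - ((d / (a + 1))^2 * (a / 2 + 1))" using a by (simp add: power2_eq_square divide_simps) (simp add: algebra_simps)
  finally have "(d / (a + 1))^2 <= 0" using a by (auto simp: mult_le_0_iff not_le add_nonneg_pos)
  then have "d = 0" using a by (auto simp: add_nonneg_eq_0_iff)
  then show ?thesis unfolding d_def by simp
 qed
 ultimately show thesis using that by blast
qed

text \<open>The Riesz vector of the functional \<open>x \<bullet> v\<close> on \<open>W\<close> is
  the orthogonal projection of x.\<close>

lemma projection_exists:
 fixes W :: "'a::{real_inner,complete_space} set"
 assumes W: "subspace W" "closed W"
 obtains p where "p : W" "!!v. v : W ==> x \<bullet> v = p \<bullet> v"
proof -
 have "abs (x \<bullet> v) <= norm x * norm v" for v by (rule Cauchy_Schwarz_ineq2)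
 from riesz_subspace[OF W(1), of "%v. x \<bullet> v" "norm x"]
 obtain F where "F : closure W" "!!v. v : W ==> x \<bullet> v = F \<bullet> v"
  using `!!v. abs (x \<bullet> v) <= norm x * norm v` by (auto simp: inner_simps)
 then show ?thesis using that W(2) by simp
qed

text \<open>With the form written as \<open>B u \<bullet> v\<close> and the functional as
  \<open>g \<bullet> v\<close>, the equation \<open>B u = g\<close> is the fixed-point equation of
  the map \<open>u - t *R (B u - g)\<close>. For t = c / C'^2 the expansion of the squared norm
  shows that this map contracts with factor sqrt (1 - c^2 / C'^2).\<close>

lemma lax_milgram:
 fixes b :: "'a::{real_inner,complete_space} => 'a => real"
 assumes W: "subspace W" "closed W"
  and l1: "!!u v w c d. u : W ==> v : W ==> w : W ==> b (c *R u + d *R v) w = c * b u w + d * b v w"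
  and l2: "!!u v w c d. u : W ==> v : W ==> w : W ==> b w (c *R u + d *R v) = c * b w u + d * b w v"
  and bd: "!!u v. u : W ==> v : W ==> (abs (b u v)) <= C * norm u * norm v"
  and co: "!!u. u : W ==> c * (norm u)^2 <= b u u" and "c > 0"
  and F: "!!u v c d. u : W ==> v : W ==> f (c *R u + d *R v) = c * f u + d * f v"
  and Fb: "!!v. v : W ==> (abs (f v)) <= K * norm v"
 obtains u where "u : W" "!!v. v : W ==> b u v = f v"
proof -
 \<comment> \<open>The maximum with c makes the constant positive and keeps c^2 / C'^2 at most 1,
   which the given \<open>C\<close> does not ensure when \<open>W\<close> is trivial.\<close>
 define C' where "C' = max C c"
 have C': "C' >= c" "C' > 0" using `c > 0` by (auto simp: C'_def)
 have bd': "abs (b u v) <= C' * norm u * norm v" if "u : W" "v : W" for u v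
 proof -
  have "C * norm u * norm v <= C' * norm u * norm v" unfolding C'_def by (intro mult_right_mono) auto
  then show ?thesis using bd[OF that] by linarith
 qed
 have "EX B. B : W & (ALL v:W. b u v = B \<bullet> v)" if u: "u : W" for u
 proof (rule riesz_subspace[OF W(1), of "b u" "C' * norm u"])
  show "b u (c *R ua + d *R v) = c * b u ua + d * b u v" if "ua : W" "v : W" for ua v c d
   using l2[OF that u] .
  show "abs (b u v) <= C' * norm u * norm v" if "v : W" for v using bd'[OF u that] .
 qed (use W(2) in auto)
 then obtain B where B: "!!u. u : W ==> B u : W" "!!u v. u : W ==> v : W ==> b u v = B u \<bullet> v"
  by metis
 obtain g where g: "g : W" "!!v. v : W ==> f v = g \<bullet> v"
  using riesz_subspace[OF W(1), of f K] F Fb W(2) by (metis closure_closed)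
 define t where "t = c / C'^2"
 define h where "h u = u - t *R (B u - g)" for u
 define q where "q = sqrt (1 - c^2 / C'^2)"
 have cC: "c^2 / C'^2 <= 1" "c^2 / C'^2 > 0"
  using C' `c > 0` by (auto simp: power_mono)
 have q: "0 <= q" "q < 1" unfolding q_def using cC by (auto simp: real_less_lsqrt)
 have hW: "h ` W <= W" unfolding h_def
  by (auto intro!: subspace_diff[OF W(1)] subspace_scale[OF W(1)] B g)
 have Bdiff: "B u - B v = B (u - v)" if "u : W" "v : W" for u v
 proof -
  have uv: "u - v : W" using that by (intro subspace_diff[OF W(1)])
  have d: "B u - B v - B (u - v) : W" using that uv by (intro subspace_diff[OF W(1)] B)
  have "(B u - B v - B (u - v)) \<bullet> w = 0" if w: "w : W" for w
   using l1[OF `u : W` `v : W` w, of 1 "-1"] B(2)[OF `u : W` w] B(2)[OF `v : W` w] B(2)[OF uv w]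
   by (simp add: inner_simps)
  from this[OF d] show ?thesis by simp
 qed
 have Bn: "norm (B u) <= C' * norm u" if u: "u : W" for u
 proof -
  have "(norm (B u))^2 <= C' * norm u * norm (B u)"
   using B(2)[OF u B(1)[OF u]] bd'[OF u B(1)[OF u]] by (simp add: power2_norm_eq_inner)
  then show ?thesis using C'(2)
   by (cases "norm (B u) = 0") (auto simp: power2_eq_square)
 qed
 have lip: "dist (h u) (h v) <= q * dist u v" if uv: "u : W" "v : W" for u v
 proof -
  define d where "d = u - v"
  have d: "d : W" unfolding d_def using uv by (intro subspace_diff[OF W(1)])
  have e: "h u - h v = d - t *R B d" unfolding h_def d_def Bdiff[OF uv, symmetric]
   by (simp add: algebra_simps)
  have "t >= 0" unfolding t_def using `c > 0` by simp
  have "(norm (d - t *R B d))^2 = (norm d)^2 - 2 * t * b d d + t^2 * (norm (B d))^2"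
   unfolding power2_norm_eq_inner B(2)[OF d d]
   by (simp add: inner_simps inner_commute power2_eq_square algebra_simps)
  also have "... <= (norm d)^2 - 2 * t * (c * (norm d)^2) + t^2 * (C' * norm d)^2"
   using co[OF d] Bn[OF d] `t >= 0`
   by (intro add_mono diff_mono mult_left_mono power_mono) auto
  also have "... = (1 - c^2 / C'^2) * (norm d)^2"
   unfolding t_def using C'(2) by (simp add: field_simps power2_eq_square)
  also have "... = (q * norm d)^2" unfolding q_def power_mult_distrib using cC by simp
  finally have "norm (d - t *R B d) <= q * norm d"
   using q(1) by (meson mult_nonneg_nonneg norm_ge_zero power2_le_imp_le)
  then show ?thesis unfolding dist_norm e d_def by simp
 qed
 have "complete W" using W(2) by (simp add: complete_eq_closed)
 moreover have "W ~= {}" using subspace_0[OF W(1)] by auto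
 ultimately have "EX! x:W. h x = x" using q hW lip by (intro Banach_fix) auto
 then obtain u where u: "u : W" "h u = u" by auto
 have "t ~= 0" unfolding t_def using C' `c > 0` by auto
 then have "B u = g" using u(2) unfolding h_def by simp
 then show ?thesis using that[OF u(1)] B(2)[OF u(1)] g(2) by simp
qed

section \<open>Diagonal extraction\<close>

lemma diagonal_scalars:
 fixes a :: "nat => nat => real"
 assumes bd: "!!k. EX C. ALL n. abs (a k n) <= C"
 obtains r :: "nat => nat" where "strict_mono r" "!!k. convergent (%n. a k (r n))"
proof -
 interpret subseqs "%k s. convergent (%n. a k (s n))"
 proof
  fix n s assume "strict_mono (s :: nat => nat)"
  obtain C where C: "!!m. abs (a n m) <= C" using bd by blast
  have "bounded (range (%m. a n (s m)))" using C by (intro boundedI[where B=C]) auto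
  then obtain l r where "strict_mono r" "((%m. a n (s m)) \<circ> r) ----> l"
   using bounded_imp_convergent_subsequence by blast
  then show "EX r'. strict_mono r' & convergent (%m. a n ((s \<circ> r') m))"
   by (auto simp: convergent_def o_def)
 qed
 have "convergent (%n. a k (diagseq n))" for k
 proof -
  have "convergent (%n. a k ((diagseq \<circ> ((+) (Suc k))) n))"
  proof (rule diagseq_holds)
   fix r s :: "nat => nat" and n assume "strict_mono r" "convergent (%m. a n (s m))"
   then show "convergent (%m. a n ((s \<circ> r) m))"
    using convergent_subseq_convergent[of "%m. a n (s m)" r] by (simp add: o_def)
  qed
  then have "convergent (%n. a k (diagseq (n + Suc k)))" by (simp add: o_def add.commute)
  then obtain L where "(%n. a k (diagseq (n + Suc k))) ----> L" unfolding convergent_def by blast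
  then have "(%n. a k (diagseq n)) ----> L" by (rule LIMSEQ_offset)
  then show ?thesis by (rule convergentI)
 qed
 then show ?thesis using that subseq_diagseq by blast
qed

lemma diagonal_countable:
 fixes a :: "'i => nat => real"
 assumes "countable I" and bd: "!!i. i : I ==> EX C. ALL n. abs (a i n) <= C"
 obtains r :: "nat => nat" where "strict_mono r" "!!i. i : I ==> convergent (%n. a i (r n))"
proof (cases "I = {}")
 case True
 then show ?thesis using that[of id] by (auto simp: strict_mono_def)
next
 case False
 have I: "range (from_nat_into I) = I" using range_from_nat_into[OF False `countable I`] .
 obtain r :: "nat => nat" where "strict_mono r" "!!k. convergent (%n. a (from_nat_into I k) (r n))"
  using diagonal_scalars[of "%k. a (from_nat_into I k)"] bd from_nat_into[OF False] by blast
 then show ?thesis using that I by (metis imageE)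
qed

lemma convergent_approx:
 fixes f :: "nat => real"
 assumes "!!e. e > 0 ==> EX g. convergent g & (ALL n. abs (f n - g n) <= e)"
 shows "convergent f"
proof (rule Cauchy_convergent, rule CauchyI)
 fix e :: real assume e: "e > 0"
 obtain g where g: "convergent g" "!!n. abs (f n - g n) <= e / 4" using assms[of "e / 4"] e by auto
 obtain M where M: "!!m n. m >= M ==> n >= M ==> norm (g m - g n) < e / 4"
  using CauchyD[OF convergent_Cauchy[OF g(1)], of "e / 4"] e by auto
 have "norm (f m - f n) < e" if "m >= M" "n >= M" for m n
  using M[OF that] g(2)[of m] g(2)[of n] e unfolding real_norm_def by linarith
 then show "EX M. ALL m>=M. ALL n>=M. norm (f m - f n) < e" by blast
qed

lemma convergent_on_span:
 fixes a :: "nat => 'a::real_vector => real"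
 assumes lin: "!!n. linear (a n)" and D: "!!d. d : D ==> convergent (%n. a n d)" and v: "v : span D"
 shows "convergent (%n. a n v)"
 using v
proof (induction rule: span_induct_alt)
 case base
 then show ?case using linear_0[OF lin] by (simp add: convergent_const)
next
 case (step c x y)
 have "(%n. a n (c *R x + y)) = (%n. c * a n x + a n y)"
  using linear_add[OF lin] linear_scale[OF lin] by auto
 then show ?case using step D by (auto intro!: convergent_add convergent_mult convergent_const)
qed

text \<open>The common bound makes an approximation of v by the span uniform in n, so convergence
  survives the closure.\<close>

lemma convergent_on_closure_span:
 fixes a :: "nat => 'a::real_normed_vector => real"
 assumes lin: "!!n. linear (a n)" and bd: "!!n v. abs (a n v) <= C * norm v"
  and D: "!!d. d : D ==> convergent (%n. a n d)" and v: "v : closure (span D)"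
 shows "convergent (%n. a n v)"
proof (rule convergent_approx)
 fix e :: real assume e: "e > 0"
 have C: "abs C + 1 > 0" by linarith
 obtain w where w: "w : span D" "dist w v < e / (abs C + 1)"
  using v divide_pos_pos[OF e C] unfolding closure_approachable by blast
 have "abs (a n v - a n w) <= e" for n
 proof -
  have "abs (a n v - a n w) <= C * norm (v - w)" using bd[of n "v - w"] linear_diff[OF lin] by simp
  also have "... <= (abs C + 1) * norm (v - w)" by (intro mult_right_mono) auto
  also have "... <= (abs C + 1) * (e / (abs C + 1))"
   using w(2) C by (intro mult_left_mono) (auto simp: dist_norm norm_minus_commute)
  finally show ?thesis using C by simp
 qed
 then show "EX g. convergent g & (ALL n. abs (a n v - g n) <= e)" using convergent_on_span[OF lin D w(1)] by blast
qed

text \<open>The space is not assumed separable. Convergence is arranged only against the members of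
  the sequence, hence on their closed span \<open>W\<close>; since every \<open>x n\<close> lies in
  \<open>W\<close>, any other vector may be replaced by its projection onto
  \<open>W\<close>.\<close>

lemma weak_compactness:
 fixes x :: "nat => 'a::{real_inner,complete_space}"
 assumes bd: "!!n. norm (x n) <= C"
 obtains r l where "strict_mono (r :: nat => nat)" "weak_conv (%n. x (r n)) l"
proof -
 have "EX K. ALL n. abs (x n \<bullet> d) <= K" for d
 proof (intro exI allI)
  fix n show "abs (x n \<bullet> d) <= C * norm d"
   using Cauchy_Schwarz_ineq2[of "x n" d] mult_right_mono[OF bd[of n] norm_ge_zero[of d]] by linarith
 qed
 then obtain r :: "nat => nat" where r: "strict_mono r" "!!d. d : range x ==> convergent (%n. x (r n) \<bullet> d)"
  using diagonal_countable[of "range x" "%d n. x n \<bullet> d"] by auto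
 define W where "W = closure (span (range x))"
 have W: "subspace W" "closed W" unfolding W_def by (auto intro!: subspace_closure_gen)
 have xW: "x n : W" for n unfolding W_def
  by (meson closure_subset rangeI span_base subsetD)
 have bdd: "abs (x n \<bullet> v) <= C * norm v" for n v
  using Cauchy_Schwarz_ineq2[of "x n" v] mult_right_mono[OF bd[of n] norm_ge_zero[of v]] by linarith
 have conv: "convergent (%n. x (r n) \<bullet> v)" if "v : W" for v
  using that unfolding W_def
  by (intro convergent_on_closure_span[of "%n v. x (r n) \<bullet> v" C "range x" v])
   (auto intro!: r bdd bounded_linear.linear bounded_linear_inner_right)
 define f where "f v = lim (%n. x (r n) \<bullet> v)" for v
 have f: "(%n. x (r n) \<bullet> v) ----> f v" if "v : W" for v
  using conv[OF that] unfolding f_def by (simp add: convergent_LIMSEQ_iff)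
 obtain l where l: "l : closure W" "!!v. v : W ==> f v = l \<bullet> v"
 proof (rule riesz_subspace[OF W(1), of f C])
  show "f (c *R u + d *R v) = c * f u + d * f v" if uv: "u : W" "v : W" for u v c d
  proof -
   have "(%n. x (r n) \<bullet> (c *R u + d *R v)) ----> c * f u + d * f v"
    unfolding inner_add_right inner_scaleR_right by (intro tendsto_intros f uv)
   moreover have "(%n. x (r n) \<bullet> (c *R u + d *R v)) ----> f (c *R u + d *R v)"
    by (intro f subspace_add[OF W(1)] subspace_scale[OF W(1)] uv)
   ultimately show ?thesis using LIMSEQ_unique by blast
  qed
  show "abs (f v) <= C * norm v" if "v : W" for v
   using tendsto_rabs[OF f[OF that]] bdd by (intro LIMSEQ_le_const2) auto
 qed auto
 have "weak_conv (%n. x (r n)) l" unfolding weak_conv_def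
 proof
  fix v
  obtain p where p: "p : W" "!!w. w : W ==> v \<bullet> w = p \<bullet> w"
   using projection_exists[OF W] by blast
  have "x n \<bullet> v = x n \<bullet> p" for n using p(2)[OF xW] by (simp add: inner_commute)
  moreover have "l \<bullet> v = l \<bullet> p" using p(2)[of l] l(1) W(2) by (simp add: inner_commute)
  ultimately show "(%n. x (r n) \<bullet> v) ----> l \<bullet> v" using f[OF p(1)] l(2)[OF p(1)] by simp
 qed
 with r(1) show ?thesis using that by blast
qed

text \<open>Serves to close the countable set of corrector data under countably many solution
  operators while diagonal extraction stays possible.\<close>

lemma countable_invariant_superset:
 fixes f :: "nat => 'a => 'a"
 assumes "countable P"
 obtains D where "countable D" "P <= D" "!!k d. d : D ==> f k d : D"
proof -
 define E where "E = rec_nat P (%_ S. S \<union> (\<Union>k. f k ` S))"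
 have E: "E 0 = P" "E (Suc n) = E n \<union> (\<Union>k. f k ` E n)" for n by (auto simp: E_def)
 have "countable (E n)" for n by (induction n) (use assms E in auto)
 then have "countable (\<Union>n. E n)" by blast
 moreover have "P <= (\<Union>n. E n)" using E(1) by blast
 moreover have "f k d : (\<Union>n. E n)" if d: "d : (\<Union>n. E n)" for k d
 proof -
  obtain n where "d : E n" using d by blast
  then have "f k d : E (Suc n)" unfolding E by blast
  then show ?thesis by blast
 qed
 ultimately show ?thesis by (rule that)
qed

section \<open>The Hilbert space of square-integrable functions on the plane\<close>

definition sqint :: "(plane => 'b::euclidean_space) => bool" where
 "sqint f = (f : borel_measurable borel & integrable lborel (%x. (norm (f x))^2))"

lemma sqint_measurable [measurable_dest]: "sqint f ==> f : borel_measurable borel"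
 by (simp add: sqint_def)

lemma sqint_integrable_sq: "sqint f ==> integrable lborel (%x. (norm (f x))^2)"
 by (simp add: sqint_def)

lemma sqint_bound:
 assumes [measurable]: "f : borel_measurable borel" and g: "sqint g"
  and le: "AE x in lborel. norm (f x) <= C * norm (g x)"
 shows "sqint f"
 unfolding sqint_def
proof
 show "integrable lborel (%x. (norm (f x))^2)"
 proof (rule lint_bound)
  show "integrable lborel (%x. C^2 * (norm (g x))^2)"
   using sqint_integrable_sq[OF g] by simp
  show "AE x in lborel. norm ((norm (f x))^2) <= norm (C^2 * (norm (g x))^2)"
   using le
  proof eventually_elim
   case (elim x)
   then have "(norm (f x))^2 <= (C * norm (g x))^2" by (intro power_mono) auto
   then show ?case by (simp add: power_mult_distrib)
  qed
 qed measurable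
qed fact

lemma sqint_add:
 assumes f: "sqint f" and g: "sqint g" shows "sqint (%x. f x + g x)"
 unfolding sqint_def
proof
 have [measurable]: "f : borel_measurable borel" "g : borel_measurable borel" using f g by measurable
 show "(%x. f x + g x) : borel_measurable borel" by measurable
 show "integrable lborel (%x. (norm (f x + g x))^2)"
 proof (rule lint_bound)
  show "integrable lborel (%x. 2 * (norm (f x))^2 + 2 * (norm (g x))^2)"
   using sqint_integrable_sq[OF f] sqint_integrable_sq[OF g] by simp
  have "(norm (f x + g x))^2 <= 2 * (norm (f x))^2 + 2 * (norm (g x))^2" for x
  proof -
   have "(norm (f x + g x))^2 <= (norm (f x) + norm (g x))^2" by (intro power_mono norm_triangle_ineq) auto
   also have "... <= 2 * (norm (f x))^2 + 2 * (norm (g x))^2"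
    using zero_le_power2[of "norm (f x) - norm (g x)"] by (simp add: power2_eq_square algebra_simps)
   finally show ?thesis .
  qed
  then show "AE x in lborel. norm ((norm (f x + g x))^2) <= norm (2 * (norm (f x))^2 + 2 * (norm (g x))^2)"
   by (intro AE_I2) (simp add: abs_of_nonneg)
 qed measurable
qed

lemma sqint_scaleR: "sqint f ==> sqint (%x. c *R f x)"
 by (rule sqint_bound[of _ f "abs c"]) auto

lemma sqint_minus: "sqint f ==> sqint (%x. - f x)"
 by (rule sqint_bound[of _ f 1]) auto

lemma sqint_diff: "sqint f ==> sqint g ==> sqint (%x. f x - g x)"
 using sqint_add[OF _ sqint_minus, of f g] by simp

lemma sqint_zero: "sqint (%x. 0)"
 by (simp add: sqint_def)

lemma sqint_mult_integrable:
 assumes f: "sqint f" and g: "sqint g"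
 shows "integrable lborel (%x. norm (f x) * norm (g x))"
proof (rule lint_bound)
 have [measurable]: "f : borel_measurable borel" "g : borel_measurable borel" using f g by measurable
 show "integrable lborel (%x. (norm (f x))^2 + (norm (g x))^2)"
  using sqint_integrable_sq[OF f] sqint_integrable_sq[OF g] by simp
 show "(%x. norm (f x) * norm (g x)) : borel_measurable lborel" by measurable
 have "norm (f x) * norm (g x) <= (norm (f x))^2 + (norm (g x))^2" for x
  using sum_squares_bound[of "norm (f x)" "norm (g x)"] mult_nonneg_nonneg[OF norm_ge_zero[of "f x"] norm_ge_zero[of "g x"]]
  by linarith
 then show "AE x in lborel. norm (norm (f x) * norm (g x)) <= norm ((norm (f x))^2 + (norm (g x))^2)"
  by (intro AE_I2) (simp add: abs_of_nonneg)
qed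

lemma sqint_inner_integrable:
 assumes f: "sqint f" and g: "sqint g"
 shows "integrable lborel (%x. f x \<bullet> g x)"
proof (rule lint_bound[OF sqint_mult_integrable[OF f g]])
 have [measurable]: "f : borel_measurable borel" "g : borel_measurable borel" using f g by measurable
 show "(%x. f x \<bullet> g x) : borel_measurable lborel" by measurable
qed (use Cauchy_Schwarz_ineq2 in auto)

quotient_type (overloaded) 'b l2 = "plane => 'b::euclidean_space" / partial: "%f g. sqint f & sqint g & (AE x in lborel. f x = g x)"
proof (rule part_equivpI)
 show "EX f::plane => 'b. sqint f & sqint f & (AE x in lborel. f x = f x)"
  by (rule exI[of _ "%x. 0"]) (simp add: sqint_zero)
 show "symp (%f g. sqint f & sqint g & (AE x in lborel. f x = (g x::'b)))"
  by (auto intro!: sympI elim: eventually_mono)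
 show "transp (%f g. sqint f & sqint g & (AE x in lborel. f x = (g x::'b)))"
  by (auto intro!: transpI elim: eventually_elim2)
qed

text \<open>\<open>fn\<close> selects a Borel representative on the whole plane. Algebraic
  identities between representatives hold only almost everywhere.\<close>

definition fn :: "'b::euclidean_space l2 => plane => 'b" where "fn = rep_l2"
definition L2of :: "(plane => 'b::euclidean_space) => 'b l2" where "L2of = abs_l2"

lemma sqint_fn [simp]: "sqint (fn x)"
 unfolding fn_def using Quotient3_rep_reflp[OF Quotient3_l2, of x] by simp

lemma fn_measurable [measurable]: "fn x : borel_measurable borel"
 using sqint_fn by (rule sqint_measurable)

lemma fn_L2of: "sqint f ==> AE x in lborel. fn (L2of f) x = f x"
 unfolding fn_def L2of_def using rep_abs_rsp_left[OF Quotient3_l2, of f f] by simp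

lemma L2of_fn [simp]: "L2of (fn x) = x"
 unfolding fn_def L2of_def by (rule Quotient3_abs_rep[OF Quotient3_l2])

lemma L2of_cong: "sqint f ==> sqint g ==> AE x in lborel. f x = g x ==> L2of f = L2of g"
 unfolding L2of_def using Quotient3_rel_abs[OF Quotient3_l2] by blast

lemma l2_eqI: "AE t in lborel. fn x t = fn y t ==> x = y"
 using L2of_cong[OF sqint_fn sqint_fn, of x y] by simp

instantiation l2 :: (euclidean_space) real_inner
begin

definition zero_l2_def: "0 = L2of (%t. 0)"
definition plus_l2_def: "x + y = L2of (%t. fn x t + fn y t)"
definition minus_l2_def: "x - y = L2of (%t. fn x t - fn y t)"
definition uminus_l2_def: "- x = L2of (%t. - fn x t)"
definition scaleR_l2_def: "c *R x = L2of (%t. c *R fn x t)"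
definition inner_l2_def: "x \<bullet> y = (LBINT t. fn x t \<bullet> fn y t)"
definition norm_l2_def: "norm (x :: 'a l2) = sqrt (x \<bullet> x)"
definition dist_l2_def: "dist x y = norm (x - y :: 'a l2)"
definition sgn_l2_def: "sgn x = inverse (norm x) *R (x :: 'a l2)"
definition uniformity_l2_def:
 "uniformity = (INF e\<in>{0<..}. principal {(x, y). dist x (y :: 'a l2) < e})"
definition open_l2_def:
 "open (U :: 'a l2 set) \<longleftrightarrow> (ALL x:U. \<forall>\<^sub>F (x', y) in uniformity. x' = x --> y : U)"

lemma fn_zero: "AE t in lborel. fn (0 :: 'a l2) t = 0"
 unfolding zero_l2_def using fn_L2of[OF sqint_zero] .
lemma fn_plus: "AE t in lborel. fn (x + y :: 'a l2) t = fn x t + fn y t"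
 unfolding plus_l2_def by (rule fn_L2of[OF sqint_add]) auto
lemma fn_minus: "AE t in lborel. fn (x - y :: 'a l2) t = fn x t - fn y t"
 unfolding minus_l2_def by (rule fn_L2of[OF sqint_diff]) auto
lemma fn_uminus: "AE t in lborel. fn (- x :: 'a l2) t = - fn x t"
 unfolding uminus_l2_def by (rule fn_L2of[OF sqint_minus]) auto
lemma fn_scaleR: "AE t in lborel. fn (c *R x :: 'a l2) t = c *R fn x t"
 unfolding scaleR_l2_def by (rule fn_L2of[OF sqint_scaleR]) auto

lemma inner_l2_cong:
 fixes x y x' y' :: "'a l2"
 assumes "AE t in lborel. fn x t \<bullet> fn y t = F t" "F : borel_measurable borel"
 shows "x \<bullet> y = integral\<^sup>L lborel F"
 unfolding inner_l2_def using assms by (intro integral_cong_AE) auto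

instance
proof
 fix x y z :: "'a l2" and a b :: real
 show "x + y + z = x + (y + z)"
  by (rule l2_eqI) (use fn_plus[of "x+y" z] fn_plus[of x y] fn_plus[of x "y+z"] fn_plus[of y z] in "eventually_elim, simp")
 show "x + y = y + x"
  by (rule l2_eqI) (use fn_plus[of x y] fn_plus[of y x] in "eventually_elim, simp")
 show "0 + x = x"
  by (rule l2_eqI) (use fn_plus[of 0 x] fn_zero in "eventually_elim, simp")
 show "- x + x = 0"
  by (rule l2_eqI) (use fn_plus[of "- x" x] fn_uminus[of x] fn_zero in "eventually_elim, simp")
 show "x - y = x + - y"
  by (rule l2_eqI) (use fn_plus[of x "- y"] fn_uminus[of y] fn_minus[of x y] in "eventually_elim, simp")
 show "a *R (x + y) = a *R x + a *R y"
  by (rule l2_eqI) (use fn_plus[of x y] fn_scaleR[of a "x+y"] fn_scaleR[of a x] fn_scaleR[of a y] fn_plus[of "a *R x" "a *R y"]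
   in \<open>eventually_elim, simp add: scaleR_add_right\<close>)
 show "(a + b) *R x = a *R x + b *R x"
  by (rule l2_eqI) (use fn_scaleR[of a x] fn_scaleR[of b x] fn_scaleR[of "a+b" x] fn_plus[of "a *R x" "b *R x"]
   in \<open>eventually_elim, simp add: scaleR_add_left\<close>)
 show "a *R b *R x = (a * b) *R x"
  by (rule l2_eqI) (use fn_scaleR[of a "b *R x"] fn_scaleR[of b x] fn_scaleR[of "a*b" x] in "eventually_elim, simp")
 show "1 *R x = x"
  by (rule l2_eqI) (use fn_scaleR[of 1 x] in "eventually_elim, simp")
 show "dist x y = norm (x - y)" by (rule dist_l2_def)
 show "sgn x = inverse (norm x) *R x" by (rule sgn_l2_def)
 show "uniformity = (INF e\<in>{0<..}. principal {(x, y). dist x (y :: 'a l2) < e})" by (rule uniformity_l2_def)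
 show "open U = (ALL x:U. \<forall>\<^sub>F (x', y) in uniformity. x' = x --> y : U)" for U :: "'a l2 set" by (rule open_l2_def)
 show "x \<bullet> y = y \<bullet> x" unfolding inner_l2_def by (simp add: inner_commute)
 show "(x + y) \<bullet> z = x \<bullet> z + y \<bullet> z"
 proof -
  have "(x + y) \<bullet> z = (LBINT t. fn x t \<bullet> fn z t + fn y t \<bullet> fn z t)"
   by (rule inner_l2_cong) (use fn_plus[of x y] in \<open>eventually_elim, simp add: inner_add_left\<close>, measurable)
  then show ?thesis unfolding inner_l2_def by (simp add: sqint_inner_integrable)
 qed
 show "a *R x \<bullet> y = a * (x \<bullet> y)"
 proof -
  have "a *R x \<bullet> y = (LBINT t. a * (fn x t \<bullet> fn y t))"
   by (rule inner_l2_cong) (use fn_scaleR[of a x] in \<open>eventually_elim, simp\<close>, measurable)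
  then show ?thesis unfolding inner_l2_def by simp
 qed
 show "0 <= x \<bullet> x" unfolding inner_l2_def by simp
 show "(x \<bullet> x = 0) = (x = 0)"
 proof
  assume "x \<bullet> x = 0"
  then have "AE t in lborel. fn x t \<bullet> fn x t = 0"
   unfolding inner_l2_def using sqint_inner_integrable[OF sqint_fn sqint_fn]
   by (subst (asm) integral_nonneg_eq_0_iff_AE) auto
  then have "AE t in lborel. fn x t = fn 0 t" using fn_zero by eventually_elim simp
  then show "x = 0" by (rule l2_eqI)
 next
  assume "x = 0"
  have "x \<bullet> x = integral\<^sup>L lborel (%t::plane. 0)"
   unfolding `x = 0` by (rule inner_l2_cong[where F = "%t. 0"]) (use fn_zero in \<open>eventually_elim, simp\<close>, measurable)
  then show "x \<bullet> x = 0" by simp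
 qed
 show "norm x = sqrt (x \<bullet> x)" by (rule norm_l2_def)
qed

end

lemma inner_L2of:
 assumes "sqint f" "sqint g"
 shows "L2of f \<bullet> L2of g = (LBINT t. f t \<bullet> g t)"
proof -
 have [measurable]: "f : borel_measurable borel" "g : borel_measurable borel" using assms by measurable
 show ?thesis by (rule inner_l2_cong) (use fn_L2of[OF assms(1)] fn_L2of[OF assms(2)] in \<open>eventually_elim, simp\<close>, measurable)
qed

lemma inner_L2of_right:
 assumes "sqint g" shows "x \<bullet> L2of g = (LBINT t. fn x t \<bullet> g t)"
 using inner_L2of[OF sqint_fn assms, of x] by simp

lemma norm_sq_fn: "(norm x)^2 = (LBINT t. (norm (fn x t))^2)"
 by (simp add: power2_norm_eq_inner inner_l2_def)

lemma norm_sq_L2of: "sqint f ==> (norm (L2of f))\<^sup>2 = (LBINT t. (norm (f t))^2)"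
 using inner_L2of[of f f] by (simp add: power2_norm_eq_inner)

lemma L2of_add: assumes "sqint f" "sqint g" shows "L2of (%t. f t + g t) = L2of f + L2of g"
 unfolding plus_l2_def by (rule L2of_cong[OF sqint_add[OF assms] sqint_add[OF sqint_fn sqint_fn]])
  (use fn_L2of[OF assms(1)] fn_L2of[OF assms(2)] in "eventually_elim, simp")

lemma L2of_diff: assumes "sqint f" "sqint g" shows "L2of (%t. f t - g t) = L2of f - L2of g"
 unfolding minus_l2_def by (rule L2of_cong[OF sqint_diff[OF assms] sqint_diff[OF sqint_fn sqint_fn]])
  (use fn_L2of[OF assms(1)] fn_L2of[OF assms(2)] in "eventually_elim, simp")

lemma L2of_scaleR: assumes "sqint f" shows "L2of (%t. c *R f t) = c *R L2of f"
 unfolding scaleR_l2_def by (rule L2of_cong[OF sqint_scaleR[OF assms] sqint_scaleR[OF sqint_fn]])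
  (use fn_L2of[OF assms] in "eventually_elim, simp")

lemma norm_l2_mono:
 assumes "AE t in lborel. norm (fn x t) <= C * norm (fn y t)" "C >= 0"
 shows "norm x <= C * norm y"
proof -
 have "(norm x)^2 <= (LBINT t. C^2 * (norm (fn y t))^2)" unfolding norm_sq_fn
 proof (rule integral_mono_AE)
  show "AE t in lborel. (norm (fn x t))^2 <= C^2 * (norm (fn y t))^2"
   using assms(1)
  proof eventually_elim
   case (elim t)
   then have "(norm (fn x t))^2 <= (C * norm (fn y t))^2" by (intro power_mono) auto
   then show ?case by (simp add: power_mult_distrib)
  qed
 qed (auto intro: sqint_integrable_sq)
 also have "... = (C * norm y)^2" by (simp add: norm_sq_fn power_mult_distrib)
 finally show ?thesis using assms(2) by (meson mult_nonneg_nonneg norm_ge_zero power2_le_imp_le)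
qed

lemma nn_norm_sq_fn: "ennreal ((norm x)^2) = (\<integral>\<^sup>+t. ennreal ((norm (fn x t))^2) \<partial>lborel)"
 unfolding norm_sq_fn by (rule nn_integral_eq_integral[symmetric]) (auto intro: sqint_integrable_sq)

text \<open>The weights 2^k still leave the sum of 2^k |f (k+1) - f k|^2 integrable, hence finite
  almost everywhere, and 2 d <= 2^k d^2 + 2^(-k) turns this into absolute convergence of the
  telescoping series. Fatou's lemma converts the pointwise limit into a limit in norm with the same
  rate.\<close>

lemma l2_fast_Cauchy_converges:
 fixes Y :: "nat => 'b::euclidean_space l2"
 assumes fast: "!!k m. m >= k ==> norm (Y m - Y k) <= (1/2)^k"
 shows "EX y. Y ----> y"
proof -
 define f where "f k = fn (Y k)" for k
 have [measurable]: "f k : borel_measurable borel" for k unfolding f_def by measurable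
 let ?N = "%h k. \<integral>\<^sup>+t. ennreal ((norm (h t - f k t))^2) \<partial>lborel"
 have nrm: "?N (f m) k = ennreal ((norm (Y m - Y k))^2)" for m k
  unfolding nn_norm_sq_fn f_def
  by (rule nn_integral_cong_AE) (use fn_minus[of "Y m" "Y k"] in "eventually_elim, simp")
 define e where "e k t = 2^k * (norm (f (Suc k) t - f k t))^2" for k t
 have [measurable]: "e k : borel_measurable borel" for k unfolding e_def by measurable
 have "(\<integral>\<^sup>+t. (\<Sum>k. ennreal (e k t)) \<partial>lborel) = (\<Sum>k. \<integral>\<^sup>+t. ennreal (e k t) \<partial>lborel)"
  by (rule nn_integral_suminf) simp
 also have "... <= (\<Sum>k. ennreal ((1/2)^k))"
 proof (rule suminf_le)
  show "(\<integral>\<^sup>+t. ennreal (e k t) \<partial>lborel) <= ennreal ((1/2)^k)" for k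
  proof -
   have "(\<integral>\<^sup>+t. ennreal (e k t) \<partial>lborel) = (\<integral>\<^sup>+t. ennreal (2^k) * ennreal ((norm (f (Suc k) t - f k t))^2) \<partial>lborel)"
    unfolding e_def by (simp add: ennreal_mult)
   also have "... = ennreal (2^k) * ennreal ((norm (Y (Suc k) - Y k))^2)"
    using nrm[of "Suc k" k] by (subst nn_integral_cmult) auto
   also have "... = ennreal (2^k * (norm (Y (Suc k) - Y k))^2)" by (simp add: ennreal_mult)
   also have "... <= ennreal (2^k * ((1/2)^k)^2)"
    using fast[of k "Suc k"] by (intro ennreal_leI mult_left_mono power_mono) auto
   also have "2^k * ((1/2)^k)^2 = (1/2::real)^k" by (simp add: power2_eq_square power_divide)
   finally show ?thesis .
  qed
 qed auto
 also have "... = ennreal (\<Sum>k. (1/2)^k)"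
  by (rule suminf_ennreal2) (auto simp: summable_geometric)
 also have "... < \<infinity>" by simp
 finally have "AE t in lborel. (\<Sum>k. ennreal (e k t)) ~= \<infinity>"
  by (intro nn_integral_PInf_AE) auto
 then have ae: "AE t in lborel. convergent (%k. f k t)"
 proof eventually_elim
  case (elim t)
  then have "summable (%k. e k t)"
   by (intro summable_suminf_not_top) (auto simp: e_def)
  then have "summable (%k. e k t + (1/2)^k)" by (intro summable_add) (auto simp: summable_geometric)
  moreover have "norm (f (Suc k) t - f k t) <= e k t + (1/2)^k" for k
  proof -
   define d where "d = norm (f (Suc k) t - f k t)"
   have "2^k * d^2 + (1/2)^k - 2 * d = 2^k * (d - (1/2)^k)^2"
    by (simp add: power2_eq_square algebra_simps power_divide)
   also have "... >= 0" by simp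
   finally have "2 * d <= 2^k * d^2 + (1/2)^k" by simp
   moreover have "d >= 0" by (simp add: d_def)
   ultimately show ?thesis unfolding e_def d_def[symmetric] by linarith
  qed
  ultimately have "summable (%k. norm (f (Suc k) t - f k t))"
   by (intro summable_comparison_test[of "%k. norm (f (Suc k) t - f k t)" "%k. e k t + (1/2)^k"]) auto
  then have "summable (%k. f (Suc k) t - f k t)" by (rule summable_norm_cancel)
  then have "convergent (%n. \<Sum>k<n. f (Suc k) t - f k t)" by (simp add: summable_iff_convergent)
  then have "convergent (%n. f n t - f 0 t)" by (simp add: sum_lessThan_telescope[of "%k. f k t"])
  then have "convergent (%n. (f n t - f 0 t) + f 0 t)" by (intro convergent_add convergent_const)
  then show ?case by simp
 qed
 define g where "g t = lim (%k. f k t)" for t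
 have gm[measurable]: "g : borel_measurable borel" unfolding g_def by measurable
 have lim: "AE t in lborel. (%k. f k t) ----> g t"
  using ae by eventually_elim (simp add: g_def convergent_LIMSEQ_iff)
 have fatou: "?N g k <= ennreal (((1/2)^k)^2)" for k
 proof -
  have "?N g k = (\<integral>\<^sup>+t. liminf (%m. ennreal ((norm (f m t - f k t))^2)) \<partial>lborel)"
  proof (rule nn_integral_cong_AE, use lim in eventually_elim)
   case (elim t)
   then have "(%m. ennreal ((norm (f m t - f k t))^2)) ----> ennreal ((norm (g t - f k t))^2)"
    by (intro tendsto_ennrealI tendsto_intros)
   then show ?case using lim_imp_Liminf[OF sequentially_bot] by metis
  qed
  also have "... <= liminf (%m. ?N (f m) k)"
   by (rule nn_integral_liminf) measurable
  also have "... <= ennreal (((1/2)^k)^2)"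
  proof (rule Liminf_le)
   show "\<forall>\<^sub>F m in sequentially. ?N (f m) k <= ennreal (((1/2)^k)^2)"
    unfolding nrm using fast
    by (intro eventually_sequentiallyI[of k] ennreal_leI power_mono) auto
  qed simp
  finally show ?thesis .
 qed
 have "sqint (%t. g t - f k t)" for k
  unfolding sqint_def
 proof
  show "integrable lborel (%t. (norm (g t - f k t))^2)"
   using fatou[of k] by (intro integrableI_bounded) (auto simp: order_le_less_trans)
 qed measurable
 note gf = this
 have g: "sqint g" using sqint_add[OF gf[of 0] sqint_fn[of "Y 0"]] by (simp add: f_def)
 have "norm (L2of g - Y k) <= (1/2)^k" for k
 proof -
  have "ennreal ((norm (L2of g - Y k))^2) = ?N g k"
   unfolding nn_norm_sq_fn
   by (rule nn_integral_cong_AE) (use fn_minus[of "L2of g" "Y k"] fn_L2of[OF g] in "eventually_elim, simp add: f_def")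
  then have "ennreal ((norm (L2of g - Y k))^2) <= ennreal (((1/2)^k)^2)" using fatou[of k] by (simp only:)
  then have "(norm (L2of g - Y k))^2 <= ((1/2)^k)^2" by (subst (asm) ennreal_le_iff) auto
  then show ?thesis by (rule power2_le_imp_le) auto
 qed
 then have "\<forall>\<^sub>F k in sequentially. norm (Y k - L2of g) <= (1/2)^k"
  by (simp add: norm_minus_commute)
 then have "(%k. Y k - L2of g) ----> 0"
  by (rule Lim_null_comparison) (simp add: LIMSEQ_power_zero)
 then have "Y ----> L2of g" by (simp add: LIM_zero_iff)
 then show ?thesis by blast
qed

instance l2 :: (euclidean_space) complete_space
proof
 fix X :: "nat => 'a l2" assume X: "Cauchy X"
 have "EX M. ALL m>=M. ALL n>=M. norm (X m - X n) < (1/2)^k" for k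
  using CauchyD[OF X, of "(1/2)^k"] by simp
 then obtain M where M: "!!k m n. m >= M k ==> n >= M k ==> norm (X m - X n) < (1/2)^k" by metis
 \<comment> \<open>The sum makes \<open>s k\<close> at least \<open>M k\<close>, and the summand k
   makes s strictly increasing.\<close>
 define s where "s k = k + (\<Sum>i\<le>k. M i)" for k
 have s: "s k >= M k" "s k < s (Suc k)" for k
  unfolding s_def using member_le_sum[of k "{..k}" M] by auto
 have smono: "strict_mono s" using s(2) by (rule strict_monoI_Suc)
 obtain y where y: "(%k. X (s k)) ----> y"
 proof -
  have "norm (X (s m) - X (s k)) <= (1/2)^k" if "m >= k" for k m
  proof -
   have "s k <= s m" using smono that by (simp add: strict_mono_less_eq)
   then show ?thesis using M[of k "s m" "s k"] s(1)[of k] by auto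
  qed
  then show ?thesis using l2_fast_Cauchy_converges[of "%k. X (s k)"] that by blast
 qed
 have "X ----> y" by (rule Cauchy_converges_subseq[OF X smono]) (use y in "simp add: o_def")
 then show "convergent X" by (rule convergentI)
qed

section \<open>Smooth functions and mollifiers\<close>

lemma cgrad_eq:
 assumes "(f has_derivative D) (at x)"
 shows "cgrad f x $ i = D (axis i 1)"
 using frechet_derivative_at[OF assms] by (simp add: cgrad_def)

lemma differentiable_cgrad:
 assumes "f differentiable (at x)"
 shows "(f has_derivative (%h. cgrad f x \<bullet> h)) (at x)"
proof -
 obtain D where D: "(f has_derivative D) (at x)" using assms differentiable_def by blast
 have lin: "linear D" using D has_derivative_linear by blast
 have "D h = cgrad f x \<bullet> h" for h
 proof -
  have "D h = D (SUM i:UNIV. (h $ i) *R axis i 1)"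
   using basis_expansion[of h] by (simp add: scalar_mult_eq_scaleR)
  also have "... = (SUM i:UNIV. (h $ i) * D (axis i 1))"
   using lin by (simp add: linear_sum linear_scale)
  finally show ?thesis unfolding inner_vec_def using cgrad_eq[OF D] by (simp add: mult.commute)
 qed
 then have "D = (%h. cgrad f x \<bullet> h)" by (rule ext)
 then show ?thesis using D by simp
qed

lemma Ck_continuous: "Ck k f ==> continuous_on UNIV f"
 by (cases k) (auto intro!: continuous_at_imp_continuous_on differentiable_imp_continuous_within)

lemma Ck_SucI:
 assumes "!!x. (f has_derivative D x) (at x)" "!!i. Ck k (%x. D x (axis i 1))"
 shows "Ck (Suc k) f"
 using assms cgrad_eq[OF assms(1)] by (auto simp: differentiable_def)

lemma Ck_has_derivative: "Ck (Suc k) f ==> (f has_derivative (%h. cgrad f x \<bullet> h)) (at x)"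
 by (auto intro: differentiable_cgrad)

lemma Ck_Suc_imp: "Ck (Suc k) f ==> Ck k f"
proof (induction k arbitrary: f)
 case 0
 then show ?case using Ck_continuous[of "Suc 0" f] by simp
next
 case (Suc k)
 then have "Ck k (%x. cgrad f x $ i)" for i by simp
 then show ?case using Suc.prems by simp
qed

lemma Ck_const: "Ck k (%x. c)"
proof (induction k arbitrary: c)
 case (Suc k)
 show ?case by (rule Ck_SucI[where D = "%x h. 0"]) (use Suc in auto)
qed simp

lemma Ck_coord: "Ck k (%x. x $ i)"
proof (cases k)
 case 0
 then show ?thesis by (simp add: continuous_intros)
next
 case (Suc m)
 have d: "((%x::plane. x $ i) has_derivative (%h. h $ i)) (at x)" for x
  using bounded_linear_imp_has_derivative[OF bounded_linear_vec_nth] .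
 show ?thesis unfolding Suc
  by (rule Ck_SucI[OF d]) (rule Ck_const)
qed

lemma Ck_add: "Ck k f ==> Ck k q ==> Ck k (%x. f x + q x)"
proof (induction k arbitrary: f q)
 case 0
 then show ?case by (auto intro: continuous_on_add)
next
 case (Suc k)
 show ?case
 proof (rule Ck_SucI)
  show "((%x. f x + q x) has_derivative (%h. cgrad f x \<bullet> h + cgrad q x \<bullet> h)) (at x)" for x
   by (intro has_derivative_add Ck_has_derivative[OF Suc.prems(1)] Ck_has_derivative[OF Suc.prems(2)])
  show "Ck k (%x. cgrad f x \<bullet> axis i 1 + cgrad q x \<bullet> axis i 1)" for i
   using Suc by (simp add: inner_axis)
 qed
qed

lemma Ck_mult: "Ck k f ==> Ck k q ==> Ck k (%x. f x * q x)"
proof (induction k arbitrary: f q)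
 case 0
 then show ?case by (auto intro: continuous_on_mult)
next
 case (Suc k)
 show ?case
 proof (rule Ck_SucI)
  show "((%x. f x * q x) has_derivative (%h. f x * (cgrad q x \<bullet> h) + (cgrad f x \<bullet> h) * q x)) (at x)" for x
   by (intro has_derivative_mult Ck_has_derivative[OF Suc.prems(1)] Ck_has_derivative[OF Suc.prems(2)])
  show "Ck k (%x. f x * (cgrad q x \<bullet> axis i 1) + (cgrad f x \<bullet> axis i 1) * q x)" for i
   using Suc.prems Ck_Suc_imp[OF Suc.prems(1)] Ck_Suc_imp[OF Suc.prems(2)]
   by (auto simp: inner_axis intro!: Ck_add Suc.IH)
 qed
qed

lemma Ck_cmult: "Ck k f ==> Ck k (%x. c * f x)"
 by (intro Ck_mult Ck_const)

lemma Ck_diff: "Ck k f ==> Ck k h ==> Ck k (%x. f x - h x)"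
 using Ck_add[OF _ Ck_cmult, of k f h "-1"] by simp

lemma Ck_affine: "Ck k f ==> Ck k (%x. f (a + c *R x))"
proof (induction k arbitrary: f)
 case 0
 then show ?case by (auto intro!: continuous_on_compose2[of UNIV f] continuous_intros)
next
 case (Suc k)
 show ?case
 proof (rule Ck_SucI)
  show "((%x. f (a + c *R x)) has_derivative (%h. cgrad f (a + c *R x) \<bullet> (c *R h))) (at x)" for x
   by (rule has_derivative_compose[OF _ Ck_has_derivative[OF Suc.prems]]) (auto intro!: derivative_eq_intros)
  show "Ck k (%x. cgrad f (a + c *R x) \<bullet> (c *R axis i 1))" for i
   using Suc.IH[of "%x. cgrad f x $ i"] Suc.prems by (simp add: inner_axis Ck_cmult)
 qed
qed

subsection \<open>A smooth bump\<close>

text \<open>Taken for general m because the family is closed under differentiation up to linear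
  combinations: the derivative of index m involves the indices m + 2 and m + 1. The bump itself is
  the case m = 0.\<close>

definition bumpE :: "nat => real => real" where
 "bumpE m t = (if t > 0 then exp (- (1 / t)) / t ^ m else 0)"

lemma power_div_fact_le_exp:
 fixes s :: real assumes "s >= 0" shows "s ^ n / fact n <= exp s"
proof -
 have "(SUM k:{n}. s ^ k /\<^sub>R fact k) <= (\<Sum>k. s ^ k /\<^sub>R fact k)"
  by (rule sum_le_suminf[OF summable_exp_generic]) (use assms in auto)
 then show ?thesis by (simp add: exp_def divide_inverse mult.commute)
qed

text \<open>The term of order m + 2 of the exponential series at 1 / t bounds exp (- 1 / t). The
  surplus factor t^2 is what makes the difference quotients at 0 vanish.\<close>

lemma bumpE_bound:
 assumes "t > 0" shows "bumpE m t <= fact (m + 2) * t^2"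
proof -
 have "(1 / t) ^ (m + 2) / fact (m + 2) <= exp (1 / t)"
  by (rule power_div_fact_le_exp) (use assms in auto)
 moreover have "1 <= N * q * E" if "1 / q / N <= E" "q > 0" "N > 0" for N q E :: real
  using that by (simp add: field_simps)
 ultimately have "1 <= fact (m + 2) * t ^ (m + 2) * exp (1 / t)"
  using assms by (simp add: power_one_over del: fact_Suc power_Suc)
 then have "exp (- (1 / t)) <= fact (m + 2) * t ^ (m + 2)"
  by (simp add: exp_minus pos_divide_le_eq divide_inverse[symmetric] inverse_eq_divide del: fact_Suc power_Suc)
 then have "exp (- (1 / t)) / t ^ m <= fact (m + 2) * t ^ (m + 2) / t ^ m"
  using assms by (intro divide_right_mono) auto
 then show ?thesis using assms by (simp add: bumpE_def power_add power2_eq_square mult.assoc)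
qed

lemma bumpE_nonneg: "bumpE m t >= 0"
 by (auto simp: bumpE_def)

lemma bumpE_deriv: "(bumpE m has_real_derivative (bumpE (m + 2) t - real m * bumpE (m + 1) t)) (at t)"
proof -
 consider "t > 0" | "t < 0" | "t = 0" by linarith
 then show ?thesis
 proof cases
  case 1
  have "((%t. exp (- (1 / t)) / t ^ m) has_real_derivative (bumpE (m + 2) t - real m * bumpE (m + 1) t)) (at t)"
  proof (cases m)
   case 0
   then show ?thesis using 1
    by (auto intro!: derivative_eq_intros simp: bumpE_def power2_eq_square field_simps)
  next
   case (Suc k)
   show ?thesis unfolding Suc using 1
    apply (auto intro!: derivative_eq_intros simp: bumpE_def)
    by (cases k) (auto simp: field_simps power2_eq_square)
  qed
  moreover have "\<forall>\<^sub>F s in nhds t. exp (- (1 / s)) / s ^ m = bumpE m s"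
   using eventually_nhds_in_open[of "{0<..}" t] 1
   by (auto elim!: eventually_mono simp: bumpE_def)
  ultimately show ?thesis using DERIV_cong_ev[OF refl _ refl, of "%s. exp (- (1 / s)) / s ^ m" "bumpE m" t] by blast
 next
  case 2
  have "((%t. 0) has_real_derivative (bumpE (m + 2) t - real m * bumpE (m + 1) t)) (at t)"
   using 2 by (simp add: bumpE_def)
  moreover have "\<forall>\<^sub>F s in nhds t. 0 = bumpE m s"
   using eventually_nhds_in_open[of "{..<0}" t] 2
   by (auto elim!: eventually_mono simp: bumpE_def)
  ultimately show ?thesis using DERIV_cong_ev[OF refl _ refl, of "%s. 0" "bumpE m" t] by blast
 next
  case 3
  have "((%h. (bumpE m (0 + h) - bumpE m 0) / h) \<longlongrightarrow> 0) (at 0)"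
  proof (rule Lim_null_comparison)
   show "\<forall>\<^sub>F h in at 0. norm ((bumpE m (0 + h) - bumpE m 0) / h) <= fact (m + 2) * abs h"
   proof (rule always_eventually, rule allI)
    fix h :: real
    show "norm ((bumpE m (0 + h) - bumpE m 0) / h) <= fact (m + 2) * abs h"
    proof (cases "h > 0")
     case True
     then have "bumpE m h / h <= fact (m + 2) * h^2 / h"
      using bumpE_bound[OF True] by (intro divide_right_mono) auto
     then show ?thesis using True bumpE_nonneg[of m h] by (simp add: bumpE_def power2_eq_square)
    next
     case False
     then have "(bumpE m (0 + h) - bumpE m 0) / h = 0" by (simp add: bumpE_def)
     then show ?thesis by (simp only: norm_zero) (intro mult_nonneg_nonneg; simp)
    qed
   qed
   show "((%h. fact (m + 2) * abs h) \<longlongrightarrow> 0) (at (0::real))"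
    by (intro tendsto_eq_intros) auto
  qed
  then show ?thesis using 3 by (simp add: DERIV_def bumpE_def)
 qed
qed

lemma Ck_bumpE: "Ck k (%x. bumpE m (1 - r * (x \<bullet> x)))"
proof (induction k arbitrary: m)
 case 0
 have "continuous_on UNIV (bumpE m)"
  using DERIV_isCont[OF bumpE_deriv] by (auto intro: continuous_at_imp_continuous_on)
 then show ?case by (auto intro!: continuous_on_compose2[of UNIV "bumpE m"] continuous_intros)
next
 case (Suc k)
 show ?case
 proof (rule Ck_SucI)
  fix x :: plane
  have "((%x::plane. 1 - r * (x \<bullet> x)) has_derivative (%h. (- 2 * r) * (x \<bullet> h))) (at x)"
   by (auto intro!: derivative_eq_intros simp: inner_commute)
  then show "((%x. bumpE m (1 - r * (x \<bullet> x))) has_derivative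
   (%h. (bumpE (m + 2) (1 - r * (x \<bullet> x)) - real m * bumpE (m + 1) (1 - r * (x \<bullet> x))) * ((- 2 * r) * (x \<bullet> h)))) (at x)"
   using bumpE_deriv[of m "1 - r * (x \<bullet> x)", unfolded has_field_derivative_def] by (rule has_derivative_compose)
 next
  fix i
  show "Ck k (%x. (bumpE (m + 2) (1 - r * (x \<bullet> x)) - real m * bumpE (m + 1) (1 - r * (x \<bullet> x))) * ((- 2 * r) * (x \<bullet> axis i 1)))"
   unfolding inner_axis real_inner_1_right
   by (intro Ck_mult[of k "%x. _ x - _ x"] Ck_mult[of k "%x. -2 * r"] Ck_mult[of k "%x. real m"] Ck_diff Ck_const Ck_coord Suc)
 qed
qed

definition bump :: "real => plane => real" where
 "bump e x = bumpE 0 (1 - (1 / e^2) * (x \<bullet> x))"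

definition mol :: "real => plane => real" where
 "mol e x = bump e x / integral\<^sup>L lborel (bump e)"

lemma Ck_bump: "Ck k (bump e)"
 unfolding bump_def by (rule Ck_bumpE)

lemma bump_pos: assumes "e > 0" "norm x < e" shows "bump e x > 0"
proof -
 have "(norm x)^2 < e^2" using assms by (intro power_strict_mono) auto
 then have "1 / e^2 * (x \<bullet> x) < 1" using assms(1) by (simp add: power2_norm_eq_inner)
 then show ?thesis unfolding bump_def bumpE_def by simp
qed

lemma bump_zero: assumes "e > 0" "norm x >= e" shows "bump e x = 0"
proof -
 have "(norm x)^2 >= e^2" using assms by (intro power_mono) auto
 then have "1 / e^2 * (x \<bullet> x) >= 1" using assms(1) by (simp add: power2_norm_eq_inner)
 then show ?thesis unfolding bump_def bumpE_def by simp
qed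

lemma bump_nonneg: "bump e x >= 0"
 by (simp add: bump_def bumpE_nonneg)

lemma bump_continuous: "continuous_on UNIV (bump e)"
 using Ck_continuous Ck_bump by blast

lemma bump_measurable [measurable]: "bump e : borel_measurable borel"
 using bump_continuous by (rule borel_measurable_continuous_onI)

lemma integrable_continuous_compact_support:
 fixes f :: "plane => 'b::euclidean_space"
 assumes "continuous_on UNIV f" "compact K" "!!x. x ~: K ==> f x = 0"
 shows "integrable lborel f"
proof -
 have "integrable lborel (%x. indicator K x *R f x)"
  using borel_integrable_compact[OF assms(2)] continuous_on_subset[OF assms(1)] by auto
 moreover have "(%x. indicator K x *R f x) = f" using assms(3) by (auto simp: indicator_def)
 ultimately show ?thesis by simp
qed

lemma bump_integrable: "e > 0 ==> integrable lborel (bump e)"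
 by (rule integrable_continuous_compact_support[OF bump_continuous compact_cball[of 0 e]]) (auto simp: bump_zero)

lemma bump_integral_pos: assumes "e > 0" shows "integral\<^sup>L lborel (bump e) > 0"
proof -
 have "integral\<^sup>L lborel (bump e) >= 0" by (simp add: bump_nonneg)
 moreover have "integral\<^sup>L lborel (bump e) ~= 0"
 proof
  assume "integral\<^sup>L lborel (bump e) = 0"
  then have "AE x in lborel. bump e x = 0"
   using bump_integrable[OF assms] by (subst (asm) integral_nonneg_eq_0_iff_AE) (auto simp: bump_nonneg)
  then have "AE x in lborel. x ~: ball (0::plane) e"
   by eventually_elim (use bump_pos[OF assms] in fastforce)
  then have "emeasure lborel (ball (0::plane) e) = 0"
   using AE_iff_null_sets[of "ball (0::plane) e" lborel] by auto
  then show False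
   using assms open_ball[of "0::plane" e] open_not_negligible[of "ball (0::plane) e"]
   by (auto simp: negligible_iff_emeasure0)
 qed
 ultimately show ?thesis by linarith
qed

lemma Ck_mol: "Ck k (mol e)"
 unfolding mol_def[abs_def] divide_inverse using Ck_mult[OF Ck_bump Ck_const] .

lemma mol_continuous: "continuous_on UNIV (mol e)"
 using Ck_continuous Ck_mol by blast

lemma mol_measurable [measurable]: "mol e : borel_measurable borel"
 using mol_continuous by (rule borel_measurable_continuous_onI)

lemma mol_nonneg: "mol e x >= 0"
 by (simp add: mol_def bump_nonneg)

lemma mol_zero: "e > 0 ==> norm x >= e ==> mol e x = 0"
 by (simp add: mol_def bump_zero)

lemma mol_even: "mol e (x - y) = mol e (y - x)"
 by (simp add: mol_def bump_def inner_diff_left inner_diff_right inner_commute algebra_simps)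

lemma mol_integrable: "e > 0 ==> integrable lborel (mol e)"
 unfolding mol_def[abs_def] using bump_integrable by simp

lemma mol_integral: "e > 0 ==> integral\<^sup>L lborel (mol e) = 1"
 unfolding mol_def[abs_def] using bump_integral_pos[of e] by simp

subsection \<open>Compactly supported smooth functions\<close>

lemma closure_nonzero_compact:
 fixes f :: "plane => real"
 assumes "compact K" "!!x. x ~: K ==> f x = 0" "K <= S"
 shows "compact_supp_in S f"
proof -
 have sub: "closure {x. f x ~= 0} <= K"
  using assms by (intro closure_minimal compact_imp_closed) auto
 have "compact (K \<inter> closure {x. f x ~= 0})"
  by (intro compact_Int_closed assms closed_closure)
 moreover have "K \<inter> closure {x. f x ~= 0} = closure {x. f x ~= 0}" using sub by blast
 ultimately show ?thesis unfolding compact_supp_in_def using sub assms(3) by auto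
qed

lemma compact_supp_inE:
 assumes "compact_supp_in S f"
 obtains K where "compact K" "K <= S" "!!x. x ~: K ==> f x = 0"
proof -
 have "f x = 0" if "x ~: closure {x. f x ~= 0}" for x
  using that closure_subset[of "{x. f x ~= 0}"] by blast
 then show ?thesis using that assms unfolding compact_supp_in_def by blast
qed

lemma Ccinf_Ck: "f : Ccinf S ==> Ck k f"
 by (simp add: Ccinf_def)

lemma Ccinf_supp: "f : Ccinf S ==> compact_supp_in S f"
 by (simp add: Ccinf_def)

lemma CcinfI: "(!!k. Ck k f) ==> compact K ==> K <= S ==> (!!x. x ~: K ==> f x = 0) ==> f : Ccinf S"
 unfolding Ccinf_def using closure_nonzero_compact by blast

lemma Ccinf_continuous: "f : Ccinf S ==> continuous_on UNIV f"
 using Ccinf_Ck[of f S 0] by simp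

lemma Ccinf_measurable: "f : Ccinf S ==> f : borel_measurable borel"
 using Ccinf_continuous by (rule borel_measurable_continuous_onI)

lemma Ccinf_has_derivative: "f : Ccinf S ==> (f has_derivative (%h. cgrad f x \<bullet> h)) (at x)"
 using Ck_has_derivative[OF Ccinf_Ck[of f S "Suc 0"]] .

lemma Ccinf_mono: "f : Ccinf S ==> S <= T ==> f : Ccinf T"
 by (auto simp: Ccinf_def compact_supp_in_def)

lemma Ccinf_subset_Cc: "Ccinf S <= Cc S"
 using Ccinf_continuous Ccinf_supp by (auto simp: Cc_def)

lemma Cc_supp: "f : Cc S ==> compact_supp_in S f"
 by (simp add: Cc_def)

lemma Cc_continuous: "f : Cc S ==> continuous_on UNIV f"
 by (simp add: Cc_def)

lemma Cc_measurable: "f : Cc S ==> f : borel_measurable borel"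
 using Cc_continuous by (rule borel_measurable_continuous_onI)

lemma Cc_bounded:
 assumes "f : Cc S" obtains B where "B >= 0" "!!x. abs (f x) <= B"
proof -
 obtain K where K0: "compact K" "K <= S" "!!x. x ~: K ==> f x = 0"
  by (rule compact_supp_inE[OF Cc_supp[OF assms]]) (rule that)
 note K = K0(1,3)
 have "compact (f ` K)" using K(1) Cc_continuous[OF assms] by (intro compact_continuous_image) (auto intro: continuous_on_subset)
 then obtain B where B: "!!y. y : f ` K ==> norm y <= B" using compact_imp_bounded bounded_iff by metis
 have "abs (f x) <= max B 0" for x using B[of "f x"] K(2)[of x] by (cases "x : K") auto
 then show ?thesis using that[of "max B 0"] by auto
qed

lemma cgrad_zero_outside:
 assumes "compact K" "!!x. x ~: K ==> f x = 0" "x ~: K"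
 shows "cgrad f x = 0"
proof -
 have "open (- K)" using assms(1) compact_imp_closed by blast
 then have "(f has_derivative (%h. 0)) (at x)"
  using has_derivative_transform_within_open[of "%x. 0" "%h. 0" x UNIV "- K" f] assms by auto
 then show ?thesis by (simp add: vec_eq_iff cgrad_eq)
qed

lemma Ccinf_cgrad: assumes "f : Ccinf S" shows "(%x. cgrad f x $ i) : Ccinf S"
proof -
 obtain K where K: "compact K" "K <= S" "!!x. x ~: K ==> f x = 0"
  by (rule compact_supp_inE[OF Ccinf_supp[OF assms]]) (rule that)
 show ?thesis
  by (rule CcinfI[OF _ K(1,2)]) (use Ccinf_Ck[OF assms, of "Suc _"] cgrad_zero_outside[OF K(1,3)] in auto)
qed

lemma cgrad_measurable: "p : Ccinf S ==> cgrad p : borel_measurable borel"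
 using Ccinf_measurable[OF Ccinf_cgrad]
 by (intro borel_measurable_continuous_onI continuous_on_vec_lambda[where f="%i x. cgrad p x $ i", simplified])
  (rule Ccinf_continuous[OF Ccinf_cgrad])

lemma Ccinf_add: assumes "f : Ccinf S" "h : Ccinf S" shows "(%x. f x + h x) : Ccinf S"
proof -
 obtain K where K: "compact K" "K <= S" "!!x. x ~: K ==> f x = 0"
  by (rule compact_supp_inE[OF Ccinf_supp[OF assms(1)]]) (rule that)
 obtain L where L: "compact L" "L <= S" "!!x. x ~: L ==> h x = 0"
  by (rule compact_supp_inE[OF Ccinf_supp[OF assms(2)]]) (rule that)
 show ?thesis
  by (rule CcinfI[OF _ compact_Un[OF K(1) L(1)]]) (use K L assms in "auto intro: Ck_add Ccinf_Ck")
qed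

lemma Ccinf_mult_left: assumes "f : Ccinf S" "!!k. Ck k h" shows "(%x. h x * f x) : Ccinf S"
proof -
 obtain K where K: "compact K" "K <= S" "!!x. x ~: K ==> f x = 0"
  by (rule compact_supp_inE[OF Ccinf_supp[OF assms(1)]]) (rule that)
 show ?thesis
  by (rule CcinfI[OF _ K(1,2)]) (use K assms in "auto intro: Ck_mult Ccinf_Ck")
qed

lemma Ccinf_cmult: "f : Ccinf S ==> (%x. c * f x) : Ccinf S"
 by (rule Ccinf_mult_left) (auto simp: Ck_const)

lemma Ccinf_zero: "(%x. 0) : Ccinf S"
 by (rule CcinfI[of _ "{}"]) (auto simp: Ck_const)

lemma cgrad_add: "f : Ccinf S ==> h : Ccinf T ==> cgrad (%x. f x + h x) x = cgrad f x + cgrad h x"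
 using cgrad_eq[OF has_derivative_add[OF Ccinf_has_derivative Ccinf_has_derivative]]
 by (simp add: vec_eq_iff inner_axis)

lemma cgrad_cmult: "f : Ccinf S ==> cgrad (%x. c * f x) x = c *R cgrad f x"
 using cgrad_eq[OF has_derivative_mult_right[OF Ccinf_has_derivative]]
 by (simp add: vec_eq_iff inner_axis)

text \<open>These test functions turn an integral identity valid for all test functions into a
  pointwise statement about the mollified field at x.\<close>

lemma Ccinf_affine_mol:
 assumes "e > 0" "cball x e <= S"
 shows "(%y. mol e (x - y)) : Ccinf S"
proof (rule CcinfI[OF _ compact_cball assms(2)])
 show "Ck k (%y. mol e (x - y))" for k using Ck_affine[OF Ck_mol, of k e x "-1"] by simp
 show "mol e (x - y) = 0" if "y ~: cball x e" for y
  using that assms(1) by (intro mol_zero) (auto simp: dist_norm)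
qed

lemma mol_Ccinf: "e > 0 ==> mol e : Ccinf UNIV"
 by (rule CcinfI[OF Ck_mol compact_cball[of 0 e]]) (auto simp: mol_zero)

subsection \<open>Convolution with smooth functions\<close>

definition conv :: "(plane => real) => (plane => real) => plane => real" where
 "conv p f x = (LBINT y. p (x - y) * f y)"

lemma Ccinf_bounded:
 assumes "f : Ccinf S" obtains B where "B >= 0" "!!x. abs (f x) <= B"
 using Cc_bounded[of f S] Ccinf_subset_Cc assms by blast

lemma cgrad_bounded:
 assumes "f : Ccinf S" obtains B where "B >= 0" "!!x. norm (cgrad f x) <= B"
proof -
 have "EX B. B >= 0 & (ALL x. abs (cgrad f x $ i) <= B)" for i
  using Ccinf_bounded[OF Ccinf_cgrad[OF assms]] by metis
 then obtain B where B: "!!i. B i >= 0" "!!i x. abs (cgrad f x $ i) <= B i" by metis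
 have "norm (cgrad f x) <= (SUM i:UNIV. B i)" for x
  using norm_le_l1_cart[of "cgrad f x"] B(2) by (meson order_trans sum_mono)
 moreover have "(SUM i:UNIV. B i) >= 0" using B(1) by (simp add: sum_nonneg)
 ultimately show ?thesis using that by blast
qed

lemma Ccinf_lipschitz:
 assumes "f : Ccinf S" "!!x. norm (cgrad f x) <= B"
 shows "abs (f x - f y) <= B * norm (x - y)"
proof -
 have "norm (f x - f y) <= B * norm (x - y)"
 proof (rule differentiable_bound[OF convex_UNIV])
  show "(f has_derivative (%h. cgrad f x \<bullet> h)) (at x within UNIV)" for x
   using Ccinf_has_derivative[OF assms(1)] .
  show "onorm (%h. cgrad f x \<bullet> h) <= B" for x
  proof (rule onorm_le)
   show "norm (cgrad f x \<bullet> h) <= B * norm h" for h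
    using Cauchy_Schwarz_ineq2[of "cgrad f x" h] mult_right_mono[OF assms(2)[of x] norm_ge_zero[of h]]
    by simp
  qed
 qed auto
 then show ?thesis by simp
qed

lemma conv_integrable:
 assumes "p : Ccinf S" "integrable lborel f"
 shows "integrable lborel (%y. p (x - y) * f y)"
proof -
 obtain B where B: "B >= 0" "!!x. abs (p x) <= B" by (rule Ccinf_bounded[OF assms(1)]) (rule that)
 have [measurable]: "p : borel_measurable borel" "f : borel_measurable borel"
  using Ccinf_measurable[OF assms(1)] assms(2) by auto
 show ?thesis
  by (rule lint_bound[of _ "%y. B * f y"])
   (use assms(2) B in "auto simp: abs_mult intro!: mult_mono")
qed

text \<open>Differentiation under the integral by dominated convergence along sequences: the
  Lipschitz bound for p dominates the remainder quotient by 2 B |f|, with f merely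
  integrable.\<close>

lemma conv_has_derivative:
 assumes p: "p : Ccinf S" and f: "integrable lborel f"
 shows "(conv p f has_derivative (%h. SUM i:UNIV. h $ i * conv (%y. cgrad p y $ i) f x)) (at x)"
proof -
 obtain B where B: "B >= 0" "!!x. norm (cgrad p x) <= B" by (rule cgrad_bounded[OF p]) (rule that)
 have [measurable]: "p : borel_measurable borel" "f : borel_measurable borel" "cgrad p : borel_measurable borel"
  using Ccinf_measurable[OF p] f cgrad_measurable[OF p] by auto
 have Deq: "(SUM i:UNIV. h $ i * conv (%y. cgrad p y $ i) f x) = (LBINT y. (cgrad p (x - y) \<bullet> h) * f y)" for h
  unfolding conv_def inner_vec_def sum_distrib_right
  by (subst Bochner_Integration.integral_sum)
   (auto intro!: sum.cong Bochner_Integration.integrable_mult_right conv_integrable[OF Ccinf_cgrad[OF p] f]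
    simp: mult.assoc mult.left_commute[of _ "h $ _"] integral_mult_right_zero simp flip: integral_mult_right_zero)
 have int: "integrable lborel (%y. (cgrad p (x - y) \<bullet> h) * f y)" for h
  unfolding inner_vec_def sum_distrib_right
  by (intro Bochner_Integration.integrable_sum)
   (simp add: mult.commute[of "_ $ _" "h $ _"] mult.assoc conv_integrable[OF Ccinf_cgrad[OF p] f])
 show ?thesis unfolding has_derivative_at
 proof
  show "bounded_linear (%h. SUM i:UNIV. h $ i * conv (%y. cgrad p y $ i) f x)"
   by (intro bounded_linear_sum bounded_linear_mult_const bounded_linear_vec_nth)
  show "((%h. norm (conv p f (x + h) - conv p f x - (SUM i:UNIV. h $ i * conv (%y. cgrad p y $ i) f x)) / norm h) \<longlongrightarrow> 0) (at 0)"
   unfolding tendsto_at_iff_sequentially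
  proof (intro allI impI)
   fix X :: "nat => plane" assume X: "ALL i. X i : UNIV - {0}" "X ----> 0"
   define g where "g n y = (p (x + X n - y) - p (x - y) - cgrad p (x - y) \<bullet> X n) / norm (X n) * f y" for n y
   have [measurable]: "g n : borel_measurable borel" for n unfolding g_def by measurable
   have eq: "(conv p f (x + X n) - conv p f x - (SUM i:UNIV. X n $ i * conv (%y. cgrad p y $ i) f x)) / norm (X n) = (LBINT y. g n y)" for n
   proof -
    have "conv p f (x + X n) - conv p f x - (SUM i:UNIV. X n $ i * conv (%y. cgrad p y $ i) f x)
     = (LBINT y. p (x + X n - y) * f y - p (x - y) * f y - (cgrad p (x - y) \<bullet> X n) * f y)"
     unfolding Deq unfolding conv_def using conv_integrable[OF p f] int by simp
    moreover have "(LBINT y. g n y) = (LBINT y. (p (x + X n - y) * f y - p (x - y) * f y - (cgrad p (x - y) \<bullet> X n) * f y) / norm (X n))"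
     unfolding g_def by (rule lint_cong) (auto simp: algebra_simps diff_divide_distrib)
    ultimately show ?thesis by simp
   qed
   have "(%n. LBINT y. g n y) ----> integral\<^sup>L lborel (%y::plane. 0)"
   proof (rule integral_dominated_convergence[where w = "%y. 2 * B * norm (f y)"])
    show "integrable lborel (%y. 2 * B * norm (f y))" using f by simp
    show "AE y in lborel. (%n. g n y) ----> 0"
    proof (rule AE_I2)
     fix y
     have "((%h. norm (p (x - y + h) - p (x - y) - cgrad p (x - y) \<bullet> h) / norm h) \<longlongrightarrow> 0) (at 0)"
      using Ccinf_has_derivative[OF p, of "x - y"] unfolding has_derivative_at by blast
     then have "(%n. norm (p (x - y + X n) - p (x - y) - cgrad p (x - y) \<bullet> X n) / norm (X n)) ----> 0"
      using X unfolding tendsto_at_iff_sequentially o_def by blast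
     then have "(%n. (norm (p (x - y + X n) - p (x - y) - cgrad p (x - y) \<bullet> X n) / norm (X n)) * norm (f y)) ----> 0"
      by (rule tendsto_mult_left_zero)
     moreover have "norm (g n y) = (norm (p (x - y + X n) - p (x - y) - cgrad p (x - y) \<bullet> X n) / norm (X n)) * norm (f y)" for n
      unfolding g_def using arg_cong[of "x - y + X n" "x + X n - y" p] by (simp add: abs_mult)
     ultimately have "(%n. norm (g n y)) ----> 0" by (simp only:)
     then show "(%n. g n y) ----> 0" by (rule tendsto_norm_zero_cancel)
    qed
    show "AE y in lborel. norm (g n y) <= 2 * B * norm (f y)" for n
    proof (rule AE_I2)
     fix y
     have "abs (p (x + X n - y) - p (x - y)) <= B * norm (X n)"
      using Ccinf_lipschitz[OF p B(2), of "x + X n - y" "x - y"] by simp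
     moreover have "abs (cgrad p (x - y) \<bullet> X n) <= B * norm (X n)"
      using Cauchy_Schwarz_ineq2[of "cgrad p (x - y)" "X n"] mult_right_mono[OF B(2) norm_ge_zero[of "X n"], of "x - y"] by linarith
     ultimately have "abs (p (x + X n - y) - p (x - y) - cgrad p (x - y) \<bullet> X n) <= 2 * B * norm (X n)" by linarith
     moreover have "norm (X n) > 0" using X(1) by auto
     ultimately have "abs (p (x + X n - y) - p (x - y) - cgrad p (x - y) \<bullet> X n) / norm (X n) <= 2 * B"
      by (simp add: pos_divide_le_eq)
     from mult_right_mono[OF this norm_ge_zero[of "f y"]] show "norm (g n y) <= 2 * B * norm (f y)"
      unfolding g_def by (simp add: abs_mult)
    qed
   qed auto
   then have "(%n. norm (LBINT y. g n y)) ----> 0" by (intro tendsto_norm_zero) simp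
   moreover have "norm (LBINT y. g n y) = norm (conv p f (x + X n) - conv p f x - (SUM i:UNIV. X n $ i * conv (%y. cgrad p y $ i) f x)) / norm (X n)" for n
    unfolding eq[symmetric] by simp
   ultimately show "((%h. norm (conv p f (x + h) - conv p f x - (SUM i:UNIV. h $ i * conv (%y. cgrad p y $ i) f x)) / norm h) \<circ> X) ----> 0"
    by (simp add: o_def)
  qed
 qed
qed

lemma cgrad_conv:
 assumes "p : Ccinf S" "integrable lborel f"
 shows "cgrad (conv p f) x $ i = conv (%y. cgrad p y $ i) f x"
 using cgrad_eq[OF conv_has_derivative[OF assms]] by (simp add: axis_def if_distrib[of "%z. z * _"] cong: if_cong)

lemma Ck_conv:
 assumes "p : Ccinf S" "integrable lborel f"
 shows "Ck k (conv p f)"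
 using assms(1)
proof (induction k arbitrary: p)
 case 0
 have "conv p f differentiable (at x)" for x using conv_has_derivative[OF 0 assms(2)] differentiable_def by blast
 then show ?case by (auto intro!: continuous_at_imp_continuous_on differentiable_imp_continuous_within)
next
 case (Suc k)
 have "conv p f differentiable (at x)" for x using conv_has_derivative[OF Suc.prems assms(2)] differentiable_def by blast
 then show ?case using Suc.IH[OF Ccinf_cgrad[OF Suc.prems]] cgrad_conv[OF Suc.prems assms(2)] by simp
qed

lemma conv_mol_supp:
 assumes "e > 0" "!!y. y ~: K ==> f y = 0" "!!y. y : K ==> dist x y >= e"
 shows "conv (mol e) f x = 0"
proof -
 have "(%y. mol e (x - y) * f y) = (%y. 0)"
 proof
  fix y show "mol e (x - y) * f y = 0"
   using assms mol_zero[of e "x - y"] by (cases "y : K") (auto simp: dist_norm)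
 qed
 then show ?thesis unfolding conv_def by simp
qed

section \<open>Mollification in the space of square-integrable functions\<close>

lemma nn_integral_plane_shift:
 assumes [measurable]: "g : borel_measurable borel"
 shows "(\<integral>\<^sup>+x. g (x - y) \<partial>lborel) = (\<integral>\<^sup>+x. g x \<partial>(lborel :: plane measure))"
proof -
 have "(\<integral>\<^sup>+x. g x \<partial>(lborel :: plane measure)) = (\<integral>\<^sup>+x. g x \<partial>(distr lborel borel ((+) (- y))))"
  by (subst lborel_distr_plus) simp
 also have "... = (\<integral>\<^sup>+x. g (- y + x) \<partial>lborel)" by (subst nn_integral_distr) auto
 finally show ?thesis by (simp add: algebra_simps)
qed

lemma integral_plane_shift:
 fixes g :: "plane => real"
 assumes [measurable]: "g : borel_measurable borel"
 shows "(LBINT x. g (x + y)) = (LBINT x. g x)"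
proof -
 have "(\<integral>x. g x \<partial>(lborel :: plane measure)) = (\<integral>x. g x \<partial>(distr lborel borel ((+) y)))"
  by (subst lborel_distr_plus) simp
 also have "... = (LBINT x. g (y + x))" by (subst integral_distr) auto
 finally show ?thesis by (simp add: add.commute)
qed

lemma integrable_plane_shift:
 fixes g :: "plane => real"
 assumes "integrable lborel g"
 shows "integrable lborel (%x. g (x + y))"
proof -
 have "integrable (distr lborel borel ((+) y)) g"
  using assms by (subst lborel_distr_plus)
 then have "integrable lborel (%x. g (y + x))"
  using assms by (subst (asm) integrable_distr_eq) auto
 then show ?thesis by (simp add: add.commute)
qed

lemma mol_shift_integrable: "e > 0 ==> integrable lborel (%y. mol e (x - y))"
 using integrable_plane_shift[OF mol_integrable, of e "- x"] by (simp add: mol_even[of e x])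

lemma mol_shift_integral: "e > 0 ==> (LBINT y. mol e (x - y)) = 1"
 using integral_plane_shift[of "mol e" "- x"] mol_integral[of e] by (simp add: mol_even[of e x])

lemma mol_mult_integrable:
 fixes f :: "plane => real"
 assumes "e > 0" "integrable lborel f"
 shows "integrable lborel (%y. mol e (x - y) * f y)"
 using conv_integrable[OF mol_Ccinf assms(2)] assms(1) by blast

lemma sqint_integrable_on_compact_weight:
 fixes f :: "plane => real"
 assumes "e > 0" "sqint f"
 shows "integrable lborel (%y. mol e (x - y) * f y)"
proof (rule lint_bound)
 have [measurable]: "f : borel_measurable borel" using assms(2) by measurable
 show "(%y. mol e (x - y) * f y) : borel_measurable lborel" by measurable
 show "integrable lborel (%y. mol e (x - y) + mol e (x - y) * (f y)^2)"
  using mol_shift_integrable[OF assms(1)] sqint_integrable_sq[OF assms(2)] assms(1)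
  by (intro Bochner_Integration.integrable_add mol_mult_integrable) auto
 show "AE y in lborel. norm (mol e (x - y) * f y) <= norm (mol e (x - y) + mol e (x - y) * (f y)^2)"
 proof (rule AE_I2)
  fix y
  have "abs (f y) <= 1 + (f y)^2" using sum_squares_bound[of 1 "abs (f y)"] zero_le_power2[of "f y"] by simp
  then have "mol e (x - y) * abs (f y) <= mol e (x - y) * (1 + (f y)^2)" by (intro mult_left_mono mol_nonneg)
  then show "norm (mol e (x - y) * f y) <= norm (mol e (x - y) + mol e (x - y) * (f y)^2)"
   by (simp add: abs_mult mol_nonneg abs_of_nonneg distrib_left)
 qed
qed

text \<open>Jensen's inequality for the probability density \<open>mol e (x - y)\<close>: the
  variance of f around its mean \<open>c\<close> is nonnegative.\<close>

lemma conv_mol_sq_le: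
 fixes f :: "plane => real"
 assumes e: "e > 0" and f: "sqint f"
 shows "(conv (mol e) f x)^2 <= (LBINT y. mol e (x - y) * (f y)^2)"
proof -
 define c where "c = conv (mol e) f x"
 have i1: "integrable lborel (%y. mol e (x - y) * f y)"
  by (rule sqint_integrable_on_compact_weight[OF e f])
 have i2: "integrable lborel (%y. mol e (x - y) * (f y)^2)"
  using sqint_integrable_sq[OF f] e by (intro mol_mult_integrable) auto
 have i3: "integrable lborel (%y. mol e (x - y))" by (rule mol_shift_integrable[OF e])
 have "0 <= (LBINT y. mol e (x - y) * (f y - c)^2)"
  by (intro integral_nonneg_AE AE_I2 mult_nonneg_nonneg mol_nonneg zero_le_power2)
 also have "... = (LBINT y. mol e (x - y) * (f y)^2 - 2 * c * (mol e (x - y) * f y) + c^2 * mol e (x - y))"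
  by (rule lint_cong) (auto simp: power2_eq_square algebra_simps)
 also have "... = (LBINT y. mol e (x - y) * (f y)^2) - 2 * c * c + c^2 * 1"
  using i1 i2 i3 mol_shift_integral[OF e, of x] by (simp add: c_def conv_def)
 finally show ?thesis unfolding c_def[symmetric] by (simp add: power2_eq_square)
qed

lemma conv_measurable [measurable]:
 assumes [measurable]: "p : borel_measurable borel" "f : borel_measurable borel"
 shows "conv p f : borel_measurable borel"
 unfolding conv_def[abs_def] by measurable

lemma conv_mol_nn_sq:
 fixes f :: "plane => real"
 assumes e: "e > 0" and f: "sqint f"
 shows "(\<integral>\<^sup>+x. ennreal ((conv (mol e) f x)^2) \<partial>lborel) <= (\<integral>\<^sup>+y. ennreal ((f y)^2) \<partial>lborel)"
proof -
 have [measurable]: "f : borel_measurable borel" using f by measurable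
 have "(\<integral>\<^sup>+x. ennreal ((conv (mol e) f x)^2) \<partial>lborel) <= (\<integral>\<^sup>+x. (\<integral>\<^sup>+y. ennreal (mol e (x - y)) * ennreal ((f y)^2) \<partial>lborel) \<partial>lborel)"
 proof (rule nn_integral_mono)
  fix x
  have "integrable lborel (%y. mol e (x - y) * (f y)^2)"
   using sqint_integrable_sq[OF f] e by (intro mol_mult_integrable) auto
  then have "(\<integral>\<^sup>+y. ennreal (mol e (x - y) * (f y)^2) \<partial>lborel) = ennreal (LBINT y. mol e (x - y) * (f y)^2)"
   by (intro nn_integral_eq_integral) (auto simp: mol_nonneg)
  then show "ennreal ((conv (mol e) f x)^2) <= (\<integral>\<^sup>+y. ennreal (mol e (x - y)) * ennreal ((f y)^2) \<partial>lborel)"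
   using conv_mol_sq_le[OF e f, of x] by (simp add: ennreal_mult mol_nonneg ennreal_leI)
 qed
 also have "... = (\<integral>\<^sup>+y. (\<integral>\<^sup>+x. ennreal (mol e (x - y)) * ennreal ((f y)^2) \<partial>lborel) \<partial>lborel)"
  by (rule lborel_pair.Fubini') measurable
 also have "... = (\<integral>\<^sup>+y. ennreal ((f y)^2) \<partial>lborel)"
 proof (rule nn_integral_cong)
  fix y
  have "(\<integral>\<^sup>+x. ennreal (mol e (x - y)) * ennreal ((f y)^2) \<partial>lborel) = (\<integral>\<^sup>+x. ennreal (mol e (x - y)) \<partial>lborel) * ennreal ((f y)^2)"
   by (rule nn_integral_multc) measurable
  also have "(\<integral>\<^sup>+x. ennreal (mol e (x - y)) \<partial>lborel) = (\<integral>\<^sup>+x. ennreal (mol e x) \<partial>lborel)"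
   by (rule nn_integral_plane_shift) measurable
  also have "... = ennreal (LBINT x. mol e x)"
   using mol_integrable[OF e] by (intro nn_integral_eq_integral) (auto simp: mol_nonneg)
  also have "... = 1" using mol_integral[OF e] by simp
  finally show "(\<integral>\<^sup>+x. ennreal (mol e (x - y)) * ennreal ((f y)^2) \<partial>lborel) = ennreal ((f y)^2)" by simp
 qed
 finally show ?thesis .
qed

lemma sqint_conv_mol:
 fixes f :: "plane => real"
 assumes e: "e > 0" and f: "sqint f"
 shows "sqint (conv (mol e) f)"
 unfolding sqint_def
proof
 have [measurable]: "f : borel_measurable borel" using f by measurable
 show "conv (mol e) f : borel_measurable borel" by measurable
 have "(\<integral>\<^sup>+y. ennreal ((f y)^2) \<partial>lborel) < \<infinity>"
  using sqint_integrable_sq[OF f] by (simp add: integrable_iff_bounded)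
 then show "integrable lborel (%x. (norm (conv (mol e) f x))^2)"
  using conv_mol_nn_sq[OF e f] by (intro integrableI_bounded) (auto simp: order_le_less_trans)
qed

lemma norm_conv_mol_le:
 fixes f :: "plane => real"
 assumes e: "e > 0" and f: "sqint f"
 shows "norm (L2of (conv (mol e) f)) <= norm (L2of f)"
proof -
 have *: "ennreal ((norm (L2of g))^2) = (\<integral>\<^sup>+y. ennreal ((g y)^2) \<partial>lborel)" if "sqint g" for g :: "plane => real"
  unfolding norm_sq_L2of[OF that]
  using sqint_integrable_sq[OF that] by (subst nn_integral_eq_integral) auto
 have "ennreal ((norm (L2of (conv (mol e) f)))^2) <= ennreal ((norm (L2of f))^2)"
  using conv_mol_nn_sq[OF e f] unfolding *[OF f] *[OF sqint_conv_mol[OF e f]] .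
 then have "(norm (L2of (conv (mol e) f)))^2 <= (norm (L2of f))^2" by (subst (asm) ennreal_le_iff) auto
 then show ?thesis by (rule power2_le_imp_le) simp
qed

lemma conv_mol_add:
 fixes f g :: "plane => real"
 assumes "e > 0" "sqint f" "sqint g"
 shows "conv (mol e) (%y. c * f y + d * g y) x = c * conv (mol e) f x + d * conv (mol e) g x"
proof -
 have "(%y. mol e (x - y) * (c * f y + d * g y)) = (%y. c * (mol e (x - y) * f y) + d * (mol e (x - y) * g y))"
  by (auto simp: algebra_simps)
 then show ?thesis unfolding conv_def
  using sqint_integrable_on_compact_weight[OF assms(1,2)] sqint_integrable_on_compact_weight[OF assms(1,3)] by simp
qed

lemma conv_cong_AE:
 assumes "AE y in lborel. f y = g y" "f : borel_measurable borel" "g : borel_measurable borel" "p : borel_measurable borel"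
 shows "conv p f x = conv p g x"
proof -
 have [measurable]: "f : borel_measurable borel" "g : borel_measurable borel" "p : borel_measurable borel" by fact+
 show ?thesis unfolding conv_def
  by (rule integral_cong_AE) (measurable, use assms(1) in \<open>eventually_elim, simp\<close>)
qed

definition mollify :: "real => real l2 => real l2" where
 "mollify e x = L2of (conv (mol e) (fn x))"

lemma mollify_L2of:
 assumes e: "e > 0" and f: "sqint f"
 shows "mollify e (L2of f) = L2of (conv (mol e) f)"
proof -
 have [measurable]: "f : borel_measurable borel" using f by measurable
 have "conv (mol e) (fn (L2of f)) = conv (mol e) f"
  by (rule ext, rule conv_cong_AE[OF fn_L2of[OF f]]) measurable
 then show ?thesis by (simp add: mollify_def)
qed

lemma norm_mollify: "e > 0 ==> norm (mollify e x) <= norm x"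
 unfolding mollify_def using norm_conv_mol_le[of e "fn x"] by simp

lemma mollify_lin:
 assumes e: "e > 0"
 shows "mollify e (c *R x + d *R y) = c *R mollify e x + d *R mollify e y"
proof -
 have s: "sqint (%t. c * fn x t)" "sqint (%t. d * fn y t)" using sqint_scaleR[OF sqint_fn, of c x] sqint_scaleR[OF sqint_fn, of d y] by simp_all
 have "c *R x + d *R y = L2of (%t. c * fn x t) + L2of (%t. d * fn y t)"
  using L2of_scaleR[OF sqint_fn[of x], of c] L2of_scaleR[OF sqint_fn[of y], of d] by simp
 also have "... = L2of (%t. c * fn x t + d * fn y t)" using L2of_add[OF s] by simp
 finally have "mollify e (c *R x + d *R y) = L2of (conv (mol e) (%t. c * fn x t + d * fn y t))"
  using mollify_L2of[OF e sqint_add[OF s]] by simp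
 also have "conv (mol e) (%t. c * fn x t + d * fn y t) = (%t. c * conv (mol e) (fn x) t + d * conv (mol e) (fn y) t)"
  by (rule ext) (rule conv_mol_add[OF e]; simp)
 also have "L2of ... = c *R mollify e x + d *R mollify e y"
 proof -
  have t: "sqint (conv (mol e) (fn x))" "sqint (conv (mol e) (fn y))" by (auto intro: sqint_conv_mol[OF e])
  show ?thesis
   using L2of_add[OF sqint_scaleR[OF t(1), of c] sqint_scaleR[OF t(2), of d]] L2of_scaleR[OF t(1), of c] L2of_scaleR[OF t(2), of d]
   by (simp add: mollify_def)
 qed
 finally show ?thesis .
qed

lemma integrable_indicator_bounded:
 "bounded A ==> A : sets borel ==> integrable lborel (indicator A :: plane => real)"
 using emeasure_bounded_finite[of A] by (auto simp: integrable_indicator_iff)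

lemma sqint_indicator_box: "sqint (indicator (box a b) :: plane => real)"
 unfolding sqint_def
proof
 have "integrable lborel (indicator (box a b) :: plane => real)"
  by (rule integrable_indicator_bounded) auto
 moreover have "(%x. (norm (indicator (box a b) x :: real))^2) = indicator (box a b)"
  by (auto simp: indicator_def)
 ultimately show "integrable lborel (%x. (norm (indicator (box a b) x :: real))^2)" by simp
qed measurable

text \<open>The positive and the negative part of f, as densities, give the same finite value to
  every box, and the boxes are an intersection-stable generator of the Borel sets.\<close>

lemma AE_zero_if_box_integrals_zero:
 fixes f :: "plane => real"
 assumes f: "sqint f" and zero: "!!a b. (LBINT x. f x * indicator (box a b) x) = 0"
 shows "AE x in lborel. f x = 0"
proof -
 have [measurable]: "f : borel_measurable borel" using f by measurable
 \<comment> \<open>\<open>ennreal\<close> truncates at 0, so \<open>M1\<close> and \<open>M2\<close>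
   carry the positive and the negative part of f.\<close>
 define M1 where "M1 = density lborel (%x. ennreal (f x))"
 define M2 where "M2 = density lborel (%x. ennreal (- f x))"
 have int: "integrable lborel (%x. f x * indicator (box a b) x)" for a b
  using sqint_inner_integrable[OF f sqint_indicator_box[of a b]] by simp
 have em: "emeasure M1 (box a b) = emeasure M2 (box a b) & emeasure M1 (box a b) ~= \<infinity>" for a b
 proof -
  let ?g = "%x. f x * indicator (box a b) x"
  let ?P = "\<integral>\<^sup>+x. ennreal (?g x) \<partial>lborel" and ?N = "\<integral>\<^sup>+x. ennreal (- ?g x) \<partial>lborel"
  have e: "emeasure M1 (box a b) = ?P" "emeasure M2 (box a b) = ?N"
   unfolding M1_def M2_def by (subst emeasure_density; auto intro!: nn_integral_cong simp: indicator_def)+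
  have fin: "?P < top" "?N < top" using int[of a b] by (auto simp: real_integrable_def less_top)
  have "enn2real ?P = enn2real ?N" using real_lebesgue_integral_def[OF int[of a b]] zero[of a b] by simp
  then have "?P = ?N" using ennreal_enn2real[OF fin(1)] ennreal_enn2real[OF fin(2)] by metis
  then show ?thesis unfolding e using fin(1) by (simp only: less_top infinity_ennreal_def simp_thms)
 qed
 have "M1 = M2"
 proof (rule measure_eqI_generator_eq[where E = "range (%(a, b). box a b::plane set)" and \<Omega> = UNIV and A = "%n::nat. box (- (real n *R One)) (real n *R One)"])
  show "Int_stable (range (%(a, b). box a b::plane set))"
   by (auto simp: Int_stable_def box_Int_box)
  show "range (%(a, b). box a b::plane set) <= Pow UNIV" by simp
  show "sets M1 = sigma_sets UNIV (range (%(a, b). box a b))" "sets M2 = sigma_sets UNIV (range (%(a, b). box a b))"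
   by (simp_all add: M1_def M2_def borel_eq_box)
  show "range (%n::nat. box (- (real n *R One)) (real n *R One)::plane set) <= range (%(a, b). box a b)" by auto
  show "(\<Union>n::nat. box (- (real n *R One)) (real n *R One)::plane set) = UNIV" by (rule UN_box_eq_UNIV)
  show "emeasure M1 (box (- (real i *R One)) (real i *R One)) ~= \<infinity>" for i using em by blast
  show "emeasure M1 X = emeasure M2 X" if "X : range (%(a, b). box a b)" for X using em that by auto
 qed
 then have "AE x in lborel. ennreal (f x) = ennreal (- f x)"
  unfolding M1_def M2_def
  by (intro sigma_finite_measure.density_unique[OF sigma_finite_lborel]) auto
 then show ?thesis
 proof eventually_elim
  case (elim x)
  show ?case using elim ennreal_neg[of "f x"] ennreal_neg[of "- f x"] by (cases "f x >= 0") (simp_all add: ennreal_eq_0_iff)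
 qed
qed

abbreviation "boxes == range (%(a, b). L2of (indicator (box a b) :: plane => real))"

text \<open>The residual of a vector after projection onto the closed span has zero integral over
  every box and is therefore zero.\<close>

lemma span_box_dense: "closure (span boxes) = UNIV"
proof -
 define W where "W = closure (span boxes)"
 have W: "subspace W" "closed W" unfolding W_def by (auto intro!: subspace_closure_gen)
 have "x : W" for x
 proof -
  obtain p where p: "p : W" "!!v. v : W ==> x \<bullet> v = p \<bullet> v" using projection_exists[OF W] by blast
  have "AE t in lborel. fn (x - p) t = 0"
  proof (rule AE_zero_if_box_integrals_zero)
   fix a b
   have "L2of (indicator (box a b) :: plane => real) : W" unfolding W_def
    by (rule set_mp[OF closure_subset], rule span_base) auto
   then have "(x - p) \<bullet> L2of (indicator (box a b) :: plane => real) = 0" using p(2) by (simp add: inner_diff_left)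
   then show "(LBINT t. fn (x - p) t * indicator (box a b) t) = 0"
    unfolding inner_L2of_right[OF sqint_indicator_box] by simp
  qed simp
  then have "AE t in lborel. fn (x - p) t = fn 0 t" using fn_zero by eventually_elim simp
  then have "x - p = 0" by (rule l2_eqI)
  then show ?thesis using p(1) by simp
 qed
 then show ?thesis unfolding W_def by auto
qed

abbreviation eps :: "nat => real" where "eps n == 1 / (real n + 1)"

lemma eps_tendsto: "eps ----> 0"
 using LIMSEQ_inverse_real_of_nat by (simp add: inverse_eq_divide add.commute)

lemma eps_less: "d > 0 ==> \<forall>\<^sub>F n in sequentially. eps n < d"
 using order_tendstoD(2)[OF eps_tendsto] by blast

lemma mollify_box:
 "(%n. norm (mollify (eps n) (L2of (indicator (box a b))) - L2of (indicator (box a b)))) ----> 0"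
proof -
 let ?f = "indicator (box a b) :: plane => real"
 let ?c = "%n. conv (mol (eps n)) ?f"
 have c: "sqint (?c n)" for n by (rule sqint_conv_mol[OF _ sqint_indicator_box]) simp
 obtain R where R: "R > 0" "box a b <= ball 0 R"
  using bounded_box[of a b] bounded_subset_ballD[of "box a b" 0] by auto
 have c01: "0 <= ?c n x & ?c n x <= 1" for n x
 proof -
  have "?c n x <= (LBINT y. mol (eps n) (x - y))" unfolding conv_def
   by (rule integral_mono[OF sqint_integrable_on_compact_weight[OF _ sqint_indicator_box] mol_shift_integrable])
    (auto simp: indicator_def mol_nonneg)
  moreover have "0 <= ?c n x" unfolding conv_def
   by (intro integral_nonneg_AE AE_I2 mult_nonneg_nonneg mol_nonneg) auto
  ultimately show ?thesis using mol_shift_integral[of "eps n" x] by simp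
 qed
 have "(%n. (LBINT x. (norm (?c n x - ?f x))^2)) ----> integral\<^sup>L lborel (%x::plane. 0)"
 proof (rule integral_dominated_convergence[where w = "indicator (cball 0 (R + 1))"])
  show "integrable lborel (indicator (cball (0::plane) (R + 1)) :: plane => real)"
   by (rule integrable_indicator_bounded) auto
  \<comment> \<open>Off the boundary of the box, the mollified indicator equals the indicator as
    soon as \<open>eps n\<close> is small enough.\<close>
  have "cbox a b - box a b : null_sets lborel"
   using negligible_frontier_interval[of a b] by (simp add: negligible_iff_null_sets null_sets_completion_iff)
  then have "AE x in lborel. x ~: cbox a b - box a b" by (rule AE_not_in)
  then show "AE x in lborel. (%n. (norm (?c n x - ?f x))^2) ----> 0"
  proof eventually_elim
   case (elim x)
   have "\<forall>\<^sub>F n in sequentially. ?c n x = ?f x"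
   proof (cases "x : box a b")
    case True
    then obtain d where d: "d > 0" "ball x d <= box a b" using open_box openE by blast
    from eps_less[OF d(1)] show ?thesis
    proof eventually_elim
     case (elim n)
     have eqp: "mol (eps n) (x - y) * ?f y = mol (eps n) (x - y)" for y
      using d elim mol_zero[of "eps n" "x - y"] by (cases "y : ball x d") (auto simp: dist_norm)
     have "?c n x = (LBINT y. mol (eps n) (x - y))" unfolding conv_def
      by (rule lint_cong[OF refl eqp])
     then show ?case using mol_shift_integral[of "eps n" x] True by simp
    qed
   next
    case False
    then have "x : - cbox a b" using elim by blast
    then obtain d where d: "d > 0" "ball x d <= - cbox a b" using openE[of "- cbox a b"] closed_cbox by (metis open_Compl)
    from eps_less[OF d(1)] show ?thesis
    proof eventually_elim
     case (elim n)
     have "?c n x = 0"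
     proof (rule conv_mol_supp[of _ "box a b"])
      fix y assume "y : box a b"
      then have "y ~: ball x d" using d(2) box_subset_cbox by blast
      then show "eps n <= dist x y" using elim by auto
     qed auto
     then show ?case using False by simp
    qed
   qed
   then have "\<forall>\<^sub>F n in sequentially. (norm (?c n x - ?f x))^2 = 0"
    by eventually_elim simp
   then show ?case by (rule tendsto_eventually)
  qed
  show "AE x in lborel. norm ((norm (?c n x - ?f x))^2) <= indicator (cball 0 (R + 1)) x" for n
  proof (rule AE_I2)
   fix x
   show "norm ((norm (?c n x - ?f x))^2) <= indicator (cball 0 (R + 1)) x"
   proof (cases "x : cball 0 (R + 1)")
    case True
    have "abs (?c n x - ?f x) <= 1" using c01[of n x] by (auto simp: indicator_def)
    then have "abs (?c n x - ?f x)^2 <= 1^2" by (intro power_mono) auto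
    then show ?thesis using True by simp
   next
    case False
    have "?c n x = 0"
    proof (rule conv_mol_supp[of _ "box a b"])
     fix y assume "y : box a b"
     then have "norm y < R" using R by auto
     moreover have "norm x > R + 1" using False by simp
     moreover have "norm x - norm y <= dist x y" by (simp add: dist_norm norm_triangle_ineq2)
     moreover have "eps n <= 1" by simp
     ultimately show "eps n <= dist x y" by linarith
    qed auto
    moreover have "?f x = 0" using False R by (auto simp: indicator_def)
    ultimately show ?thesis by simp
   qed
  qed
 qed measurable
 then have "(%n. (norm (mollify (eps n) (L2of ?f) - L2of ?f))^2) ----> 0"
  using norm_sq_L2of[OF sqint_diff[OF c sqint_indicator_box]] mollify_L2of[OF _ sqint_indicator_box, of "eps _"]
  by (simp add: L2of_diff[OF c sqint_indicator_box])
 from tendsto_real_sqrt[OF this] show ?thesis by simp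
qed

text \<open>Mollification does not increase norms, so convergence on the dense span of box
  indicators is enough.\<close>

lemma mollify_tendsto: "(%n. norm (mollify (eps n) x - x)) ----> 0"
proof -
 let ?M = "%n. mollify (eps n)"
 have lin1: "?M n (x - y) = ?M n x - ?M n y" for n x y
  using mollify_lin[of "eps n" 1 x "-1" y] by simp
 have sp: "(%n. norm (?M n w - w)) ----> 0" if "w : span boxes" for w
  using that
 proof (induction rule: span_induct_alt)
  case base
  have "?M n 0 = 0" for n using lin1[of n 0 0] by simp
  then show ?case by simp
 next
  case (step c x y)
  have 1: "?M n (c *R x + y) = c *R ?M n x + ?M n y" for n
   using mollify_lin[of "eps n" c x 1 y] by simp
  have "(%n. ?M n x - x) ----> 0"
  proof -
   obtain a b where x: "x = L2of (indicator (box a b) :: plane => real)" using step(1) by auto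
   show ?thesis unfolding x by (rule tendsto_norm_zero_cancel[OF mollify_box])
  qed
  moreover have "(%n. ?M n y - y) ----> 0" by (rule tendsto_norm_zero_cancel[OF step(2)])
  ultimately have "(%n. c *R (?M n x - x) + (?M n y - y)) ----> c *R 0 + 0"
   by (intro tendsto_intros)
  then have "(%n. ?M n (c *R x + y) - (c *R x + y)) ----> 0"
   unfolding 1 by (simp add: scaleR_diff_right add_diff_add)
  then show ?case by (rule tendsto_norm_zero)
 qed
 have "x : closure (span boxes)"
  by (simp add: span_box_dense)
 note cl = this[unfolded closure_approachable]
 have "EX N. ALL n>=N. norm (?M n x - x) < e" if "e > 0" for e
 proof -
  obtain w where w: "w : span boxes" "dist w x < e / 3"
   using cl[rule_format, of "e / 3"] `e > 0` by auto
  obtain N where N: "!!n. n >= N ==> norm (?M n w - w) < e / 3"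
   using LIMSEQ_D[OF sp[OF w(1)], of "e/3"] `e > 0` by auto
  have "norm (?M n x - x) < e" if "n >= N" for n
  proof -
   have eq: "?M n x - x = ?M n (x - w) + (?M n w - w) + (w - x)"
    unfolding lin1 by simp
   have "norm (?M n x - x) <= norm (?M n (x - w)) + norm (?M n w - w) + norm (w - x)"
    unfolding eq using norm_triangle_ineq[of "?M n (x - w) + (?M n w - w)" "w - x"]
     norm_triangle_ineq[of "?M n (x - w)" "?M n w - w"] by linarith
   moreover have "norm (?M n (x - w)) <= norm (x - w)" by (rule norm_mollify) simp
   ultimately show ?thesis using w(2) N[OF that] by (simp add: dist_norm norm_minus_commute)
  qed
  then show ?thesis by blast
 qed
 then show ?thesis by (intro LIMSEQ_I) simp
qed

lemma conv_mol_tendsto_L2: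
 fixes f :: "plane => real"
 assumes f: "sqint f"
 shows "(%n. LBINT x. (conv (mol (eps n)) f x - f x)^2) ----> 0"
proof -
 have c: "sqint (conv (mol (eps n)) f)" for n by (rule sqint_conv_mol[OF _ f]) simp
 have "(%n. (norm (mollify (eps n) (L2of f) - L2of f))^2) ----> 0^2"
  by (intro tendsto_power mollify_tendsto)
 moreover have "(norm (mollify (eps n) (L2of f) - L2of f))^2 = (LBINT x. (conv (mol (eps n)) f x - f x)^2)" for n
  using norm_sq_L2of[OF sqint_diff[OF c f]] mollify_L2of[OF _ f, of "eps n"] by (simp add: L2of_diff[OF c f])
 ultimately show ?thesis by simp
qed

text \<open>Convergence in mean square gives almost everywhere convergence along a subsequence, and
  for x in the open set the balls of radius \<open>eps\<close> eventually lie inside it, so the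
  limit inherits the sign.\<close>

lemma AE_nonneg_if_conv_nonneg:
 fixes f :: "plane => real"
 assumes f: "sqint f" and "open S"
  and pos: "!!x e. e > 0 ==> cball x e <= S ==> conv (mol e) f x >= 0"
 shows "AE x in lborel. x : S --> f x >= 0"
proof -
 have c: "sqint (conv (mol (eps n)) f)" for n by (rule sqint_conv_mol[OF _ f]) simp
 have "EX r::nat => nat. strict_mono r & (AE x in lborel. (%n. (conv (mol (eps (r n))) f x - f x)^2) ----> 0)"
  using sqint_integrable_sq[OF sqint_diff[OF c f]] conv_mol_tendsto_L2[OF f]
  by (intro tendsto_L1_AE_subseq) auto
 then obtain r :: "nat => nat" where r: "strict_mono r" "AE x in lborel. (%n. (conv (mol (eps (r n))) f x - f x)^2) ----> 0" by blast
 from r(2) show ?thesis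
 proof eventually_elim
  case (elim x)
  show ?case
  proof
   assume "x : S"
   then obtain d where d: "d > 0" "cball x d <= S" using `open S` open_contains_cball by blast
   have "(%n. conv (mol (eps (r n))) f x - f x) ----> 0"
    using tendsto_real_sqrt[OF elim] by (simp add: tendsto_rabs_zero_iff)
   then have lim: "(%n. conv (mol (eps (r n))) f x) ----> f x" by (simp add: LIM_zero_iff)
   have "\<forall>\<^sub>F n in sequentially. eps (r n) < d"
    using eventually_subseq[OF r(1) eps_less[OF d(1)]] .
   then have "\<forall>\<^sub>F n in sequentially. conv (mol (eps (r n))) f x >= 0"
    by eventually_elim (rule pos, simp, use d(2) in force)
   then show "f x >= 0" using tendsto_lowerbound[OF lim] by simp
  qed
 qed
qed

lemma AE_zero_if_conv_zero:
 fixes f :: "plane => real"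
 assumes f: "sqint f" and "open S"
  and zero: "!!x e. e > 0 ==> cball x e <= S ==> conv (mol e) f x = 0"
 shows "AE x in lborel. x : S --> f x = 0"
proof -
 have 1: "AE x in lborel. x : S --> f x >= 0"
  by (rule AE_nonneg_if_conv_nonneg[OF f `open S`]) (simp add: zero)
 have 2: "AE x in lborel. x : S --> - f x >= 0"
 proof (rule AE_nonneg_if_conv_nonneg[OF sqint_minus[OF f] `open S`])
  show "conv (mol e) (%x. - f x) x >= 0" if "e > 0" "cball x e <= S" for x e
   using zero[OF that] by (simp add: conv_def)
 qed
 from 1 2 show ?thesis by eventually_elim auto
qed

subsection \<open>Integration by parts and the Poincare inequality\<close>

lemma difference_quotient_tendsto:
 assumes f: "f : Ccinf S" and g: "integrable lborel g" and t: "t ----> 0" "!!n::nat. t n ~= 0"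
 shows "(%n. LBINT x. (f (x + t n *R v) - f x) / t n * g x) ----> (LBINT x. (cgrad f x \<bullet> v) * g x)"
proof -
 obtain B where B: "B >= 0" "!!x. norm (cgrad f x) <= B" by (rule cgrad_bounded[OF f]) (rule that)
 have [measurable]: "f : borel_measurable borel" "g : borel_measurable borel" "cgrad f : borel_measurable borel"
  using Ccinf_measurable[OF f] g cgrad_measurable[OF f] by auto
 show ?thesis
 proof (rule integral_dominated_convergence[where w = "%x. B * norm v * norm (g x)"])
  show "integrable lborel (%x. B * norm v * norm (g x))" using g by simp
  show "AE x in lborel. (%n. (f (x + t n *R v) - f x) / t n * g x) ----> (cgrad f x \<bullet> v) * g x"
  proof (rule AE_I2)
   fix x
   have "((%s. f (x + s *R v)) has_derivative (%h. cgrad f (x + 0 *R v) \<bullet> (h *R v))) (at 0)"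
    by (rule has_derivative_compose[OF _ Ccinf_has_derivative[OF f]]) (auto intro!: derivative_eq_intros)
   then have "((%s. f (x + s *R v)) has_real_derivative (cgrad f x \<bullet> v)) (at 0)"
    unfolding has_field_derivative_def by (simp add: mult.commute[of _ "cgrad f x \<bullet> v"])
   then have "((%s. (f (x + s *R v) - f x) / s) \<longlongrightarrow> cgrad f x \<bullet> v) (at 0)"
    unfolding DERIV_def by simp
   then have "(%n. (f (x + t n *R v) - f x) / t n) ----> cgrad f x \<bullet> v"
    using t unfolding tendsto_at_iff_sequentially o_def by simp
   then show "(%n. (f (x + t n *R v) - f x) / t n * g x) ----> (cgrad f x \<bullet> v) * g x"
    by (rule tendsto_mult_right)
  qed
  show "AE x in lborel. norm ((f (x + t n *R v) - f x) / t n * g x) <= B * norm v * norm (g x)" for n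
  proof (rule AE_I2)
   fix x
   have "abs (f (x + t n *R v) - f x) <= B * (abs (t n) * norm v)"
    using Ccinf_lipschitz[OF f B(2), of "x + t n *R v" x] by simp
   then have "abs (f (x + t n *R v) - f x) / abs (t n) <= B * norm v"
    using t(2)[of n] by (simp add: pos_divide_le_eq algebra_simps)
   from mult_right_mono[OF this norm_ge_zero[of "g x"]]
   show "norm ((f (x + t n *R v) - f x) / t n * g x) <= B * norm v * norm (g x)"
    by (simp add: abs_mult)
  qed
 qed measurable
qed

lemma Ccinf_integrable: assumes "f : Ccinf S" shows "integrable lborel f"
proof -
 obtain K where K: "compact K" "K <= S" "!!x. x ~: K ==> f x = 0"
  by (rule compact_supp_inE[OF Ccinf_supp[OF assms]]) (rule that)
 show ?thesis by (rule integrable_continuous_compact_support[OF Ccinf_continuous[OF assms] K(1,3)])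
qed

lemma Ccinf_outside_ball:
 assumes "f : Ccinf S" obtains R where "R > 0" "!!x. norm x >= R ==> f x = 0"
proof -
 obtain K where K: "compact K" "K <= S" "!!x. x ~: K ==> f x = 0"
  by (rule compact_supp_inE[OF Ccinf_supp[OF assms]]) (rule that)
 obtain R where "R > 0" "K <= ball 0 R"
  using compact_imp_bounded[OF K(1)] bounded_subset_ballD[of K 0] by auto
 then show ?thesis using that[of R] K(3) by (metis dist_0_norm mem_ball not_less subsetD)
qed

text \<open>Each difference quotient of f has integral zero by translation invariance. The ball of
  radius R + 1 contains the supports of all of them, since the steps are at most 1; its indicator
  supplies the integrable factor for the passage to the limit.\<close>

lemma integral_cgrad_zero:
 assumes f: "f : Ccinf S" shows "(LBINT x. cgrad f x $ i) = 0"
proof -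
 obtain R where R: "R > 0" "!!x. norm x >= R ==> f x = 0" by (rule Ccinf_outside_ball[OF f]) (rule that)
 have [measurable]: "f : borel_measurable borel" using Ccinf_measurable[OF f] .
 let ?g = "indicator (cball (0::plane) (R + 1)) :: plane => real"
 let ?v = "axis i 1 :: plane"
 let ?q = "%n x. (f (x + eps n *R ?v) - f x) / eps n"
 have lim: "(%n. LBINT x. ?q n x * ?g x) ----> (LBINT x. (cgrad f x \<bullet> ?v) * ?g x)"
  by (rule difference_quotient_tendsto[OF f _ eps_tendsto]) (auto intro: integrable_indicator_bounded)
 have "(LBINT x. ?q n x * ?g x) = 0" for n
 proof -
  have eqp: "?q n x * ?g x = ?q n x" for x
  proof (cases "x : cball 0 (R + 1)")
   case False
   then have "norm x > R + 1" by simp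
   moreover have "norm x - norm (eps n *R ?v) <= norm (x + eps n *R ?v)"
    using norm_triangle_ineq2[of x "- (eps n *R ?v)"] by simp
   moreover have "norm (eps n *R ?v) <= 1" by (simp add: norm_axis_1)
   ultimately have "norm (x + eps n *R ?v) >= R" "norm x >= R" by linarith+
   then show ?thesis using R(2) by simp
  qed simp
  have "(LBINT x. ?q n x * ?g x) = (LBINT x. ?q n x)"
   by (rule lint_cong[OF refl eqp])
  also have "... = ((LBINT x. f (x + eps n *R ?v)) - (LBINT x. f x)) / eps n"
   using Ccinf_integrable[OF f] integrable_plane_shift[OF Ccinf_integrable[OF f]] by simp
  also have "... = 0" using integral_plane_shift[of f] by simp
  finally show ?thesis .
 qed
 then have "(LBINT x. (cgrad f x \<bullet> ?v) * ?g x) = 0" using LIMSEQ_unique[OF lim, of 0] by simp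
 moreover have "(cgrad f x \<bullet> ?v) * ?g x = cgrad f x $ i" for x
  using cgrad_zero_outside[OF compact_cball[of 0 "R"], of f x] R
  by (cases "x : cball 0 (R + 1)") (auto simp: inner_axis)
 ultimately show ?thesis by simp
qed

lemma cgrad_mult:
 assumes "!!k. Ck k f" "!!k. Ck k h"
 shows "cgrad (%x. f x * h x) x = f x *R cgrad h x + h x *R cgrad f x"
 using cgrad_eq[OF has_derivative_mult[OF Ck_has_derivative[OF assms(1)] Ck_has_derivative[OF assms(2)]]]
 by (simp add: vec_eq_iff inner_axis)

lemma integration_by_parts:
 assumes f: "f : Ccinf S" and h: "!!k. Ck k h"
 shows "(LBINT x. h x * cgrad f x $ i) = - (LBINT x. cgrad h x $ i * f x)"
proof -
 have "0 = (LBINT x. cgrad (%x. h x * f x) x $ i)"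
  using integral_cgrad_zero[OF Ccinf_mult_left[OF f h]] by simp
 also have "... = (LBINT x. h x * cgrad f x $ i + cgrad h x $ i * f x)"
  by (simp add: cgrad_mult[OF h Ccinf_Ck[OF f]]) (simp add: mult.commute)
 also have "... = (LBINT x. h x * cgrad f x $ i) + (LBINT x. cgrad h x $ i * f x)"
 proof (rule Bochner_Integration.integral_add)
  show "integrable lborel (%x. h x * cgrad f x $ i)"
   using Ccinf_integrable[OF Ccinf_mult_left[OF Ccinf_cgrad[OF f] h]] .
  have "Ck k (%x. cgrad h x $ i)" for k using h[of "Suc k"] by simp
  from Ccinf_integrable[OF Ccinf_mult_left[OF f this]]
  show "integrable lborel (%x. cgrad h x $ i * f x)" .
 qed
 finally show ?thesis by simp
qed

text \<open>A weak form of the symmetry of second derivatives: with a difference quotient in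
  direction i in place of the derivative, integration by parts in direction j is exact. The limit
  leaves both derivatives on f, in the order that a second integration by parts undoes. This makes
  gradients weakly curl-free.\<close>

lemma cgrad_cross:
 assumes f: "f : Ccinf S" and q: "q : Ccinf T"
 shows "(LBINT x. cgrad f x $ i * cgrad q x $ j) = (LBINT x. cgrad f x $ j * cgrad q x $ i)"
proof -
 let ?v = "axis i 1 :: plane"
 have qj: "(%x. cgrad q x $ j) : Ccinf T" and fj: "(%x. cgrad f x $ j) : Ccinf S"
  by (rule Ccinf_cgrad, fact)+
 have [measurable]: "q : borel_measurable borel" "f : borel_measurable borel"
  "(%x. cgrad f x $ j) : borel_measurable borel"
  using Ccinf_measurable f q fj by auto
 have l1: "(%n. LBINT x. (f (x + eps n *R ?v) - f x) / eps n * cgrad q x $ j) ----> (LBINT x. (cgrad f x \<bullet> ?v) * cgrad q x $ j)"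
  by (rule difference_quotient_tendsto[OF f Ccinf_integrable[OF qj] eps_tendsto]) simp
 have l2: "(%n. LBINT x. (cgrad f (x + eps n *R ?v) $ j - cgrad f x $ j) / eps n * q x) ----> (LBINT x. (cgrad (%x. cgrad f x $ j) x \<bullet> ?v) * q x)"
  by (rule difference_quotient_tendsto[OF fj Ccinf_integrable[OF q] eps_tendsto]) simp
 have eq: "(LBINT x. (f (x + eps n *R ?v) - f x) / eps n * cgrad q x $ j) = - (LBINT x. (cgrad f (x + eps n *R ?v) $ j - cgrad f x $ j) / eps n * q x)" for n
 proof -
  define s c where "s = eps n *R ?v" and "c = 1 / eps n"
  have Ck: "Ck k (%x. c * (f (s + 1 *R x) - f x))" for k
   by (intro Ck_cmult Ck_diff Ck_affine Ccinf_Ck[OF f])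
  have gs: "cgrad (%x. c * (f (s + 1 *R x) - f x)) x $ j = c * (cgrad f (s + x) $ j - cgrad f x $ j)" for x
  proof -
   have "((%x. f (s + 1 *R x)) has_derivative (%h. cgrad f (s + 1 *R x) \<bullet> h)) (at x)"
    by (rule has_derivative_compose[OF _ Ccinf_has_derivative[OF f]]) (auto intro!: derivative_eq_intros)
   from cgrad_eq[OF has_derivative_mult_right[OF has_derivative_diff[OF this Ccinf_has_derivative[OF f]]], of c j]
   show ?thesis by (simp add: inner_axis)
  qed
  show ?thesis using integration_by_parts[OF q Ck, of j] unfolding gs by (simp add: s_def c_def add.commute mult.commute[of "1 + real n"])
 qed
 have "(LBINT x. (cgrad f x \<bullet> ?v) * cgrad q x $ j) = - (LBINT x. (cgrad (%x. cgrad f x $ j) x \<bullet> ?v) * q x)"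
  using LIMSEQ_unique[OF l1] tendsto_minus[OF l2] unfolding eq by blast
 then show ?thesis using integration_by_parts[OF q Ccinf_Ck[OF fj], of i] by (simp add: inner_axis mult.commute)
qed

lemma sqint_continuous_compact_support:
 fixes f :: "plane => 'b::euclidean_space"
 assumes "continuous_on UNIV f" "compact K" "!!x. x ~: K ==> f x = 0"
 shows "sqint f"
 unfolding sqint_def
proof
 show "f : borel_measurable borel" using assms(1) by (rule borel_measurable_continuous_onI)
 show "integrable lborel (%x. (norm (f x))^2)"
  by (rule integrable_continuous_compact_support[OF _ assms(2)]) (use assms in "auto intro!: continuous_intros")
qed

lemma Cc_sqint: assumes "f : Cc S" shows "sqint f"
proof -
 obtain K where K: "compact K" "K <= S" "!!x. x ~: K ==> f x = 0"
  by (rule compact_supp_inE[OF Cc_supp[OF assms]]) (rule that)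
 show ?thesis by (rule sqint_continuous_compact_support[OF Cc_continuous[OF assms] K(1,3)])
qed

lemma Ccinf_sqint: "f : Ccinf S ==> sqint f"
 using Cc_sqint Ccinf_subset_Cc by blast

lemma cgrad_continuous: "f : Ccinf S ==> continuous_on UNIV (cgrad f)"
 using Ccinf_continuous[OF Ccinf_cgrad]
  continuous_on_vec_lambda[of UNIV "%i x. cgrad f x $ i"] by simp

lemma cgrad_sqint: assumes "f : Ccinf S" shows "sqint (cgrad f)"
proof -
 obtain K where K: "compact K" "K <= S" "!!x. x ~: K ==> f x = 0"
  by (rule compact_supp_inE[OF Ccinf_supp[OF assms]]) (rule that)
 show ?thesis
  by (rule sqint_continuous_compact_support[OF cgrad_continuous[OF assms] K(1)])
   (rule cgrad_zero_outside[OF K(1,3)])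
qed

text \<open>Since the first coordinate has derivative 1, integration by parts gives the integral of
  f^2 as that of -2 x1 f f_1. On the support |x1| is at most R, and half of the integral of f^2 is
  absorbed on the left.\<close>

lemma poincare:
 assumes f: "f : Ccinf S" and S: "S <= ball 0 R"
 shows "(LBINT x. (f x)^2) <= 4 * R^2 * (LBINT x. (norm (cgrad f x))^2)"
proof -
 obtain K where K: "compact K" "K <= S" "!!x. x ~: K ==> f x = 0"
  by (rule compact_supp_inE[OF Ccinf_supp[OF f]]) (rule that)
 have f2: "(%x. f x * f x) : Ccinf S" by (rule Ccinf_mult_left[OF f Ccinf_Ck[OF f]])
 have g1: "cgrad (%x. x $ 1) x $ 1 = 1" for x :: plane
  using cgrad_eq[OF bounded_linear_imp_has_derivative[OF bounded_linear_vec_nth[of 1]], of x 1] by (simp add: axis_def)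
 have i\<phi>: "integrable lborel (%x. (f x)^2)" using sqint_integrable_sq[OF Ccinf_sqint[OF f]] by simp
 have ig: "integrable lborel (%x. (norm (cgrad f x))^2)" using sqint_integrable_sq[OF cgrad_sqint[OF f]] .
 have "(LBINT x. (f x)^2) = - (LBINT x. x $ 1 * cgrad (%x. f x * f x) x $ 1)"
  using integration_by_parts[OF f2 Ck_coord, of 1 1] g1 by (simp add: power2_eq_square)
 also have "... = (LBINT x. - 2 * x $ 1 * (f x * cgrad f x $ 1))"
  unfolding integral_minus[symmetric]
  by (rule lint_cong) (auto simp: cgrad_mult[OF Ccinf_Ck[OF f] Ccinf_Ck[OF f]])
 also have "... <= (LBINT x. (f x)^2 / 2 + 2 * R^2 * (norm (cgrad f x))^2)"
 proof (rule integral_mono)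
  show "integrable lborel (%x. - 2 * x $ 1 * (f x * cgrad f x $ 1))"
  proof -
   have "Ck k (%x. - 2 * x $ 1 * cgrad f x $ 1)" for k
    using Ccinf_Ck[OF Ccinf_cgrad[OF f]] by (intro Ck_mult Ck_coord Ck_const)
   from Ccinf_integrable[OF Ccinf_mult_left[OF f this]] show ?thesis by (simp add: mult.assoc mult.left_commute mult.commute)
  qed
  show "integrable lborel (%x. (f x)^2 / 2 + 2 * R^2 * (norm (cgrad f x))^2)" using i\<phi> ig by simp
  fix x
  show "- 2 * x $ 1 * (f x * cgrad f x $ 1) <= (f x)^2 / 2 + 2 * R^2 * (norm (cgrad f x))^2"
  proof (cases "x : S")
   case True
   then have "norm x < R" using S by auto
   then have x1: "abs (x $ 1) <= R" using component_le_norm_cart[of x 1] by linarith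
   have g: "abs (cgrad f x $ 1) <= norm (cgrad f x)" using component_le_norm_cart by blast
   have "- 2 * x $ 1 * (f x * cgrad f x $ 1) <= abs (- 2 * x $ 1 * (f x * cgrad f x $ 1))" by (rule abs_ge_self)
   also have "... = 2 * (abs (x $ 1) * abs (cgrad f x $ 1)) * abs (f x)" by (simp add: abs_mult)
   also have "... <= 2 * (R * norm (cgrad f x)) * abs (f x)"
    using x1 g by (intro mult_right_mono mult_left_mono mult_mono) auto
   also have "... <= (f x)^2 / 2 + 2 * (R * norm (cgrad f x))^2"
    using zero_le_power2[of "abs (f x) - 2 * (R * norm (cgrad f x))"] by (simp add: power2_eq_square algebra_simps)
   finally show ?thesis by (simp add: power_mult_distrib)
  next
   case False
   then have "f x = 0" using K by blast
   then show ?thesis by simp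
  qed
 qed
 also have "... = (LBINT x. (f x)^2) / 2 + 2 * R^2 * (LBINT x. (norm (cgrad f x))^2)" using i\<phi> ig by simp
 finally show ?thesis by simp
qed

section \<open>Stream functions on squares\<close>

abbreviation "cont2 I K f == continuous_on (I \<times> K) (%(x, y). f x y)"

lemma cont2_slice1:
 "cont2 I K f ==> y : K ==> continuous_on I (%x. f x y)"
 by (rule continuous_on_compose2[of "I \<times> K" "%(x, y). f x y" I "%x. (x, y)", simplified])
  (auto intro!: continuous_intros)

lemma cont2_slice2:
 "cont2 I K f ==> x : I ==> continuous_on K (%y. f x y)"
 by (rule continuous_on_compose2[of "I \<times> K" "%(x, y). f x y" K "%y. (x, y)", simplified])
  (auto intro!: continuous_intros)

lemma continuous_on_swap_args:
 assumes "cont2 I K f"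
 shows "continuous_on (K \<times> I) (%(y, x). f x y)"
proof -
 have "continuous_on (K \<times> I) (%p. case (snd p, fst p) of (x, y) => f x y)"
  by (rule continuous_on_compose2[OF assms]) (auto intro!: continuous_intros)
 then show ?thesis by (simp add: split_beta)
qed

lemma real_param_cont:
 fixes f :: "real => real => real"
 assumes "continuous_on (U \<times> {a..b}) (%(x, t). f x t)"
 shows "continuous_on U (%x. integral {a..b} (f x))"
 using integral_continuous_on_param[of U a b f] assms by (simp add: box_real)

lemma real_swap:
 fixes f :: "real => real => real"
 assumes "cont2 {a..b} {c..d} f"
 shows "integral {a..b} (%x. integral {c..d} (f x)) = integral {c..d} (%y. integral {a..b} (%x. f x y))"
 using integral_swap_continuous[of a c b d f] assms by (simp add: box_real cbox_Pair_eq)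

lemma abs_diff_le_integral:
 fixes g g' :: "real => real"
 assumes d: "!!t. t : {a..b} ==> (g has_real_derivative g' t) (at t within {a..b})"
  and c: "continuous_on {a..b} g'" and x: "x : {a..b}" and y: "y : {a..b}"
 shows "abs (g x - g y) <= integral {a..b} (%t. abs (g' t))"
proof -
 have *: "abs (g x - g y) <= integral {a..b} (%t. abs (g' t))" if "y <= x" "x : {a..b}" "y : {a..b}" for x y
 proof -
  have sub: "{y..x} <= {a..b}" using that by auto
  have "(g' has_integral (g x - g y)) {y..x}"
   using that d DERIV_subset[OF _ sub]
   by (intro fundamental_theorem_of_calculus) (auto simp: has_real_derivative_iff_has_vector_derivative[symmetric])
  then have "abs (g x - g y) = abs (integral {y..x} g')" by (simp add: integral_unique)
  also have "... <= integral {y..x} (%t. abs (g' t))"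
   using integral_norm_bound_integral[of g' "{y..x}" "%t. abs (g' t)"] continuous_on_subset[OF c sub]
   by (auto intro!: integrable_continuous_real continuous_intros)
  also have "... <= integral {a..b} (%t. abs (g' t))"
   using c continuous_on_subset[OF c sub] sub
   by (intro integral_subset_le) (auto intro!: integrable_continuous_real continuous_intros)
  finally show ?thesis .
 qed
 show ?thesis using *[of y x] *[of x y] x y by (cases "y <= x") (auto simp: abs_minus_commute)
qed

lemma exists_below_mean:
 fixes G :: "real => real"
 assumes "s > 0" "continuous_on {a..a+s} G"
 obtains x where "x : {a..a+s}" "s * G x <= integral {a..a+s} G"
proof -
 obtain x where x: "x : {a..a+s}" "!!y. y : {a..a+s} ==> G x <= G y"
  using continuous_attains_inf[of "{a..a+s}" G] assms by auto
 have "integral {a..a+s} (%y. G x) <= integral {a..a+s} G"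
  by (intro integral_le integrable_continuous_real assms continuous_intros x(2))
 then show ?thesis using that[OF x(1)] assms by simp
qed

text \<open>Two paths from \<open>(x, y)\<close> to a well chosen point give two bounds for \<open>\<bar>w x y - c\<bar>\<close>; their
 product has separated variables.\<close>

lemma square_poincare_L1_L2:
 fixes w w1 w2 :: "real => real => real"
 assumes s: "s > 0" and I: "I = {a1..a1+s}" and K: "K = {a2..a2+s}"
  and c: "cont2 I K w"
  and c1: "cont2 I K w1" and c2: "cont2 I K w2"
  and d1: "!!x y. x : I ==> y : K ==> ((%x. w x y) has_real_derivative w1 x y) (at x within I)"
  and d2: "!!x y. x : I ==> y : K ==> ((%y. w x y) has_real_derivative w2 x y) (at y within K)"
 obtains c where "integral I (%x. integral K (%y. (w x y - c)^2))
  <= (integral I (%x. integral K (%y. abs (w1 x y))) + integral I (%x. integral K (%y. abs (w2 x y))))^2"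
proof -
 define F where "F y = integral I (%x. abs (w1 x y))" for y
 define G where "G x = integral K (%y. abs (w2 x y))" for x
 define A where "A = integral I (%x. integral K (%y. abs (w1 x y)))"
 define B where "B = integral I (%x. integral K (%y. abs (w2 x y)))"
 have ca1: "continuous_on (I \<times> K) (%(x, y). abs (w1 x y))" and ca2: "continuous_on (I \<times> K) (%(x, y). abs (w2 x y))"
  using c1 c2 by (auto simp: split_beta intro!: continuous_intros)
 have cF: "continuous_on K F" unfolding F_def I
  using continuous_on_swap_args[OF ca1] by (intro real_param_cont) (simp add: I)
 have cG: "continuous_on I G" unfolding G_def K
  using ca2 by (intro real_param_cont) (simp add: K)
 have A: "A = integral K F" unfolding A_def F_def using ca1 unfolding I K by (rule real_swap)
 have B: "B = integral I G" unfolding B_def G_def ..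
 obtain x0 where x0: "x0 : I" "s * G x0 <= B"
  using exists_below_mean[OF s, of a1 G] cG unfolding B I by blast
 obtain y0 where y0: "y0 : K" "s * F y0 <= A"
  using exists_below_mean[OF s, of a2 F] cF unfolding A K by blast
 have Fn: "F y >= 0" if "y : K" for y unfolding F_def I
  using cont2_slice1[OF ca1 that] by (intro integral_nonneg integrable_continuous_real) (auto simp: I)
 have Gn: "G x >= 0" if "x : I" for x unfolding G_def K
  using cont2_slice2[OF ca2 that] by (intro integral_nonneg integrable_continuous_real) (auto simp: K)
 have p1: "abs (w x y - w x' y) <= F y" if "x : I" "x' : I" "y : K" for x x' y
  unfolding F_def I
  by (rule abs_diff_le_integral[where g = "%x. w x y"]) (use that d1 cont2_slice1[OF c1] in "auto simp: I")
 have p2: "abs (w x y - w x y') <= G x" if "x : I" "y : K" "y' : K" for x y y'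
  unfolding G_def K
  by (rule abs_diff_le_integral[where g = "%y. w x y"]) (use that d2 cont2_slice2[OF c2] in "auto simp: K")
 define k where "k = w x0 y0"
 let ?d = "%x y. (w x y - k)^2" and ?E = "%x. (G x + F y0) * (A + s * G x0)"
 have pt: "(w x y - k)^2 <= (G x + F y0) * (F y + G x0)" if xy: "x : I" "y : K" for x y
 proof -
  have "abs (w x y - k) <= F y + G x0"
   using p1[OF xy(1) x0(1) xy(2)] p2[OF x0(1) xy(2) y0(1)] unfolding k_def by linarith
  moreover have "abs (w x y - k) <= G x + F y0"
   using p2[OF xy y0(1)] p1[OF xy(1) x0(1) y0(1)] unfolding k_def by linarith
  ultimately have "abs (w x y - k) * abs (w x y - k) <= (G x + F y0) * (F y + G x0)"
   by (intro mult_mono) auto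
  then show ?thesis by (simp add: power2_eq_square)
 qed
 have cw: "continuous_on (I \<times> K) (%(x, y). (w x y - k)^2)"
  using c by (auto simp: split_beta intro!: continuous_intros)
 have ci: "continuous_on I (%x. integral K (?d x))"
  unfolding K by (rule real_param_cont) (use cw K in simp)
 have "integral I (%x. integral K (?d x)) <= integral I (%x. ?E x)"
 proof (rule integral_le)
  show "(%x. integral K (?d x)) integrable_on I"
   using ci unfolding I by (rule integrable_continuous_real)
  show "(%x. ?E x) integrable_on I"
   using cG unfolding I by (intro integrable_continuous_real continuous_intros)
  show "integral K (?d x) <= ?E x" if x: "x : I" for x
  proof -
   have "integral K (?d x) <= integral K (%y. (G x + F y0) * (F y + G x0))"
   proof (rule integral_le)
    show "?d x integrable_on K"
     using cont2_slice2[OF cw x] unfolding K by (rule integrable_continuous_real)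
    show "(%y. (G x + F y0) * (F y + G x0)) integrable_on K"
     using cF unfolding K by (intro integrable_continuous_real continuous_intros)
   qed (use pt[OF x] in auto)
   also have "... = (G x + F y0) * (integral K (%y. F y + G x0))" by simp
   also have "integral K (%y. F y + G x0) = A + s * G x0"
    unfolding A K using integrable_continuous_real[OF cF[unfolded K]] s
    by (subst Henstock_Kurzweil_Integration.integral_add) auto
   finally show ?thesis .
  qed
 qed
 also have "... = integral I (%x. G x + F y0) * (A + s * G x0)" by simp
 also have "integral I (%x. G x + F y0) = B + s * F y0"
  unfolding B I using integrable_continuous_real[OF cG[unfolded I]] s
  by (subst Henstock_Kurzweil_Integration.integral_add) auto
 \<comment> \<open>The point (x0, y0) was chosen so that its two line integrals do not exceed the
   means: s G x0 <= B and s F y0 <= A.\<close>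
 also have "(B + s * F y0) * (A + s * G x0) <= (A + B) * (A + B)"
 proof -
  have n: "0 <= s * F y0" "0 <= s * G x0" using s Fn[OF y0(1)] Gn[OF x0(1)] by auto
  then have "A >= 0" "B >= 0" using x0(2) y0(2) by linarith+
  then show ?thesis using n x0(2) y0(2) by (intro mult_mono) linarith+
 qed
 finally show ?thesis using that[of k] unfolding A_def B_def by (simp add: power2_eq_square)
qed

text \<open>Vanishing divergence is the integrability condition for the rotated field (z2, -z1). Its
  potential is the integral along the bottom edge of the square and then along a vertical segment;
  the x-derivative of the vertical part is found by differentiating under the integral.\<close>

lemma stream_function:
 fixes z1 z2 z1x z2y :: "real => real => real"
 assumes s: "s > 0" and I: "I = {a1..a1+s}" and K: "K = {a2..a2+s}"
  and c1: "cont2 I K z1" and c2: "cont2 I K z2"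
  and cx: "cont2 I K z1x"
  and d1: "!!x y. x : I ==> y : K ==> ((%x. z1 x y) has_real_derivative z1x x y) (at x within I)"
  and d2: "!!x y. x : I ==> y : K ==> ((%y. z2 x y) has_real_derivative - z1x x y) (at y within K)"
 obtains w where "cont2 I K w"
  "!!x y. x : I ==> y : K ==> ((%x. w x y) has_real_derivative z2 x y) (at x within I)"
  "!!x y. x : I ==> y : K ==> ((%y. w x y) has_real_derivative - z1 x y) (at y within K)"
proof -
 define w where "w x y = integral {a1..x} (%t. z2 t a2) - integral {a2..y} (%t. z1 x t)" for x y
 have a2K: "a2 : K" using s K by auto
 have wx: "((%x. w x y) has_real_derivative z2 x y) (at x within I)" if xy: "x : I" "y : K" for x y
 proof -
  have sub: "{a2..y} <= K" using xy K by auto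
  have e1: "((%x. integral {a1..x} (%t. z2 t a2)) has_real_derivative z2 x a2) (at x within I)"
   using integral_has_vector_derivative[of a1 "a1+s" "%t. z2 t a2" x] cont2_slice1[OF c2 a2K] xy
   unfolding I by (simp add: has_real_derivative_iff_has_vector_derivative)
  have e2: "((%x. integral (cbox a2 y) (z1 x)) has_field_derivative integral (cbox a2 y) (z1x x)) (at x within I)"
  proof (rule leibniz_rule_field_derivative)
   show "((%x. z1 x t) has_real_derivative z1x x t) (at x within I)" if "x : I" "t : cbox a2 y" for x t
    using d1 that sub by (auto simp: box_real)
   show "z1 x integrable_on cbox a2 y" if "x : I" for x
    using continuous_on_subset[OF cont2_slice2[OF c1 that] sub] by (auto simp: box_real intro: integrable_continuous_real)
   show "continuous_on (I \<times> cbox a2 y) (%(x, t). z1x x t)"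
    by (rule continuous_on_subset[OF cx]) (use sub in "auto simp: box_real")
  qed (use xy I in auto)
  have "((%t. - z1x x t) has_integral (z2 x y - z2 x a2)) {a2..y}"
  proof (rule fundamental_theorem_of_calculus)
   show "a2 <= y" using xy K by auto
   show "((%t. z2 x t) has_vector_derivative - z1x x t) (at t within {a2..y})" if "t : {a2..y}" for t
    using DERIV_subset[OF d2[OF xy(1), of t] sub] that sub
    by (auto simp: has_real_derivative_iff_has_vector_derivative[symmetric])
  qed
  from has_integral_neg[OF this] have "(z1x x has_integral - (z2 x y - z2 x a2)) {a2..y}" by simp
  then have e3: "integral {a2..y} (z1x x) = - (z2 x y - z2 x a2)" by (rule integral_unique)
  have "((%x. integral {a1..x} (%t. z2 t a2) - integral {a2..y} (z1 x)) has_real_derivative z2 x a2 - integral {a2..y} (z1x x)) (at x within I)"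
   using DERIV_diff[OF e1 e2] by (simp add: box_real)
  then show ?thesis unfolding w_def e3 by simp
 qed
 have wy: "((%y. w x y) has_real_derivative - z1 x y) (at y within K)" if xy: "x : I" "y : K" for x y
 proof -
  have "((%y. integral {a2..y} (z1 x)) has_real_derivative z1 x y) (at y within K)"
   using integral_has_vector_derivative[of a2 "a2+s" "z1 x" y] cont2_slice2[OF c1 xy(1)] xy
   unfolding K by (simp add: has_real_derivative_iff_has_vector_derivative)
  from DERIV_diff[OF DERIV_const this] show ?thesis unfolding w_def by simp
 qed
 \<comment> \<open>The partial derivatives are bounded on the compact square, so w is Lipschitz in
   each variable and hence jointly.\<close>
 have "cont2 I K w"
 proof -
  have cpt: "compact (I \<times> K)" unfolding I K by (intro compact_Times) auto
  have "compact ((%(x, y). z1 x y) ` (I \<times> K))" "compact ((%(x, y). z2 x y) ` (I \<times> K))"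
   using c1 c2 cpt by (auto intro: compact_continuous_image)
  then obtain M1 M2 where "!!v. v : (%(x, y). z1 x y) ` (I \<times> K) ==> norm v <= M1"
   "!!v. v : (%(x, y). z2 x y) ` (I \<times> K) ==> norm v <= M2"
   using compact_imp_bounded bounded_iff by metis
  then have M: "abs (z1 x y) <= M1" "abs (z2 x y) <= M2" if "x : I" "y : K" for x y using that by force+
  have lx: "abs (w x y - w x' y) <= M2 * abs (x - x')" if "x : I" "x' : I" "y : K" for x x' y
   using field_differentiable_bound[of I "%x. w x y" "%x. z2 x y" M2 x x'] wx M(2) that
   by (auto simp: I)
  have ly: "abs (w x y - w x y') <= M1 * abs (y - y')" if "x : I" "y : K" "y' : K" for x y y'
   using field_differentiable_bound[of K "%y. w x y" "%y. - z1 x y" M1 y y'] wy M(1) that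
   by (auto simp: K)
  have "(M2 + M1)-lipschitz_on (I \<times> K) (%p. w (fst p) (snd p))"
  proof (rule lipschitz_onI)
   fix p q :: "real \<times> real" assume "p : I \<times> K" "q : I \<times> K"
   then have pq: "fst p : I" "snd p : K" "fst q : I" "snd q : K" by auto
   have Mn: "M1 >= 0" "M2 >= 0" using M[OF pq(1,2)] abs_ge_zero order_trans by blast+
   have "abs (w (fst p) (snd p) - w (fst q) (snd q)) <= M2 * abs (fst p - fst q) + M1 * abs (snd p - snd q)"
    using lx[OF pq(1,3,2)] ly[OF pq(3,2,4)] by linarith
   also have "... <= M2 * dist p q + M1 * dist p q"
    using Mn dist_fst_le[of p q] dist_snd_le[of p q] by (intro add_mono mult_left_mono) (auto simp: dist_real_def)
   finally show "dist (w (fst p) (snd p)) (w (fst q) (snd q)) <= (M2 + M1) * dist p q"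
    by (simp add: dist_real_def distrib_right)
  next
   have "a1 : I" using s I by auto
   then show "0 <= M2 + M1" using M[OF _ a2K, of a1] by (meson abs_ge_zero add_nonneg_nonneg order_trans)
  qed
  then show ?thesis using lipschitz_on_continuous_on by (auto simp: split_beta)
 qed
 then show ?thesis using that wx wy by blast
qed

text \<open>The difference of the integrands is the x-derivative of h w p2 minus the y-derivative of
  h w p1; the terms with \<open>q\<close> cancel because (p1, p2) is curl-free. Both derivatives
  integrate to zero since h vanishes on the boundary. No derivative of (p1, p2) remains, so the
  result is suited to weak convergence of that field.\<close>

lemma stream_identity:
 fixes z1 z2 p1 p2 w h :: "real => real => real"
 assumes s: "s > 0" and I: "I = {a1..a1+s}" and K: "K = {a2..a2+s}"
  and cw: "cont2 I K w"
  and cz: "cont2 I K z1" "cont2 I K z2"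
  and cp: "cont2 I K p1" "cont2 I K p2"
  and cf: "cont2 I K h"
  and cq: "cont2 I K q"
  and cf': "cont2 I K hx" "cont2 I K hy"
  and wx: "!!x y. x : I ==> y : K ==> ((%x. w x y) has_real_derivative z2 x y) (at x within I)"
  and wy: "!!x y. x : I ==> y : K ==> ((%y. w x y) has_real_derivative - z1 x y) (at y within K)"
  and px: "!!x y. x : I ==> y : K ==> ((%x. p2 x y) has_real_derivative q x y) (at x within I)"
  and py: "!!x y. x : I ==> y : K ==> ((%y. p1 x y) has_real_derivative q x y) (at y within K)"
  and fx: "!!x y. x : I ==> y : K ==> ((%x. h x y) has_real_derivative hx x y) (at x within I)"
  and fy: "!!x y. x : I ==> y : K ==> ((%y. h x y) has_real_derivative hy x y) (at y within K)"
  and bx: "!!y. y : K ==> h a1 y = 0 & h (a1+s) y = 0" and bY: "!!x. x : I ==> h x a2 = 0 & h x (a2+s) = 0"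
 shows "integral I (%x. integral K (%y. h x y * (z1 x y * p1 x y + z2 x y * p2 x y)))
   = integral I (%x. integral K (%y. w x y * (hy x y * p1 x y - hx x y * p2 x y)))"
proof -
 let ?J = "%f. integral I (%x. integral K (f x))"
 define X where "X x y = hx x y * (w x y * p2 x y) + h x y * (z2 x y * p2 x y + w x y * q x y)" for x y
 define Y where "Y x y = hy x y * (w x y * p1 x y) + h x y * (- z1 x y * p1 x y + w x y * q x y)" for x y
 note cs = cw cz cp cf cq cf'
 have cX: "cont2 I K X" and cY: "cont2 I K Y"
  unfolding X_def Y_def using cs by (auto simp: split_beta intro!: continuous_intros)
 have X0: "integral I (%x. X x y) = 0" if y: "y : K" for y
 proof -
  have "((%x. X x y) has_integral (h (a1+s) y * (w (a1+s) y * p2 (a1+s) y) - h a1 y * (w a1 y * p2 a1 y))) {a1..a1+s}"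
  proof (rule fundamental_theorem_of_calculus)
   show "((%x. h x y * (w x y * p2 x y)) has_vector_derivative X x y) (at x within {a1..a1+s})" if "x : {a1..a1+s}" for x
   proof -
    have "((%x. h x y * (w x y * p2 x y)) has_real_derivative X x y) (at x within I)"
     unfolding X_def using that y wx[of x y] px[of x y] fx[of x y]
     by (auto intro!: derivative_eq_intros simp: I)
    then show ?thesis by (simp add: has_real_derivative_iff_has_vector_derivative I)
   qed
  qed (use s in auto)
  then show ?thesis using bx[OF y] by (simp add: integral_unique I)
 qed
 have Y0: "integral K (%y. Y x y) = 0" if x: "x : I" for x
 proof -
  have "((%y. Y x y) has_integral (h x (a2+s) * (w x (a2+s) * p1 x (a2+s)) - h x a2 * (w x a2 * p1 x a2))) {a2..a2+s}"
  proof (rule fundamental_theorem_of_calculus)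
   show "((%y. h x y * (w x y * p1 x y)) has_vector_derivative Y x y) (at y within {a2..a2+s})" if "y : {a2..a2+s}" for y
   proof -
    have "((%y. h x y * (w x y * p1 x y)) has_real_derivative Y x y) (at y within K)"
     unfolding Y_def using that x wy[of x y] py[of x y] fy[of x y]
     by (auto intro!: derivative_eq_intros simp: K)
    then show ?thesis by (simp add: has_real_derivative_iff_has_vector_derivative K)
   qed
  qed (use s in auto)
  then show ?thesis using bY[OF x] by (simp add: integral_unique K)
 qed
 have "?J X = integral K (%y. integral I (%x. X x y))"
  using cX unfolding I K by (rule real_swap)
 also have "... = integral K (%y. 0)" by (rule Henstock_Kurzweil_Integration.integral_cong) (rule X0)
 finally have iX: "?J X = 0" by simp
 have "?J Y = integral I (%x. 0)" by (rule Henstock_Kurzweil_Integration.integral_cong) (rule Y0)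
 then have iY: "?J Y = 0" by simp
 define L where "L x y = h x y * (z1 x y * p1 x y + z2 x y * p2 x y)" for x y
 define R where "R x y = w x y * (hy x y * p1 x y - hx x y * p2 x y)" for x y
 have cL: "cont2 I K L" and cR: "cont2 I K R"
  unfolding L_def R_def using cs by (auto simp: split_beta intro!: continuous_intros)
 have XY: "L x y - R x y = X x y - Y x y" for x y
  unfolding L_def R_def X_def Y_def by (simp add: algebra_simps)
 have dif: "integral I (%x. integral K (%y. f x y - g x y)) = ?J f - ?J g"
  if f: "cont2 I K f" and g: "cont2 I K g" for f g :: "real => real => real"
 proof -
  have "integral I (%x. integral K (%y. f x y - g x y)) = integral I (%x. integral K (f x) - integral K (g x))"
   by (rule Henstock_Kurzweil_Integration.integral_cong, rule integral_diff)
    (use cont2_slice2[OF f] cont2_slice2[OF g] in "auto simp: K intro!: integrable_continuous_real")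
  also have "... = ?J f - ?J g"
   by (rule integral_diff)
    (use real_param_cont[of I a2 "a2+s" f] real_param_cont[of I a2 "a2+s" g] f g in "auto simp: I K intro!: integrable_continuous_real")
  finally show ?thesis .
 qed
 have "?J L - ?J R = 0"
  unfolding dif[OF cL cR, symmetric] XY dif[OF cX cY] iX iY by simp
 then show ?thesis unfolding L_def R_def by simp
qed

section \<open>Transfer to the plane\<close>

definition pt :: "real => real => plane" where "pt x y = vector [x, y]"
definition sqr :: "plane => real => plane set" where
 "sqr c s = {x. ALL i. c $ i <= x $ i & x $ i <= c $ i + s}"
text \<open>Half-open, so that the cells of a grid partition a square exactly.\<close>

definition hsq :: "plane => real => plane set" where
 "hsq c s = {x. ALL i. c $ i <= x $ i & x $ i < c $ i + s}"

lemma pt_nth [simp]: "pt x y $ 1 = x" "pt x y $ 2 = y"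
 by (simp_all add: pt_def)

lemma pt_eta: "pt (z $ 1) (z $ 2) = z"
 by (simp add: vec_eq_iff forall_2)

lemma pt_eq: "pt x y = x *R axis 1 1 + y *R axis 2 1"
 by (simp add: vec_eq_iff forall_2 axis_def)

lemma plane_inner: "x \<bullet> y = x $ 1 * y $ 1 + x $ 2 * y $ (2::2)" for x y :: plane
 by (simp add: inner_vec_def sum_2)

lemma sqr_cbox: "sqr c s = cbox c (c + s *R 1)"
 by (auto simp: sqr_def mem_box_cart)

lemma hsq_subset_sqr: "hsq c s <= sqr c s"
 by (auto simp: hsq_def sqr_def less_imp_le)

lemma compact_sqr: "compact (sqr c s)"
 unfolding sqr_cbox by (rule compact_cbox)

lemma hsq_measurable [measurable]: "hsq c s : sets borel"
 unfolding hsq_def by measurable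

lemma sqr_measurable [measurable]: "sqr c s : sets borel"
 unfolding sqr_cbox by simp

lemma Basis_plane: "(Basis :: plane set) = {axis 1 1, axis 2 1}"
 unfolding Basis_vec_def by (auto simp: UNIV_2)

lemma pt_measurable: "(%p. pt (fst p) (snd p)) : borel_measurable borel"
 unfolding pt_eq by (intro borel_measurable_continuous_onI continuous_intros)

text \<open>Carries iterated integrals over pairs of reals to the plane: a measure is Lebesgue
  measure as soon as it has the right value on every box.\<close>

lemma lborel_plane: "distr lborel borel (%p. pt (fst p) (snd p)) = lborel"
proof (rule lborel_eqI[symmetric])
 have m: "(%p. pt (fst p) (snd p)) : borel_measurable (lborel :: (real \<times> real) measure)"
  using pt_measurable by simp
 have ax: "axis 1 1 ~= (axis 2 1 :: plane)" by (simp add: axis_eq_axis)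
 fix l u :: plane assume lu: "!!b. b : Basis ==> l \<bullet> b <= u \<bullet> b"
 have le: "l $ 1 <= u $ 1" "l $ 2 <= u $ 2" using lu[of "axis 1 1"] lu[of "axis 2 1"] by (auto simp: Basis_plane inner_axis)
 have "(%p. pt (fst p) (snd p)) -` box l u \<inter> space (lborel :: (real \<times> real) measure) = box (l $ 1, l $ 2) (u $ 1, u $ 2)"
  by (auto simp: mem_box Basis_prod_def Basis_plane inner_axis ball_Un)
 then have "emeasure (distr lborel borel (%p. pt (fst p) (snd p))) (box l u) = emeasure lborel (box (l $ 1, l $ 2) (u $ 1, u $ 2))"
  using m by (subst emeasure_distr) auto
 also have "... = ennreal ((u $ 1 - l $ 1) * (u $ 2 - l $ 2))"
  using le by (subst emeasure_lborel_box_eq) (auto simp: Basis_prod_def prod.union_disjoint inner_Pair)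
 also have "... = (\<Prod>b\<in>Basis. (u - l) \<bullet> b)"
  using ax by (simp add: Basis_plane inner_axis inner_diff_left)
 finally show "emeasure (distr lborel borel (%p. pt (fst p) (snd p))) (box l u) = ennreal (\<Prod>b\<in>Basis. (u - l) \<bullet> b)" .
qed simp

lemma hsq_ae_sqr: "AE x in lborel. x : hsq c s \<longleftrightarrow> x : sqr c s"
proof -
 have "negligible ({x::plane. x $ 1 = c $ 1 + s} \<union> {x. x $ 2 = c $ 2 + s})"
  using negligible_standard_hyperplane[of "axis 1 1 :: plane" "c $ 1 + s"] negligible_standard_hyperplane[of "axis 2 1 :: plane" "c $ 2 + s"]
  by (intro negligible_Un) (auto simp: inner_axis Basis_plane)
 moreover have "{x::plane. x $ 1 = c $ 1 + s} \<union> {x. x $ 2 = c $ 2 + s} : sets lborel" by simp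
 ultimately have "{x::plane. x $ 1 = c $ 1 + s} \<union> {x. x $ 2 = c $ 2 + s} : null_sets lborel"
  by (simp add: negligible_iff_null_sets null_sets_completion_iff)
 then have "AE x in lborel. x ~: {x::plane. x $ 1 = c $ 1 + s} \<union> {x. x $ 2 = c $ 2 + s}" by (rule AE_not_in)
 then show ?thesis by eventually_elim (auto simp: hsq_def sqr_def forall_2)
qed

lemma hsq_integral:
 fixes f :: "plane => real"
 assumes f: "continuous_on (sqr c s) f"
 shows "set_integrable lborel (hsq c s) f"
  and "(LBINT x:hsq c s. f x) = integral {c$1..c$1+s} (%x. integral {c$2..c$2+s} (%y. f (pt x y)))"
proof -
 let ?g = "%x. indicator (sqr c s) x *R f x"
 have ig: "integrable lborel ?g" by (rule borel_integrable_compact[OF compact_sqr f])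
 then have mg[measurable]: "?g : borel_measurable borel" by auto
 have hg: "(%x. indicator (hsq c s) x *R f x) = (%x. indicator (hsq c s) x *R ?g x)"
  using hsq_subset_sqr[of c s] by (auto simp: indicator_def fun_eq_iff)
 have mh[measurable]: "(%x. indicator (hsq c s) x *R f x) : borel_measurable borel" unfolding hg by measurable
 have ae: "AE x in lborel. indicator (hsq c s) x *R f x = ?g x"
  using hsq_ae_sqr[of c s] by eventually_elim (auto simp: indicator_def)
 show "set_integrable lborel (hsq c s) f"
  unfolding set_integrable_def
 proof (rule integrable_cong_AE_imp[OF ig])
  show "AE x in lborel. ?g x = indicator (hsq c s) x *R f x" using ae by eventually_elim (rule sym)
 qed measurable
 define G where "G p = ?g (pt (fst p) (snd p))" for p :: "real \<times> real"
 have m: "(%p. pt (fst p) (snd p)) : borel_measurable (lborel :: (real \<times> real) measure)"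
  using pt_measurable by simp
 have cont: "continuous_on (cbox (c$1, c$2) (c$1+s, c$2+s)) (%p. f (pt (fst p) (snd p)))"
  by (rule continuous_on_compose2[OF f])
   (auto simp: pt_eq cbox_Pair_eq sqr_def forall_2 axis_def intro!: continuous_intros)
 have Gi: "G = (%p. indicator (cbox (c$1, c$2) (c$1+s, c$2+s)) p *R f (pt (fst p) (snd p)))"
  by (auto simp: G_def indicator_def sqr_def forall_2 cbox_Pair_eq fun_eq_iff)
 have "(LBINT x:hsq c s. f x) = (LBINT x. ?g x)"
  unfolding set_lebesgue_integral_def
 proof (rule integral_cong_AE)
  show "(%x. indicator (hsq c s) x *R f x) : borel_measurable lborel" unfolding measurable_lborel2 by (rule mh)
  show "?g : borel_measurable lborel" unfolding measurable_lborel2 by (rule mg)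
 qed (rule ae)
 also have "... = (LBINT p. G p)"
  unfolding G_def by (subst lborel_plane[symmetric], subst integral_distr[OF m mg]) (rule refl)
 also have "... = (LBINT p:cbox (c$1, c$2) (c$1+s, c$2+s). f (pt (fst p) (snd p)))"
  unfolding set_lebesgue_integral_def Gi ..
 also have "... = integral (cbox (c$1, c$2) (c$1+s, c$2+s)) (%p. f (pt (fst p) (snd p)))"
  by (rule set_borel_integral_eq_integral(2)) (unfold set_integrable_def, rule borel_integrable_compact[OF compact_cbox cont])
 also have "... = integral {c$1..c$1+s} (%x. integral {c$2..c$2+s} (%y. f (pt x y)))"
  using integral_prod_continuous[OF cont] by (simp add: box_real)
 finally show "(LBINT x:hsq c s. f x) = integral {c$1..c$1+s} (%x. integral {c$2..c$2+s} (%y. f (pt x y)))" .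
qed

lemma pt_sqr: "x : {c$1..c$1+s} ==> y : {c$2..c$2+s} ==> pt x y : sqr c s"
 by (auto simp: sqr_def forall_2)

lemma continuous_pt:
 assumes "continuous_on (sqr c s) f"
 shows "continuous_on ({c$1..c$1+s} \<times> {c$2..c$2+s}) (%(x, y). f (pt x y))"
proof -
 have "continuous_on ({c$1..c$1+s} \<times> {c$2..c$2+s}) (%p. f (pt (fst p) (snd p)))"
  by (rule continuous_on_compose2[OF assms])
   (auto simp: pt_eq sqr_def forall_2 axis_def intro!: continuous_intros)
 then show ?thesis by (simp add: split_beta)
qed

lemma Ck_partial:
 assumes "Ck (Suc k) f"
 shows "((%x. f (pt x y)) has_real_derivative cgrad f (pt x y) $ 1) (at x within S)" "((%y. f (pt x y)) has_real_derivative cgrad f (pt x y) $ 2) (at y within T)"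
proof -
 have d: "((%t. f (p t)) has_real_derivative cgrad f (p t) $ i) (at t within U)" if "(p has_derivative (%h. h *R axis i 1)) (at t)" for p i t and U :: "real set"
 proof (rule has_field_derivative_at_within)
  have "((%t. f (p t)) has_derivative (%h. cgrad f (p t) \<bullet> (h *R axis i 1))) (at t)" by (rule has_derivative_compose[OF that Ck_has_derivative[OF assms]])
  then show "((%t. f (p t)) has_real_derivative cgrad f (p t) $ i) (at t)"
   unfolding has_field_derivative_def by (simp add: inner_axis mult.commute[of _ "cgrad _ _ $ _"])
 qed
 show "((%x. f (pt x y)) has_real_derivative cgrad f (pt x y) $ 1) (at x within S)" "((%y. f (pt x y)) has_real_derivative cgrad f (pt x y) $ 2) (at y within T)"
  unfolding pt_eq by (rule d; auto intro!: derivative_eq_intros)+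
qed

definition sq_boundary :: "plane => real => plane set" where
 "sq_boundary c s = {x : sqr c s. EX i. x $ i = c $ i \<or> x $ i = c $ i + s}"

definition mass :: "(plane => real) => (plane => real) => plane set => real" where
 "mass f g A = (LBINT x:A. abs (f x)) + (LBINT x:A. abs (g x))"

text \<open>Collects for one stream function everything the grid argument uses: the integration by
  parts, the Poincare inequality with its own constant on every subsquare, and the same inequality
  without a constant on the whole square. For the last one the constant \<open>k0\<close> of the
  whole square is subtracted once and for all.\<close>

lemma plane_stream:
 fixes Z1 Z2 :: "plane => real"
 assumes s: "s > 0" and Z: "!!k. Ck k Z1" "!!k. Ck k Z2"
  and div: "!!x. x : sqr c s ==> cgrad Z1 x $ 1 + cgrad Z2 x $ 2 = 0"
 obtains w where "continuous_on (sqr c s) w"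
  "!!P1 P2 p. (!!k. Ck k P1) ==> (!!k. Ck k P2) ==> (!!k. Ck k p) ==>
   (!!x. x : sqr c s ==> cgrad P2 x $ 1 = cgrad P1 x $ 2) ==> (!!x. x : sq_boundary c s ==> p x = 0) ==>
   (LBINT x:hsq c s. p x * (Z1 x * P1 x + Z2 x * P2 x))
    = (LBINT x:hsq c s. w x * (cgrad p x $ 2 * P1 x - cgrad p x $ 1 * P2 x))"
  "!!d t. t > 0 ==> sqr d t <= sqr c s ==>
   EX k. (LBINT x:hsq d t. (w x - k)^2) <= (mass Z1 Z2 (hsq d t))^2"
  "(LBINT x:hsq c s. (w x)^2) <= (mass Z1 Z2 (hsq c s))^2"
proof -
 define I where "I = {c$1..c$1+s}"
 define K where "K = {c$2..c$2+s}"
 have cont: "continuous_on (I \<times> K) (%(x, y). f (pt x y))" if "!!k. Ck k f" for f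
  unfolding I_def K_def by (rule continuous_pt) (rule continuous_on_subset[OF Ck_continuous[OF that[of 0]]], simp)
 have cg: "Ck k (%x. cgrad f x $ i)" if "!!k. Ck k f" for f k i using that[of "Suc k"] by simp
 have inQ: "pt x y : sqr c s" if "x : I" "y : K" for x y using pt_sqr that unfolding I_def K_def by blast
 obtain w0 where w0: "cont2 I K w0"
  "!!x y. x : I ==> y : K ==> ((%x. w0 x y) has_real_derivative Z2 (pt x y)) (at x within I)"
  "!!x y. x : I ==> y : K ==> ((%y. w0 x y) has_real_derivative - Z1 (pt x y)) (at y within K)"
 proof (rule stream_function[OF s I_def K_def, of "%x y. Z1 (pt x y)" "%x y. Z2 (pt x y)" "%x y. cgrad Z1 (pt x y) $ 1"])
  show "continuous_on (I \<times> K) (%(x, y). Z1 (pt x y))" "continuous_on (I \<times> K) (%(x, y). Z2 (pt x y))"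
   "continuous_on (I \<times> K) (%(x, y). cgrad Z1 (pt x y) $ 1)"
   using cont[OF Z(1)] cont[OF Z(2)] cont[OF cg[OF Z(1)]] by auto
  show "((%x. Z1 (pt x y)) has_real_derivative cgrad Z1 (pt x y) $ 1) (at x within I)" for x y
   by (rule Ck_partial(1)[OF Z(1)])
  show "((%y. Z2 (pt x y)) has_real_derivative - cgrad Z1 (pt x y) $ 1) (at y within K)" if "x : I" "y : K" for x y
  proof -
   have "cgrad Z2 (pt x y) $ 2 = - cgrad Z1 (pt x y) $ 1" using div[OF inQ[OF that]] by linarith
   then show ?thesis using Ck_partial(2)[OF Z(2), of x y K] by simp
  qed
 qed (rule that)
 note ineq = square_poincare_L1_L2[where ?w1.0 = "%x y. Z2 (pt x y)" and ?w2.0 = "%x y. - Z1 (pt x y)"]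
 let ?J = "%d t k. integral {d$1..d$1+t} (%x. integral {d$2..d$2+t} (%y. (w0 x y - k)^2))"
 have sub: "EX k. ?J d t k
  <= (mass Z1 Z2 (hsq d t))^2"
  if t: "t > 0" and sq: "sqr d t <= sqr c s" for d t
 proof -
  have "d : sqr d t" "d + t *R 1 : sqr d t" using t by (auto simp: sqr_def)
  then have "d : sqr c s" "d + t *R 1 : sqr c s" using sq by blast+
  then have I': "{d$1..d$1+t} <= I" and K': "{d$2..d$2+t} <= K"
   unfolding I_def K_def by (auto simp: sqr_def forall_2)
  have prod: "{d$1..d$1+t} \<times> {d$2..d$2+t} <= I \<times> K" using I' K' by auto
  have cZ: "continuous_on (sqr d t) (%x. abs (Z1 x))" "continuous_on (sqr d t) (%x. abs (Z2 x))"
   using Ck_continuous[OF Z(1)[of 0]] Ck_continuous[OF Z(2)[of 0]] by (auto intro!: continuous_intros intro: continuous_on_subset)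
  show ?thesis
  proof (rule ineq[OF t refl refl, of "d$1" "d$2" w0])
   show "cont2 {d$1..d$1+t} {d$2..d$2+t} w0" by (rule continuous_on_subset[OF w0(1) prod])
   show "continuous_on ({d$1..d$1+t} \<times> {d$2..d$2+t}) (%(x, y). Z2 (pt x y))"
    by (rule continuous_on_subset[OF cont[OF Z(2)] prod])
   show "continuous_on ({d$1..d$1+t} \<times> {d$2..d$2+t}) (%(x, y). - Z1 (pt x y))"
    using continuous_on_minus[OF continuous_on_subset[OF cont[OF Z(1)] prod]] by (simp add: split_beta)
   show "((%x. w0 x y) has_real_derivative Z2 (pt x y)) (at x within {d$1..d$1+t})" if "x : {d$1..d$1+t}" "y : {d$2..d$2+t}" for x y
    using w0(2)[of x y] that I' K' DERIV_subset by blast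
   show "((%y. w0 x y) has_real_derivative - Z1 (pt x y)) (at y within {d$2..d$2+t})" if "x : {d$1..d$1+t}" "y : {d$2..d$2+t}" for x y
    using w0(3)[of x y] that I' K' DERIV_subset by blast
   fix k
   assume "?J d t k
    <= (integral {d$1..d$1+t} (%x. integral {d$2..d$2+t} (%y. abs (Z2 (pt x y)))) + integral {d$1..d$1+t} (%x. integral {d$2..d$2+t} (%y. abs (- Z1 (pt x y)))))^2"
   then show ?thesis unfolding mass_def hsq_integral(2)[OF cZ(1)] hsq_integral(2)[OF cZ(2)] by (auto simp: add.commute)
  qed
 qed
 obtain k0 where k0: "integral I (%x. integral K (%y. (w0 x y - k0)^2))
  <= (mass Z1 Z2 (hsq c s))^2"
  using sub[OF s order_refl] unfolding I_def K_def by blast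
 define w where "w x = w0 (x $ 1) (x $ 2) - k0" for x :: plane
 have cw0: "continuous_on (sqr c s) (%x. w0 (x $ 1) (x $ 2))"
 proof -
  have "continuous_on (sqr c s) (%x. case (x $ 1, x $ 2) of (x, y) => w0 x y)"
   by (rule continuous_on_compose2[OF w0(1)]) (auto simp: I_def K_def sqr_def intro!: continuous_intros)
  then show ?thesis by simp
 qed
 then have cw: "continuous_on (sqr c s) w" unfolding w_def by (intro continuous_intros)
 show thesis
 proof (rule that[of w])
  show "continuous_on (sqr c s) w" by (rule cw)
  show "(LBINT x:hsq c s. (w x)^2) <= (mass Z1 Z2 (hsq c s))^2"
   by (subst hsq_integral(2)) (use cw k0 in "auto simp: w_def I_def K_def intro!: continuous_intros")
  show "EX k. (LBINT x:hsq d t. (w x - k)^2) <= (mass Z1 Z2 (hsq d t))^2"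
   if t: "t > 0" and sq: "sqr d t <= sqr c s" for d t
  proof -
   obtain k where k: "?J d t k
    <= (mass Z1 Z2 (hsq d t))^2" using sub[OF t sq] by blast
   have "(LBINT x:hsq d t. (w x - (k - k0))^2) = ?J d t k"
    by (subst hsq_integral(2)) (use continuous_on_subset[OF cw0 sq] in "auto simp: w_def intro!: continuous_intros")
   then show ?thesis using k by metis
  qed
  fix P1 P2 p :: "plane => real"
  assume P: "!!k. Ck k P1" "!!k. Ck k P2" and p: "!!k. Ck k p"
   and curl: "!!x. x : sqr c s ==> cgrad P2 x $ 1 = cgrad P1 x $ 2" and bd: "!!x. x : sq_boundary c s ==> p x = 0"
  have cs: "continuous_on (sqr c s) f" if "!!k. Ck k f" for f
   by (rule continuous_on_subset[OF Ck_continuous[OF that[of 0]]]) simp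
  have "integral I (%x. integral K (%y. p (pt x y) * (Z1 (pt x y) * P1 (pt x y) + Z2 (pt x y) * P2 (pt x y))))
   = integral I (%x. integral K (%y. (w0 x y - k0) * (cgrad p (pt x y) $ 2 * P1 (pt x y) - cgrad p (pt x y) $ 1 * P2 (pt x y))))"
  proof (rule stream_identity[OF s I_def K_def, of "%x y. w0 x y - k0" "%x y. Z1 (pt x y)" "%x y. Z2 (pt x y)"
    "%x y. P1 (pt x y)" "%x y. P2 (pt x y)" "%x y. p (pt x y)" "%x y. cgrad P2 (pt x y) $ 1"
    "%x y. cgrad p (pt x y) $ 1" "%x y. cgrad p (pt x y) $ 2"])
   show "continuous_on (I \<times> K) (%(x, y). w0 x y - k0)" using w0(1) by (auto simp: split_beta intro!: continuous_intros)
   show "((%x. w0 x y - k0) has_real_derivative Z2 (pt x y)) (at x within I)" if "x : I" "y : K" for x y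
    using DERIV_diff[OF w0(2)[OF that] DERIV_const] by simp
   show "((%y. w0 x y - k0) has_real_derivative - Z1 (pt x y)) (at y within K)" if "x : I" "y : K" for x y
    using DERIV_diff[OF w0(3)[OF that] DERIV_const] by simp
   show "((%y. P1 (pt x y)) has_real_derivative cgrad P2 (pt x y) $ 1) (at y within K)" if "x : I" "y : K" for x y
    using Ck_partial(2)[OF P(1), of x y K] curl[OF inQ[OF that]] by simp
   show "p (pt (c$1) y) = 0 & p (pt (c$1+s) y) = 0" if "y : K" for y
   proof (intro conjI bd)
    show "pt (c$1) y : sq_boundary c s" "pt (c$1+s) y : sq_boundary c s"
     unfolding sq_boundary_def using inQ[of "c$1" y] inQ[of "c$1+s" y] that s
     by (auto simp: I_def) (rule exI[of _ 1], simp)+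
   qed
   show "p (pt x (c$2)) = 0 & p (pt x (c$2+s)) = 0" if "x : I" for x
   proof (intro conjI bd)
    show "pt x (c$2) : sq_boundary c s" "pt x (c$2+s) : sq_boundary c s"
     unfolding sq_boundary_def using inQ[of x "c$2"] inQ[of x "c$2+s"] that s
     by (auto simp: K_def) (rule exI[of _ 2], simp)+
   qed
  qed (use cont[OF Z(1)] cont[OF Z(2)] cont[OF P(1)] cont[OF P(2)] cont[OF p] cont[OF cg[OF P(2)]] cont[OF cg[OF p]]
    Ck_partial(1)[OF P(2)] Ck_partial(1)[OF p] Ck_partial(2)[OF p] in auto)
  then show "(LBINT x:hsq c s. p x * (Z1 x * P1 x + Z2 x * P2 x))
    = (LBINT x:hsq c s. w x * (cgrad p x $ 2 * P1 x - cgrad p x $ 1 * P2 x))"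
   by (subst hsq_integral(2), intro continuous_on_mult continuous_on_add cs p Z P)
    (subst hsq_integral(2), intro continuous_on_mult continuous_on_diff cw cs cg[OF p] P, simp add: w_def I_def K_def)
 qed
qed

section \<open>A quantitative div-curl estimate on a square\<close>

definition grid :: "nat => (nat \<times> nat) set" where "grid N = {..<N} \<times> {..<N}"
definition cell :: "plane => real => nat \<times> nat => plane set" where
 "cell c t p = hsq (c + t *R pt (real (fst p)) (real (snd p))) t"

lemma finite_grid [simp]: "finite (grid N)"
 by (simp add: grid_def)

lemma cell_measurable [measurable]: "cell c t p : sets borel"
 by (simp add: cell_def)

lemma indicator_slices:
 fixes u t :: real
 assumes "t > 0"
 shows "(\<Sum>i<N. of_bool (t * real i <= u & u < t * real i + t)) = (of_bool (0 <= u & u < t * real N) :: real)"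
proof (induction N)
 case (Suc N)
 have "t * real N >= 0" using assms by simp
 then have k: "t * real N <= u ==> 0 <= u" by linarith
 have e: "t * real (Suc N) = t * real N + t" by (simp add: algebra_simps)
 show ?case unfolding sum.lessThan_Suc Suc.IH e using assms k by auto
qed simp

lemma indicator_cells:
 assumes "s > 0" "N > 0"
 shows "(SUM p:grid N. indicator (cell c (s / real N) p) x) = (indicator (hsq c s) x :: real)"
proof -
 define t where "t = s / real N"
 have t: "t > 0" "t * real N = s" using assms by (auto simp: t_def)
 have ic: "indicator (cell c t (i, j)) x = of_bool (t * real i <= x$1 - c$1 & x$1 - c$1 < t * real i + t)
   * (of_bool (t * real j <= x$2 - c$2 & x$2 - c$2 < t * real j + t) :: real)" for i j
  by (auto simp: cell_def hsq_def forall_2 indicator_def)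
 have "(SUM p:grid N. indicator (cell c t p) x) = (\<Sum>i<N. \<Sum>j<N. indicator (cell c t (i, j)) x :: real)"
  unfolding grid_def by (simp add: sum.cartesian_product)
 also have "... = (\<Sum>i<N. of_bool (t * real i <= x$1 - c$1 & x$1 - c$1 < t * real i + t))
   * (\<Sum>j<N. of_bool (t * real j <= x$2 - c$2 & x$2 - c$2 < t * real j + t))"
  unfolding ic sum_product ..
 also have "... = of_bool (0 <= x$1 - c$1 & x$1 - c$1 < s) * of_bool (0 <= x$2 - c$2 & x$2 - c$2 < s)"
  unfolding indicator_slices[OF t(1)] t(2) ..
 also have "... = indicator (hsq c s) x" by (auto simp: hsq_def forall_2 indicator_def)
 finally show ?thesis unfolding t_def .
qed

lemma sum_cells_integral:
 fixes f :: "plane => real"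
 assumes "s > 0" "N > 0" and f: "set_integrable lborel (hsq c s) f" and m: "!!p. p : grid N ==> set_integrable lborel (cell c (s / real N) p) f"
 shows "(SUM p:grid N. (LBINT x:cell c (s / real N) p. f x)) = (LBINT x:hsq c s. f x)"
proof -
 have "(SUM p:grid N. (LBINT x:cell c (s / real N) p. f x)) = (LBINT x. (SUM p:grid N. indicator (cell c (s / real N) p) x *R f x))"
  unfolding set_lebesgue_integral_def using m
  by (subst Bochner_Integration.integral_sum) (auto simp: set_integrable_def)
 also have "... = (LBINT x:hsq c s. f x)"
  unfolding set_lebesgue_integral_def scaleR_left.sum[symmetric] indicator_cells[OF assms(1,2)] ..
 finally show ?thesis .
qed

lemma cell_subset:
 assumes "s > 0" "N > 0" "p : grid N"
 shows "sqr (c + (s / real N) *R pt (real (fst p)) (real (snd p))) (s / real N) <= sqr c s"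
proof -
 obtain i j where p: "p = (i, j)" "i < N" "j < N" using assms(3) by (auto simp: grid_def)
 have b: "s / real N * real k + s / real N <= s" "s / real N * real k >= 0" if "k < N" for k
 proof -
  have "s / real N * (real k + 1) <= s / real N * real N" using that assms by (intro mult_left_mono) auto
  then show "s / real N * real k + s / real N <= s" using assms by (simp add: distrib_left)
  show "s / real N * real k >= 0" using assms by simp
 qed
 show ?thesis
 proof
  fix x assume "x : sqr (c + (s / real N) *R pt (real (fst p)) (real (snd p))) (s / real N)"
  then have "c$1 + s / real N * real i <= x$1" "x$1 <= c$1 + s / real N * real i + s / real N"
   "c$2 + s / real N * real j <= x$2" "x$2 <= c$2 + s / real N * real j + s / real N"
   by (auto simp: sqr_def forall_2 p)
  then show "x : sqr c s" using b[OF p(2)] b[OF p(3)] unfolding sqr_def forall_2 mem_Collect_eq by linarith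
 qed
qed

lemma hsq_measure: "t >= 0 ==> (LBINT x:hsq d t. (1::real)) = t^2"
 by (subst hsq_integral(2)) (auto simp: power2_eq_square)

lemma cauchy_schwarz_integral:
 fixes f g :: "plane => real"
 assumes "sqint f" "sqint g"
 shows "abs (LBINT x. f x * g x) <= sqrt (LBINT x. (f x)^2) * sqrt (LBINT x. (g x)^2)"
 using Cauchy_Schwarz_ineq2[of "L2of f" "L2of g"] inner_L2of[OF assms]
  norm_sq_L2of[OF assms(1)] norm_sq_L2of[OF assms(2)]
 by (metis (mono_tags, lifting) norm_ge_zero real_sqrt_unique inner_real_def real_norm_def power2_abs lint_cong)

lemma sqint_bounded_indicator:
 fixes f :: "plane => real"
 assumes "f : borel_measurable borel" "!!x. abs (f x) <= B" "bounded A" "A : sets borel" "!!x. x ~: A ==> f x = 0"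
 shows "sqint f"
proof (rule sqint_bound[OF assms(1)])
 show "sqint (indicator A :: plane => real)"
  unfolding sqint_def
 proof
  show "indicator A : borel_measurable borel" using assms(4) by simp
  have "(%x. (norm (indicator A x :: real))^2) = indicator A" by (auto simp: indicator_def)
  then show "integrable lborel (%x. (norm (indicator A x :: real))^2)"
   using integrable_indicator_bounded[OF assms(3,4)] by simp
 qed
 show "AE x in lborel. norm (f x) <= B * norm (indicator A x :: real)"
  using assms(2,5) by (intro AE_I2) (auto simp: indicator_def)
qed

lemma bounded_hsq: "bounded (hsq c s)"
 using bounded_subset[OF compact_imp_bounded[OF compact_sqr] hsq_subset_sqr] .

lemma sqint_continuous_cell:
 fixes f :: "plane => real"
 assumes f: "continuous_on (sqr d t) f"
 shows "sqint (%x. indicator (hsq d t) x *R f x)"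
proof -
 have "compact (f ` sqr d t)" using f compact_sqr by (rule compact_continuous_image)
 then obtain B where B: "!!x. x : sqr d t ==> (abs (f x)) <= B"
  using compact_imp_bounded bounded_iff by (metis imageI real_norm_def)
 have "(%x. indicator (hsq d t) x *R f x) : borel_measurable borel"
  using hsq_integral(1)[OF f] by (auto simp: set_integrable_def)
 then show ?thesis
 proof (rule sqint_bounded_indicator[where A = "hsq d t" and B = "max B 0"])
  show "abs (indicator (hsq d t) x *R f x) <= max B 0" for x
   using B[of x] hsq_subset_sqr[of d t] by (auto simp: indicator_def subset_iff intro: max.coboundedI1)
 qed (auto simp: bounded_hsq)
qed

lemma cs_cell:
 fixes f g :: "plane => real"
 assumes f: "continuous_on (sqr d t) f" and g: "continuous_on (sqr d t) g"
 shows "abs (LINT x:hsq d t|lborel. f x * g x) <= sqrt (LBINT x:hsq d t. (f x)^2) * sqrt (LBINT x:hsq d t. (g x)^2)"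
proof -
 have *: "(indicator (hsq d t) x *R f x) * (indicator (hsq d t) x *R g x) = indicator (hsq d t) x *R (f x * g x)"
  for f g :: "plane => real" and x by (auto simp: indicator_def)
 show ?thesis
  using cauchy_schwarz_integral[OF sqint_continuous_cell[OF f] sqint_continuous_cell[OF g]]
  unfolding power2_eq_square * set_lebesgue_integral_def .
qed

lemma cell_l1:
 fixes f :: "plane => real"
 assumes "t >= 0" and f: "continuous_on (sqr d t) f"
 shows "(LBINT x:hsq d t. abs (f x)) <= t * sqrt (LBINT x:hsq d t. (f x)^2)"
proof -
 have "abs (LINT x:hsq d t|lborel. 1 * abs (f x)) <= sqrt (LBINT x:hsq d t. 1^2) * sqrt (LBINT x:hsq d t. abs (f x)^2)"
  by (rule cs_cell) (use f in "auto intro: continuous_intros")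
 then show ?thesis using hsq_measure[OF assms(1), of d] assms(1) by simp
qed

lemma set_integral_nonneg_real:
 fixes f :: "plane => real"
 shows "(!!x. f x >= 0) ==> (LBINT x:A. f x) >= 0"
 unfolding set_lebesgue_integral_def by (intro integral_nonneg_AE AE_I2) (auto simp: indicator_def)

text \<open>After integration by parts the left side is the integral of w g. On each cell w is
  replaced by a constant \<open>k p\<close>; the error is controlled by the cell masses through
  Cauchy-Schwarz, first on a cell and then over the cells. What remains are the numbers
  \<open>k p\<close> times the cell integrals of g, which later tend to zero because g depends
  linearly on a weakly convergent field.\<close>

lemma smooth_square_bound:
 fixes Z1 Z2 P1 P2 h :: "plane => real"
 assumes s: "s > 0" and N: "N > 0" and Z: "!!k. Ck k Z1" "!!k. Ck k Z2"
  and P: "!!k. Ck k P1" "!!k. Ck k P2" and h: "!!k. Ck k h"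
  and div: "!!x. x : sqr c s ==> cgrad Z1 x $ 1 + cgrad Z2 x $ 2 = 0"
  and curl: "!!x. x : sqr c s ==> cgrad P2 x $ 1 = cgrad P1 x $ 2"
  and bd: "!!x. x : sq_boundary c s ==> h x = 0"
 defines "g == %x. cgrad h x $ 2 * P1 x - cgrad h x $ 1 * P2 x"
  and "a == mass Z1 Z2"
 shows "abs (LINT x:hsq c s|lborel. h x * (Z1 x * P1 x + Z2 x * P2 x))
  <= sqrt (SUM p:grid N. (a (cell c (s / real N) p))^2) * sqrt (LBINT x:hsq c s. (g x)^2)
   + 2 * a (hsq c s) / (s / real N) * (SUM p:grid N. abs (LINT x:cell c (s / real N) p|lborel. g x))"
proof -
 define t where "t = s / real N"
 have t: "t > 0" using s N by (simp add: t_def)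
 show ?thesis
 proof (rule plane_stream[of s Z1 Z2 c, OF s Z])
 show "cgrad Z1 x $ 1 + cgrad Z2 x $ 2 = 0" if "x : sqr c s" for x by (rule div[OF that])
 next
 fix w
 assume w: "continuous_on (sqr c s) w"
  and id0: "!!P1 P2 h. (!!k. Ck k P1) ==> (!!k. Ck k P2) ==> (!!k. Ck k h) ==>
   (!!x. x : sqr c s ==> cgrad P2 x $ 1 = cgrad P1 x $ 2) ==> (!!x. x : sq_boundary c s ==> h x = 0) ==>
   (LBINT x:hsq c s. h x * (Z1 x * P1 x + Z2 x * P2 x))
    = (LBINT x:hsq c s. w x * (cgrad h x $ 2 * P1 x - cgrad h x $ 1 * P2 x))"
  and loc: "!!d t. t > 0 ==> sqr d t <= sqr c s ==> EX k. (LBINT x:hsq d t. (w x - k)^2) <= (mass Z1 Z2 (hsq d t))^2"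
  and glob: "(LBINT x:hsq c s. (w x)^2) <= (mass Z1 Z2 (hsq c s))^2"
 let ?c = "cell c t" let ?g1 = "%p. abs (LBINT x:?c p. g x)" and ?g2 = "%p. LBINT x:?c p. (g x)^2"
 define d where "d p = c + t *R pt (real (fst p)) (real (snd p))" for p
 have cell: "cell c t p = hsq (d p) t" for p by (simp add: cell_def d_def)
 have sub: "sqr (d p) t <= sqr c s" if "p : grid N" for p
  using cell_subset[OF s N that, of c] unfolding d_def t_def .
 have ck: "continuous_on S f" if "!!k. Ck k f" for f S
  by (rule continuous_on_subset[OF Ck_continuous[OF that[of 0]]]) simp
 have cg: "continuous_on S g" for S
 proof (rule ck)
  fix k show "Ck k g" unfolding g_def using h[of "Suc k"] P by (intro Ck_diff Ck_mult) auto
 qed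
 have cwp: "continuous_on (sqr (d p) t) w" if "p : grid N" for p by (rule continuous_on_subset[OF w sub[OF that]])
 have isplit: "(SUM p:grid N. (LBINT x:?c p. f x)) = (LBINT x:hsq c s. f x)" if f: "continuous_on (sqr c s) f" for f :: "plane => real"
  unfolding t_def
 proof (rule sum_cells_integral[OF s N hsq_integral(1)[OF f]])
  show "set_integrable lborel (cell c (s / real N) p) f" if "p : grid N" for p
   using hsq_integral(1)[OF continuous_on_subset[OF f sub[OF that]]] unfolding cell[unfolded t_def] t_def .
 qed
 have a0: "a A >= 0" for A unfolding a_def mass_def by (intro add_nonneg_nonneg set_integral_nonneg_real) auto
 have mono_cell: "(LBINT x:?c p. f x) <= (LBINT x:hsq c s. f x)"
  if f: "continuous_on (sqr c s) f" and f0: "!!x. f x >= 0" and p: "p : grid N" for f :: "plane => real" and p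
  unfolding isplit[OF f, symmetric] using p f0 set_integral_nonneg_real[of f] by (intro member_le_sum) auto
 have aA: "a (?c p) <= a (hsq c s)" if p: "p : grid N" for p
  unfolding a_def mass_def using Z by (intro add_mono mono_cell p continuous_intros ck) auto
 have "EX k. (LBINT x:?c p. (w x - k)^2) <= (a (?c p))^2" if "p : grid N" for p
  unfolding cell a_def by (rule loc[OF t sub[OF that]])
 then obtain k where k: "!!p. p : grid N ==> (LBINT x:?c p. (w x - k p)^2) <= (a (?c p))^2" by metis
 \<comment> \<open>The constant is compared with w on the cell: the means of |w - k| and of |w| are
   both at most a / t, by the local and by the global inequality.\<close>
 have kb: "abs (k p) <= 2 * a (hsq c s) / t" if p: "p : grid N" for p
 proof -
  have c1: "continuous_on (sqr (d p) t) (%x. w x - k p)" using cwp[OF p] by (intro continuous_intros)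
  have "(LBINT x:?c p. abs (w x - k p)) <= t * sqrt (LBINT x:?c p. (w x - k p)^2)"
   unfolding cell using t by (intro cell_l1 c1) auto
  also have "... <= t * sqrt ((a (?c p))^2)" using t k[OF p] by (intro mult_left_mono real_sqrt_le_mono) auto
  also have "... <= t * a (hsq c s)" using t aA[OF p] a0 by (simp add: mult_left_mono)
  finally have e1: "(LBINT x:?c p. abs (w x - k p)) <= t * a (hsq c s)" .
  have "(LBINT x:?c p. abs (w x)) <= t * sqrt (LBINT x:?c p. (w x)^2)"
   unfolding cell using t by (intro cell_l1 cwp[OF p]) auto
  also have "... <= t * sqrt ((a (hsq c s))^2)"
  proof (intro mult_left_mono real_sqrt_le_mono)
   have "(LBINT x:?c p. (w x)^2) <= (LBINT x:hsq c s. (w x)^2)"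
    using w by (intro mono_cell p continuous_intros) auto
   then show "(LBINT x:?c p. (w x)^2) <= (a (hsq c s))^2" using glob unfolding a_def by linarith
  qed (use t in auto)
  also have "... = t * a (hsq c s)" using a0 by simp
  finally have e2: "(LBINT x:?c p. abs (w x)) <= t * a (hsq c s)" .
  have i1: "set_integrable lborel (?c p) (%x. abs (w x - k p))" "set_integrable lborel (?c p) (%x. abs (w x))"
   "set_integrable lborel (?c p) (%x. abs (k p))"
   unfolding cell using c1 cwp[OF p] by (auto intro!: hsq_integral(1) continuous_intros)
  have "abs (k p) * t^2 = (LBINT x:?c p. abs (k p))"
   unfolding cell by (subst hsq_integral(2)) (use t in "auto simp: power2_eq_square")
  also have "... <= (LBINT x:?c p. abs (w x - k p) + abs (w x))"
   by (rule set_integral_mono) (use i1 in "auto intro: set_integral_add(1)")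
  also have "... = (LBINT x:?c p. abs (w x - k p)) + (LBINT x:?c p. abs (w x))"
   by (rule set_integral_add(2)[OF i1(1,2)])
  also have "... <= 2 * t * a (hsq c s)" using e1 e2 by simp
  finally have "abs (k p) * t <= 2 * a (hsq c s)" using t by (simp add: power2_eq_square)
  then show ?thesis using t by (simp add: pos_le_divide_eq)
 qed
 have piece: "abs (LBINT x:?c p. w x * g x) <= a (?c p) * sqrt (?g2 p)
  + 2 * a (hsq c s) / t * ?g1 p" if p: "p : grid N" for p
 proof -
  have c1: "continuous_on (sqr (d p) t) (%x. w x - k p)" using cwp[OF p] by (intro continuous_intros)
  have i: "set_integrable lborel (?c p) (%x. (w x - k p) * g x)" "set_integrable lborel (?c p) (%x. k p * g x)"
   unfolding cell using c1 cg by (auto intro!: hsq_integral(1) continuous_intros)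
  have "(LBINT x:?c p. w x * g x) = (LBINT x:?c p. (w x - k p) * g x + k p * g x)"
   by (simp add: algebra_simps)
  also have "... = (LBINT x:?c p. (w x - k p) * g x) + k p * (LBINT x:?c p. g x)"
   using set_integral_add(2)[OF i] by simp
  finally have "abs (LBINT x:?c p. w x * g x) <= abs (LBINT x:?c p. (w x - k p) * g x) + abs (k p) * ?g1 p"
   by (simp add: abs_mult[symmetric])
  moreover have "abs (LBINT x:?c p. (w x - k p) * g x) <= a (?c p) * sqrt (?g2 p)"
  proof -
   have "abs (LBINT x:?c p. (w x - k p) * g x) <= sqrt (LBINT x:?c p. (w x - k p)^2) * sqrt (?g2 p)"
    unfolding cell by (rule cs_cell[OF c1 cg])
   also have "... <= sqrt ((a (?c p))^2) * sqrt (?g2 p)"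
    using k[OF p] set_integral_nonneg_real[of "%x. (g x)^2"] by (intro mult_right_mono real_sqrt_le_mono) auto
   finally show ?thesis using a0 by simp
  qed
  moreover have "abs (k p) * ?g1 p <= 2 * a (hsq c s) / t * ?g1 p"
   by (intro mult_right_mono kb[OF p]) auto
  ultimately show ?thesis by linarith
 qed
 have "(LBINT x:hsq c s. h x * (Z1 x * P1 x + Z2 x * P2 x)) = (LBINT x:hsq c s. w x * g x)"
  unfolding g_def by (rule id0[OF P h curl bd])
 also have "... = (SUM p:grid N. (LBINT x:?c p. w x * g x))"
  using w cg by (intro isplit[symmetric] continuous_intros)
 finally have "abs (LINT x:hsq c s|lborel. h x * (Z1 x * P1 x + Z2 x * P2 x)) <= (SUM p:grid N. abs (LBINT x:?c p. w x * g x))"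
  by simp
 also have "... <= (SUM p:grid N. a (?c p) * sqrt (?g2 p)
  + 2 * a (hsq c s) / t * ?g1 p)"
  by (intro sum_mono piece)
 also have "... = (SUM p:grid N. a (?c p) * sqrt (?g2 p))
  + 2 * a (hsq c s) / t * (SUM p:grid N. ?g1 p)"
  by (simp add: sum.distrib sum_distrib_left)
 also have "(SUM p:grid N. a (?c p) * sqrt (?g2 p))
  <= sqrt (SUM p:grid N. (a (?c p))^2) * sqrt (LBINT x:hsq c s. (g x)^2)"
 proof -
  have "(SUM p:grid N. a (?c p) * sqrt (?g2 p))^2
   <= (SUM p:grid N. (a (?c p))^2) * (SUM p:grid N. (sqrt (?g2 p))^2)"
   by (rule Cauchy_Schwarz_ineq_sum)
  also have "(SUM p:grid N. (sqrt (?g2 p))^2) = (SUM p:grid N. ?g2 p)"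
   using set_integral_nonneg_real[of "%x. (g x)^2"] by simp
  also have "... = (LBINT x:hsq c s. (g x)^2)" using cg by (intro isplit continuous_intros)
  finally show ?thesis unfolding real_sqrt_mult[symmetric] by (rule real_le_rsqrt)
 qed
 finally show ?thesis unfolding t_def by simp
 qed
qed

subsection \<open>Passage to square-integrable fields\<close>

definition Jv :: "plane => plane" where "Jv v = pt (- v $ 2) (v $ 1)"

lemma Jv_nth [simp]: "Jv v $ 1 = - v $ 2" "Jv v $ 2 = v $ 1"
 by (simp_all add: Jv_def)

definition divfree_on :: "plane set => (plane => plane) => bool" where
 "divfree_on S Z = (ALL h:Ccinf S. (LBINT x. cgrad h x \<bullet> Z x) = 0)"
text \<open>The weak form of vanishing curl: for smooth P, integration by parts turns the pairing
  with a rotated test gradient into one of the test function with the curl of P.\<close>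

definition curlfree_on :: "plane set => (plane => plane) => bool" where
 "curlfree_on S P = (ALL h:Ccinf S. (LBINT x. Jv (cgrad h x) \<bullet> P x) = 0)"

definition L2conv :: "(nat => plane => real) => (plane => real) => bool" where
 "L2conv F f = ((ALL m. sqint (F m)) & sqint f & (%m. L2of (F m)) ----> L2of f)"

lemma L2convD: "L2conv F f ==> sqint (F m)" "L2conv F f ==> sqint f"
 by (auto simp: L2conv_def)

lemma L2conv_inner:
 assumes "L2conv F f" "L2conv H h"
 shows "(%m. LBINT x. F m x * H m x) ----> (LBINT x. f x * h x)"
proof -
 have "(%m. L2of (F m) \<bullet> L2of (H m)) ----> L2of f \<bullet> L2of h"
  using assms unfolding L2conv_def by (intro tendsto_inner) auto
 then show ?thesis
  unfolding inner_L2of[OF L2convD(2)[OF assms(1)] L2convD(2)[OF assms(2)]]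
   inner_L2of[OF L2convD(1)[OF assms(1)] L2convD(1)[OF assms(2)]] by simp
qed

lemma L2conv_const: "sqint f ==> L2conv (%m. f) f"
 by (simp add: L2conv_def)

lemma L2convI:
 assumes "!!m. sqint (F m)" "sqint f" "L2conv G g" "!!m x. abs (F m x - f x) <= B * abs (G m x - g x)" "B >= 0"
 shows "L2conv F f"
 unfolding L2conv_def
proof (intro conjI allI assms)
 have "norm (L2of (F m) - L2of f) <= B * norm (L2of (G m) - L2of g)" for m
 proof -
  have s: "sqint (%x. F m x - f x)" "sqint (%x. G m x - g x)"
   using assms(1,2) L2convD[OF assms(3)] by (auto intro: sqint_diff)
  have "norm (L2of (%x. F m x - f x)) <= B * norm (L2of (%x. G m x - g x))"
  proof (rule norm_l2_mono[OF _ assms(5)])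
   show "AE t in lborel. norm (fn (L2of (%x. F m x - f x)) t) <= B * norm (fn (L2of (%x. G m x - g x)) t)"
    using fn_L2of[OF s(1)] fn_L2of[OF s(2)] by eventually_elim (use assms(4)[of m] in simp)
  qed
  then show ?thesis using assms(1,2) L2convD[OF assms(3)] by (simp add: L2of_diff)
 qed
 moreover have "(%m. B * norm (L2of (G m) - L2of g)) ----> 0"
 proof -
  have "(%m. L2of (G m) - L2of g) ----> 0" using assms(3) unfolding L2conv_def by (simp add: LIM_zero)
  then show ?thesis using tendsto_mult_left[OF tendsto_norm_zero] by fastforce
 qed
 ultimately have "(%m. L2of (F m) - L2of f) ----> 0"
  by (intro Lim_null_comparison[of "%m. L2of (F m) - L2of f" "%m. B * norm (L2of (G m) - L2of g)"]) auto
 then show "(%m. L2of (F m)) ----> L2of f" by (simp add: LIM_zero_iff)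
qed

lemma L2conv_abs: assumes "L2conv F f" shows "L2conv (%m x. abs (F m x)) (%x. abs (f x))"
proof (rule L2convI[OF _ _ assms, of _ _ 1])
 have "sqint (%x. abs (h x))" if h: "sqint h" for h :: "plane => real"
  by (rule sqint_bound[OF _ h, of _ 1]) (use sqint_measurable[OF h] in auto)
 then show "sqint (%x. abs (F m x))" "sqint (%x. abs (f x))" for m using L2convD[OF assms] by auto
qed auto

lemma sqint_mult_bounded:
 fixes f b :: "plane => real"
 assumes "sqint f" "b : borel_measurable borel" "!!x. abs (b x) <= B"
 shows "sqint (%x. b x * f x)"
proof (rule sqint_bound[OF _ assms(1), of _ B])
 show "(%x. b x * f x) : borel_measurable borel" using assms by measurable
 show "AE x in lborel. norm (b x * f x) <= B * norm (f x)"
  using assms(3) by (intro AE_I2) (auto simp: abs_mult intro!: mult_right_mono)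
qed

lemma L2conv_mult:
 assumes "L2conv F f" "b : borel_measurable borel" "!!x. abs (b x) <= B"
 shows "L2conv (%m x. b x * F m x) (%x. b x * f x)"
proof (rule L2convI[OF _ _ assms(1), of _ _ B])
 show "sqint (%x. b x * F m x)" "sqint (%x. b x * f x)" for m
  using L2convD[OF assms(1)] assms by (auto intro: sqint_mult_bounded)
 show "abs (b x * F m x - b x * f x) <= B * abs (F m x - f x)" for m x
  unfolding right_diff_distrib[symmetric] abs_mult by (intro mult_right_mono assms) auto
 show "B >= 0" using assms(3) abs_ge_zero order_trans by blast
qed

lemma L2conv_diff: "L2conv F f ==> L2conv G g ==> L2conv (%m x. F m x - G m x) (%x. f x - g x)"
 unfolding L2conv_def by (auto simp: sqint_diff L2of_diff intro!: tendsto_diff)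

lemma L2conv_mol: assumes "sqint f" shows "L2conv (%m. conv (mol (eps m)) f) f"
proof -
 have "(%m. mollify (eps m) (L2of f) - L2of f) ----> 0"
  using mollify_tendsto by (rule tendsto_norm_zero_cancel)
 then have "(%m. L2of (conv (mol (eps m)) f)) ----> L2of f"
  using mollify_L2of[OF _ assms, of "eps _"] by (simp add: LIM_zero_iff)
 then show ?thesis unfolding L2conv_def using sqint_conv_mol[OF _ assms] assms by auto
qed

lemma sqint_nth: "sqint (f :: plane => plane) ==> sqint (%x. f x $ i)"
 by (rule sqint_bound[of _ f 1]) (auto simp: component_le_norm_cart intro: measurable_compose[OF sqint_measurable])

lemma sqint_vec:
 fixes f :: "plane => plane"
 assumes "sqint (%x. f x $ 1)" "sqint (%x. f x $ 2)" shows "sqint f"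
proof -
 have "sqint (%x. f x $ i *R axis i 1 :: plane)" for i
 proof (rule sqint_bound[of _ "%x. f x $ i" 1])
  have "sqint (%x. f x $ i)" using assms exhaust_2[of i] by auto
  then show "sqint (%x. f x $ i)" and "(%x. f x $ i *R axis i 1 :: plane) : borel_measurable borel" by auto
 qed (auto simp: norm_axis_1)
 from sqint_add[OF this[of 1] this[of 2]] show ?thesis
  using pt_eta by (simp add: pt_eq)
qed

lemma integrable_if_sqint_bounded_support:
 fixes f :: "plane => real"
 assumes f: "sqint f" and A: "bounded A" "!!x. x ~: A ==> f x = 0"
 shows "integrable lborel f"
proof -
 obtain R where R: "A <= ball 0 R" using bounded_subset_ballD[OF A(1), of 0] by auto
 have "sqint (indicator (ball 0 R) :: plane => real)"
  by (rule sqint_bounded_indicator[OF borel_measurable_indicator[OF borel_open[OF open_ball]], of _ _ 1 "ball 0 R"])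
   (auto split: split_indicator)
 from sqint_inner_integrable[OF f this] have "integrable lborel (%x. f x * indicator (ball 0 R) x)" by simp
 moreover have "(%x. f x * indicator (ball 0 R) x) = f"
 proof
  fix x show "f x * indicator (ball 0 R) x = f x"
   using A(2)[of x] R by (cases "x : A") (auto simp: indicator_def)
 qed
 ultimately show ?thesis by simp
qed

lemma cgrad_mol_reflect: "e > 0 ==> cgrad (%y. mol e (x - y)) y = - cgrad (mol e) (x - y)"
proof -
 assume "e > 0"
 have "((%y. mol e (x - y)) has_derivative (%h. cgrad (mol e) (x - y) \<bullet> (- h))) (at y)"
  by (rule has_derivative_compose[OF _ Ck_has_derivative[OF Ck_mol[of "Suc 0"]]]) (auto intro!: derivative_eq_intros)
 from cgrad_eq[OF this] show ?thesis by (simp add: vec_eq_iff inner_axis)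
qed

lemma conv_mol_divfree:
 assumes Z: "sqint Z" "integrable lborel (%x. Z x $ 1)" "integrable lborel (%x. Z x $ 2)"
  and div: "divfree_on S Z" and e: "e > 0" "cball x e <= S"
 shows "cgrad (conv (mol e) (%x. Z x $ 1)) x $ 1 + cgrad (conv (mol e) (%x. Z x $ 2)) x $ 2 = 0"
proof -
 have "0 = (LBINT y. cgrad (%y. mol e (x - y)) y \<bullet> Z y)"
  using div Ccinf_affine_mol[OF e] unfolding divfree_on_def by simp
 also have "... = (LBINT y. - (cgrad (mol e) (x - y) $ 1 * Z y $ 1) - (cgrad (mol e) (x - y) $ 2 * Z y $ 2))"
  unfolding cgrad_mol_reflect[OF e(1)] plane_inner by simp
 also have "... = - conv (%y. cgrad (mol e) y $ 1) (%x. Z x $ 1) x - conv (%y. cgrad (mol e) y $ 2) (%x. Z x $ 2) x"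
  unfolding conv_def using conv_integrable[OF Ccinf_cgrad[OF mol_Ccinf[OF e(1)]] Z(2)] conv_integrable[OF Ccinf_cgrad[OF mol_Ccinf[OF e(1)]] Z(3)]
  by simp
 finally show ?thesis
  using cgrad_conv[OF mol_Ccinf[OF e(1)] Z(2)] cgrad_conv[OF mol_Ccinf[OF e(1)] Z(3)] by simp
qed

lemma conv_mol_curlfree:
 assumes P: "sqint P" "integrable lborel (%x. P x $ 1)" "integrable lborel (%x. P x $ 2)"
  and curl: "curlfree_on S P" and e: "e > 0" "cball x e <= S"
 shows "cgrad (conv (mol e) (%x. P x $ 2)) x $ 1 = cgrad (conv (mol e) (%x. P x $ 1)) x $ 2"
proof -
 have "0 = (LBINT y. Jv (cgrad (%y. mol e (x - y)) y) \<bullet> P y)"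
  using curl Ccinf_affine_mol[OF e] unfolding curlfree_on_def by simp
 also have "... = (LBINT y. (cgrad (mol e) (x - y) $ 2 * P y $ 1) - (cgrad (mol e) (x - y) $ 1 * P y $ 2))"
  unfolding cgrad_mol_reflect[OF e(1)] plane_inner by simp
 also have "... = conv (%y. cgrad (mol e) y $ 2) (%x. P x $ 1) x - conv (%y. cgrad (mol e) y $ 1) (%x. P x $ 2) x"
  unfolding conv_def using conv_integrable[OF Ccinf_cgrad[OF mol_Ccinf[OF e(1)]] P(2)] conv_integrable[OF Ccinf_cgrad[OF mol_Ccinf[OF e(1)]] P(3)]
  by simp
 finally show ?thesis
  using cgrad_conv[OF mol_Ccinf[OF e(1)] P(2)] cgrad_conv[OF mol_Ccinf[OF e(1)] P(3)] by simp
qed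

definition osq :: "plane => real => plane set" where
 "osq c s = {x. ALL i. c $ i < x $ i & x $ i < c $ i + s}"

lemma osq_subset: "osq c s <= hsq c s" "osq c s <= sqr c s"
 by (auto simp: osq_def hsq_def sqr_def less_imp_le)

lemma open_osq: "open (osq c s)"
proof -
 have "osq c s = box c (c + s *R 1)" by (auto simp: osq_def mem_box_cart)
 then show ?thesis by (simp only: open_box)
qed

definition cell_mass :: "(plane => plane) => plane set => real" where
 "cell_mass Z = mass (%x. Z x $ 1) (%x. Z x $ 2)"

text \<open>Both fields are mollified. The square has positive distance to the complement of S, so
  for small mollification the fields are smooth, divergence-free and curl-free on it, and the smooth
  estimate applies. All its terms are built from sequences converging in L^2 and pass to the
  limit.\<close>

theorem div_curl_bound:
 fixes Z P :: "plane => plane"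
 assumes s: "s > 0" and N: "N > 0" and S: "open S" "sqr c s <= S" and A: "bounded A"
  and Z: "sqint Z" "!!x. x ~: A ==> Z x = 0" "divfree_on S Z"
  and P: "sqint P" "!!x. x ~: A ==> P x = 0" "curlfree_on S P"
  and f: "f : Ccinf (osq c s)"
 defines "g == %x. cgrad f x $ 2 * P x $ 1 - cgrad f x $ 1 * P x $ 2"
 shows "abs (LBINT x. f x * (Z x \<bullet> P x))
  <= sqrt (SUM p:grid N. (cell_mass Z (cell c (s / real N) p))^2) * sqrt (LBINT x. (g x)^2)
   + 2 * cell_mass Z (hsq c s) / (s / real N) * (SUM p:grid N. abs (LINT x:cell c (s / real N) p|lborel. g x))"
proof -
 define Zm where "Zm i m = conv (mol (eps m)) (%x. Z x $ i)" for i m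
 define Pm where "Pm i m = conv (mol (eps m)) (%x. P x $ i)" for i m
 let ?c = "cell c (s / real N)" and ?m = "%m. mass (Zm 1 m) (Zm 2 m)" and ?z = "%m x. Zm 1 m x * Pm 1 m x + Zm 2 m x * Pm 2 m x"
 have Zi: "integrable lborel (%x. Z x $ i)" for i
  by (rule integrable_if_sqint_bounded_support[OF sqint_nth[OF Z(1)] A]) (simp add: Z(2))
 have Pi: "integrable lborel (%x. P x $ i)" for i
  by (rule integrable_if_sqint_bounded_support[OF sqint_nth[OF P(1)] A]) (simp add: P(2))
 have ZL: "L2conv (Zm i) (%x. Z x $ i)" for i unfolding Zm_def by (rule L2conv_mol[OF sqint_nth[OF Z(1)]])
 have PL: "L2conv (Pm i) (%x. P x $ i)" for i unfolding Pm_def by (rule L2conv_mol[OF sqint_nth[OF P(1)]])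
 have ZC: "Ck k (Zm i m)" for k i m unfolding Zm_def by (rule Ck_conv[OF mol_Ccinf Zi]) simp
 have PC: "Ck k (Pm i m)" for k i m unfolding Pm_def by (rule Ck_conv[OF mol_Ccinf Pi]) simp
 define gm where "gm m x = cgrad f x $ 2 * Pm 1 m x - cgrad f x $ 1 * Pm 2 m x" for m x
 obtain B where B: "B >= 0" "!!x. norm (cgrad f x) <= B" by (rule cgrad_bounded[OF f]) (rule that)
 have cb: "abs (cgrad f x $ i) <= B" for x i using component_le_norm_cart[of "cgrad f x" i] B(2)[of x] by linarith
 have cm[measurable]: "(%x. cgrad f x $ i) : borel_measurable borel" for i
  using Ccinf_measurable[OF Ccinf_cgrad[OF f]] .
 obtain B0 where B0: "B0 >= 0" "!!x. abs (f x) <= B0" by (rule Ccinf_bounded[OF f]) (rule that)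
 have pm[measurable]: "f : borel_measurable borel" using Ccinf_measurable[OF f] .
 have gL: "L2conv gm g" unfolding gm_def[abs_def] g_def
  by (intro L2conv_diff L2conv_mult[OF PL cm cb])
 obtain K where K: "compact K" "K <= osq c s" "!!x. x ~: K ==> f x = 0"
  by (rule compact_supp_inE[OF Ccinf_supp[OF f]]) (rule that)
 have f0: "f x = 0" if "x ~: osq c s" for x
  using that K(2) by (intro K(3)) auto
 have fh: "f x = 0" if "x ~: hsq c s" for x using f0[of x] that osq_subset(1) by blast
 have cg0: "cgrad f x = 0" if "x ~: osq c s" for x
  using K(2) that by (intro cgrad_zero_outside[OF K(1,3)]) auto
 have sqi: "sqint (indicator (hsq d t) :: plane => real)" for d t
  by (rule sqint_bounded_indicator[of _ 1 "hsq d t"]) (auto simp: bounded_hsq split: split_indicator)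
 have mass_lim: "(%m. ?m m (hsq d t)) ----> cell_mass Z (hsq d t)" for d t
  unfolding cell_mass_def mass_def set_lebesgue_integral_def real_scaleR_def
  by (intro tendsto_add L2conv_inner[OF L2conv_const[OF sqi] L2conv_abs[OF ZL]])
 have g_lim: "(%m. LBINT x:?c p. gm m x) ----> (LBINT x:?c p. g x)" for p
  unfolding set_lebesgue_integral_def real_scaleR_def cell_def
  by (rule L2conv_inner[OF L2conv_const[OF sqi] gL])
 have gm0: "gm m x = 0" if "x ~: hsq c s" for m x
 proof -
  have "cgrad f x = 0" using cg0[of x] that osq_subset(1) by blast
  then show ?thesis by (simp add: gm_def)
 qed
 have gsq: "(LBINT x:hsq c s. (gm m x)^2) = (LBINT x. gm m x * gm m x)" for m
  unfolding set_lebesgue_integral_def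
  by (rule lint_cong)
   (use gm0 in "auto simp: indicator_def power2_eq_square")
 have gsq_lim: "(%m. LINT x:hsq c s|lborel. (gm m x)^2) ----> (LBINT x. (g x)^2)"
  unfolding gsq using L2conv_inner[OF gL gL] by (simp only: power2_eq_square)
 have lhs: "(LBINT x:hsq c s. f x * ?z m x)
  = (LBINT x. (f x * Zm 1 m x) * Pm 1 m x) + (LBINT x. (f x * Zm 2 m x) * Pm 2 m x)" for m
 proof -
  have i: "integrable lborel (%x. (f x * Zm i m x) * Pm i m x)" for i
   using sqint_inner_integrable[OF sqint_mult_bounded[OF L2convD(1)[OF ZL] pm B0(2)] L2convD(1)[OF PL]] by simp
  have "(LBINT x:hsq c s. f x * ?z m x)
   = (LBINT x. (f x * Zm 1 m x) * Pm 1 m x + (f x * Zm 2 m x) * Pm 2 m x)"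
   unfolding set_lebesgue_integral_def
   by (rule lint_cong)
    (use fh in "auto simp: indicator_def algebra_simps")
  then show ?thesis using i by simp
 qed
 have rhs: "(LBINT x. (f x * Z x $ 1) * P x $ 1) + (LBINT x. (f x * Z x $ 2) * P x $ 2) = (LBINT x. f x * (Z x \<bullet> P x))"
 proof -
  have i: "integrable lborel (%x. (f x * Z x $ i) * P x $ i)" for i
   using sqint_inner_integrable[OF sqint_mult_bounded[OF sqint_nth[OF Z(1)] pm B0(2)] sqint_nth[OF P(1)]] by simp
  show ?thesis unfolding plane_inner using i by (simp add: distrib_left mult.assoc)
 qed
 have lhs_lim: "(%m. LINT x:hsq c s|lborel. f x * ?z m x) ----> (LBINT x. f x * (Z x \<bullet> P x))"
  unfolding lhs rhs[symmetric] by (intro tendsto_add L2conv_inner L2conv_mult[OF ZL pm B0(2)] PL)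
 obtain d where d: "d > 0" "!!x. x : sqr c s ==> cball x d <= S"
 proof -
  obtain e where "e > 0" "(\<Union>x\<in>sqr c s. ball x e) <= S"
   using compact_subset_open_imp_ball_epsilon_subset[OF compact_sqr S] by blast
  then show ?thesis using that[of "e/2"] by (force simp: subset_iff)
 qed
 have bound: "\<forall>\<^sub>F m in sequentially. abs (LINT x:hsq c s|lborel. f x * ?z m x)
  <= sqrt (SUM p:grid N. ?m m (?c p)^2) * sqrt (LBINT x:hsq c s. (gm m x)^2)
   + 2 * ?m m (hsq c s) / (s / real N) * (SUM p:grid N. abs (LBINT x:?c p. gm m x))"
  using eps_less[OF d(1)]
 proof eventually_elim
  case (elim m)
  have cb: "cball x (eps m) <= S" if "x : sqr c s" for x using d(2)[OF that] elim by force
  show ?case unfolding gm_def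
  proof (rule smooth_square_bound[OF s N ZC ZC PC PC Ccinf_Ck[OF f]])
   fix x assume x: "x : sqr c s"
   show "cgrad (Zm 1 m) x $ 1 + cgrad (Zm 2 m) x $ 2 = 0"
    unfolding Zm_def by (rule conv_mol_divfree[OF Z(1) Zi Zi Z(3) _ cb[OF x]]) simp
   show "cgrad (Pm 2 m) x $ 1 = cgrad (Pm 1 m) x $ 2"
    unfolding Pm_def by (rule conv_mol_curlfree[OF P(1) Pi Pi P(3) _ cb[OF x]]) simp
  next
   fix x assume "x : sq_boundary c s"
   then have "x ~: osq c s" by (auto simp: sq_boundary_def osq_def) (metis less_irrefl)+
   then show "f x = 0" by (rule f0)
  qed
 qed
 have s0: "s / real N ~= 0" using s N by simp
 show ?thesis
 proof (rule tendsto_le[OF sequentially_bot _ tendsto_rabs[OF lhs_lim] bound])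
  show "(%m. sqrt (SUM p:grid N. ?m m (?c p)^2) * sqrt (LBINT x:hsq c s. (gm m x)^2)
   + 2 * ?m m (hsq c s) / (s / real N) * (SUM p:grid N. abs (LBINT x:?c p. gm m x)))
  ----> sqrt (SUM p:grid N. (cell_mass Z (?c p))^2) * sqrt (LBINT x. (g x)^2)
   + 2 * cell_mass Z (hsq c s) / (s / real N) * (SUM p:grid N. abs (LBINT x:?c p. g x))"
   by (intro tendsto_add tendsto_mult tendsto_real_sqrt tendsto_sum tendsto_power tendsto_divide tendsto_const
      tendsto_rabs gsq_lim g_lim mass_lim mass_lim[folded cell_def] s0)
    (unfold cell_def, rule mass_lim)
 qed
qed

section \<open>The div-curl lemma for weighted fields\<close>

definition grd :: "(plane => real) => plane l2" where "grd h = L2of (cgrad h)"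
definition jl :: "plane l2 => plane l2" where "jl z = L2of (%t. Jv (fn z t))"
definition dfree :: "plane set => plane l2 => bool" where
 "dfree S z = (ALL h:Ccinf S. grd h \<bullet> z = 0)"
definition cfree :: "plane set => plane l2 => bool" where
 "cfree S z = (ALL h:Ccinf S. jl (grd h) \<bullet> z = 0)"
text \<open>Representatives are truncated to S at every point, because the mollification argument
  asks for fields that vanish exactly outside a bounded set.\<close>

definition fo :: "plane set => plane l2 => plane => plane" where
 "fo S z t = indicator S t *R fn z t"

lemma Jv_inner: "Jv u \<bullet> v = - (u \<bullet> Jv v)"
 by (simp add: plane_inner)

lemma norm_Jv [simp]: "norm (Jv u) = norm u"
 by (simp add: norm_eq_sqrt_inner plane_inner)

lemma Jv_linear: "Jv (a *R u + b *R v) = a *R Jv u + b *R Jv v"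
 by (simp add: vec_eq_iff forall_2)

lemma Jv_measurable [measurable]: "Jv : borel_measurable borel"
 unfolding Jv_def pt_eq by (intro borel_measurable_continuous_onI continuous_intros)

lemma sqint_Jv: "sqint f ==> sqint (%x. Jv (f x))"
 by (rule sqint_bound[of _ f 1]) (auto intro: measurable_compose[OF sqint_measurable])

lemma fn_jl: "AE t in lborel. fn (jl z) t = Jv (fn z t)"
 unfolding jl_def by (rule fn_L2of[OF sqint_Jv[OF sqint_fn]])

lemma jl_L2of: assumes f: "sqint f" shows "jl (L2of f) = L2of (%t. Jv (f t))"
 unfolding jl_def by (rule L2of_cong[OF sqint_Jv[OF sqint_fn] sqint_Jv[OF f]]) (use fn_L2of[OF f] in "eventually_elim, simp")

lemma jl_inner: "jl x \<bullet> y = - (x \<bullet> jl y)"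
proof -
 have "jl x \<bullet> y = (LBINT t. - (fn x t \<bullet> Jv (fn y t)))"
  by (rule inner_l2_cong) (use fn_jl[of x] in \<open>eventually_elim, simp add: Jv_inner\<close>, measurable)
 also have "... = - (LBINT t. fn x t \<bullet> Jv (fn y t))" by simp
 also have "(LBINT t. fn x t \<bullet> Jv (fn y t)) = x \<bullet> jl y"
  unfolding jl_def by (rule inner_L2of_right[OF sqint_Jv[OF sqint_fn], symmetric])
 finally show ?thesis .
qed

lemma norm_jl [simp]: "norm (jl x) = norm x"
proof -
 have 1: "norm (jl x) <= 1 * norm x" by (rule norm_l2_mono) (use fn_jl[of x] in \<open>eventually_elim, simp\<close>, simp)
 have 2: "norm x <= 1 * norm (jl x)" by (rule norm_l2_mono) (use fn_jl[of x] in \<open>eventually_elim, simp\<close>, simp)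
 from 1 2 show ?thesis by simp
qed

lemma jl_jl [simp]: "jl (jl x) = - x"
proof (rule l2_eqI)
 show "AE t in lborel. fn (jl (jl x)) t = fn (- x) t"
  using fn_jl[of "jl x"] fn_jl[of x] fn_uminus[of x]
  by eventually_elim (simp add: vec_eq_iff forall_2)
qed

lemma sqint_fo: "S : sets borel ==> sqint (fo S z)"
 unfolding fo_def[abs_def]
 by (rule sqint_bound[of _ "fn z" 1]) (auto split: split_indicator)

lemma cgrad_outside: assumes "h : Ccinf S" "x ~: S" shows "cgrad h x = 0"
proof -
 obtain K where K: "compact K" "K <= S" "!!x. x ~: K ==> h x = 0"
  by (rule compact_supp_inE[OF Ccinf_supp[OF assms(1)]]) (rule that)
 show ?thesis using K(2) assms(2) by (intro cgrad_zero_outside[OF K(1,3)]) auto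
qed

lemma Cc_outside: assumes "h : Cc S" "x ~: S" shows "h x = 0"
proof -
 obtain K where K: "compact K" "K <= S" "!!x. x ~: K ==> h x = 0"
  by (rule compact_supp_inE[OF Cc_supp[OF assms(1)]]) (rule that)
 show ?thesis using K(2) assms(2) by (intro K(3)) auto
qed

lemma Ccinf_outside: "h : Ccinf S ==> x ~: S ==> h x = 0"
 using Cc_outside Ccinf_subset_Cc by blast

lemma grd_inner: "h : Ccinf S ==> grd h \<bullet> z = (LBINT x. cgrad h x \<bullet> fn z x)"
 using inner_L2of[OF cgrad_sqint sqint_fn[of z], of h S] by (simp add: grd_def)

lemma divfree_on_fo: "S <= T ==> dfree S z ==> divfree_on S (fo T z)"
 unfolding divfree_on_def dfree_def
proof
 fix h assume S: "S <= T" and d: "ALL h:Ccinf S. grd h \<bullet> z = 0" and h: "h : Ccinf S"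
 have c0: "cgrad h x = 0" if "x ~: T" for x using cgrad_outside[OF h, of x] S that by blast
 have "(LBINT x. cgrad h x \<bullet> fo T z x) = (LBINT x. cgrad h x \<bullet> fn z x)"
  by (rule lint_cong) (use c0 in "auto simp: fo_def indicator_def")
 then show "(LBINT x. cgrad h x \<bullet> fo T z x) = 0" using d[rule_format, OF h] grd_inner[OF h, of z] by simp
qed

lemma curlfree_on_fo: "S <= T ==> cfree S z ==> curlfree_on S (fo T z)"
 unfolding curlfree_on_def cfree_def
proof
 fix h assume S: "S <= T" and d: "ALL h:Ccinf S. jl (grd h) \<bullet> z = 0" and h: "h : Ccinf S"
 have c0: "cgrad h x = 0" if "x ~: T" for x using cgrad_outside[OF h, of x] S that by blast
 have J0: "Jv 0 = 0" by (simp add: vec_eq_iff forall_2)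
 have "(LBINT x. Jv (cgrad h x) \<bullet> fo T z x) = (LBINT x. Jv (cgrad h x) \<bullet> fn z x)"
  by (rule lint_cong) (use c0 J0 in "auto simp: fo_def indicator_def")
 also have "... = jl (grd h) \<bullet> z"
  unfolding grd_def jl_L2of[OF cgrad_sqint[OF h]]
  using inner_L2of[OF sqint_Jv[OF cgrad_sqint[OF h]] sqint_fn[of z]] by simp
 finally show "(LBINT x. Jv (cgrad h x) \<bullet> fo T z x) = 0" using d h by simp
qed

lemma cfree_grd: "f : Ccinf S ==> cfree T (grd f)"
 unfolding cfree_def
proof
 fix h assume f: "f : Ccinf S" and h: "h : Ccinf T"
 have i: "integrable lborel (%x. cgrad h x $ i * cgrad f x $ j)" for i j
  using sqint_inner_integrable[OF sqint_nth[OF cgrad_sqint[OF h]] sqint_nth[OF cgrad_sqint[OF f]]] by simp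
 have "jl (grd h) \<bullet> grd f = (LBINT x. Jv (cgrad h x) \<bullet> cgrad f x)"
  unfolding grd_def jl_L2of[OF cgrad_sqint[OF h]] by (rule inner_L2of[OF sqint_Jv[OF cgrad_sqint[OF h]] cgrad_sqint[OF f]])
 also have "... = (LBINT x. cgrad h x $ 1 * cgrad f x $ 2 - cgrad h x $ 2 * cgrad f x $ 1)"
  by (simp add: plane_inner algebra_simps)
 also have "... = 0" using i cgrad_cross[OF h f, of 1 2] by simp
 finally show "jl (grd h) \<bullet> grd f = 0" .
qed

lemma cfree_closed:
 assumes "!!n. cfree S (x n)" "x ----> l" shows "cfree S l"
 unfolding cfree_def
proof
 fix h assume "h : Ccinf S"
 have "(%n. jl (grd h) \<bullet> x n) ----> jl (grd h) \<bullet> l" by (intro tendsto_intros assms)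
 moreover have "jl (grd h) \<bullet> x n = 0" for n using assms(1) `h : Ccinf S` unfolding cfree_def by blast
 ultimately show "jl (grd h) \<bullet> l = 0" by (simp add: LIMSEQ_const_iff)
qed

lemma cfree_diff: "cfree S x ==> cfree S y ==> cfree S (x - y)"
 by (simp add: cfree_def inner_simps)

lemma cfree_add: "cfree S x ==> cfree S y ==> cfree S (x + y)"
 by (simp add: cfree_def inner_simps)

lemma cfree_scaleR: "cfree S x ==> cfree S (a *R x)"
 by (simp add: cfree_def)

text \<open>Moving the quarter turn across the inner product exchanges the two weak conditions; this
  planar fact makes curl-free fields out of fluxes.\<close>

lemma cfree_jl: "dfree S z ==> cfree S (jl z)"
 unfolding cfree_def dfree_def by (simp add: jl_inner)

text \<open>Cauchy-Schwarz for |Z| = sqrt k (|Z| / sqrt k). Each of the two components is at most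
  |Z|, whence a factor 2 and, after squaring, 4.\<close>

lemma cell_mass_sq:
 fixes k :: "plane => real"
 assumes k: "k : borel_measurable borel" "!!x. k x >= 1" "!!x. k x <= B" and A: "A : sets borel" "bounded A" and Z: "sqint Z"
 shows "(cell_mass Z A)^2 <= 4 * (LBINT x:A. k x) * (LBINT x:A. (norm (Z x))^2 / k x)"
proof -
 let ?g = "%x. indicator A x * (norm (Z x) / sqrt (k x))" and ?I = "LBINT x:A. (norm (Z x))^2 / k x" and ?K = "LBINT x:A. k x"
 have [measurable]: "k : borel_measurable borel" "A : sets borel" "Z : borel_measurable borel" using k A Z by auto
 have kp: "k x > 0" for x using k(2)[of x] by linarith
 have s1: "sqint (%x. indicator A x * sqrt (k x))"
 proof (rule sqint_bounded_indicator[OF _ _ A(2,1)])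
  show "abs (indicator A x * sqrt (k x)) <= sqrt B" for x
   using k(3)[of x] k(2)[of x] by (auto simp: indicator_def)
 qed auto
 have s2: "sqint (%x. ?g x)"
 proof (rule sqint_bound[OF _ Z, of _ 1])
  show "AE x in lborel. norm (?g x) <= 1 * norm (Z x)"
  proof (rule AE_I2)
   fix x
   have "norm (Z x) / sqrt (k x) <= norm (Z x) / 1" using k(2)[of x] by (intro divide_left_mono) auto
   then show "norm (?g x) <= 1 * norm (Z x)"
    using kp[of x] by (auto simp: indicator_def)
  qed
 qed measurable
 have e: "(indicator A x * sqrt (k x)) * ?g x = indicator A x * norm (Z x)" for x
  using kp[of x] by (auto simp: indicator_def)
 have iZ: "integrable lborel (%x. indicator A x * norm (Z x))"
  using sqint_inner_integrable[OF s1 s2] unfolding inner_real_def e .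
 have "cell_mass Z A <= 2 * (LBINT x. indicator A x * norm (Z x))"
 proof -
  have "(LBINT x:A. abs (Z x $ i)) <= (LBINT x. indicator A x * norm (Z x))" for i
   unfolding set_lebesgue_integral_def
  proof (rule integral_mono_AE'[OF iZ])
   show "AE x in lborel. indicator A x *R (abs (Z x $ i)) <= indicator A x * norm (Z x)"
    using component_le_norm_cart by (intro AE_I2) (auto simp: indicator_def)
  qed auto
  from this[of 1] this[of 2] show ?thesis unfolding cell_mass_def mass_def by linarith
 qed
 also have "... <= 2 * (sqrt (LBINT x. (indicator A x * sqrt (k x))^2) * sqrt (LBINT x. ?g x^2))"
  using cauchy_schwarz_integral[OF s1 s2] unfolding e by linarith
 also have "(LBINT x. (indicator A x * sqrt (k x))^2) = ?K"
  unfolding set_lebesgue_integral_def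
  by (rule lint_cong) (use kp in "auto simp: indicator_def less_imp_le")
 also have "(LBINT x. ?g x^2) = ?I"
  unfolding set_lebesgue_integral_def
  by (rule lint_cong) (use kp in "auto simp: indicator_def less_imp_le power_divide")
 finally have "cell_mass Z A <= 2 * sqrt (?K * ?I)"
  by (simp add: real_sqrt_mult)
 moreover have "cell_mass Z A >= 0" unfolding cell_mass_def mass_def by (intro add_nonneg_nonneg set_integral_nonneg_real) auto
 ultimately have "(cell_mass Z A)^2 <= (2 * sqrt (?K * ?I))^2"
  by (intro power_mono)
 also have "... = 4 * ?K * ?I"
  using kp by (auto simp: power_mult_distrib less_imp_le intro!: mult_nonneg_nonneg set_integral_nonneg_real)
 finally show ?thesis .
qed

lemma dc_g_bound:
 assumes f: "f : Ccinf S" and B: "B >= 0" "!!x. norm (cgrad f x) <= B" and P: "sqint (P :: plane => plane)"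
 shows "sqint (%x. cgrad f x $ 2 * P x $ 1 - cgrad f x $ 1 * P x $ 2)"
  and "sqrt (LBINT x. (cgrad f x $ 2 * P x $ 1 - cgrad f x $ 1 * P x $ 2)^2) <= B * sqrt (LBINT x. (norm (P x))^2)"
proof -
 let ?g = "%x. cgrad f x $ 2 * P x $ 1 - cgrad f x $ 1 * P x $ 2"
 have [measurable]: "(%x. cgrad f x $ i) : borel_measurable borel" "(%x. P x $ i) : borel_measurable borel" for i
  using Ccinf_measurable[OF Ccinf_cgrad[OF f]] sqint_measurable[OF sqint_nth[OF P]] by auto
 have g: "abs (?g x) <= B * norm (P x)" for x
 proof -
  have "?g x = - (Jv (cgrad f x) \<bullet> P x)" by (simp add: plane_inner)
  then have "abs (?g x) <= norm (cgrad f x) * norm (P x)" using Cauchy_Schwarz_ineq2[of "Jv (cgrad f x)" "P x"] by simp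
  also have "... <= B * norm (P x)" by (intro mult_right_mono B) auto
  finally show ?thesis .
 qed
 have gm: "?g : borel_measurable borel" by measurable
 show s: "sqint ?g" by (rule sqint_bound[OF gm P, of B]) (use g in auto)
 have "(LBINT x. (?g x)^2) <= (LBINT x. B^2 * (norm (P x))^2)"
 proof (rule integral_mono)
  show "integrable lborel (%x. (?g x)^2)" using sqint_integrable_sq[OF s] by simp
  show "integrable lborel (%x. B^2 * (norm (P x))^2)" using sqint_integrable_sq[OF P] by simp
  show "(?g x)^2 <= B^2 * (norm (P x))^2" for x
   using power_mono[OF g[of x] abs_ge_zero, of 2] by (simp add: power_mult_distrib)
 qed
 then have "sqrt (LBINT x. (?g x)^2) <= sqrt (B^2 * (LBINT x. (norm (P x))^2))" by simp
 then show "sqrt (LBINT x. (?g x)^2) <= B * sqrt (LBINT x. (norm (P x))^2)" using B(1) by (simp add: real_sqrt_mult)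
qed

text \<open>\<open>ka n\<close> models a conductivity that is large on small sets. \<open>Kt\<close>
  bounds its total mass; the bound \<open>Kl\<close> per unit area holds for a given square only
  from some n on, which suffices because a grid has finitely many cells.\<close>

locale weights =
 fixes Om :: "plane set" and ka :: "nat => plane => real" and Kt Kl :: real
 assumes open_Om: "open Om" and bounded_Om: "bounded Om"
  and ka_meas [measurable]: "!!n. ka n : borel_measurable borel"
  and ka_ge: "!!n x. ka n x >= 1"
  and ka_bdd: "!!n. EX B. ALL x. ka n x <= B"
  and ka_total: "!!n. (LBINT x:Om. ka n x) <= Kt"
  and ka_local: "!!c s. s > 0 ==> sqr c s <= Om ==> \<forall>\<^sub>F n in sequentially. (LBINT x:hsq c s. ka n x) <= Kl * s^2"
begin

lemma Om_borel [measurable]: "Om : sets borel" using open_Om by simp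

text \<open>The energy of a flux z with respect to the inverse conductivity.\<close>

definition en :: "nat => plane set => plane l2 => real" where
 "en n A z = (LBINT x:A. (norm (fn z x))^2 / ka n x)"

lemma ka_pos: "ka n x > 0" using ka_ge[of n x] by linarith

lemma en_integrable: "integrable lborel (%x. (norm (fn z x))^2 / ka n x)"
proof (rule lint_bound[OF sqint_integrable_sq[OF sqint_fn[of z]]])
 show "AE x in lborel. norm ((norm (fn z x))^2 / ka n x) <= norm ((norm (fn z x))^2)"
 proof (rule AE_I2)
  fix x
  have "(norm (fn z x))^2 / ka n x <= (norm (fn z x))^2 / 1"
   using ka_ge[of n x] by (intro divide_left_mono) auto
  then show "norm ((norm (fn z x))^2 / ka n x) <= norm ((norm (fn z x))^2)" using ka_pos[of n x] by simp
 qed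
qed measurable

lemma en_set_integrable: "A : sets borel ==> set_integrable lborel A (%x. (norm (fn z x))^2 / ka n x)"
 unfolding set_integrable_def using integrable_mult_indicator[OF _ en_integrable, of A] by simp

lemma en_nonneg: "en n A z >= 0"
 unfolding en_def using ka_pos by (intro set_integral_nonneg_real) (auto simp: less_imp_le)

lemma en_mono: "A <= B ==> A : sets borel ==> B : sets borel ==> en n A z <= en n B z"
 unfolding en_def set_lebesgue_integral_def
 using en_set_integrable[of A z n] en_set_integrable[of B z n] ka_pos[of n]
 by (intro integral_mono) (auto simp: set_integrable_def indicator_def less_imp_le)

lemma ka_set_integrable: "A : sets borel ==> bounded A ==> set_integrable lborel A (ka n)"
 unfolding set_integrable_def
proof -
 assume A: "A : sets borel" "bounded A"
 obtain B where B: "!!x. ka n x <= B" using ka_bdd by blast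
 show "integrable lborel (%x. indicator A x *R ka n x)"
 proof (rule lint_bound[of _ "%x. B * indicator A x"])
  show "integrable lborel (%x. B * indicator A x)" using integrable_indicator_bounded[OF A(2,1)] by simp
  show "AE x in lborel. norm (indicator A x *R ka n x) <= norm (B * indicator A x)"
   using B ka_pos[of n] order_less_le_trans[OF ka_pos B] by (intro AE_I2) (auto simp: indicator_def less_imp_le abs_of_pos)
 qed (use A in measurable)
qed

lemma ka_mono: "A <= B ==> A : sets borel ==> B : sets borel ==> bounded B ==> (LBINT x:A. ka n x) <= (LBINT x:B. ka n x)"
 unfolding set_lebesgue_integral_def
 using ka_set_integrable[of A n] ka_set_integrable[of B n] bounded_subset[of B A] ka_pos[of n]
 by (intro integral_mono) (auto simp: set_integrable_def indicator_def less_imp_le)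

lemma cell_mass_fo:
 assumes "A <= Om" "A : sets borel"
 shows "(cell_mass (fo Om z) A)^2 <= 4 * (LBINT x:A. ka n x) * en n A z"
proof -
 obtain B where B: "!!x. ka n x <= B" using ka_bdd by blast
 have "(cell_mass (fo Om z) A)^2 <= 4 * (LBINT x:A. ka n x) * (LBINT x:A. (norm (fo Om z x))^2 / ka n x)"
  by (rule cell_mass_sq[OF ka_meas ka_ge B assms(2) bounded_subset[OF bounded_Om assms(1)] sqint_fo]) simp
 also have "(LBINT x:A. (norm (fo Om z x))^2 / ka n x) = en n A z"
  unfolding en_def set_lebesgue_integral_def
  by (rule lint_cong) (use assms(1) in "auto simp: fo_def indicator_def")
 finally show ?thesis .
qed

lemma cell_mass_fo_total:
 assumes "A <= Om" "A : sets borel" "en n Om z <= E"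
 shows "cell_mass (fo Om z) A <= 2 * sqrt (Kt * E)"
proof -
 have "(cell_mass (fo Om z) A)^2 <= 4 * ((LBINT x:A. ka n x) * en n A z)"
  using cell_mass_fo[OF assms(1,2), of z n] by simp
 also have "... <= 4 * (Kt * E)"
 proof (intro mult_left_mono mult_mono)
  show "(LBINT x:A. ka n x) <= Kt" using ka_mono[OF assms(1,2) Om_borel bounded_Om, of n] ka_total[of n] by linarith
  show "en n A z <= E" using en_mono[OF assms(1,2) Om_borel, of n z] assms(3) by linarith
  have "0 <= (LBINT x:Om. ka n x)" using ka_pos by (intro set_integral_nonneg_real) (auto simp: less_imp_le)
  then show "0 <= Kt" using ka_total[of n] by linarith
 qed (auto intro: en_nonneg)
 finally have "cell_mass (fo Om z) A <= sqrt (4 * (Kt * E))" by (rule real_le_rsqrt)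
 then show ?thesis by (simp add: real_sqrt_mult)
qed

lemma fo_inner: "f : Cc Om ==> f x * (fo Om y x \<bullet> fo Om z x) = f x * (fn y x \<bullet> fn z x)"
 using Cc_outside[of f Om x] by (cases "x : Om") (auto simp: fo_def)

lemma sqint_norm_fo: "sqrt (LBINT x. (norm (fo Om z x))^2) <= norm z"
proof -
 have "(LBINT x. (norm (fo Om z x))^2) <= (LBINT x. (norm (fn z x))^2)"
  by (rule integral_mono[OF sqint_integrable_sq[OF sqint_fo] sqint_integrable_sq[OF sqint_fn]]) (auto simp: fo_def indicator_def)
 then show ?thesis unfolding norm_sq_fn[symmetric] by (simp add: real_le_lsqrt)
qed

text \<open>In the grid estimate the first term is at most a constant times 1 / N for all large n,
  since the squared cell masses add up to at most \<open>4 * (Kl * t^2) * E\<close>. For fixed N the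
  second term tends to zero with the cell integrals of \<open>g n\<close>.\<close>

theorem div_curl_null:
 assumes s: "s > 0" and Q: "sqr c s <= Om" and f: "f : Ccinf (osq c s)"
  and Z: "!!n. dfree Om (Z n)" "!!n. en n Om (Z n) <= E"
  and P: "!!n. cfree Om (P n)" "!!n. norm (P n) <= M" "weak_conv P 0"
 shows "(%n. LBINT x. f x * (fn (Z n) x \<bullet> fn (P n) x)) ----> 0"
proof -
 have fOm: "f : Cc Om" using Ccinf_mono[OF f] osq_subset(2)[of c s] Q Ccinf_subset_Cc by blast
 have E0: "E >= 0" using en_nonneg[of 0 Om "Z 0"] Z(2)[of 0] by linarith
 have M0: "M >= 0" using norm_ge_zero[of "P 0"] P(2)[of 0] by linarith
 have K0: "Kl >= 0"
 proof -
  obtain n where "(LBINT x:hsq c s. ka n x) <= Kl * s^2"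
   using eventually_happens[OF ka_local[OF s Q]] by auto
  moreover have "0 <= (LBINT x:hsq c s. ka n x)" using ka_pos by (intro set_integral_nonneg_real) (auto simp: less_imp_le)
  ultimately have "0 <= Kl * s^2" by linarith
  then show ?thesis using s by (simp add: zero_le_mult_iff)
 qed
 obtain B where B: "B >= 0" "!!x. norm (cgrad f x) <= B" by (rule cgrad_bounded[OF f]) (rule that)
 define g where "g n x = cgrad f x $ 2 * fo Om (P n) x $ 1 - cgrad f x $ 1 * fo Om (P n) x $ 2" for n x
 have g2: "sqrt (LBINT x. (g n x)^2) <= B * M" for n
 proof -
  have "sqrt (LBINT x. (g n x)^2) <= B * sqrt (LBINT x. (norm (fo Om (P n) x))^2)"
   unfolding g_def by (rule dc_g_bound(2)[OF f B sqint_fo]) simp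
  also have "... <= B * M" using sqint_norm_fo[of "P n"] P(2)[of n] B(1) by (intro mult_left_mono) auto
  finally show ?thesis .
 qed
 have gcell: "(%n. LINT x:cell c (s / real N) p|lborel. g n x) ----> 0" if N: "N > 0" and p: "p : grid N" for N p
 proof -
  \<comment> \<open>The cell integral of \<open>g n\<close> is the inner product of
    \<open>P n\<close> with this fixed field, the rotated gradient of the cutoff restricted to the
    cell, so weak convergence applies.\<close>
  define h where "h x = indicator (cell c (s / real N) p) x *R pt (cgrad f x $ 2) (- cgrad f x $ 1)" for x
  have [measurable]: "(%x. cgrad f x $ i) : borel_measurable borel" for i
   using Ccinf_measurable[OF Ccinf_cgrad[OF f]] .
  have h: "sqint h"
  proof (rule sqint_bound[OF _ cgrad_sqint[OF f], of _ 1])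
   show "h : borel_measurable borel" unfolding h_def pt_eq by measurable
   have "norm (pt (cgrad f x $ 2) (- cgrad f x $ 1)) = norm (cgrad f x)" for x
    by (simp add: norm_eq_sqrt_inner plane_inner add.commute)
   then show "AE x in lborel. norm (h x) <= 1 * norm (cgrad f x)" unfolding h_def by (intro AE_I2) (auto simp: indicator_def)
  qed
  have "(LBINT x:cell c (s / real N) p. g n x) = P n \<bullet> L2of h" for n
   unfolding inner_L2of_right[OF h] set_lebesgue_integral_def
  proof (rule lint_cong)
   fix x
   have "x : cell c (s / real N) p ==> x : Om"
    using cell_subset[OF s N p, of c] hsq_subset_sqr Q unfolding cell_def by blast
   then show "indicator (cell c (s / real N) p) x *R g n x = fn (P n) x \<bullet> h x"
    by (auto simp: g_def h_def fo_def indicator_def plane_inner mult.commute)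
  qed simp
  then show ?thesis using weak_convD[OF P(3), of "L2of h"] by simp
 qed
 have main: "\<forall>\<^sub>F n in sequentially. abs (LBINT x. f x * (fn (Z n) x \<bullet> fn (P n) x)) < e" if e: "e > 0" for e
 proof -
  \<comment> \<open>With t = s / N the first term of the estimate is \<open>R / N\<close>; N is
    chosen to make it smaller than e / 2.\<close>
  define R where "R = 2 * sqrt (Kl * E) * s * (B * M)"
  have R0: "R >= 0" unfolding R_def using K0 E0 s B(1) M0 by simp
  obtain N :: nat where N: "real N > 2 * R / e" using reals_Archimedean2 by blast
  have N0: "N > 0" using N R0 e by (metis divide_nonneg_pos gr0I mult_nonneg_nonneg not_less of_nat_0 zero_le_numeral)
  define t where "t = s / real N"
  have t: "t > 0" using s N0 by (simp add: t_def)
  have small: "2 * sqrt (Kl * E) * t * (B * M) < e / 2"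
  proof -
   have "2 * sqrt (Kl * E) * t * (B * M) = R / real N" unfolding R_def t_def by simp
   also have "... < e / 2" using N N0 e by (simp add: field_simps)
   finally show ?thesis .
  qed
  have cellsub: "sqr (c + t *R pt (real (fst p)) (real (snd p))) t <= Om" if "p : grid N" for p
   using cell_subset[OF s N0 that, of c] Q unfolding t_def by blast
  have ev1: "\<forall>\<^sub>F n in sequentially. ALL p:grid N. (LBINT x:cell c t p. ka n x) <= Kl * t^2"
   using ka_local[OF t cellsub] unfolding cell_def by (intro eventually_ball_finite) auto
  define T where "T n = 2 * (2 * sqrt (Kt * E)) / t * (SUM p:grid N. abs (LINT x:cell c t p|lborel. g n x))" for n
  have "(%n. 2 * (2 * sqrt (Kt * E)) / t * (SUM p:grid N. abs (LINT x:cell c t p|lborel. g n x))) ----> 2 * (2 * sqrt (Kt * E)) / t * (SUM p:grid N. abs 0)"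
   by (intro tendsto_mult tendsto_const tendsto_sum tendsto_rabs) (use gcell[OF N0] in "simp add: t_def")
  then have "T ----> 0" unfolding T_def[abs_def] by simp
  then have ev2: "\<forall>\<^sub>F n in sequentially. T n < e / 2" using order_tendstoD(2)[of T 0 _ "e/2"] e by simp
  from ev1 ev2 show ?thesis
  proof eventually_elim
   case (elim n)
   have pc: "cell c t p <= Om" if "p : grid N" for p
    using cellsub[OF that] hsq_subset_sqr unfolding cell_def by blast
   have hQ: "hsq c s <= Om" using hsq_subset_sqr Q by blast
   have mm: "cell_mass (fo Om (Z n)) (hsq c s) <= 2 * sqrt (Kt * E)" by (rule cell_mass_fo_total[OF hQ _ Z(2)]) simp
   have m0: "cell_mass (fo Om (Z n)) (hsq c s) >= 0"
    unfolding cell_mass_def mass_def by (intro add_nonneg_nonneg set_integral_nonneg_real) auto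
   then have "0 <= sqrt (Kt * E)" using mm by linarith
   then have k0: "0 <= 4 * sqrt (Kt * E) / t" using t by (intro divide_nonneg_pos mult_nonneg_nonneg) auto
   have sum: "(SUM p:grid N. (cell_mass (fo Om (Z n)) (cell c t p))^2) <= 4 * (Kl * t^2) * E"
   proof -
    have "(SUM p:grid N. (cell_mass (fo Om (Z n)) (cell c t p))^2) <= (SUM p:grid N. 4 * (Kl * t^2) * en n (cell c t p) (Z n))"
    proof (rule sum_mono)
     fix p assume p: "p : grid N"
     have "(cell_mass (fo Om (Z n)) (cell c t p))^2 <= 4 * (LBINT x:cell c t p. ka n x) * en n (cell c t p) (Z n)"
      by (rule cell_mass_fo[OF pc[OF p]]) simp
     also have "... <= 4 * (Kl * t^2) * en n (cell c t p) (Z n)"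
      using elim(1) p by (intro mult_right_mono mult_left_mono en_nonneg) auto
     finally show "(cell_mass (fo Om (Z n)) (cell c t p))^2 <= 4 * (Kl * t^2) * en n (cell c t p) (Z n)" .
    qed
    also have "... = 4 * (Kl * t^2) * (SUM p:grid N. en n (cell c t p) (Z n))" by (simp add: sum_distrib_left)
    also have "(SUM p:grid N. en n (cell c t p) (Z n)) = en n (hsq c s) (Z n)"
     unfolding en_def t_def by (rule sum_cells_integral[OF s N0]) (auto intro: en_set_integrable)
    also have "4 * (Kl * t^2) * en n (hsq c s) (Z n) <= 4 * (Kl * t^2) * E"
     using en_mono[OF hQ _ Om_borel, of n "Z n"] Z(2)[of n] K0 by (intro mult_left_mono) auto
    finally show ?thesis .
   qed
   have "abs (LBINT x. f x * (fn (Z n) x \<bullet> fn (P n) x)) = abs (LBINT x. f x * (fo Om (Z n) x \<bullet> fo Om (P n) x))"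
    unfolding fo_inner[OF fOm] ..
   also have "... <= sqrt (SUM p:grid N. (cell_mass (fo Om (Z n)) (cell c (s / real N) p))^2) * sqrt (LBINT x. (g n x)^2)
    + 2 * cell_mass (fo Om (Z n)) (hsq c s) / (s / real N) * (SUM p:grid N. abs (LINT x:cell c (s / real N) p|lborel. g n x))"
    unfolding g_def
    by (rule div_curl_bound[OF s N0 open_Om Q bounded_Om sqint_fo _ divfree_on_fo[OF order_refl Z(1)] sqint_fo _ curlfree_on_fo[OF order_refl P(1)] f])
     (auto simp: fo_def)
   also have "... <= sqrt (4 * (Kl * t^2) * E) * (B * M) + T n"
    unfolding t_def[symmetric] T_def
    using sum g2[of n] K0 E0 mm t B(1) M0 m0 k0
    by (intro add_mono mult_mono real_sqrt_le_mono divide_right_mono mult_left_mono order_refl)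
     (auto intro!: sum_nonneg real_sqrt_ge_zero mult_nonneg_nonneg)
   also have "sqrt (4 * (Kl * t^2) * E) = 2 * sqrt (Kl * E) * t"
    using t by (simp add: real_sqrt_mult)
   finally show ?case using small elim(2) by linarith
  qed
 qed
 show ?thesis
 proof (rule tendstoI)
  fix e :: real assume "e > 0"
  from main[OF this] show "\<forall>\<^sub>F n in sequentially. dist (LBINT x. f x * (fn (Z n) x \<bullet> fn (P n) x)) 0 < e" by simp
 qed
qed

end

section \<open>The closed space of gradients\<close>

definition gsp :: "plane set => plane l2 set" where "gsp S = closure (grd ` Ccinf S)"

lemma grd_lin: "f : Ccinf S ==> h : Ccinf S ==> grd (%x. a * f x + b * h x) = a *R grd f + b *R grd h"
proof -
 assume p: "f : Ccinf S" "h : Ccinf S"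
 have "cgrad (%x. a * f x + b * h x) = (%x. a *R cgrad f x + b *R cgrad h x)"
  by (rule ext) (simp add: cgrad_add[OF Ccinf_cmult[OF p(1)] Ccinf_cmult[OF p(2)]] cgrad_cmult[OF p(1)] cgrad_cmult[OF p(2)])
 then show ?thesis unfolding grd_def using p
  by (simp add: L2of_add sqint_scaleR cgrad_sqint L2of_scaleR)
qed

lemma grd_diff: "f : Ccinf S ==> h : Ccinf S ==> grd (%x. f x - h x) = grd f - grd h"
 using grd_lin[of f S h 1 "-1"] by simp

lemma Ccinf_lin: "f : Ccinf S ==> h : Ccinf S ==> (%x. a * f x + b * h x) : Ccinf S"
 by (intro Ccinf_add Ccinf_cmult)

lemma subspace_grd: "subspace (grd ` Ccinf S)"
 unfolding subspace_def
proof (intro conjI ballI allI)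
 show "0 : grd ` Ccinf S"
  using grd_lin[OF Ccinf_zero Ccinf_zero, of 0 0] Ccinf_zero by (force intro: image_eqI)
 fix x assume "x : grd ` Ccinf S"
 then obtain f where f: "f : Ccinf S" "x = grd f" by blast
 show "c *R x : grd ` Ccinf S" for c
  using grd_lin[OF f(1) f(1), of c 0] Ccinf_lin[OF f(1) f(1), of c 0] f(2) by (intro image_eqI[of _ _ "%x. c * f x + 0 * f x"]) auto
 fix y assume "y : grd ` Ccinf S"
 then obtain h where h: "h : Ccinf S" "y = grd h" by blast
 show "x + y : grd ` Ccinf S"
  using grd_lin[OF f(1) h(1), of 1 1] Ccinf_lin[OF f(1) h(1), of 1 1] f(2) h(2) by (intro image_eqI[of _ _ "%x. 1 * f x + 1 * h x"]) auto
qed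

lemma gsp_subspace: "subspace (gsp S)" and gsp_closed: "closed (gsp S)"
 unfolding gsp_def using subspace_grd by (auto intro: subspace_closure_gen)

lemma gsp_grd: "f : Ccinf S ==> grd f : gsp S"
 unfolding gsp_def by (rule set_mp[OF closure_subset imageI])

lemma gsp_seq:
 assumes "U : gsp S" obtains p where "!!k::nat. p k : Ccinf S" "(%k. grd (p k)) ----> U"
proof -
 obtain f where f: "!!k. f k : grd ` Ccinf S" "f ----> U" using assms unfolding gsp_def closure_sequential by blast
 then have "ALL k. EX p. p : Ccinf S & f k = grd p" by blast
 then obtain p where p: "!!k. p k : Ccinf S & f k = grd (p k)" by metis
 then have "f = (%k. grd (p k))" by auto
 then show ?thesis using that[of p] f(2) p by simp
qed

lemma gsp_cfree: assumes "U : gsp S" shows "cfree T U"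
proof -
 obtain f where "!!k::nat. f k : Ccinf S" "(%k. grd (f k)) ----> U" by (rule gsp_seq[OF assms]) (rule that)
 then show ?thesis using cfree_closed cfree_grd by metis
qed

lemma dfree_gsp: "dfree S z = (ALL V:gsp S. V \<bullet> z = 0)"
proof
 assume d: "dfree S z"
 show "ALL V:gsp S. V \<bullet> z = 0"
 proof
  fix V assume "V : gsp S"
  then obtain f where f: "!!k::nat. f k : Ccinf S" "(%k. grd (f k)) ----> V" by (rule gsp_seq) (rule that)
  have "(%k. grd (f k) \<bullet> z) ----> V \<bullet> z" by (intro tendsto_intros f)
  moreover have "grd (f k) \<bullet> z = 0" for k using d f(1) unfolding dfree_def by blast
  ultimately show "V \<bullet> z = 0" by (simp add: LIMSEQ_const_iff)
 qed
qed (auto simp: dfree_def gsp_grd)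

text \<open>A rotated gradient is divergence-free. This is why a constant multiple of J in a
  conductivity does not change its solutions.\<close>

lemma gsp_jl_ortho: "U : gsp S ==> V : gsp S ==> jl U \<bullet> V = 0"
proof -
 assume U: "U : gsp S" and V: "V : gsp S"
 obtain f where f: "!!k::nat. f k : Ccinf S" "(%k. grd (f k)) ----> V" by (rule gsp_seq[OF V]) (rule that)
 have "(%k. jl U \<bullet> grd (f k)) ----> jl U \<bullet> V" by (intro tendsto_intros f)
 moreover have "jl U \<bullet> grd (f k) = 0" for k
  using gsp_cfree[OF U, of S] f(1)[of k] unfolding cfree_def by (auto simp: jl_inner inner_commute)
 ultimately show ?thesis by (simp add: LIMSEQ_const_iff)
qed

text \<open>The component of u orthogonal to the space is orthogonal to all \<open>U n\<close>,
  hence in the limit to u itself.\<close>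

lemma gsp_weakly_closed: assumes "!!n. U n : gsp S" "weak_conv U u" shows "u : gsp S"
proof -
 obtain p where p: "p : gsp S" "!!v. v : gsp S ==> u \<bullet> v = p \<bullet> v" by (rule projection_exists[OF gsp_subspace gsp_closed]) (rule that)
 have "(%n. U n \<bullet> (u - p)) ----> u \<bullet> (u - p)" by (rule weak_convD[OF assms(2)])
 moreover have "U n \<bullet> (u - p) = 0" for n using p(2)[OF assms(1)[of n]] by (simp add: inner_diff_right inner_commute)
 ultimately have "u \<bullet> (u - p) = 0" by (simp add: LIMSEQ_const_iff)
 moreover have "p \<bullet> (u - p) = 0" using p(2)[OF p(1)] by (simp add: inner_diff_right inner_commute)
 ultimately have "(u - p) \<bullet> (u - p) = 0" by (simp add: inner_diff_left)
 then show ?thesis using p(1) by simp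
qed

definition ip :: "(plane => real) => plane l2 => plane l2 => real" where
 "ip f y z = (LBINT x. f x * (fn y x \<bullet> fn z x))"

lemma sqint_mult_vec:
 assumes "f : Cc S" shows "sqint (%x. f x *R fn y x)"
proof -
 obtain B where B: "B >= 0" "!!x. abs (f x) <= B" by (rule Cc_bounded[OF assms]) (rule that)
 have [measurable]: "f : borel_measurable borel" using Cc_measurable[OF assms] .
 show ?thesis by (rule sqint_bound[of _ "fn y" B]) (use B(2) in "auto intro!: mult_right_mono")
qed

lemma ip_inner: assumes "f : Cc S" shows "ip f y z = L2of (%x. f x *R fn y x) \<bullet> z"
 using inner_L2of[OF sqint_mult_vec[OF assms] sqint_fn[of z], of y] by (simp add: ip_def)

lemma ip_commute: "ip f y z = ip f z y"
 by (simp add: ip_def inner_commute)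

lemma ip_diff_right: "f : Cc S ==> ip f y (z - w) = ip f y z - ip f y w"
 by (simp add: ip_inner inner_simps)

lemma ip_diff_left: "f : Cc S ==> ip f (z - w) y = ip f z y - ip f w y"
 using ip_diff_right ip_commute by metis

lemma ip_integrable: "f : Cc S ==> integrable lborel (%x. f x * (fn y x \<bullet> fn z x))"
 using sqint_inner_integrable[OF sqint_mult_vec[of f S y] sqint_fn[of z]] by simp

lemma ip_bound:
 assumes "f : Cc S" obtains B where "B >= 0" "!!y z. abs (ip f y z) <= B * norm y * norm z"
proof -
 obtain B where B: "B >= 0" "!!x. abs (f x) <= B" by (rule Cc_bounded[OF assms]) (rule that)
 have "abs (ip f y z) <= B * norm y * norm z" for y z
 proof -
  have "norm (L2of (%x. f x *R fn y x)) <= B * norm y"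
   by (rule norm_l2_mono[OF _ B(1)])
    (use fn_L2of[OF sqint_mult_vec[OF assms, of y]] in "eventually_elim, simp add: mult_right_mono B(2)")
  from mult_right_mono[OF this norm_ge_zero[of z]] show ?thesis unfolding ip_inner[OF assms]
   using Cauchy_Schwarz_ineq2[of "L2of (%x. f x *R fn y x)" z] by linarith
 qed
 then show ?thesis using that B(1) by blast
qed

lemma ip_weak: "f : Cc S ==> weak_conv z l ==> (%n. ip f y (z n)) ----> ip f y l"
 unfolding ip_inner weak_conv_def by (simp add: inner_commute[of "L2of _"])

text \<open>Weak-star convergence of the components as measures. No bound in L^2 is implied along
  the sequence, although each member lies in it.\<close>

definition wstar :: "plane set => (nat => plane l2) => plane l2 => bool" where
 "wstar S D d = (ALL f:Cc S. ALL i. (%n. LBINT x. f x * fn (D n) x $ i) ----> (LBINT x. f x * fn d x $ i))"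

lemma wstarD: "wstar S D d ==> f : Cc S ==> (%n. LBINT x. f x * fn (D n) x $ i) ----> (LBINT x. f x * fn d x $ i)"
 by (simp add: wstar_def)

lemma wstar_subseq: "wstar S D d ==> strict_mono r ==> wstar S (%n. D (r n)) d"
 unfolding wstar_def using LIMSEQ_subseq_LIMSEQ[of _ _ r] by (auto simp: o_def)

lemma Cc_mult: assumes "p : Cc S" "continuous_on UNIV f" shows "(%x. p x * f x) : Cc S"
proof -
 obtain K where K: "compact K" "K <= S" "!!x. x ~: K ==> p x = 0"
  by (rule compact_supp_inE[OF Cc_supp[OF assms(1)]]) (rule that)
 have "compact_supp_in S (%x. p x * f x)" by (rule closure_nonzero_compact[OF K(1) _ K(2)]) (simp add: K(3))
 then show ?thesis using assms Cc_continuous[OF assms(1)] by (simp add: Cc_def continuous_intros)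
qed

context weights
begin

text \<open>The grid estimate with a single cell. Its two terms contribute once and twice the
  product of the mass with \<open>B * norm P\<close>, and the mass is at most
  \<open>2 * sqrt (Kt * E)\<close>, whence the factor 6. Being uniform in Z, it permits
  approximation of the limit gradient by smooth ones.\<close>

lemma div_curl_simple_bound:
 assumes s: "s > 0" and Q: "sqr c s <= Om" and f: "f : Ccinf (osq c s)" and B: "B >= 0" "!!x. norm (cgrad f x) <= B"
  and Z: "dfree Om Z" "en n Om Z <= E" and P: "cfree Om P"
 shows "abs (ip f Z P) <= 6 * sqrt (Kt * E) * B * norm P"
proof -
 have fOm: "f : Cc Om" using Ccinf_mono[OF f] osq_subset(2)[of c s] Q Ccinf_subset_Cc by blast
 define g where "g x = cgrad f x $ 2 * fo Om P x $ 1 - cgrad f x $ 1 * fo Om P x $ 2" for x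
 let ?G = "sqrt (LBINT x. (g x)^2)" and ?m = "cell_mass (fo Om Z) (hsq c s)"
 have g: "sqint g" "?G <= B * sqrt (LBINT x. (norm (fo Om P x))^2)"
  using dc_g_bound[OF f B sqint_fo] unfolding g_def[abs_def] by auto
 have G: "?G <= B * norm P" using order_trans[OF g(2) mult_left_mono[OF sqint_norm_fo B(1)]] .
 have m: "0 <= ?m" "?m <= 2 * sqrt (Kt * E)" unfolding cell_mass_def mass_def
  by (intro add_nonneg_nonneg set_integral_nonneg_real; simp)
   (fold mass_def cell_mass_def, rule cell_mass_fo_total[OF _ _ Z(2)], use hsq_subset_sqr Q in \<open>blast, simp\<close>)
 have sqi: "sqint (indicator (hsq c s) :: plane => real)"
  by (rule sqint_bounded_indicator[of _ 1 "hsq c s"]) (auto simp: bounded_hsq split: split_indicator)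
 have "abs (LBINT x:hsq c s. g x) <= sqrt (LBINT x. (indicator (hsq c s) x)^2) * ?G"
  using cauchy_schwarz_integral[OF sqi g(1)] by (simp add: set_lebesgue_integral_def)
 also have "(LBINT x. (indicator (hsq c s) x :: real)^2) = (LBINT x:hsq c s. 1)"
  unfolding set_lebesgue_integral_def by (rule lint_cong) (auto simp: indicator_def)
 also have "... = s^2" using s by (intro hsq_measure) auto
 finally have gi: "abs (LBINT x:hsq c s. g x) <= s * ?G" using s by simp
 have f0: "x ~: Om ==> fo Om z x = 0" for x z by (simp add: fo_def)
 have gr: "grid 1 = {(0, 0)}" "cell c s (0, 0) = hsq c s" by (auto simp: grid_def cell_def hsq_def forall_2)
 have "abs (LBINT x. f x * (fo Om Z x \<bullet> fo Om P x)) <= ?m * ?G + 2 * ?m / s * abs (LBINT x:hsq c s. g x)"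
  using div_curl_bound[OF s zero_less_one open_Om Q bounded_Om sqint_fo[OF Om_borel] f0 divfree_on_fo[OF order_refl Z(1)] sqint_fo[OF Om_borel] f0 curlfree_on_fo[OF order_refl P] f] m(1)
  unfolding gr g_def[symmetric] by (simp add: gr)
 also have "... <= ?m * ?G + 2 * ?m / s * (s * ?G)" using s m(1) by (intro add_left_mono mult_left_mono gi) auto
 also have "... = 3 * (?m * ?G)" using s by simp
 also have "... <= 3 * (2 * sqrt (Kt * E) * (B * norm P))" using m G order_trans[OF m] by (intro mult_left_mono mult_mono) auto
 finally show ?thesis unfolding fo_inner[OF fOm] ip_def by (simp add: mult_ac)
qed

text \<open>On the dense set of gradients of test functions the pairing with the oscillating field is a weak-star
 limit, and the previous bound is uniform in the field.\<close>

theorem div_curl_limit: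
 assumes s: "s > 0" and Q: "sqr c s <= Om" and f: "f : Ccinf (osq c s)"
  and D: "!!n. dfree Om (D n - F)" "!!n. en n Om (D n - F) <= E" and lim: "wstar Om D d"
  and P: "!!n. cfree Om (P n)" "!!n. norm (P n) <= M" "weak_conv P p" "p : gsp Om"
 shows "(%n. ip f (D n) (P n)) ----> ip f d p"
proof -
 have fOm: "f : Cc Om" using Ccinf_mono[OF f] osq_subset(2)[of c s] Q Ccinf_subset_Cc by blast
 obtain B where B: "B >= 0" "!!x. norm (cgrad f x) <= B" by (rule cgrad_bounded[OF f]) (rule that)
 obtain K where K: "K >= 0" "!!y z. abs (ip f y z) <= K * norm y * norm z" by (rule ip_bound[OF fOm]) (rule that)
 define W where "W = 6 * sqrt (Kt * E) * B + K * norm F + K * norm d"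
 obtain h where h: "!!k::nat. h k : Ccinf Om" "(%k. grd (h k)) ----> p" by (rule gsp_seq[OF P(4)]) (rule that)
 have W: "abs (ip f (D n) z) + abs (ip f d z) <= W * norm z" if "cfree Om z" for n z
  using div_curl_simple_bound[OF s Q f B D that, of n] K(2)[of F z] K(2)[of d z] ip_diff_left[OF fOm, of "D n" F z]
  unfolding W_def by (simp add: distrib_right)
 have ip: "ip f y (grd et) = (LBINT x. (f x * cgrad et x $ 1) * fn y x $ 1) + (LBINT x. (f x * cgrad et x $ 2) * fn y x $ 2)"
  and cc: "(%x. f x * cgrad et x $ i) : Cc Om" if et: "et : Ccinf Om" for y et i
 proof -
  show cc: "(%x. f x * cgrad et x $ i) : Cc Om" for i
   by (rule Cc_mult[OF fOm Cc_continuous[OF set_mp[OF Ccinf_subset_Cc Ccinf_cgrad[OF et]]]])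
  have "integrable lborel (%x. (f x * cgrad et x $ i) * fn y x $ i)" for i
   using sqint_inner_integrable[OF Cc_sqint[OF cc] sqint_nth[OF sqint_fn[of y]]] by simp
  moreover have "ip f y (grd et) = (LBINT x. f x * (fn y x \<bullet> cgrad et x))"
   unfolding ip_inner[OF fOm] grd_def by (subst inner_L2of[OF sqint_mult_vec[OF fOm] cgrad_sqint[OF et]]) simp
  ultimately show "ip f y (grd et) = (LBINT x. (f x * cgrad et x $ 1) * fn y x $ 1) + (LBINT x. (f x * cgrad et x $ 2) * fn y x $ 2)"
   by (simp add: plane_inner distrib_left mult_ac)
 qed
 have 3: "(%n. ip f (D n) p) ----> ip f d p"
 proof (rule LIMSEQ_I)
  fix e :: real assume e: "e > 0"
  have "(%k. W * norm (p - grd (h k))) ----> W * norm (p - p)" by (intro tendsto_intros h(2))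
  then have "\<forall>\<^sub>F k in sequentially. W * norm (p - grd (h k)) < e / 2" using e by (intro order_tendstoD) auto
  then obtain k where k: "W * norm (p - grd (h k)) < e / 2" using eventually_happens by force
  have "(%n. ip f (D n) (grd (h k))) ----> ip f d (grd (h k))"
   unfolding ip[OF h(1)] by (intro tendsto_add wstarD[OF lim] cc h(1))
  then obtain N where N: "!!n. n >= N ==> norm (ip f (D n) (grd (h k)) - ip f d (grd (h k))) < e / 2"
   using LIMSEQ_D[of _ _ "e/2"] e by force
  have "norm (ip f (D n) p - ip f d p) < e" if "n >= N" for n
   using N[OF that] k W[OF cfree_diff[OF gsp_cfree[OF P(4)] cfree_grd[OF h(1)]], of n k] unfolding ip_diff_right[OF fOm] real_norm_def by linarith
  then show "EX N. ALL n>=N. norm (ip f (D n) p - ip f d p) < e" by blast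
 qed
 have w0: "weak_conv (%n. P n - p) 0" using weak_conv_diff[OF P(3) weak_conv_const[of p]] by simp
 have nP: "norm (P n - p) <= M + norm p" for n using norm_triangle_ineq4[of "P n" p] P(2)[of n] by linarith
 have 1: "(%n. ip f (D n - F) (P n - p)) ----> 0" unfolding ip_def
  by (rule div_curl_null[OF s Q f D cfree_diff[OF P(1) gsp_cfree[OF P(4)]] nP w0])
 \<comment> \<open>Bilinear splitting of \<open>ip f (D n) (P n)\<close>: the divergence-free part
   against the weak null sequence, the fixed datum \<open>F\<close> against it, and the flux against
   the fixed limit.\<close>
 have "(%n. ip f (D n - F) (P n - p) + ip f F (P n - p) + ip f (D n) p) ----> 0 + ip f F 0 + ip f d p"
  by (intro tendsto_add 1 ip_weak[OF fOm w0] 3)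
 moreover have "ip f F 0 = 0" using ip_inner[OF fOm] by simp
 ultimately show ?thesis by (simp add: ip_diff_left[OF fOm] ip_diff_right[OF fOm])
qed

end

section \<open>The space of gradients and bounded coefficients\<close>

text \<open>Gradients of test functions are orthogonal to the restriction of \<open>U\<close> to the
  complement of S. By density so is \<open>U\<close>, and the restriction has norm zero.\<close>

lemma gsp_outside: assumes U: "U : gsp S" "S : sets borel" shows "AE t in lborel. t ~: S --> fn U t = 0"
proof -
 let ?w = "%t. indicator (- S) t *R fn U t"
 define W where "W = L2of (%t. indicator (- S) t *R fn U t)"
 have s: "sqint (%t. indicator (- S) t *R fn U t)"
  by (rule sqint_bound[of _ "fn U" 1]) (use U(2) in "auto split: split_indicator")
 obtain f where f: "!!k::nat. f k : Ccinf S" "(%k. grd (f k)) ----> U" by (rule gsp_seq[OF U(1)]) (rule that)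
 have "grd (f k) \<bullet> W = 0" for k
 proof -
  have "grd (f k) \<bullet> W = (LBINT t. cgrad (f k) t \<bullet> ?w t)"
   unfolding grd_def W_def by (rule inner_L2of[OF cgrad_sqint[OF f(1)] s])
  moreover have "(%t. cgrad (f k) t \<bullet> ?w t) = (%t. 0)"
  proof
   have z: "cgrad (f k) t = 0" if "t ~: S" for t using cgrad_outside[OF f(1)[of k] that] .
   show "cgrad (f k) t \<bullet> ?w t = 0" for t by (cases "t : S") (auto simp: z)
  qed
  ultimately show ?thesis by simp
 qed
 moreover have "(%k. grd (f k) \<bullet> W) ----> U \<bullet> W" by (intro tendsto_intros f)
 ultimately have "U \<bullet> W = 0" by (simp add: LIMSEQ_const_iff)
 moreover have "U \<bullet> W = W \<bullet> W"
 proof -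
  have "U \<bullet> W = (LBINT t. fn U t \<bullet> ?w t)" unfolding W_def by (rule inner_L2of_right[OF s])
  also have "... = (LBINT t. ?w t \<bullet> ?w t)"
   by (rule lint_cong) (auto simp: indicator_def)
  finally show ?thesis unfolding W_def inner_L2of[OF s s] .
 qed
 ultimately have "W = 0" by simp
 then have "AE x in lborel. fn 0 x = indicator (- S) x *R fn U x" using fn_L2of[OF s] unfolding W_def by simp
 then have "AE t in lborel. indicator (- S) t *R fn U t = 0"
  using fn_zero[where ?'a = plane] by eventually_elim simp
 then show ?thesis by eventually_elim (auto simp: indicator_def)
qed

section \<open>Bounded matrix fields and their solution operators\<close>

definition bmat :: "(plane => mat2) => real => bool" where
 "bmat A C = (A : borel_measurable borel & C >= 0 & (ALL t z. norm (A t *v z) <= C * norm z))"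
definition opM :: "(plane => mat2) => plane l2 => plane l2" where
 "opM A z = L2of (%t. A t *v fn z t)"

lemma mat_vec_pt: "A *v x = pt (A$1$1 * x$1 + A$1$2 * x$2) (A$2$1 * x$1 + A$2$2 * x$(2::2))" for A :: mat2
 by (simp add: vec_eq_iff forall_2 matrix_vector_mult_def sum_2)

lemma entry_measurable: "A : borel_measurable M ==> (%t. (A t :: mat2) $ i $ j) : borel_measurable M"
 by (rule measurable_compose[of A M borel "%B. B $ i $ j"]) (auto intro!: borel_measurable_continuous_onI continuous_intros)

lemma nth_measurable: "f : borel_measurable M ==> (%t. (f t :: plane) $ i) : borel_measurable M"
 by (rule measurable_compose[of f M borel "%v. v $ i"]) (auto intro!: borel_measurable_continuous_onI continuous_intros)

lemma pt_meas: "f : borel_measurable M ==> g : borel_measurable M ==> (%t. pt (f t) (g t)) : borel_measurable M"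
 unfolding pt_eq by (intro borel_measurable_add borel_measurable_scaleR borel_measurable_const)

lemma mat_vec_measurable [measurable (raw)]:
 "A : borel_measurable M ==> f : borel_measurable M ==> (%t. (A t :: mat2) *v f t) : borel_measurable M"
 unfolding mat_vec_pt by (intro pt_meas borel_measurable_add borel_measurable_times entry_measurable nth_measurable)

lemma bmat_sqint: "bmat A C ==> sqint (%t. A t *v fn z t)"
 by (rule sqint_bound[of _ "fn z" C]) (auto simp: bmat_def)

lemma fn_opM: "bmat A C ==> AE t in lborel. fn (opM A z) t = A t *v fn z t"
 unfolding opM_def by (rule fn_L2of[OF bmat_sqint])

lemma opM_inner: "bmat A C ==> opM A y \<bullet> z = (LBINT t. (A t *v fn y t) \<bullet> fn z t)"
 unfolding opM_def using inner_L2of[OF bmat_sqint sqint_fn[of z]] by simp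

lemma opM_lin: assumes A: "bmat A C" shows "opM A (a *R x + b *R y) = a *R opM A x + b *R opM A y"
proof (rule l2_eqI)
 show "AE t in lborel. fn (opM A (a *R x + b *R y)) t = fn (a *R opM A x + b *R opM A y) t"
  using fn_opM[OF A, of "a *R x + b *R y"] fn_plus[of "a *R x" "b *R y"] fn_scaleR[of a x] fn_scaleR[of b y]
   fn_plus[of "a *R opM A x" "b *R opM A y"] fn_scaleR[of a "opM A x"] fn_scaleR[of b "opM A y"] fn_opM[OF A, of x] fn_opM[OF A, of y]
  by eventually_elim (simp add: matrix_vector_right_distrib matrix_vector_mult_scaleR)
qed

lemma opM_diff: "bmat A C ==> opM A (x - y) = opM A x - opM A y"
 using opM_lin[of A C 1 x "-1" y] by simp

lemma opM_norm: assumes A: "bmat A C" shows "norm (opM A x) <= C * norm x"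
proof (rule norm_l2_mono)
 show "AE t in lborel. norm (fn (opM A x) t) <= C * norm (fn x t)"
  using fn_opM[OF A, of x] by eventually_elim (use A in "simp add: bmat_def")
qed (use A in "simp add: bmat_def")

definition coercive :: "(plane => mat2) => real => bool" where
 "coercive A c = (c > 0 & (ALL t z. c * (norm z)^2 <= (A t *v z) \<bullet> z))"

lemma coercive_opM: assumes A: "bmat A C" and c: "coercive A c" shows "c * (norm x)^2 <= opM A x \<bullet> x"
proof -
 have "c * (norm x)^2 = (LBINT t. c * (norm (fn x t))^2)" by (simp add: norm_sq_fn)
 also have "... <= opM A x \<bullet> x" unfolding opM_inner[OF A]
  by (rule integral_mono) (use c sqint_integrable_sq[OF sqint_fn[of x]] sqint_inner_integrable[OF bmat_sqint[OF A] sqint_fn] in "auto simp: coercive_def")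
 finally show ?thesis .
qed

text \<open>The weak equation div (A U) = div F, for gradients in place of functions; the right-hand
  side enters through a field \<open>F\<close> that represents it.\<close>

definition is_sol :: "plane set => (plane => mat2) => plane l2 => plane l2 => bool" where
 "is_sol S A F U = (U : gsp S & (ALL V:gsp S. opM A U \<bullet> V = F \<bullet> V))"
definition sol :: "plane set => (plane => mat2) => plane l2 => plane l2" where
 "sol S A F = (SOME U. is_sol S A F U)"

lemma is_sol_unique:
 assumes A: "bmat A C" "coercive A c" and U: "is_sol S A F U" "is_sol S A F U'"
 shows "U = U'"
proof -
 have d: "U - U' : gsp S" using U subspace_diff[OF gsp_subspace] unfolding is_sol_def by blast
 have "opM A (U - U') \<bullet> (U - U') = 0" unfolding opM_diff[OF A(1)] inner_diff_left[of "opM A U"] using U d unfolding is_sol_def by simp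
 then have "c * (norm (U - U'))^2 <= 0" using coercive_opM[OF A, of "U - U'"] by simp
 then show ?thesis using A(2) by (simp add: coercive_def mult_le_0_iff)
qed

lemma sol: assumes A: "bmat A C" "coercive A c" shows "is_sol S A F (sol S A F)"
proof -
 obtain u where "u : gsp S" "!!v. v : gsp S ==> opM A u \<bullet> v = F \<bullet> v"
 proof (rule lax_milgram[OF gsp_subspace gsp_closed, where b = "%u v. opM A u \<bullet> v" and f = "%v. F \<bullet> v" and c = c and C = C and K = "norm F"])
  show "abs (opM A u \<bullet> v) <= C * norm u * norm v" for u v
   using Cauchy_Schwarz_ineq2[of "opM A u" v] mult_right_mono[OF opM_norm[OF A(1), of u] norm_ge_zero[of v]] by linarith
  show "c > 0" using A(2) by (simp add: coercive_def)
 qed (auto simp: opM_lin[OF A(1)] inner_simps Cauchy_Schwarz_ineq2 coercive_opM[OF A])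
 then have "is_sol S A F u" by (simp add: is_sol_def)
 then show ?thesis unfolding sol_def by (rule someI)
qed

lemma sol_gsp: "bmat A C ==> coercive A c ==> sol S A F : gsp S"
 and sol_eq: "bmat A C ==> coercive A c ==> V : gsp S ==> opM A (sol S A F) \<bullet> V = F \<bullet> V"
 using sol[of A C c S F] by (auto simp: is_sol_def)

lemma sol_lin:
 assumes A: "bmat A C" "coercive A c"
 shows "sol S A (a *R F + b *R G) = a *R sol S A F + b *R sol S A G"
proof (rule is_sol_unique[OF A sol[OF A]])
 show "is_sol S A (a *R F + b *R G) (a *R sol S A F + b *R sol S A G)"
  unfolding is_sol_def using sol_gsp[OF A] sol_eq[OF A]
  by (auto simp: opM_lin[OF A(1)] inner_simps intro!: subspace_add[OF gsp_subspace] subspace_scale[OF gsp_subspace])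
qed

lemma sol_norm: assumes A: "bmat A C" "coercive A c" shows "norm (sol S A F) <= norm F / c"
proof -
 have "c * (norm (sol S A F))^2 <= F \<bullet> sol S A F" using coercive_opM[OF A, of "sol S A F"] sol_eq[OF A sol_gsp[OF A]] by simp
 also have "... <= norm F * norm (sol S A F)" by (rule norm_cauchy_schwarz)
 finally have "c * norm (sol S A F) <= norm F" by (cases "norm (sol S A F) = 0") (auto simp: power2_eq_square)
 then show ?thesis using A(2) by (simp add: coercive_def pos_le_divide_eq mult.commute)
qed

section \<open>Sobolev functions as elements of the Hilbert space\<close>

lemma borel_representative:
 fixes f :: "plane => 'b::euclidean_space"
 assumes S: "S : sets borel" and f: "f : borel_measurable (lebesgue_on S)"
 obtains g where "g : borel_measurable borel" "AE x in lborel. g x = indicator S x *R f x"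
proof -
 have m: "(%x. indicator S x *R f x) : borel_measurable lebesgue"
  using f S by (subst (asm) borel_measurable_restrict_space_iff) auto
 have "ALL b. EX g. g : borel_measurable lborel & (AE x in lborel. (indicator S x *R f x) \<bullet> b = g x)"
  unfolding Bex_def[symmetric] by (rule allI, rule completion_ex_borel_measurable_real) (rule borel_measurable_inner[OF m borel_measurable_const])
 then obtain g where g: "!!b. g b : borel_measurable lborel" "!!b. AE x in lborel. (indicator S x *R f x) \<bullet> b = g b x"
  using choice[of "%b g. g : borel_measurable lborel & (AE x in lborel. (indicator S x *R f x) \<bullet> b = g x)"] by blast
 have "AE x in lborel. ALL b:Basis. (indicator S x *R f x) \<bullet> b = g b x" unfolding AE_finite_all[OF finite_Basis] using g(2) by blast
 then have "AE x in lborel. (SUM b:Basis. g b x *R b) = indicator S x *R f x"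
 proof eventually_elim
  case (elim x)
  have "(SUM b:Basis. g b x *R b) = (SUM b:Basis. ((indicator S x *R f x) \<bullet> b) *R b)" using elim by (intro sum.cong) auto
  then show ?case by (simp only: euclidean_representation)
 qed
 moreover have "(%x. SUM b:Basis. g b x *R b) : borel_measurable borel" using g(1) by simp
 ultimately show ?thesis using that by blast
qed

text \<open>The class of f extended by zero outside S. The choice passes from a function that is
  Lebesgue measurable on S to a Borel one on the plane.\<close>

definition toL :: "plane set => (plane => 'b::euclidean_space) => 'b l2" where
 "toL S f = (SOME z. AE x in lborel. fn z x = indicator S x *R f x)"

lemma lebesgue_on_integral:
 fixes h :: "plane => 'b::euclidean_space"
 assumes S: "S : sets borel" and k: "k : borel_measurable borel" "AE x in lborel. k x = indicator S x *R h x"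
  and h: "h : borel_measurable (lebesgue_on S)"
 shows "integral\<^sup>L (lebesgue_on S) h = integral\<^sup>L lborel k" "integrable (lebesgue_on S) h = (integrable lborel k)"
proof -
 have S': "S \<inter> space lebesgue : sets lebesgue" using S by simp
 have m: "(%x. indicator S x *R h x) : borel_measurable lebesgue"
  using h S by (subst (asm) borel_measurable_restrict_space_iff) auto
 have k': "k : borel_measurable lebesgue" using k(1) by (simp add: measurable_completion)
 have ae: "AE x in lebesgue. k x = indicator S x *R h x" using k(2) by (rule AE_completion)
 show "integral\<^sup>L (lebesgue_on S) h = integral\<^sup>L lborel k"
  unfolding integral_restrict_space[OF S'] using integral_cong_AE[OF k' m ae] integral_completion[of k lborel] k(1) by simp
 show "integrable (lebesgue_on S) h = (integrable lborel k)"
  unfolding integrable_restrict_space[OF S'] using integrable_cong_AE[OF k' m ae] integrable_completion[of k lborel] k(1) by simp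
qed

lemma fn_toL:
 fixes f :: "plane => 'b::euclidean_space"
 assumes S: "S : sets borel" and f: "f : L2 S"
 shows "AE x in lborel. fn (toL S f) x = indicator S x *R f x"
proof -
 have fm: "f : borel_measurable (lebesgue_on S)" using f by (simp add: L2_def)
 obtain g where g: "g : borel_measurable borel" "AE x in lborel. g x = indicator S x *R f x" by (rule borel_representative[OF S fm]) (rule that)
 have sg: "sqint g" unfolding sqint_def
 proof
  have "integrable (lebesgue_on S) (%x. (norm (f x))^2)" using f by (simp add: L2_def)
  moreover have "AE x in lborel. (norm (g x))^2 = indicator S x *R (norm (f x))\<^sup>2" using g(2) by eventually_elim (auto simp: indicator_def)
  ultimately show "integrable lborel (%x. (norm (g x))^2)"
   using g(1) fm by (subst lebesgue_on_integral(2)[OF S, symmetric, where h = "%x. (norm (f x))^2"]) auto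
 qed (rule g(1))
 have "AE x in lborel. fn (L2of g) x = indicator S x *R f x" using fn_L2of[OF sg] g(2) by eventually_elim simp
 then show ?thesis unfolding toL_def by (rule someI)
qed

lemma toL_eqI:
 assumes S: "S : sets borel" and f: "f : L2 S" and z: "AE x in lborel. fn z x = indicator S x *R f x"
 shows "toL S f = z"
proof (rule l2_eqI)
 show "AE x in lborel. fn (toL S f) x = fn z x" using fn_toL[OF S f] z by eventually_elim simp
qed

lemma L2_fn: assumes S: "S : sets borel" shows "fn z : L2 S"
proof -
 have m: "fn z : borel_measurable (lebesgue_on S)"
  by (intro measurable_restrict_space1 measurable_completion) simp
 have mn: "(%x. (norm (fn z x))^2) : borel_measurable (lebesgue_on S)" using m by simp
 have "integrable lborel (%x. indicator S x *R (norm (fn z x))\<^sup>2)"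
  using S by (intro integrable_mult_indicator sqint_integrable_sq) auto
 then show ?thesis unfolding L2_def using m S
  by (simp add: lebesgue_on_integral(2)[OF S _ _ mn, of "%x. indicator S x *R (norm (fn z x))\<^sup>2"])
qed

lemma L2_sqint: assumes S: "S : sets borel" and f: "sqint f" shows "f : L2 S"
proof -
 have m: "f : borel_measurable (lebesgue_on S)"
  using f by (intro measurable_restrict_space1 measurable_completion) auto
 have mn: "(%x. (norm (f x))^2) : borel_measurable (lebesgue_on S)" using m by simp
 have "integrable lborel (%x. indicator S x *R (norm (f x))\<^sup>2)"
  using S f by (intro integrable_mult_indicator sqint_integrable_sq) auto
 then show ?thesis unfolding L2_def using m S f
  by (simp add: lebesgue_on_integral(2)[OF S _ _ mn, of "%x. indicator S x *R (norm (f x))\<^sup>2"])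
qed

lemma L2_inner:
 fixes f g :: "plane => 'b::euclidean_space"
 assumes S: "S : sets borel" and f: "f : L2 S" and g: "g : L2 S"
 shows "(\<integral>x. f x \<bullet> g x \<partial>(lebesgue_on S)) = toL S f \<bullet> toL S g"
 unfolding inner_l2_def
proof (rule lebesgue_on_integral(1)[OF S])
 show "AE x in lborel. fn (toL S f) x \<bullet> fn (toL S g) x = indicator S x *R (f x \<bullet> g x)"
  using fn_toL[OF S f] fn_toL[OF S g] by eventually_elim (auto simp: indicator_def)
qed (use f g in "auto simp: L2_def")

lemma L2_lin:
 fixes f g :: "plane => 'b::euclidean_space"
 assumes S: "S : sets borel" and f: "f : L2 S" and g: "g : L2 S"
 shows "(%x. a *R f x + b *R g x) : L2 S" and "toL S (%x. a *R f x + b *R g x) = a *R toL S f + b *R toL S g"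
proof -
 let ?h = "%x. a *R f x + b *R g x" and ?z = "a *R toL S f + b *R toL S g"
 have m: "?h : borel_measurable (lebesgue_on S)" using f g by (auto simp: L2_def)
 have ae: "AE x in lborel. fn ?z x = indicator S x *R ?h x"
  using fn_toL[OF S f] fn_toL[OF S g] fn_plus[of "a *R toL S f" "b *R toL S g"] fn_scaleR[of a "toL S f"] fn_scaleR[of b "toL S g"]
  by eventually_elim (auto simp: indicator_def)
 then have "AE x in lborel. (norm (fn ?z x))^2 = indicator S x *R (norm (?h x))\<^sup>2" by eventually_elim (auto simp: indicator_def)
 moreover have mn: "(%x. (norm (?h x))^2) : borel_measurable (lebesgue_on S)" using m by simp
 ultimately show h: "?h : L2 S" unfolding L2_def
  using m lebesgue_on_integral(2)[OF S _ _ mn, of "%x. (norm (fn ?z x))^2"] sqint_integrable_sq[OF sqint_fn[of ?z]]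
  by auto
 show "toL S ?h = ?z" by (rule toL_eqI[OF S h ae])
qed

section \<open>Weak gradients and Sobolev functions as classes\<close>

definition dl :: "(plane => real) => 2 => real l2" where "dl f i = L2of (%x. cgrad f x $ i)"
definition ax :: "(plane => real) => 2 => plane l2" where "ax f i = L2of (%x. f x *R axis i 1)"
definition weak_id :: "plane set => real l2 => plane l2 => bool" where
 "weak_id S y U = (ALL f:Ccinf S. ALL i. y \<bullet> dl f i = - (U \<bullet> ax f i))"
definition gr :: "plane set => (plane => real) => plane l2" where "gr S u = toL S (wgrad S u)"

lemma sqint_ax: "f : Ccinf S ==> sqint (%x. f x *R (axis i 1 :: plane))"
 by (rule sqint_bound[of _ f 1]) (auto intro: borel_measurable_scaleR Ccinf_measurable Ccinf_sqint)

lemma toL_L2of: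
 assumes "S : sets borel" "sqint f" "!!x. x ~: S ==> f x = 0" shows "toL S f = L2of f"
proof (rule toL_eqI[OF assms(1) L2_sqint[OF assms(1,2)]])
 show "AE x in lborel. fn (L2of f) x = indicator S x *R f x"
  using fn_L2of[OF assms(2)] by eventually_elim (use assms(3) in "auto simp: indicator_def")
qed

lemma toL_fn: "S : sets borel ==> AE x in lborel. x ~: S --> fn z x = 0 ==> toL S (fn z) = z"
 by (rule toL_eqI[OF _ L2_fn]) (auto elim!: eventually_mono simp: indicator_def)

lemma weak_id_iff:
 assumes S: "S : sets borel" and u: "u : L2 S" and G: "G : L2 S"
 shows "is_weak_grad S u G = (weak_id S (toL S u) (toL S G))"
 unfolding is_weak_grad_def weak_id_def
proof (intro ball_cong refl all_cong1)
 fix f i assume f: "f : Ccinf S"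
 have d: "sqint (%x. cgrad f x $ i)" by (rule sqint_nth[OF cgrad_sqint[OF f]])
 have "(\<integral>x. u x * cgrad f x $ i \<partial>lebesgue_on S) = toL S u \<bullet> dl f i"
  using L2_inner[OF S u L2_sqint[OF S d]] toL_L2of[OF S d] cgrad_outside[OF f] by (simp add: dl_def)
 moreover have "(\<integral>x. G x $ i * f x \<partial>lebesgue_on S) = toL S G \<bullet> ax f i"
  using L2_inner[OF S G L2_sqint[OF S sqint_ax[OF f, of i]]] toL_L2of[OF S sqint_ax[OF f, of i]] Ccinf_outside[OF f]
  by (simp add: ax_def inner_axis mult.commute)
 ultimately show "(\<integral>x. u x * cgrad f x $ i \<partial>lebesgue_on S) = - (\<integral>x. G x $ i * f x \<partial>lebesgue_on S) \<longleftrightarrow> toL S u \<bullet> dl f i = - (toL S G \<bullet> ax f i)" by simp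
qed

text \<open>The difference is orthogonal to the test functions \<open>mol e (x - y)\<close> times
  unit vectors, so its mollifications vanish inside S.\<close>

lemma weak_id_unique:
 assumes S: "open S" and U: "weak_id S y U" "weak_id S y U'"
  and 0: "AE x in lborel. x ~: S --> fn U x = 0" "AE x in lborel. x ~: S --> fn U' x = 0"
 shows "U = U'"
proof -
 let ?Z = "U - U'"
 have z: "?Z \<bullet> ax f i = 0" if "f : Ccinf S" for f i
  using U that unfolding weak_id_def inner_diff_left by force
 have "AE x in lborel. x : S --> fn ?Z x $ i = 0" for i
 proof (rule AE_zero_if_conv_zero[OF sqint_nth[OF sqint_fn] S])
  fix x e assume e: "0 < e" "cball x e <= S"
  have "conv (mol e) (%t. fn ?Z t $ i) x = ?Z \<bullet> ax (%y. mol e (x - y)) i"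
   unfolding conv_def ax_def inner_L2of_right[OF sqint_ax[OF Ccinf_affine_mol[OF e]]]
   by (simp add: inner_axis)
  then show "conv (mol e) (%t. fn ?Z t $ i) x = 0" using z[OF Ccinf_affine_mol[OF e]] by simp
 qed
 from this[of 1] this[of 2] have "AE x in lborel. fn U x = fn U' x"
  using 0 fn_minus[of U U'] by eventually_elim (auto simp: vec_eq_iff forall_2)
 then show ?thesis by (rule l2_eqI)
qed

lemma toL_outside: "S : sets borel ==> f : L2 S ==> AE x in lborel. x ~: S --> fn (toL S f) x = 0"
 using fn_toL[of S f] by (auto elim!: eventually_mono simp: indicator_def)

text \<open>Removes the arbitrary choice in \<open>wgrad\<close>: its class is determined by any
  square-integrable field, vanishing outside S, that satisfies the weak identity.\<close>

lemma gr_eqI: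
 assumes S: "open S" and u: "u : L2 S" and U: "weak_id S (toL S u) U" "AE x in lborel. x ~: S --> fn U x = 0"
 shows "u : H1 S" "gr S u = U" "wgrad S u : L2 S"
proof -
 have Sb: "S : sets borel" using S by simp
 have w: "fn U : L2 S & is_weak_grad S u (fn U)"
  using weak_id_iff[OF Sb u L2_fn[OF Sb]] U toL_fn[OF Sb U(2)] L2_fn[OF Sb] by simp
 then show "u : H1 S" using u unfolding H1_def by blast
 have g: "wgrad S u : L2 S & is_weak_grad S u (wgrad S u)" unfolding wgrad_def by (rule someI[of _ "fn U"]) (rule w)
 then show "wgrad S u : L2 S" by simp
 have "weak_id S (toL S u) (gr S u)" unfolding gr_def using g weak_id_iff[OF Sb u, of "wgrad S u"] by simp
 then show "gr S u = U" using g by (intro weak_id_unique[OF S _ U(1) _ U(2)]) (auto simp: gr_def toL_outside[OF Sb])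
qed

lemma H1_gr:
 assumes S: "open S" and u: "u : H1 S"
 shows "u : L2 S" "wgrad S u : L2 S" "weak_id S (toL S u) (gr S u)" "AE x in lborel. x ~: S --> fn (gr S u) x = 0"
  and "H1_norm S u = sqrt ((norm (toL S u))^2 + (norm (gr S u))^2)"
proof -
 have Sb: "S : sets borel" using S by simp
 show u2: "u : L2 S" using u by (simp add: H1_def)
 have g: "wgrad S u : L2 S & is_weak_grad S u (wgrad S u)"
  unfolding wgrad_def by (rule someI_ex[of "%G. G : L2 S & is_weak_grad S u G"]) (use u in "auto simp: H1_def")
 then show g2: "wgrad S u : L2 S" by simp
 show "weak_id S (toL S u) (gr S u)" unfolding gr_def using g weak_id_iff[OF Sb u2, of "wgrad S u"] by simp
 show "AE x in lborel. x ~: S --> fn (gr S u) x = 0" unfolding gr_def by (rule toL_outside[OF Sb g2])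
 show "H1_norm S u = sqrt ((norm (toL S u))^2 + (norm (gr S u))^2)"
  unfolding H1_norm_def gr_def power2_norm_eq_inner L2_inner[OF Sb u2 u2, symmetric] L2_inner[OF Sb g2 g2, symmetric]
  by (simp add: power2_eq_square)
qed

lemma weak_id_lin: "weak_id S y U ==> weak_id S z V ==> weak_id S (a *R y + b *R z) (a *R U + b *R V)"
 unfolding weak_id_def by (simp add: inner_add_left)

lemma weak_id_grd: assumes f: "f : Ccinf T" shows "weak_id S (L2of f) (grd f)"
 unfolding weak_id_def
proof (intro ballI allI)
 fix h i assume h: "h : Ccinf S"
 have "L2of f \<bullet> dl h i = (LBINT x. f x * cgrad h x $ i)"
  unfolding dl_def by (simp add: inner_L2of[OF Ccinf_sqint[OF f] sqint_nth[OF cgrad_sqint[OF h]]])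
 also have "... = - (LBINT x. cgrad f x $ i * h x)" by (rule integration_by_parts[OF h Ccinf_Ck[OF f]])
 finally show "L2of f \<bullet> dl h i = - (grd f \<bullet> ax h i)"
  unfolding grd_def ax_def inner_L2of[OF cgrad_sqint[OF f] sqint_ax[OF h]] by (simp add: inner_axis mult.commute)
qed

text \<open>Exchanges convergence in \<open>H1_norm\<close>, which involves \<open>wgrad\<close> of
  a difference, for separate convergence of test functions and of their gradients. The claim about
  \<open>gr\<close> is included so that membership and gradient are obtained together.\<close>

lemma H10_iff:
 assumes S: "open S"
 shows "u : H10 S & gr S u = U \<longleftrightarrow> u : L2 S & (EX f. (ALL k::nat. f k : Ccinf S) & (%k. L2of (f k)) ----> toL S u & (%k. grd (f k)) ----> U)"
  (is "?l \<longleftrightarrow> ?r")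
proof -
 have Sb: "S : sets borel" using S by simp
 have n: "H1_norm S (%x. u x - f x) = sqrt ((norm (toL S u - L2of f))^2 + (norm (gr S u - grd f))^2)"
  if u: "u : H1 S" and f: "f : Ccinf S" for f
 proof -
  note h = H1_gr[OF S u] and l = L2_lin[OF Sb H1_gr(1)[OF S u] L2_sqint[OF Sb Ccinf_sqint[OF f]], of 1 "-1"]
  have t: "toL S (%x. u x - f x) = toL S u - L2of f" using l(2) toL_L2of[OF Sb Ccinf_sqint[OF f] Ccinf_outside[OF f]] by simp
  have w: "weak_id S (toL S (%x. u x - f x)) (gr S u - grd f)"
   using weak_id_lin[OF h(3) weak_id_grd[OF f], of 1 "-1"] t by simp
  have o: "AE x in lborel. x ~: S --> fn (gr S u - grd f) x = 0"
   using h(4) fn_minus[of "gr S u" "grd f"] fn_L2of[OF cgrad_sqint[OF f]] unfolding grd_def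
   by eventually_elim (use cgrad_outside[OF f] in auto)
  note e = gr_eqI[OF S _ w o]
  have d: "(%x. u x - f x) : L2 S" using l(1) by simp
  show ?thesis using H1_gr(5)[OF S e(1)[OF d]] e(2)[OF d] t by simp
 qed
 show ?thesis
 proof
  assume l: ?l
  then have u: "u : H1 S" by (simp add: H10_def)
  obtain f where f: "!!k::nat. f k : Ccinf S" "(%k. H1_norm S (%x. u x - f k x)) ----> 0" using l by (auto simp: H10_def)
  have "(%k. norm (L2of (f k) - toL S u)) ----> 0" "(%k. norm (grd (f k) - gr S u)) ----> 0"
   by (rule tendsto_sandwich[OF _ _ tendsto_const f(2)]; auto simp: n[OF u f(1)] norm_minus_commute intro!: always_eventually real_le_rsqrt)+
  then have "(%k. L2of (f k)) ----> toL S u" "(%k. grd (f k)) ----> gr S u" by (simp_all only: tendsto_norm_zero_iff LIM_zero_iff)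
  then show ?r using l H1_gr(1)[OF S u] f(1) by auto
 next
  assume r: ?r
  then obtain f where f: "!!k::nat. f k : Ccinf S" "(%k. L2of (f k)) ----> toL S u" "(%k. grd (f k)) ----> U" by blast
  have u: "u : L2 S" using r by simp
  have "weak_id S (toL S u) U" unfolding weak_id_def
  proof (intro ballI allI)
   fix q i assume q: "q : Ccinf S"
   have "(%k. L2of (f k) \<bullet> dl q i) ----> toL S u \<bullet> dl q i" "(%k. - (grd (f k) \<bullet> ax q i)) ----> - (U \<bullet> ax q i)"
    by (intro tendsto_intros f)+
   moreover have "(%k. L2of (f k) \<bullet> dl q i) = (%k. - (grd (f k) \<bullet> ax q i))"
    using weak_id_grd[OF f(1), of S] q unfolding weak_id_def by auto
   ultimately show "toL S u \<bullet> dl q i = - (U \<bullet> ax q i)" using LIMSEQ_unique by metis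
  qed
  moreover have "U : gsp S" unfolding gsp_def closure_sequential using f by (intro exI[of _ "%k. grd (f k)"]) auto
  ultimately have e: "u : H1 S" "gr S u = U" using gr_eqI[OF S u _ gsp_outside[OF _ Sb]] by auto
  have "(%k. sqrt ((norm (toL S u - L2of (f k)))^2 + (norm (gr S u - grd (f k)))^2)) ----> sqrt ((norm (toL S u - toL S u))^2 + (norm (gr S u - U))^2)"
   by (intro tendsto_intros f)
  then have "(%k. H1_norm S (%x. u x - f k x)) ----> 0" using n[OF e(1) f(1)] e(2) by simp
  then show ?l unfolding H10_def using e f(1) by blast
 qed
qed

lemma H10_lin:
 assumes S: "open S" and u: "u : H10 S" and v: "v : H10 S"
 shows "(%x. a * u x + b * v x) : H10 S" "gr S (%x. a * u x + b * v x) = a *R gr S u + b *R gr S v"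
proof -
 have Sb: "S : sets borel" using S by simp
 obtain f where f: "!!k::nat. f k : Ccinf S" "(%k. L2of (f k)) ----> toL S u" "(%k. grd (f k)) ----> gr S u" and uL: "u : L2 S"
  using H10_iff[OF S, of u "gr S u"] u by auto
 obtain h where h: "!!k::nat. h k : Ccinf S" "(%k. L2of (h k)) ----> toL S v" "(%k. grd (h k)) ----> gr S v" and vL: "v : L2 S"
  using H10_iff[OF S, of v "gr S v"] v by auto
 note l = L2_lin[OF Sb uL vL, of a b, simplified]
 have "(%k. a *R L2of (f k) + b *R L2of (h k)) ----> a *R toL S u + b *R toL S v"
  "(%k. a *R grd (f k) + b *R grd (h k)) ----> a *R gr S u + b *R gr S v" by (intro tendsto_intros f h)+
 moreover have "L2of (%x. a * f k x + b * h k x) = a *R L2of (f k) + b *R L2of (h k)" for k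
  using L2of_add[OF sqint_scaleR[OF Ccinf_sqint[OF f(1)[of k]], of a] sqint_scaleR[OF Ccinf_sqint[OF h(1)[of k]], of b]]
   L2of_scaleR[OF Ccinf_sqint[OF f(1)[of k]], of a] L2of_scaleR[OF Ccinf_sqint[OF h(1)[of k]], of b] by simp
 ultimately have "(%x. a * u x + b * v x) : H10 S & gr S (%x. a * u x + b * v x) = a *R gr S u + b *R gr S v"
  unfolding H10_iff[OF S] using l f(1) h(1) grd_lin[OF f(1) h(1), of a _ b] by (intro conjI exI[of _ "%k x. a * f k x + b * h k x"]) (auto simp: Ccinf_lin)
 then show "(%x. a * u x + b * v x) : H10 S" "gr S (%x. a * u x + b * v x) = a *R gr S u + b *R gr S v" by auto
qed

lemma poincare_l2:
 assumes "f : Ccinf S" "S <= ball 0 R" "R >= 0" shows "norm (L2of f) <= 2 * R * norm (grd f)"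
proof (rule power2_le_imp_le)
 show "(norm (L2of f))^2 <= (2 * R * norm (grd f))^2"
  using poincare[OF assms(1,2)] norm_sq_L2of[OF Ccinf_sqint[OF assms(1)]] norm_sq_L2of[OF cgrad_sqint[OF assms(1)]]
  by (simp add: grd_def power_mult_distrib)
qed (use assms(3) in simp)

lemma H10_poincare:
 assumes S: "open S" "S <= ball 0 R" "R >= 0" and u: "u : H10 S"
 shows "gr S u : gsp S" "norm (toL S u) <= 2 * R * norm (gr S u)" "H1_norm S u <= (2 * R + 1) * norm (gr S u)"
proof -
 obtain f where f: "!!k::nat. f k : Ccinf S" "(%k. L2of (f k)) ----> toL S u" "(%k. grd (f k)) ----> gr S u"
  using H10_iff[OF S(1), of u "gr S u"] u by auto
 show "gr S u : gsp S" unfolding gsp_def closure_sequential using f by (intro exI[of _ "%k. grd (f k)"]) auto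
 show n: "norm (toL S u) <= 2 * R * norm (gr S u)"
  by (rule LIMSEQ_le[OF tendsto_norm[OF f(2)] tendsto_mult_left[OF tendsto_norm[OF f(3)]]]) (use poincare_l2[OF f(1) S(2,3)] in auto)
 have "H1_norm S u <= norm (toL S u) + norm (gr S u)"
  using H1_gr(5)[OF S(1), of u] u sqrt_sum_squares_le_sum_abs[of "norm (toL S u)" "norm (gr S u)"] by (simp add: H10_def)
 then show "H1_norm S u <= (2 * R + 1) * norm (gr S u)" using n by (simp add: algebra_simps)
qed

text \<open>By the Poincare inequality a Cauchy sequence of gradients forces the test functions to
  be Cauchy; a representative of their limit is the function sought.\<close>

lemma H10_surj:
 assumes S: "open S" "S <= ball 0 R" "R >= 0" and U: "U : gsp S" obtains u where "u : H10 S" "gr S u = U"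
proof -
 have Sb: "S : sets borel" using S by simp
 obtain f where f: "!!k::nat. f k : Ccinf S" "(%k. grd (f k)) ----> U" by (rule gsp_seq[OF U]) (rule that)
 have d: "norm (L2of (f k) - L2of (f l)) <= 2 * R * norm (grd (f k) - grd (f l))" for k l
  using poincare_l2[OF Ccinf_lin[OF f(1) f(1), of 1 k "-1" l] S(2,3)] grd_diff[OF f(1) f(1), of k l] L2of_diff[OF Ccinf_sqint[OF f(1)] Ccinf_sqint[OF f(1)], of k l] by simp
 have "Cauchy (%k. L2of (f k))"
 proof (rule metric_CauchyI)
  fix e :: real assume "e > 0"
  then have "e / (2 * R + 1) > 0" using S(3) by simp
  then obtain M where M: "dist (grd (f m)) (grd (f n)) < e / (2 * R + 1)" if "m >= M" "n >= M" for m n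
   using metric_CauchyD[OF LIMSEQ_imp_Cauchy[OF f(2)]] by blast
  have "dist (L2of (f m)) (L2of (f n)) < e" if mn: "m >= M" "n >= M" for m n
  proof -
   have "(2 * R + 1) * dist (grd (f m)) (grd (f n)) < e" using M[OF mn] S(3) by (simp add: pos_less_divide_eq mult.commute)
   then show ?thesis using d[of m n] zero_le_dist[of "grd (f m)" "grd (f n)"] unfolding dist_norm distrib_right by linarith
  qed
  then show "EX M. ALL m>=M. ALL n>=M. dist (L2of (f m)) (L2of (f n)) < e" by blast
 qed
 then obtain y where y: "(%k. L2of (f k)) ----> y" using Cauchy_convergent convergent_def by blast
 have t: "toL S (fn y) = y"
 proof -
  have "norm (L2of (f k) - toL S (fn y)) <= 1 * norm (L2of (f k) - y)" for k
  proof (rule norm_l2_mono)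
   show "AE t in lborel. norm (fn (L2of (f k) - toL S (fn y)) t) <= 1 * norm (fn (L2of (f k) - y) t)"
    using fn_minus[of "L2of (f k)" "toL S (fn y)"] fn_minus[of "L2of (f k)" y] fn_toL[OF Sb L2_fn[OF Sb, of y]] fn_L2of[OF Ccinf_sqint[OF f(1)[of k]]]
    by eventually_elim (use Ccinf_outside[OF f(1)[of k]] in "auto simp: indicator_def")
  qed simp
  then have a: "norm (L2of (f k) - toL S (fn y)) <= norm (L2of (f k) - y)" for k by simp
  have b: "(%k. norm (L2of (f k) - y)) ----> 0" using y by (simp only: tendsto_norm_zero_iff LIM_zero_iff)
  have "(%k. norm (L2of (f k) - toL S (fn y))) ----> 0"
   by (rule tendsto_sandwich[OF _ _ tendsto_const b]) (simp_all add: a)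
  then have "(%k. L2of (f k)) ----> toL S (fn y)" by (simp only: tendsto_norm_zero_iff LIM_zero_iff)
  then show ?thesis using y LIMSEQ_unique by blast
 qed
 have "fn y : H10 S & gr S (fn y) = U" unfolding H10_iff[OF S(1)] using t L2_fn[OF Sb] y f by auto
 then show ?thesis using that by blast
qed

text \<open>By the Poincare inequality the gradient norm controls \<open>H1_norm\<close>, so f
  depends on the gradient only and is a bounded functional on \<open>gsp S\<close>. The minus sign
  matches the one in \<open>solves\<close>.\<close>

lemma Hm1_riesz:
 assumes S: "open S" "S <= ball 0 R" "R >= 0" and f: "f : Hm1 S"
 obtains F where "F : gsp S" "!!u. u : H10 S ==> f u = - (F \<bullet> gr S u)"
proof -
 obtain C where lin: "!!u v c d. u : H10 S ==> v : H10 S ==> f (%x. c * u x + d * v x) = c * f u + d * f v" and C: "!!v. v : H10 S ==> (abs (f v)) <= C * H1_norm S v"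
  using f unfolding Hm1_def by blast
 have b: "abs (f v) <= abs C * (2 * R + 1) * norm (gr S v)" if "v : H10 S" for v
 proof -
  have "abs (f v) <= abs C * H1_norm S v" using C[OF that] mult_right_mono[OF abs_ge_self[of C], of "H1_norm S v"] by (auto simp: H1_norm_def)
  also have "... <= abs C * ((2 * R + 1) * norm (gr S v))" by (intro mult_left_mono H10_poincare(3)[OF S that]) simp
  finally show ?thesis by (simp add: mult.assoc)
 qed
 have cong: "f u = f v" if "u : H10 S" "v : H10 S" "gr S u = gr S v" for u v
  using b[OF H10_lin(1)[OF S(1) that(1,2), of 1 "-1"]] lin[OF that(1,2), of 1 "-1"] H10_lin(2)[OF S(1) that(1,2), of 1 "-1"] that(3) by simp
 \<comment> \<open>A right inverse of \<open>gr\<close>; by \<open>cong\<close> the value of f does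
   not depend on the choice.\<close>
 define p where "p U = (SOME u. u : H10 S & gr S u = U)" for U
 have p: "p U : H10 S & gr S (p U) = U" if "U : gsp S" for U
  unfolding p_def by (rule someI_ex[of "%u. u : H10 S & gr S u = U"], rule H10_surj[OF S that]) blast
 obtain F where F: "F : closure (gsp S)" "!!v. v : gsp S ==> f (p v) = F \<bullet> v"
 proof (rule riesz_subspace[OF gsp_subspace[of S], of "%v. f (p v)" "abs C * (2 * R + 1)"])
  fix u v c d assume uv: "u : gsp S" "v : gsp S"
  have w: "c *R u + d *R v : gsp S" by (intro subspace_add[OF gsp_subspace] subspace_scale[OF gsp_subspace] uv)
  have "f (p (c *R u + d *R v)) = f (%x. c * p u x + d * p v x)"
   by (rule cong) (use p[OF uv(1)] p[OF uv(2)] p[OF w] H10_lin[OF S(1)] in auto)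
  then show "f (p (c *R u + d *R v)) = c * f (p u) + d * f (p v)" using lin p[OF uv(1)] p[OF uv(2)] by simp
 next
  show "abs (f (p v)) <= abs C * (2 * R + 1) * norm v" if "v : gsp S" for v using b[of "p v"] p[OF that] by simp
 qed (rule that)
 have "- F : gsp S" using F(1) gsp_closed[of S] subspace_neg[OF gsp_subspace] by simp
 moreover have "f u = - (- F \<bullet> gr S u)" if "u : H10 S" for u
  using F(2)[OF H10_poincare(1)[OF S that]] cong[OF that, of "p (gr S u)"] p[OF H10_poincare(1)[OF S that]] by simp
 ultimately show ?thesis using that by blast
qed

lemma bmat_L2: assumes A: "bmat A C" and S: "S : sets borel" and u: "u : L2 S"
 shows "(%x. A x *v u x) : L2 S" "AE t in lborel. fn (opM A (toL S u)) t = indicator S t *R (A t *v u t)"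
  "toL S (%x. A x *v u x) = opM A (toL S u)"
proof -
 have m: "(%x. A x *v u x) : borel_measurable (lebesgue_on S)"
  using A u by (intro mat_vec_measurable measurable_restrict_space1[OF measurable_completion, of A]) (auto simp: bmat_def L2_def)
 show ae: "AE t in lborel. fn (opM A (toL S u)) t = indicator S t *R (A t *v u t)"
  using fn_opM[OF A, of "toL S u"] fn_toL[OF S u] by eventually_elim (simp add: matrix_vector_mult_scaleR)
 then have "AE t in lborel. (norm (fn (opM A (toL S u)) t))^2 = indicator S t *R (norm (A t *v u t))\<^sup>2" by eventually_elim (auto simp: indicator_def)
 moreover have mn: "(%x. (norm (A x *v u x))^2) : borel_measurable (lebesgue_on S)" using m by simp
 ultimately show L: "(%x. A x *v u x) : L2 S" unfolding L2_def
  using m lebesgue_on_integral(2)[OF S _ _ mn, of "%x. (norm (fn (opM A (toL S u)) x))^2"] sqint_integrable_sq[OF sqint_fn[of "opM A (toL S u)"]] by auto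
 show "toL S (%x. A x *v u x) = opM A (toL S u)" by (rule toL_eqI[OF S L ae])
qed

lemma solves_iff:
 assumes S: "open S" "S <= ball 0 R" "R >= 0" and A: "bmat A C" and F: "!!u. u : H10 S ==> f u = - (F \<bullet> gr S u)"
 shows "solves S A f u = (u : H10 S & is_sol S A F (gr S u))"
proof -
 have Sb: "S : sets borel" using S by simp
 have H: "wgrad S u : L2 S" if "u : H10 S" for u using H1_gr(2)[OF S(1)] that by (simp add: H10_def)
 have e: "(\<integral>x. (A x *v wgrad S u x) \<bullet> wgrad S v x \<partial>lebesgue_on S) = opM A (gr S u) \<bullet> gr S v" if "u : H10 S" "v : H10 S" for u v
  using L2_inner[OF Sb bmat_L2(1)[OF A Sb H[OF that(1)]] H[OF that(2)]] bmat_L2(3)[OF A Sb H[OF that(1)]] by (simp add: gr_def)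
 have i: "integrable (lebesgue_on S) (%x. (A x *v wgrad S u x) \<bullet> wgrad S v x)" if "u : H10 S" "v : H10 S" for u v
 proof (subst lebesgue_on_integral(2)[OF Sb, of "%x. fn (opM A (gr S u)) x \<bullet> fn (gr S v) x"])
  show "AE x in lborel. fn (opM A (gr S u)) x \<bullet> fn (gr S v) x = indicat_real S x *R ((A x *v wgrad S u x) \<bullet> wgrad S v x)"
   using bmat_L2(2)[OF A Sb H[OF that(1)]] fn_toL[OF Sb H[OF that(2)]] unfolding gr_def by eventually_elim (auto simp: indicator_def)
 qed (use bmat_L2(1)[OF A Sb H[OF that(1)]] H[OF that(2)] in "auto simp: L2_def sqint_inner_integrable")
 have "(ALL v:H10 S. opM A (gr S u) \<bullet> gr S v = F \<bullet> gr S v) \<longleftrightarrow> (ALL V:gsp S. opM A (gr S u) \<bullet> V = F \<bullet> V)" for u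
 proof (intro iffI ballI)
  fix V assume "ALL v:H10 S. opM A (gr S u) \<bullet> gr S v = F \<bullet> gr S v" "V : gsp S"
  then show "opM A (gr S u) \<bullet> V = F \<bullet> V" by - (rule H10_surj[OF S, of V], auto)
 qed (use H10_poincare(1)[OF S] in blast)
 then show ?thesis unfolding solves_def is_sol_def using e i F H10_poincare(1)[OF S] by auto
qed

text \<open>Two solutions have equal gradients by coercivity, and the Poincare inequality then
  identifies the functions almost everywhere.\<close>

lemma is_the_solution_iff:
 assumes S: "open S" "S <= ball 0 R" "R >= 0" and A: "bmat A C" "coercive A c" and F: "!!u. u : H10 S ==> f u = - (F \<bullet> gr S u)"
  and u: "u : H10 S" "gr S u = sol S A F"
 shows "is_the_solution S A f u"
 unfolding is_the_solution_def
proof (intro conjI allI impI)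
 have Sb: "S : sets borel" using S by simp
 have s: "solves S A f v = (v : H10 S & is_sol S A F (gr S v))" for v by (rule solves_iff[OF S A(1) F])
 show "solves S A f u" unfolding s using u sol[OF A, of S F] by simp
 fix v assume "solves S A f v"
 then have v: "v : H10 S" "gr S v = gr S u" unfolding s u(2) using is_sol_unique[OF A _ sol[OF A]] by auto
 have uv: "u : L2 S" "v : L2 S" using u v by (auto simp: H10_def H1_def)
 have "norm (toL S v - toL S u) = 0"
  using H10_poincare(2)[OF S H10_lin(1)[OF S(1) v(1) u(1), of 1 "-1"]] H10_lin(2)[OF S(1) v(1) u(1), of 1 "-1"] v(2) L2_lin(2)[OF Sb uv(2,1), of 1 "-1"] by simp
 then have t: "toL S v = toL S u" by simp
 have "AE x in lborel. x : S --> v x = u x" using fn_toL[OF Sb uv(1)] fn_toL[OF Sb uv(2), unfolded t] by eventually_elim auto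
 then have "AE x in lebesgue. x : S --> v x = u x" by (rule AE_completion)
 then show "AE x in lebesgue_on S. v x = u x" using Sb by (subst AE_restrict_space_iff) auto
qed

section \<open>From the Hilbert space back to H-convergence\<close>

lemma weak_conv_H10I:
 assumes S: "open S" "S <= ball 0 R" "R >= 0" and U: "!!n. U n : H10 S" "u : H10 S" "weak_conv (%n. gr S (U n)) (gr S u)"
 shows "weak_conv_H10 S U u"
 unfolding weak_conv_H10_def
proof (intro conjI allI ballI U)
 fix f assume f: "f : Hm1 S"
 obtain F where F: "F : gsp S" "!!u. u : H10 S ==> f u = - (F \<bullet> gr S u)" by (rule Hm1_riesz[OF S f]) (rule that)
 have "(%n. - (gr S (U n) \<bullet> F)) ----> - (gr S u \<bullet> F)" by (intro tendsto_intros weak_convD[OF U(3)])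
 then show "(%n. f (U n)) ----> f u" using F(2) U(1,2) by (simp add: inner_commute)
qed

lemma integrable_scaleR_sqint:
 assumes "sqint (f :: plane => real)" "sqint g" shows "integrable lborel (%x. f x *R g x)"
 by (rule lint_bound[OF sqint_mult_integrable[OF assms]])
  (use assms in "auto intro!: borel_measurable_scaleR sqint_measurable")

lemma weakstar_conv_MI:
 assumes S: "S : sets borel" "bounded S" and D: "!!n. f n : L2 S" "g : L2 S" "wstar S (%n. toL S (f n)) (toL S g)"
 shows "weakstar_conv_M S f (g :: plane => plane)"
 unfolding weakstar_conv_M_def
proof (intro conjI allI ballI)
 have i: "integrable (lebesgue_on S) f" if f: "f : L2 S" for f :: "plane => plane"
 proof (subst lebesgue_on_integral(2)[OF S(1), of "%x. indicator S x *R fn (toL S f) x"])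
  have "sqint (indicator S :: plane => real)" by (rule sqint_bounded_indicator[OF _ _ S(2,1), of _ 1]) (use S(1) in auto)
  then show "integrable lborel (%x. indicat_real S x *R fn (toL S f) x)" by (rule integrable_scaleR_sqint[OF _ sqint_fn])
  show "AE x in lborel. indicat_real S x *R fn (toL S f) x = indicat_real S x *R f x"
   using fn_toL[OF S(1) f] by eventually_elim (auto simp: indicator_def)
 qed (use S f in "auto simp: L2_def")
 show "integrable (lebesgue_on S) (f n)" "integrable (lebesgue_on S) g" for n using D i by auto
 fix h assume h: "h : Cc S"
 have e: "(\<integral>x. h x *R f x \<partial>lebesgue_on S) $ i = (LBINT x. h x * fn (toL S f) x $ i)" if f: "f : L2 S" for f :: "plane => plane" and i
 proof -
  have p: "integrable lborel (%x. h x *R fn (toL S f) x)" by (rule integrable_scaleR_sqint[OF Cc_sqint[OF h] sqint_fn])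
  have "(\<integral>x. h x *R f x \<partial>lebesgue_on S) = (LBINT x. h x *R fn (toL S f) x)"
  proof (rule lebesgue_on_integral(1)[OF S(1)])
   show "AE x in lborel. h x *R fn (toL S f) x = indicat_real S x *R h x *R f x"
    using fn_toL[OF S(1) f] by eventually_elim (use Cc_outside[OF h] in "auto simp: indicator_def")
   show "(%x. h x *R f x) : borel_measurable (lebesgue_on S)" using f Cc_measurable[OF h]
    by (intro borel_measurable_scaleR measurable_restrict_space1[OF measurable_completion, of h]) (auto simp: L2_def)
  qed (use Cc_measurable[OF h] in auto)
  then show ?thesis using integral_inner_left[OF p, of "axis i 1"] by (simp add: inner_axis)
 qed
 have "(%n. (\<integral>x. h x *R f n x \<partial>lebesgue_on S) $ i) ----> (\<integral>x. h x *R g x \<partial>lebesgue_on S) $ i" for i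
  unfolding e[OF D(1)] e[OF D(2)] by (rule wstarD[OF D(3) h])
 then show "(%n. \<integral>x. h x *R f n x \<partial>lebesgue_on S) ----> (\<integral>x. h x *R g x \<partial>lebesgue_on S)" by (rule vec_tendstoI)
qed

text \<open>The lower bound on the inverse is the assumption \<open>up\<close> at the vector
  \<open>matrix_inv (A x) *v z\<close>. In this form no inverse occurs before coercivity has shown
  that it exists.\<close>

lemma M_classI:
 assumes S: "S : sets borel" and A: "A : borel_measurable borel" and c: "c > 0"
  and ell: "AE x in lborel. x : S --> (ALL z. c * (norm z)^2 <= (A x *v z) \<bullet> z)"
  and up: "AE x in lborel. x : S --> (ALL z. inverse b * (norm (A x *v z))^2 <= (A x *v z) \<bullet> z)"
 shows "A : M_class c b S"
 unfolding M_class_def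
proof (intro CollectI conjI)
 let ?P = "%x. ALL z. c * (norm z)^2 <= (A x *v z) \<bullet> z & inverse b * (norm z)^2 <= (matrix_inv (A x) *v z) \<bullet> z"
 show "A : borel_measurable (lebesgue_on S)" using A by (intro measurable_restrict_space1 measurable_completion) simp
 have "AE x in lborel. x : S --> invertible (A x) & ?P x"
  using ell up
 proof eventually_elim
  case (elim x)
  show ?case
  proof
   assume x: "x : S"
   have "z = 0" if "A x *v z = 0" for z
    using elim(1) x c that by (metis inner_zero_left mult_le_0_iff not_less norm_eq_zero zero_less_norm_iff zero_less_power2)
   then have i: "invertible (A x)" by (simp add: invertible_left_inverse matrix_left_invertible_ker)
   have "inverse b * (norm z)^2 <= (matrix_inv (A x) *v z) \<bullet> z" for z
   proof -
    have "A x ** matrix_inv (A x) = mat 1" unfolding matrix_inv_def using someI_ex[OF i[unfolded invertible_def]] by simp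
    then have "A x *v (matrix_inv (A x) *v z) = z" by (simp add: matrix_vector_mul_assoc)
    then show ?thesis using elim(2)[rule_format, OF x, of "matrix_inv (A x) *v z"] by (simp add: inner_commute)
   qed
   then show "invertible (A x) & ?P x" using i elim(1) x by blast
  qed
 qed
 then have "AE x in lebesgue. x : S --> invertible (A x) & ?P x" by (rule AE_completion)
 then show "AE x in lebesgue_on S. invertible (A x) & (ALL z. (A x *v z) \<bullet> z >= c * (norm z)^2 & (matrix_inv (A x) *v z) \<bullet> z >= inverse b * (norm z)^2)"
  using S by (subst AE_restrict_space_iff) auto
qed

theorem H_convergesI:
 assumes S: "open S" "bounded S" and A: "!!n. bmat (A n) (C n)" "!!n. coercive (A n) (c n)" and B: "bmat B C'" "coercive B c'"
  and conv: "!!F. F : gsp S ==> weak_conv (%n. sol S (A n) F) (sol S B F) & wstar S (%n. opM (A n) (sol S (A n) F)) (opM B (sol S B F))"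
 shows "H_converges S A B"
 unfolding H_converges_def
proof (intro conjI ballI)
 have Sb: "S : sets borel" using S by simp
 \<comment> \<open>The upper constant comes from |A z|^2 <= C^2 |z|^2 <= (C^2 / c) (A z . z); the
   maximum with \<open>c n\<close> secures the ordering of the two constants.\<close>
 have "0 < c n & c n <= max (c n) ((C n)^2 / c n) & A n : M_class (c n) (max (c n) ((C n)^2 / c n)) S" for n
 proof (intro conjI M_classI[OF Sb])
  have c: "c n > 0" and A': "c n * (norm z)^2 <= (A n t *v z) \<bullet> z" "norm (A n t *v z) <= C n * norm z" for t z
   using A[of n] by (auto simp: coercive_def bmat_def)
  let ?b = "max (c n) ((C n)^2 / c n)"
  show "0 < c n" "0 < c n" by fact+
  show "A n : borel_measurable borel" using A[of n] by (simp add: bmat_def)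
  show "AE x in lborel. x : S --> (ALL z. c n * (norm z)^2 <= (A n x *v z) \<bullet> z)" using A' by simp
  have "inverse ?b * (norm (A n x *v z))^2 <= (A n x *v z) \<bullet> z" for x z
  proof -
   have "(norm (A n x *v z))^2 <= (C n * norm z)^2" by (rule power_mono[OF A'(2)]) simp
   also have "... = (C n)^2 / c n * (c n * (norm z)^2)" using c by (simp add: power_mult_distrib)
   also have "... <= ?b * (c n * (norm z)^2)" using c by (intro mult_right_mono) auto
   also have "... <= ?b * ((A n x *v z) \<bullet> z)" using c by (intro mult_left_mono A') auto
   finally show ?thesis using c by (subst inverse_eq_divide) (simp add: pos_divide_le_eq mult.commute less_max_iff_disj)
  qed
  then show "AE x in lborel. x : S --> (ALL z. inverse ?b * (norm (A n x *v z))^2 <= (A n x *v z) \<bullet> z)" by simp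
 qed simp
 then show "EX l q :: nat => real. ALL n. 0 < l n & l n <= q n & A n : M_class (l n) (q n) S" by (intro exI allI)
next
 have Sb: "S : sets borel" using S by simp
 obtain R0 where R0: "S <= ball 0 R0" using bounded_subset_ballD[OF S(2)] by blast
 define R where "R = max R0 0"
 have R: "S <= ball 0 R" "R >= 0" using R0 subset_ball[of R0 R 0] by (auto simp: R_def)
 note S' = S(1) R
 fix f assume f: "f : Hm1 S"
 obtain F where F: "F : gsp S" "!!u. u : H10 S ==> f u = - (F \<bullet> gr S u)" by (rule Hm1_riesz[OF S' f]) (rule that)
 have "ALL n. EX u. u : H10 S & gr S u = sol S (A n) F" by (rule allI, rule H10_surj[OF S' sol_gsp[OF A]]) blast
 then obtain U where U: "!!n. U n : H10 S" "!!n. gr S (U n) = sol S (A n) F" by metis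
 obtain u where u: "u : H10 S" "gr S u = sol S B F" by (rule H10_surj[OF S' sol_gsp[OF B]]) (rule that)
 have w: "wgrad S u : L2 S" if "u : H10 S" for u using H1_gr(2)[OF S(1)] that by (simp add: H10_def)
 show "EX U u. (ALL n. is_the_solution S (A n) f (U n)) & is_the_solution S B f u & weak_conv_H10 S U u & 
    weakstar_conv_M S (%n x. A n x *v wgrad S (U n) x) (%x. B x *v wgrad S u x)"
 proof (intro exI conjI allI)
  show "is_the_solution S (A n) f (U n)" for n by (rule is_the_solution_iff[OF S' A F(2) U])
  show "is_the_solution S B f u" by (rule is_the_solution_iff[OF S' B F(2) u])
  show "weak_conv_H10 S U u" using conv[OF F(1)] U u by (intro weak_conv_H10I[OF S']) auto
  show "weakstar_conv_M S (%n x. A n x *v wgrad S (U n) x) (%x. B x *v wgrad S u x)"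
   using conv[OF F(1)] bmat_L2(1)[OF A(1) Sb w[OF U(1)]] bmat_L2(1)[OF B(1) Sb w[OF u(1)]]
   by (intro weakstar_conv_MI[OF Sb S(2)]) (simp_all add: bmat_L2(3)[OF A(1) Sb w[OF U(1)]] bmat_L2(3)[OF B(1) Sb w[OF u(1)]] gr_def[symmetric] U(2) u(2))
 qed
qed

section \<open>Thin highly conducting inclusions\<close>

text \<open>Room for a cutoff that equals 1 on the square, is supported in S and has a support of at
  most twice the area.\<close>

lemma sqr_neighbourhood:
 assumes s: "s > 0" and S: "open S" "sqr c s <= S"
 obtains d where "d > 0" "sqr (c - d *R 1) (s + 2 * d) <= S" "(s + 2 * d)^2 <= 2 * s^2"
proof -
 obtain e where e: "e > 0" "(\<Union>x\<in>sqr c s. ball x e) <= S"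
  using compact_subset_open_imp_ball_epsilon_subset[OF compact_sqr S] by blast
 define d where "d = min (e / 4) (s / 10)"
 have d: "d > 0" "2 * d < e" "d <= s / 10" using e(1) s by (auto simp: d_def min_def)
 have sub: "sqr (c - d *R 1) (s + 2 * d) <= S"
 proof
  fix x assume x: "x : sqr (c - d *R 1) (s + 2 * d)"
  define y :: plane where "y = (\<chi> i. max (c $ i) (min (x $ i) (c $ i + s)))"
  have y: "y : sqr c s" using s by (auto simp: y_def sqr_def)
  have D: "abs ((x - y) $ i) <= d" for i using x d(1) s by (auto simp: y_def sqr_def max_def min_def dest: spec[of _ i])
  have "dist y x <= 2 * d" using norm_le_l1_cart[of "x - y"] D[of 1] D[of 2] unfolding sum_2 dist_norm norm_minus_commute[of y] by linarith
  then have "x : ball y e" using d(2) by simp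
  then show "x : S" using e(2) y by blast
 qed
 have "(s + 2 * d)^2 <= (4 / 3 * s)^2" using d s by (intro power_mono) auto
 moreover have "(4 / 3 * s)^2 <= 2 * s^2" by (simp add: power_mult_distrib power_divide)
 ultimately have "(s + 2 * d)^2 <= 2 * s^2" by simp
 then show ?thesis using that d(1) sub by blast
qed

definition scal :: "(plane => real) => plane => mat2" where "scal f x = f x *R mat 1"

lemma scal_vec [simp]: "scal f x *v z = f x *R z" by (simp add: scal_def flip: scaleR_matrix_vector_assoc)

lemma scal_measurable: "f : borel_measurable borel ==> scal f : borel_measurable borel"
 unfolding scal_def[abs_def] by (intro borel_measurable_scaleR) auto

lemma bmat_scal: "f : borel_measurable borel ==> (!!x. 0 <= f x & f x <= C) ==> bmat (scal f) C"
 unfolding bmat_def using scal_measurable order_trans[of 0 "f _" C] by (auto intro!: mult_right_mono)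

text \<open>The inclusions and their limit density. Here \<open>a\<close> is a Borel function
  bounded by \<open>Ma\<close> at every point, not merely almost everywhere.\<close>

locale incl =
 fixes Om :: "plane set" and w :: "nat => plane set" and th :: "nat => real" and a :: "plane => real" and Ma :: real
 assumes op: "open Om" and bd: "bounded Om" and w: "!!n. open (w n)" "!!n. w n <= Om"
  and th: "!!n. th n = measure lborel (w n)" "!!n. 0 < th n" "!!n. th n < 1" "th ----> 0"
  and a: "a : borel_measurable borel" "!!x. abs (a x) <= Ma"
  and conv: "!!\<phi>. \<phi> : Cc Om ==> (%n. LBINT x. \<phi> x * (indicator (w n) x / th n)) ----> (LBINT x. \<phi> x * a x)"
begin

lemma w_borel [measurable]: "w n : sets borel" using w(1)[of n] by simp

lemma Om_int: "integrable lborel (indicator Om :: plane => real)" and w_int: "integrable lborel (indicator (w n) :: plane => real)"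
 using bd op by (auto intro!: integrable_indicator_bounded bounded_subset[OF bd w(2)])

lemma w_integral: "integral\<^sup>L lborel (indicator (w n)) = th n" by (simp add: th(1))

lemma Cc_bounded_int:
 assumes "b : Cc Om" "f : borel_measurable borel" "!!x. abs (f x) <= C"
 shows "integrable lborel (%x. b x * f x)"
proof (rule lint_bound)
 have "integrable lborel b"
  using integrable_if_sqint_bounded_support[OF Cc_sqint[OF assms(1)] bd] Cc_outside[OF assms(1)] by blast
 then show "integrable lborel (%x. C * b x)" by simp
 show "AE x in lborel. norm (b x * f x) <= norm (C * b x)"
  using mult_right_mono[OF assms(3) abs_ge_zero] order_trans[OF abs_ge_zero assms(3)] by (intro AE_I2) (auto simp: abs_mult mult.commute)
qed (use assms(2) Cc_measurable[OF assms(1)] in auto)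

lemma Cc_int: "f : Cc Om ==> integrable lborel f" using Cc_bounded_int[of f "%_. 1" 1] by simp

text \<open>The common size of the conductivities: each oscillating coefficient below is comparable
  to this weight with constants independent of n.\<close>

definition kap :: "nat => plane => real" where "kap n x = (if x : w n then 1 / th n else 1)"

lemma kap_le: "kap n x <= 1 + indicator (w n) x / th n" and kap_ge: "1 <= kap n x" and kap_le': "kap n x <= 1 / th n"
 using th(2,3)[of n] by (auto simp: kap_def indicator_def)

lemma kap_meas [measurable]: "kap n : borel_measurable borel"
 unfolding kap_def[abs_def] by measurable

lemma kap_int: "S : sets borel ==> bounded S ==> integrable lborel (%x. indicator S x * kap n x)"
 by (rule lint_bound[OF integrable_mult_right[OF integrable_indicator_bounded[of S], of "1 / th n"]])
  (use kap_le'[of n] kap_ge[of n] th(2)[of n] in "auto simp: indicator_def abs_of_nonneg order_trans[OF zero_le_one kap_ge]")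

lemma Ma_nonneg: "Ma >= 0" using a(2)[of 0] by simp

text \<open>Since \<chi> / \<theta> has integral 1, the total mass is at most |Om| + 1. On a square,
  \<chi> / \<theta> is dominated by its product with a cutoff f, and the limit of the integral of
  that product is at most \<open>Ma\<close> times the area 2 s^2 of the enlarged square. With s^2
  from the host phase and a slack of s^2 for large n this stays below (3 + 2 Ma) s^2.\<close>

lemma kap_weights: "weights Om kap (measure lborel Om + 1) (3 + 2 * Ma)"
proof
 show "open Om" "bounded Om" by (fact op bd)+
 show "kap n : borel_measurable borel" "1 <= kap n x" "EX B. ALL x. kap n x <= B" for n x
  using kap_ge kap_le'[of n] by auto
 show "(LBINT x:Om. kap n x) <= measure lborel Om + 1" for n
 proof -
  have "(LBINT x:Om. kap n x) <= (LBINT x. indicator Om x + indicator (w n) x / th n)"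
   unfolding set_lebesgue_integral_def
  proof (rule integral_mono)
   show "indicator Om x *R kap n x <= indicator Om x + indicator (w n) x / th n" for x
    using kap_le[of n x] th(2)[of n] by (auto simp: indicator_def)
  qed (use kap_int[of Om n] Om_int w_int[of n] op bd in auto)
  also have "... = measure lborel Om + 1" using Om_int w_int[of n] w_integral[of n] th(2)[of n] op by simp
  finally show ?thesis .
 qed
 fix c s assume s: "0 < (s::real)" and Q: "sqr c s <= Om"
 obtain d where d: "d > 0" "sqr (c - d *R 1) (s + 2 * d) <= Om" "(s + 2 * d)^2 <= 2 * s^2" by (rule sqr_neighbourhood[OF s op Q]) (rule that)
 let ?B = "sqr (c - d *R 1) (s + 2 * d)"
 \<comment> \<open>Equal to 1 on the square and falling linearly to 0 at distance d; continuity is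
   all that weak-star convergence asks of it.\<close>
 define f where "f x = max 0 (1 - infdist x (sqr c s) / d)" for x
 have ne: "sqr c s ~= {}" using s by (auto simp: sqr_def intro!: exI[of _ c])
 have out: "f x = 0" if "x ~: ?B" for x
 proof -
  obtain i where "\<not> ((c - d *R 1) $ i <= x $ i & x $ i <= (c - d *R 1) $ i + (s + 2 * d))" using `x ~: ?B` unfolding sqr_def by blast
  then have i: "x $ i < c $ i - d \<or> c $ i + s + d < x $ i" by auto
  have "d <= dist x y" if y: "y : sqr c s" for y
   using i y component_le_norm_cart[of "x - y" i] by (auto simp: sqr_def dist_norm dest: spec[of _ i])
  then have "d <= infdist x (sqr c s)" using ne by (auto simp: infdist_def intro!: cINF_greatest)
  then show ?thesis using d(1) by (simp add: f_def)
 qed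
 have c: "continuous_on UNIV f" unfolding f_def by (intro continuous_intros) (use d(1) in auto)
 have f: "f : Cc Om"
 proof -
  have "{x. f x ~= 0} <= ?B" using out by blast
  then have "closure {x. f x ~= 0} <= ?B" using compact_imp_closed[OF compact_sqr] by (intro closure_minimal)
  then show ?thesis unfolding Cc_def compact_supp_in_def using c d(2) compact_sqr[of "c - d *R 1" "s + 2 * d"]
   by (auto simp: compact_eq_bounded_closed intro: bounded_subset)
 qed
 have pos: "0 <= f x" "f x <= 1" for x using d(1) infdist_nonneg[of x "sqr c s"] by (auto simp: f_def)
 have one: "f x = 1" if "x : hsq c s" for x using that hsq_subset_sqr[of c s] by (auto simp: f_def)
 have fi: "integrable lborel (%x. f x * (indicator (w n) x / th n))" for n
  by (rule Cc_bounded_int[OF f, of _ "1 / th n"]) (use th(2)[of n] in "auto simp: indicator_def")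
 have hs: "integrable lborel (indicator (hsq c s) :: plane => real)" by (rule integrable_indicator_bounded[OF bounded_hsq]) simp
 have b1: "(LBINT x:hsq c s. kap n x) <= s^2 + (LBINT x. f x * (indicator (w n) x / th n))" for n
 proof -
  have "(LBINT x:hsq c s. kap n x) <= (LBINT x. indicator (hsq c s) x + f x * (indicator (w n) x / th n))"
   unfolding set_lebesgue_integral_def
  proof (rule integral_mono)
   show "indicator (hsq c s) x *R kap n x <= indicator (hsq c s) x + f x * (indicator (w n) x / th n)" for x
    using kap_le[of n x] one[of x] pos[of x] th(2)[of n] by (cases "x : hsq c s") auto
  qed (use kap_int[of "hsq c s" n] bounded_hsq hs fi in auto)
  then show ?thesis using hs fi hsq_measure[of s c] s by (simp add: set_lebesgue_integral_def)
 qed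
 have "(LBINT x. f x * a x) <= (LBINT x. Ma * indicator ?B x)"
 proof (rule integral_mono)
  show "f x * a x <= Ma * indicator ?B x" for x
  proof (cases "x : ?B")
   case True
   have "f x * a x <= f x * Ma" using a(2)[of x] pos(1)[of x] by (intro mult_left_mono) auto
   also have "... <= 1 * Ma" using pos(2) Ma_nonneg by (rule mult_right_mono)
   finally show ?thesis using True by simp
  qed (simp add: out)
 qed (use Cc_bounded_int[OF f a(1) a(2)] integrable_indicator_bounded[OF compact_imp_bounded[OF compact_sqr]] in auto)
 also have "... = Ma * (s + 2 * d)^2"
 proof -
  have "(LBINT x. indicator ?B x *R (1::real)) = (LBINT x. indicator (hsq (c - d *R 1) (s + 2 * d)) x *R (1::real))"
   by (rule integral_cong_AE) (use hsq_ae_sqr[of "c - d *R 1" "s + 2 * d"] in "auto elim!: eventually_mono simp: indicator_def")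
  then show ?thesis using hsq_measure[of "s + 2 * d" "c - d *R 1"] s d(1) by (simp add: set_lebesgue_integral_def)
 qed
 also have "... <= Ma * (2 * s^2)" by (rule mult_left_mono[OF d(3) Ma_nonneg])
 finally have "(LBINT x. f x * a x) < 2 * Ma * s^2 + s^2"
  unfolding mult.assoc mult.left_commute[of 2] by (rule order_le_less_trans) (use s in simp)
 from order_tendstoD(2)[OF conv[OF f] this]
 show "\<forall>\<^sub>F n in sequentially. (LBINT x:hsq c s. kap n x) <= (3 + 2 * Ma) * s^2"
 proof eventually_elim
  case (elim n)
  then show ?case using b1[of n] zero_le_power2[of s] unfolding distrib_right by linarith
 qed
qed

sublocale weights Om kap "measure lborel Om + 1" "3 + 2 * Ma" by (rule kap_weights)

abbreviation "Kt == measure lborel Om + 1"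

text \<open>\<open>norm (up n z)\<close> is the energy norm of a gradient,
  \<open>norm (dn n z)\<close> the dual norm of a flux. Bounds in these norms are uniform in n,
  whereas the available L^2 operator bounds on the coefficients grow like 1 / \<theta>.\<close>

definition up :: "nat => plane l2 => plane l2" where "up n = opM (scal (%x. sqrt (kap n x)))"
definition dn :: "nat => plane l2 => plane l2" where "dn n = opM (scal (%x. 1 / sqrt (kap n x)))"

lemma bm_up: "bmat (scal (%x. sqrt (kap n x))) (sqrt (1 / th n))"
 by (rule bmat_scal) (use kap_ge[of n] kap_le'[of n] in "auto intro: real_sqrt_le_mono order_trans[OF zero_le_one]")
lemma bm_dn: "bmat (scal (%x. 1 / sqrt (kap n x))) 1"
 by (rule bmat_scal) (use kap_ge[of n] in "auto simp: divide_le_eq_1 intro: order_trans[OF zero_le_one] less_le_trans[OF zero_less_one]")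

lemma fn_up: "AE x in lborel. fn (up n z) x = sqrt (kap n x) *R fn z x"
 unfolding up_def using fn_opM[OF bm_up, of n z] by simp
lemma fn_dn: "AE x in lborel. fn (dn n z) x = (1 / sqrt (kap n x)) *R fn z x"
 unfolding dn_def using fn_opM[OF bm_dn, of n z] by simp

lemma dn_lin: "dn n (b *R x + c *R y) = b *R dn n x + c *R dn n y"
 unfolding up_def dn_def by (rule opM_lin[OF bm_up] opM_lin[OF bm_dn])+

lemma up_dn: "y \<bullet> z = dn n y \<bullet> up n z"
 unfolding inner_l2_def
proof (rule integral_cong_AE)
 show "AE x in lborel. fn y x \<bullet> fn z x = fn (dn n y) x \<bullet> fn (up n z) x"
  using fn_up[of n z] fn_dn[of n y] by eventually_elim (use ka_pos[of n] in "simp add: less_imp_neq[symmetric]")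
qed auto

lemma up_dn_le: "abs (y \<bullet> z) <= norm (dn n y) * norm (up n z)"
 unfolding up_dn[of y z n] by (rule Cauchy_Schwarz_ineq2)

lemma norm_up: "norm z <= norm (up n z)"
proof -
 have "norm z <= 1 * norm (up n z)"
 proof (rule norm_l2_mono)
  show "AE x in lborel. norm (fn z x) <= 1 * norm (fn (up n z) x)"
   using fn_up[of n z]
  proof eventually_elim
   case (elim x)
   have "1 * norm (fn z x) <= sqrt (kap n x) * norm (fn z x)" using kap_ge[of n x] by (intro mult_right_mono) auto
   then show ?case using elim kap_ge[of n x] by simp
  qed
 qed simp
 then show ?thesis by simp
qed

lemma norm_dn: "norm (dn n z) <= norm z" unfolding dn_def using opM_norm[OF bm_dn, of n z] by simp

lemma norm_up_sq: "(norm (up n z))^2 = (LBINT x. kap n x * (norm (fn z x))^2)"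
 unfolding norm_sq_fn
 by (rule integral_cong_AE) (use fn_up[of n z] kap_ge[of n] in "auto elim!: eventually_mono simp: power_mult_distrib order_trans[OF zero_le_one]")

lemma up_int: "integrable lborel (%x. kap n x * (norm (fn z x))^2)"
 by (rule lint_bound[OF integrable_mult_right[OF sqint_integrable_sq[OF sqint_fn[of z]], of "1 / th n"]])
  (use kap_le'[of n] kap_ge[of n] th(2)[of n] in "auto intro!: AE_I2 mult_right_mono simp: abs_mult abs_of_nonneg order_trans[OF zero_le_one] simp del: times_divide_eq_left")

lemma en_dn: "en n Om z <= (norm (dn n z))^2"
proof -
 have "(norm (dn n z))^2 = (LBINT x. (norm (fn z x))^2 / kap n x)" unfolding norm_sq_fn
  by (rule integral_cong_AE) (use fn_dn[of n z] kap_ge[of n] in "auto elim!: eventually_mono simp: power_divide power_mult_distrib order_trans[OF zero_le_one]")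
 moreover have "en n Om z <= (LBINT x. (norm (fn z x))^2 / kap n x)"
  unfolding en_def set_lebesgue_integral_def
  by (rule integral_mono) (use en_set_integrable[of Om z n] en_integrable[of z n] ka_pos[of n] in "auto simp: set_integrable_def indicator_def less_imp_le")
 ultimately show ?thesis by simp
qed

text \<open>Ellipticity and boundedness relative to the weight \<open>kap n\<close>; in the
  applications c and C do not depend on n.\<close>

definition adm :: "nat => (plane => mat2) => real => real => bool" where
 "adm n A c C = (A : borel_measurable borel & 0 < c & 0 <= C & 
  (ALL x z. c * kap n x * (norm z)^2 <= (A x *v z) \<bullet> z & norm (A x *v z) <= C * kap n x * norm z))"

lemma adm_bmat: assumes "adm n A c C" shows "bmat A (C / th n)" "coercive A c"
proof -
 have "norm (A x *v z) <= C / th n * norm z" for x z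
 proof -
  have "norm (A x *v z) <= C * kap n x * norm z" using assms by (simp add: adm_def)
  also have "... <= C * (1 / th n) * norm z" using assms by (intro mult_right_mono mult_left_mono kap_le') (auto simp: adm_def)
  finally show ?thesis by simp
 qed
 then show "bmat A (C / th n)" using assms th(2)[of n] by (auto simp: adm_def bmat_def)
 have "c * (norm z)^2 <= (A x *v z) \<bullet> z" for x z
 proof -
  have "c * 1 * (norm z)^2 <= c * kap n x * (norm z)^2" using assms kap_ge[of n x] by (intro mult_right_mono mult_left_mono) (auto simp: adm_def)
  also have "... <= (A x *v z) \<bullet> z" using assms by (simp add: adm_def)
  finally show ?thesis by simp
 qed
 then show "coercive A c" using assms by (auto simp: adm_def coercive_def)
qed

lemma up_coercive: assumes A: "adm n A c C" shows "c * (norm (up n z))^2 <= opM A z \<bullet> z"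
proof -
 have "c * (norm (up n z))^2 = (LBINT x. c * (kap n x * (norm (fn z x))^2))" unfolding norm_up_sq by simp
 also have "... <= opM A z \<bullet> z" unfolding opM_inner[OF adm_bmat(1)[OF A]]
  by (rule integral_mono) (use A up_int[of n z] sqint_inner_integrable[OF bmat_sqint[OF adm_bmat(1)[OF A]] sqint_fn] in "auto simp: adm_def mult.assoc")
 finally show ?thesis .
qed

lemma dn_opM:
 assumes A: "bmat A K" and C: "C >= 0" "!!x u. norm (A x *v u) <= C * kap n x * norm u"
 shows "norm (dn n (opM A z)) <= C * norm (up n z)"
proof (rule norm_l2_mono[OF _ C(1)])
 show "AE x in lborel. norm (fn (dn n (opM A z)) x) <= C * norm (fn (up n z) x)"
  using fn_dn[of n "opM A z"] fn_up[of n z] fn_opM[OF A, of z]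
 proof eventually_elim
  case (elim x)
  have k: "0 < sqrt (kap n x)" using ka_pos by simp
  have "norm (fn (dn n (opM A z)) x) = norm (A x *v fn z x) / sqrt (kap n x)" using elim k by simp
  also have "... <= C * kap n x * norm (fn z x) / sqrt (kap n x)" using C(2) k by (intro divide_right_mono) auto
  also have "... = C * (kap n x / sqrt (kap n x)) * norm (fn z x)" by simp
  also have "kap n x / sqrt (kap n x) = sqrt (kap n x)" using ka_pos[of n x] by (simp add: real_div_sqrt)
  finally show ?case using elim k by simp
 qed
qed

text \<open>Testing with the solution itself and pairing it with \<open>F\<close> in the dual norms
  bounds the gradient; since A is at most \<open>C * kap n\<close>, the flux in the norm of
  \<open>dn\<close> is at most C times the gradient in that of \<open>up\<close>.\<close>

lemma energy:
 assumes A: "adm n A c C"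
 shows "norm (up n (sol Om A F)) <= norm F / c" "norm (dn n (opM A (sol Om A F))) <= C * norm F / c"
proof -
 let ?U = "sol Om A F"
 have c: "c > 0" "C >= 0" using A by (auto simp: adm_def)
 have "c * (norm (up n ?U))^2 <= F \<bullet> ?U" using up_coercive[OF A, of ?U] sol_eq[OF adm_bmat[OF A] sol_gsp[OF adm_bmat[OF A]], of Om F F] by simp
 also have "... <= norm (dn n F) * norm (up n ?U)" using up_dn_le[of F ?U n] by simp
 also have "... <= norm F * norm (up n ?U)" by (rule mult_right_mono[OF norm_dn]) simp
 finally have "c * norm (up n ?U) <= norm F" by (cases "norm (up n ?U) = 0") (auto simp: power2_eq_square)
 then show u: "norm (up n ?U) <= norm F / c" using c by (simp add: pos_le_divide_eq mult.commute)
 have "norm (dn n (opM A ?U)) <= C * norm (up n ?U)" using A by (intro dn_opM[OF adm_bmat(1)[OF A]]) (auto simp: adm_def)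
 also have "... <= C * (norm F / c)" by (rule mult_left_mono[OF u c(2)])
 finally show "norm (dn n (opM A ?U)) <= C * norm F / c" by simp
qed

text \<open>The difference of the solutions solves the problem for A with, up to sign, the flux of A
  - A' at the second solution as datum. The perturbation is measured relative to
  \<open>kap n\<close>, so the estimate is uniform in n and lets rational conductivities approximate
  all others.\<close>

lemma sol_perturb:
 assumes A: "adm n A c C" and A': "adm n A' c' C'" and l: "l >= 0" "!!x u. norm (A x *v u - A' x *v u) <= l * kap n x * norm u"
 shows "norm (up n (sol Om A F - sol Om A' F)) <= l * norm F / (c * c')"
  and "norm (dn n (opM A (sol Om A F) - opM A' (sol Om A' F))) <= l * (C / c + 1) * norm F / c'"
proof -
 let ?U = "sol Om A F" and ?U' = "sol Om A' F" let ?d = "?U - ?U'"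
 let ?R = "%x. A x - A' x"
 have c: "c > 0" "c' > 0" "C >= 0" using A A' by (auto simp: adm_def)
 note b = adm_bmat[OF A] and b' = adm_bmat[OF A']
 have R: "norm (?R x *v u) <= l * kap n x * norm u" for x u using l(2)[of x u] by (simp add: matrix_vector_mult_diff_rdistrib)
 have bR: "bmat ?R (l / th n)"
  unfolding bmat_def
 proof (intro conjI allI)
  show "?R : borel_measurable borel" using A A' by (intro borel_measurable_diff) (auto simp: adm_def)
  show "norm (?R x *v u) <= l / th n * norm u" for x u
   using order_trans[OF R mult_right_mono[OF mult_left_mono[OF kap_le'[of n x] l(1)] norm_ge_zero[of u]]] by simp
 qed (use l(1) th(2)[of n] in auto)
 have Re: "opM A z - opM A' z = opM ?R z" for z
 proof (rule l2_eqI)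
  show "AE x in lborel. fn (opM A z - opM A' z) x = fn (opM ?R z) x"
   using fn_minus[of "opM A z" "opM A' z"] fn_opM[OF b(1), of z] fn_opM[OF b'(1), of z] fn_opM[OF bR, of z]
   by eventually_elim (simp add: matrix_vector_mult_diff_rdistrib)
 qed
 have d: "?d : gsp Om" by (intro subspace_diff[OF gsp_subspace] sol_gsp[OF b] sol_gsp[OF b'])
 have u': "norm (up n ?U') <= norm F / c'" by (rule energy(1)[OF A'])
 have r: "norm (dn n (opM ?R ?U')) <= l * (norm F / c')"
  using order_trans[OF dn_opM[OF bR l(1) R] mult_left_mono[OF u' l(1)]] .
 have "opM A ?d \<bullet> ?d = - (opM ?R ?U' \<bullet> ?d)"
  using sol_eq[OF b d, of F] sol_eq[OF b' d, of F] by (simp add: opM_diff[OF b(1)] inner_diff_left flip: Re)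
 then have "c * (norm (up n ?d))^2 <= norm (dn n (opM ?R ?U')) * norm (up n ?d)"
  using up_coercive[OF A, of ?d] up_dn_le[of "opM ?R ?U'" ?d n] by linarith
 also have "... <= l * (norm F / c') * norm (up n ?d)" by (rule mult_right_mono[OF r]) simp
 finally have "c * norm (up n ?d) <= l * (norm F / c')"
  using l(1) c mult_right_le_imp_le[of "c * norm (up n ?d)" "norm (up n ?d)" "l * (norm F / c')"]
  by (cases "norm (up n ?d) = 0") (simp_all add: power2_eq_square mult.assoc)
 then have e: "norm (up n ?d) <= l * (norm F / c') / c" using c by (simp only: pos_le_divide_eq mult.commute)
 then show "norm (up n ?d) <= l * norm F / (c * c')" by (simp add: mult.commute)
 have "opM A ?U - opM A' ?U' = opM A ?d + opM ?R ?U'" by (simp add: opM_diff[OF b(1)] flip: Re)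
 then have "norm (dn n (opM A ?U - opM A' ?U')) <= norm (dn n (opM A ?d)) + norm (dn n (opM ?R ?U'))"
  using dn_lin[of n 1 "opM A ?d" 1 "opM ?R ?U'"] norm_triangle_ineq by simp
 also have "norm (dn n (opM A ?d)) <= C * norm (up n ?d)" using A by (intro dn_opM[OF b(1)]) (auto simp: adm_def)
 also have "... <= C * (l * (norm F / c') / c)" by (rule mult_left_mono[OF e c(3)])
 finally have "norm (dn n (opM A ?U - opM A' ?U')) <= C * (l * (norm F / c') / c) + l * (norm F / c')" using r by simp
 also have "... = l * (C / c + 1) * norm F / c'" by (simp add: algebra_simps add_divide_distrib)
 finally show "norm (dn n (opM A ?U - opM A' ?U')) <= l * (C / c + 1) * norm F / c'" .
qed

end

section \<open>Compactness\<close>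

lemma CcI: "continuous_on UNIV f ==> compact K ==> K <= S ==> (!!x. x ~: K ==> f x = 0) ==> f : Cc S"
 unfolding Cc_def using closure_nonzero_compact by blast

lemma Cc_lin: assumes "f : Cc S" "h : Cc S" shows "(%x. c * f x + d * h x) : Cc S"
proof -
 obtain K where K: "compact K" "K <= S" "!!x. x ~: K ==> f x = 0"
  by (rule compact_supp_inE[OF Cc_supp[OF assms(1)]]) (rule that)
 obtain L where L: "compact L" "L <= S" "!!x. x ~: L ==> h x = 0"
  by (rule compact_supp_inE[OF Cc_supp[OF assms(2)]]) (rule that)
 show ?thesis
  by (rule CcI[OF _ compact_Un[OF K(1) L(1)]]) (use K L assms in "auto intro!: continuous_on_add continuous_on_mult_left intro: Cc_continuous")
qed

definition Ccv :: "plane set => (plane => plane) set" where "Ccv S = {f. ALL i. (%x. f x $ i) : Cc S}"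

lemma Ccv_lin: "f : Ccv S ==> g : Ccv S ==> (%x. c *R f x + d *R g x) : Ccv S"
 by (simp add: Ccv_def Cc_lin)

lemma Ccv_sqint: "f : Ccv S ==> sqint f"
 by (rule sqint_vec) (auto simp: Ccv_def intro: Cc_sqint)

lemma Ccv_axis: "f : Cc S ==> (%x. f x *R axis i 1) : Ccv S"
 using Cc_lin[of f S f 0 0] Cc_lin[of f S f 1 0] by (auto simp: Ccv_def axis_def)

lemma Ccv_grd: "f : Ccinf S ==> cgrad f : Ccv S"
 using Ccinf_cgrad Ccinf_subset_Cc by (fastforce simp: Ccv_def)

lemma Ccv_norm_sq: assumes "f : Ccv S" shows "(%x. (norm (f x))^2) : Cc S"
proof -
 have "(%x. 1 * (f x $ 1 * f x $ 1) + 1 * (f x $ 2 * f x $ 2)) : Cc S"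
  using assms by (intro Cc_lin Cc_mult Cc_continuous) (auto simp: Ccv_def)
 then show ?thesis by (simp add: power2_norm_eq_inner plane_inner)
qed

lemma Ccv_split:
 assumes "f : Ccv S"
 shows "L2of f = L2of (%x. f x $ 1 *R axis 1 1) + L2of (%x. f x $ 2 *R axis 2 1)" "(%x. f x $ i) : Cc S"
proof -
 show c: "(%x. f x $ i) : Cc S" for i using assms by (simp add: Ccv_def)
 have e: "f = (%x. f x $ 1 *R axis 1 1 + f x $ 2 *R axis 2 1)" by (auto simp: vec_eq_iff forall_2 axis_def)
 show "L2of f = L2of (%x. f x $ 1 *R axis 1 1) + L2of (%x. f x $ 2 *R axis 2 1)"
  by (subst e) (rule L2of_add; rule Ccv_sqint[OF Ccv_axis[OF c]])
qed

lemma wstar_iff: "wstar S D d = (ALL f:Ccv S. (%n. D n \<bullet> L2of f) ----> d \<bullet> L2of f)"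
proof
 have ax: "z \<bullet> L2of (%x. h x *R axis i 1) = (LBINT x. h x * fn z x $ i)" if "h : Cc S" for z h and i :: 2
  using inner_L2of_right[OF Ccv_sqint[OF Ccv_axis[OF that, of i]], of z] by (simp add: inner_axis)
 show "wstar S D d" if "ALL f:Ccv S. (%n. D n \<bullet> L2of f) ----> d \<bullet> L2of f"
  unfolding wstar_def using that Ccv_axis by (fastforce simp flip: ax)
 assume w: "wstar S D d"
 show "ALL f:Ccv S. (%n. D n \<bullet> L2of f) ----> d \<bullet> L2of f"
 proof
  fix f assume f: "f : Ccv S"
  have e: "z \<bullet> L2of f = (LBINT x. f x $ 1 * fn z x $ 1) + (LBINT x. f x $ 2 * fn z x $ 2)" for z
   unfolding Ccv_split(1)[OF f] by (simp add: inner_add_right ax[OF Ccv_split(2)[OF f]])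
  show "(%n. D n \<bullet> L2of f) ----> d \<bullet> L2of f" unfolding e by (intro tendsto_add wstarD[OF w] Ccv_split(2)[OF f])
 qed
qed

lemma fn_sum: "finite K ==> AE x in lborel. fn (SUM k:K. f k) x = (SUM k:K. fn (f k) x)"
proof (induction K rule: finite_induct)
 case (insert k K)
 show ?case using insert.IH fn_plus[of "f k" "SUM k:K. f k"] by eventually_elim (use insert.hyps in simp)
qed (simp add: fn_zero)

context incl
begin

text \<open>Coordinate fields on the cells of the grid of mesh 1 / N inside \<open>Om\<close>: a
  countable family whose span approximates continuous fields uniformly and whose energy norms are
  bounded in n, so that convergence of fluxes can be arranged against it.\<close>

definition cel :: "nat => int \<times> int => 2 => plane l2" where
 "cel N k i = L2of (%x. indicator {x\<in>Om. floor (real N * x $ 1) = fst k & floor (real N * x $ 2) = snd k} x *R axis i 1)"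
definition cells :: "plane l2 set" where "cells = range (%(N, k, i). cel N k i)"

lemma countable_cells: "countable cells" unfolding cells_def by simp

lemma cel_sqint: "sqint (%x. indicator {x\<in>Om. floor (real N * x $ 1) = k & floor (real N * x $ 2) = l} x *R (axis i 1 :: plane))"
proof (rule sqint_bound[of _ "indicator Om :: plane => real" 1])
 show "sqint (indicator Om :: plane => real)" by (rule sqint_bounded_indicator[of _ 1, OF _ _ bd]) (use op in auto)
 have "{x\<in>Om. floor (real N * x $ 1) = k & floor (real N * x $ 2) = l} = Om \<inter> {x. k <= real N * x $ 1 & real N * x $ 1 < k + 1 & l <= real N * x $ 2 & real N * x $ 2 < l + 1}"
  by (auto simp: floor_eq_iff)
 also have "... : sets borel" using op by (intro sets.Int) (auto intro!: borel_measurable_continuous_onI continuous_intros)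
 finally show "(%x. indicator {x\<in>Om. floor (real N * x $ 1) = k & floor (real N * x $ 2) = l} x *R (axis i 1 :: plane)) : borel_measurable borel" by simp
qed (auto simp: indicator_def)

text \<open>The total mass of the weight on \<open>Om\<close> is at most \<open>Kt\<close>, so a
  bound on the values gives an energy bound uniform in n. The square root of \<open>Kt\<close> is
  replaced by \<open>Kt\<close>, which is at least 1.\<close>

lemma up_bound:
 assumes "AE x in lborel. norm (fn z x) <= c * indicator Om x" "c >= 0"
 shows "norm (up n z) <= c * Kt"
proof -
 have "(norm (up n z))^2 <= (LBINT x. c^2 * (indicator Om x * kap n x))" unfolding norm_up_sq
 proof (rule integral_mono_AE)
  show "AE x in lborel. kap n x * (norm (fn z x))^2 <= c^2 * (indicator Om x * kap n x)" using assms(1)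
  proof eventually_elim
   case (elim x)
   have "kap n x * (norm (fn z x))^2 <= kap n x * (c * indicator Om x)^2" using elim ka_pos[of n x] by (intro mult_left_mono power_mono) auto
   then show ?case by (cases "x : Om") (simp_all add: power_mult_distrib mult_ac)
  qed
 qed (use up_int kap_int[of Om n] op bd in auto)
 also have "... = c^2 * (LBINT x:Om. kap n x)" unfolding set_lebesgue_integral_def by simp
 also have "... <= c^2 * Kt" by (intro mult_left_mono ka_total) simp
 also have "... <= c^2 * Kt^2" by (intro mult_left_mono self_le_power) auto
 finally have "(norm (up n z))^2 <= (c * Kt)^2" by (simp only: power_mult_distrib)
 moreover have "0 <= c * Kt" using assms(2) by (intro mult_nonneg_nonneg) auto
 ultimately show ?thesis by (rule power2_le_imp_le)
qed

lemma up_cell: assumes "v : cells" shows "norm (up n v) <= Kt"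
proof -
 obtain N k i where v: "v = cel N k i" using assms by (auto simp: cells_def)
 have "norm (up n v) <= 1 * Kt" unfolding v cel_def
  by (rule up_bound) (use fn_L2of[OF cel_sqint[of N "fst k" "snd k" i]] in "simp, elim eventually_mono, auto simp: indicator_def")
 then show ?thesis by simp
qed

lemma cell_approx:
 assumes f: "f : Cc Om" and e: "e > 0"
 obtains v where "v : span cells" "!!n. norm (up n (L2of (%x. f x *R axis i 1) - v)) <= e"
proof -
 let ?L = "L2of (%x. f x *R axis i 1) :: plane l2"
 obtain R where R: "R > 0" "Om <= ball 0 R" using bounded_subset_ballD[OF bd] by blast
 have "uniformly_continuous_on (cball 0 (R + 2)) f"
  using Cc_continuous[OF f] by (intro compact_uniformly_continuous) (auto intro: continuous_on_subset)
 moreover have d: "e / Kt > 0" using e measure_nonneg[of lborel Om] by (intro divide_pos_pos) linarith+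
 ultimately obtain u where u: "u > 0" "!!x y. x : cball 0 (R + 2) ==> y : cball 0 (R + 2) ==> dist y x < u ==> dist (f y) (f x) < e / Kt"
  unfolding uniformly_continuous_on_def by metis
 obtain N :: nat where N: "N > max 1 (2 / u)" using reals_Archimedean2 by blast
 then have N0: "real N > 1" "2 / real N < u" using u(1) by (auto simp: field_simps)
 define q where "q x = pt (floor (real N * x $ 1) / N) (floor (real N * x $ 2) / N)" for x :: plane
 have qx: "norm (q x - x) <= 2 / N" for x
 proof -
  have "abs (floor (real N * t) / N - t) <= 1 / N" for t
  proof -
   have "abs (real_of_int (floor (real N * t)) - real N * t) <= 1" by linarith
   then have "abs ((real_of_int (floor (real N * t)) - real N * t) / N) <= 1 / N" unfolding abs_divide using N0 by (simp add: divide_right_mono)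
   then show ?thesis using N0 by (simp add: diff_divide_distrib)
  qed
  from this[of "x $ 1"] this[of "x $ 2"] show ?thesis using norm_le_l1_cart[of "q x - x"] by (simp add: sum_2 q_def)
 qed
 let ?I = "%k x. indicator {x\<in>Om. floor (real N * x $ 1) = fst k & floor (real N * x $ 2) = snd k} x *R axis i 1 :: plane"
 \<comment> \<open>Every point of \<open>Om\<close> has norm less than R, so the integer parts of
   its scaled coordinates lie in the finite range \<open>K\<close>.\<close>
 define m where "m = \<lceil>real N * R\<rceil>"
 define K where "K = {-m-1..m+1} \<times> {-m-1..m+1}"
 define c where "c k = f (pt (fst k / N) (snd k / N))" for k :: "int \<times> int"
 define v where "v = (SUM k:K. c k *R cel N k i)"
 have "v : span cells" unfolding v_def by (intro span_sum span_scale span_base) (auto simp: cells_def image_iff intro: exI[of _ N])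
 moreover have "norm (up n (?L - v)) <= e / Kt * Kt" for n
 proof (rule up_bound)
  have fK: "finite K" by (simp add: K_def)
  have "AE x in lborel. ALL k:K. fn (c k *R cel N k i) x = c k *R ?I k x"
   unfolding AE_finite_all[OF fK]
  proof
   fix k assume "k : K"
   show "AE x in lborel. fn (c k *R cel N k i) x = c k *R ?I k x"
    using fn_scaleR[of "c k" "cel N k i"] fn_L2of[OF cel_sqint[of N "fst k" "snd k" i], folded cel_def] by eventually_elim simp
  qed
  then show "AE x in lborel. norm (fn (?L - v) x) <= e / Kt * indicator Om x"
   using fn_minus[of "?L" v] fn_sum[OF fK, of "%k. c k *R cel N k i", folded v_def] fn_L2of[OF Ccv_sqint[OF Ccv_axis[OF f, of i]]]
  proof eventually_elim
   case (elim x)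
   let ?k = "(floor (real N * x $ 1), floor (real N * x $ 2))"
   have v: "fn v x = (SUM k:K. c k *R ?I k x)"
    using elim(1,3) by simp
   show ?case
   proof (cases "x : Om")
    case True
    then have x: "norm x < R" using R(2) by auto
    have b: "abs (real N * x $ j) <= real N * R" for j
     using component_le_norm_cart[of x j] x by (simp add: abs_mult mult_left_mono)
    then have "-m - 1 <= floor (real N * x $ j) & floor (real N * x $ j) <= m + 1" for j unfolding m_def using b[of j] by linarith
    then have k: "?k : K" by (auto simp: K_def)
    have "fn v x = (SUM k:K. if k = ?k then c k *R axis i 1 else 0)" unfolding v
     by (intro sum.cong refl) (use True in "auto simp: indicator_def")
    also have "... = f (q x) *R axis i 1" using k fK by (simp add: c_def q_def)
    finally have "fn (?L - v) x = (f x - f (q x)) *R axis i 1" using elim(2,4) by (simp add: scaleR_diff_left)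
    then have n: "norm (fn (?L - v) x) = dist (f x) (f (q x))" by (simp add: dist_real_def)
    have "2 / real N <= 2" using N0 by (simp add: field_simps)
    then have "norm (q x) <= R + 2" using qx[of x] norm_triangle_ineq2[of "q x" x] x by linarith
    then have "dist (f x) (f (q x)) < e / Kt"
     using x qx[of x] N0 by (intro u(2)) (auto simp: dist_norm norm_minus_commute)
    then show ?thesis using n True by simp
   next
    case False
    then have "fn v x = 0" unfolding v by simp
    then show ?thesis using elim(2,4) Cc_outside[OF f False] False by simp
   qed
  qed
 qed (use d in simp)
 then have "norm (up n (?L - v)) <= e" for n using d e by (simp add: zero_less_divide_iff)
 ultimately show ?thesis using that by blast
qed

text \<open>For a fixed continuous field the squared energy norm is at most its squared L^2 norm
  plus the integral of |f|^2 \<chi> / \<theta>, whose limit is at most \<open>Ma\<close> times the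
  former. Energy bounds thus become L^2 bounds in the limit.\<close>

lemma up_Ccv_limit:
 assumes f: "f : Ccv Om" and lim: "b ----> l" "K ----> k" and b: "!!n. (b n)^2 <= K n * (norm (up n (L2of f)))^2" "!!n. 0 <= K n"
 shows "l^2 <= k * (1 + Ma) * (norm (L2of f))^2"
proof -
 let ?g = "%x. (norm (f x))^2" and ?N = "(norm (L2of f))^2"
 have g: "?g : Cc Om" by (rule Ccv_norm_sq[OF f])
 let ?X = "%n x. ?g x * (indicator (w n) x / th n)"
 have gi: "integrable lborel (?X n)" for n
  by (rule Cc_bounded_int[OF g, of _ "1 / th n"]) (use th(2)[of n] in "auto simp: indicator_def")
 have 1: "(norm (up n (L2of f)))^2 <= ?N + integral\<^sup>L lborel (?X n)" for n
 proof -
  have "(norm (up n (L2of f)))^2 <= (LBINT x. ?g x + ?X n x)" unfolding norm_up_sq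
  proof (rule integral_mono_AE)
   show "AE x in lborel. kap n x * (norm (fn (L2of f) x))^2 <= ?g x + ?X n x"
    using fn_L2of[OF Ccv_sqint[OF f]]
   proof eventually_elim
    case (elim x)
    have "kap n x * ?g x <= (1 + indicator (w n) x / th n) * ?g x" by (intro mult_right_mono kap_le) simp
    then show ?case using elim by (simp add: algebra_simps)
   qed
  qed (use up_int Cc_int[OF g] gi in auto)
  then show ?thesis using Cc_int[OF g] gi norm_sq_L2of[OF Ccv_sqint[OF f]] by simp
 qed
 have "l^2 <= k * (?N + (LBINT x. ?g x * a x))"
  by (rule LIMSEQ_le[OF tendsto_power[OF lim(1)] tendsto_mult[OF lim(2) tendsto_add[OF tendsto_const conv[OF g]]]])
   (use order_trans[OF b(1) mult_left_mono[OF 1 b(2)]] in blast)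
 also have "... <= k * (?N + ?N * Ma)"
 proof (intro mult_left_mono add_left_mono)
  have "(LBINT x. ?g x * a x) <= (LBINT x. ?g x * Ma)"
   by (rule integral_mono) (use Cc_bounded_int[OF g a] Cc_int[OF g] a(2) in "auto simp: abs_le_iff intro!: mult_left_mono")
  then show "(LBINT x. ?g x * a x) <= ?N * Ma" by (simp add: norm_sq_L2of[OF Ccv_sqint[OF f]])
  show "0 <= k" using LIMSEQ_le_const[OF lim(2)] b(2) by blast
 qed
 finally show ?thesis by (simp add: algebra_simps)
qed

text \<open>The limit of the fluxes is a priori only a functional on continuous fields. The
  preceding bound makes it continuous in L^2, and the Riesz theorem supplies a density: here the
  boundedness of \<open>a\<close> keeps singular parts out of the limit.\<close>

lemma wstar_limit:
 assumes D: "!!n. norm (dn n (D n)) <= E" "!!v. v : cells ==> convergent (%n. D n \<bullet> v)"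
 obtains et where "wstar Om D et"
proof -
 have E: "E >= 0" using order_trans[OF norm_ge_zero D(1)] .
 have ax: "convergent (%n. D n \<bullet> L2of (%x. h x *R axis i 1))" if h: "h : Cc Om" for h i
 proof (rule convergent_approx)
  fix e :: real assume e: "e > 0"
  obtain v where v: "v : span cells" "!!n. norm (up n (L2of (%x. h x *R axis i 1) - v)) <= e / (E + 1)"
   using cell_approx[OF h, of "e / (E + 1)" i thesis] e E by auto
  have "abs (D n \<bullet> L2of (%x. h x *R axis i 1) - D n \<bullet> v) <= e" for n
  proof -
   have "abs (D n \<bullet> L2of (%x. h x *R axis i 1) - D n \<bullet> v) <= E * (e / (E + 1))"
    unfolding inner_diff_right[symmetric] by (rule order_trans[OF up_dn_le mult_mono[OF D(1) v(2) E]]) simp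
   also have "... <= e" using E e by (simp add: field_simps)
   finally show ?thesis .
  qed
  then show "EX g. convergent g & (ALL n. abs (D n \<bullet> L2of (%x. h x *R axis i 1) - g n) <= e)"
   using convergent_on_span[of "%n v. D n \<bullet> v", OF bounded_linear.linear[OF bounded_linear_inner_right] D(2) v(1)] by blast
 qed
 have cv: "convergent (%n. D n \<bullet> L2of f)" if f: "f : Ccv Om" for f
  unfolding Ccv_split(1)[OF f] by (simp only: inner_add_right) (intro convergent_add ax Ccv_split(2)[OF f])
 let ?l = "%z. lim (%n. D n \<bullet> z)"
 have l: "(%n. D n \<bullet> L2of f) ----> ?l (L2of f)" if "f : Ccv Om" for f using cv[OF that] convergent_LIMSEQ_iff by blast
 have Ll: "L2of (%x. c *R f x + d *R g x) = c *R L2of f + d *R L2of g" if "f : Ccv Om" "g : Ccv Om" for c d f g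
  using that by (simp add: L2of_add L2of_scaleR sqint_scaleR Ccv_sqint)
 let ?Y = "L2of ` Ccv Om"
 have lin: "c *R y + d *R z : ?Y" if "y : ?Y" "z : ?Y" for c d y z
 proof -
  obtain f g where fg: "f : Ccv Om" "g : Ccv Om" and e: "y = L2of f" "z = L2of g" using `y : ?Y` `z : ?Y` by blast
  show ?thesis unfolding e Ll[OF fg, symmetric] by (intro imageI Ccv_lin fg)
 qed
 obtain et where et: "et : closure ?Y" "!!z. z : ?Y ==> ?l z = et \<bullet> z"
 proof (rule riesz_subspace[of ?Y ?l "E * sqrt (1 + Ma)"])
  have "(%x. 0) : Ccv Om" by (auto simp: Ccv_def intro: CcI[of _ "{}"])
  then have "0 : ?Y" using lin[of "L2of (%x. 0)" "L2of (%x. 0)" 0 0] by auto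
  then show "subspace ?Y" unfolding subspace_def using lin[of _ _ 1 1] lin[of _ _ _ 0] by auto
  show "?l (c *R u + d *R v) = c * ?l u + d * ?l v" if uv: "u : ?Y" "v : ?Y" for u v c d
  proof (rule limI)
   show "(%n. D n \<bullet> (c *R u + d *R v)) ----> c * ?l u + d * ?l v"
    unfolding inner_add_right inner_scaleR_right using uv l by (intro tendsto_add tendsto_mult_left) auto
  qed
  show "abs (?l v) <= E * sqrt (1 + Ma) * norm v" if "v : ?Y" for v
  proof -
   obtain f where f: "f : Ccv Om" "v = L2of f" using `v : ?Y` by blast
   have "(D n \<bullet> L2of f)^2 <= E^2 * (norm (up n (L2of f)))^2" for n
    unfolding power_mult_distrib[symmetric] using order_trans[OF up_dn_le mult_right_mono[OF D(1) norm_ge_zero], of n "L2of f"]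
    by (metis power2_abs power_mono abs_ge_zero)
   from up_Ccv_limit[OF f(1) l[OF f(1)] tendsto_const this]
   have "(?l v)^2 <= (E * sqrt (1 + Ma) * norm v)^2" using Ma_nonneg by (simp add: f(2) power_mult_distrib)
   then show ?thesis using E Ma_nonneg by (metis abs_le_square_iff abs_of_nonneg mult_nonneg_nonneg norm_ge_zero real_sqrt_ge_zero add_nonneg_nonneg zero_le_one)
  qed
 qed (rule that)
 have "wstar Om D et" unfolding wstar_iff using l et(2) by auto
 then show ?thesis using that by blast
qed

lemma incl_subseq: assumes r: "strict_mono r" shows "incl Om (%n. w (r n)) (%n. th (r n)) a Ma"
proof
 show "open Om" "bounded Om" "a : borel_measurable borel" by (fact op bd a)+
 show "(%n. th (r n)) ----> 0" using LIMSEQ_subseq_LIMSEQ[OF th(4) r] by (simp add: o_def)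
 show "(%n. LBINT x. f x * (indicator (w (r n)) x / th (r n))) ----> (LBINT x. f x * a x)" if "f : Cc Om" for f
  using LIMSEQ_subseq_LIMSEQ[OF conv[OF that] r] by (simp add: o_def)
qed (use w th a in auto)

lemma wstar_compact:
 assumes D: "!!n. norm (dn n (D n)) <= E"
 obtains r et where "strict_mono (r :: nat => nat)" "wstar Om (%n. D (r n)) et"
proof -
 have E: "E >= 0" using order_trans[OF norm_ge_zero D(1)] .
 obtain r where r: "strict_mono (r :: nat => nat)" "!!v. v : cells ==> convergent (%n. D (r n) \<bullet> v)"
 proof (rule diagonal_countable[OF countable_cells, of "%v n. D n \<bullet> v"])
  show "EX C. ALL n. abs (D n \<bullet> v) <= C" if "v : cells" for v
   using order_trans[OF up_dn_le mult_mono[OF D up_cell[OF that] E norm_ge_zero]] by blast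
 qed (rule that)
 interpret I: incl Om "%n. w (r n)" "%n. th (r n)" a Ma by (rule incl_subseq[OF r(1)])
 have "I.dn n = dn (r n)" for n by (simp add: I.dn_def dn_def I.kap_def kap_def)
 then obtain et where "wstar Om (%n. D (r n)) et" using I.wstar_limit[of "%n. D (r n)" E] D r(2) by auto
 then show ?thesis using that r(1) by blast
qed

end

section \<open>Correctors\<close>

definition mtx :: "plane set => real => real \<times> real => plane => mat2" where
 "mtx W t g = scal (%x. if x : W then snd g / t else fst g)"

definition Qp :: "(real \<times> real) set" where "Qp = (%(x, y). (real_of_rat x, real_of_rat y)) ` ({0<..} \<times> {0<..})"

lemma Qp_countable: "countable Qp" unfolding Qp_def by simp

lemma Qp_pos: "q : Qp ==> fst q > 0 & snd q > 0" by (auto simp: Qp_def)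

lemma Qp_dense:
 assumes "fst g > 0" "snd g > 0" "d > 0"
 obtains q where "q : Qp" "fst g <= fst q" "fst q <= fst g + d" "snd g <= snd q" "snd q <= snd g + d"
proof -
 obtain x y where x: "fst g < real_of_rat x" "real_of_rat x < fst g + d" and y: "snd g < real_of_rat y" "real_of_rat y < snd g + d"
  using of_rat_dense[of "fst g" "fst g + d"] of_rat_dense[of "snd g" "snd g + d"] assms by auto
 then have "0 < real_of_rat x" "0 < real_of_rat y" using assms by linarith+
 then show ?thesis using x y by (intro that[of "(real_of_rat x, real_of_rat y)"]) (auto simp: Qp_def)
qed

context incl
begin

abbreviation "Mg n g == mtx (w n) (th n) g"
abbreviation "T n g F == sol Om (Mg n g) F"
abbreviation "MT n g F == opM (Mg n g) (T n g F)"

lemma mtx_vec: "Mg n g x *v z = (if x : w n then snd g / th n else fst g) *R z"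
 by (simp add: mtx_def)

lemma mtx_adm:
 assumes "0 < c" "c <= fst g" "c <= snd g" "fst g <= C" "snd g <= C" shows "adm n (Mg n g) c C"
 unfolding adm_def
proof (intro conjI allI)
 show "Mg n g : borel_measurable borel" unfolding mtx_def by (intro scal_measurable) measurable
 fix x z
 show "c * kap n x * (norm z)^2 <= (Mg n g x *v z) \<bullet> z"
  unfolding mtx_vec inner_scaleR_left power2_norm_eq_inner using assms th(2)[of n] by (intro mult_right_mono) (auto simp: kap_def divide_right_mono)
 show "norm (Mg n g x *v z) <= C * kap n x * norm z"
  unfolding mtx_vec norm_scaleR using assms th(2)[of n] by (intro mult_right_mono) (auto simp: kap_def divide_right_mono)
qed (use assms in auto)

lemma mtx_adm': "fst g > 0 ==> snd g > 0 ==> adm n (Mg n g) (min (fst g) (snd g)) (max (fst g) (snd g))"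
 by (rule mtx_adm) auto

lemma sol_bounded_linear: assumes "adm n A c C" shows "bounded_linear (sol Om A)"
proof (rule bounded_linear_intro)
 note b = adm_bmat[OF assms]
 show "sol Om A (x + y) = sol Om A x + sol Om A y" for x y using sol_lin[OF b, of Om 1 x 1 y] by simp
 show "sol Om A (r *R x) = r *R sol Om A x" for r x using sol_lin[OF b, of Om r x 0 x] by simp
 show "norm (sol Om A x) <= norm x * (1 / c)" for x using sol_norm[OF b, of Om x] by simp
qed

lemma opM_bounded_linear: assumes "bmat A C" shows "bounded_linear (opM A)"
proof (rule bounded_linear_intro)
 show "opM A (x + y) = opM A x + opM A y" for x y using opM_lin[OF assms, of 1 x 1 y] by simp
 show "opM A (r *R x) = r *R opM A x" for r x using opM_lin[OF assms, of r x 0 x] by simp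
 show "norm (opM A x) <= norm x * C" for x using opM_norm[OF assms, of x] by (simp add: mult.commute)
qed

text \<open>Sought is a datum \<open>F\<close>, independent of n, whose solutions converge weakly to
  a prescribed gradient p. On the closed span \<open>W\<close> of \<open>D\<close>, which the
  solution operators leave invariant, the limits of \<open>T n g u \<bullet> v\<close> form a
  bounded coercive form, and Lax-Milgram inverts it. Convergence is given for rational
  conductivities and carried to g by perturbation.\<close>

lemma correctors:
 assumes D: "D <= gsp Om" "!!n q d. q : Qp ==> d : D ==> T n q d : D"
  and cv: "!!q d v. q : Qp ==> d : D ==> v : D ==> convergent (%n. T n q d \<bullet> v)"
   "!!q d v. q : Qp ==> d : D ==> v : cells ==> convergent (%n. MT n q d \<bullet> v)"
  and g: "fst g > 0" "snd g > 0" and p: "p : D"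
 obtains F et where "F : gsp Om" "weak_conv (%n. T n g F) p" "wstar Om (%n. MT n g F) et"
proof -
 define W where "W = closure (span D)"
 define c C where "c = min (fst g) (snd g)" and "C = max (fst g) (snd g) + 1"
 have c: "c > 0" "C >= 0" using g by (auto simp: c_def C_def)
 have Ag: "adm n (Mg n g) c C" for n by (rule mtx_adm) (use g in "auto simp: c_def C_def")
 have Wsub: "subspace W" unfolding W_def by (rule subspace_closure_gen[OF subspace_span])
 have Wcl: "closed W" by (simp add: W_def)
 have DW: "D <= W" unfolding W_def using span_superset closure_subset by blast
 have min: "W <= V" if "D <= V" "subspace V" "closed V" for V
  unfolding W_def by (rule closure_minimal[OF span_minimal[OF that(1,2)] that(3)])
 have Wg: "W <= gsp Om" by (rule min[OF D(1) gsp_subspace gsp_closed])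
 have cvW: "convergent (%n. f n v)" if f: "!!n. bounded_linear (f n)" "!!n v. abs (f n v) <= K * norm v" "!!d. d : D ==> convergent (%n. f n d)" "v : W"
  for f :: "nat => plane l2 => real" and K v
  by (rule convergent_on_closure_span[of f K D, OF bounded_linear.linear[OF f(1)] f(2,3)]) (use f(4) in "auto simp: W_def")
 have Wq: "T n q F : W" if "q : Qp" "F : W" for n q F
 proof -
  have bl: "bounded_linear (T n q)" using Qp_pos[OF that(1)] sol_bounded_linear[OF mtx_adm'] by blast
  have "W <= T n q -` W"
  proof (rule min)
   show "D <= T n q -` W" using D(2)[OF that(1)] DW by auto
   show "subspace (T n q -` W)" by (rule linear_subspace_vimage[OF bounded_linear.linear[OF bl] Wsub])
   show "closed (T n q -` W)" by (rule closed_vimage[OF Wcl linear_continuous_on[OF bl]])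
  qed
  then show ?thesis using that(2) by blast
 qed
 have cq: "convergent (%n. T n q F \<bullet> v)" "u : cells ==> convergent (%n. MT n q F \<bullet> u)" if q: "q : Qp" and F: "F : W" and v: "v : W" for q F v u
 proof -
  define k K where "k = min (fst q) (snd q)" and "K = max (fst q) (snd q)"
  have A: "adm n (Mg n q) k K" for n unfolding k_def K_def using Qp_pos[OF q] by (intro mtx_adm') auto
  have k: "k > 0" "K >= 0" using A[of 0] by (auto simp: adm_def)
  have b: "abs (T n q d \<bullet> v) <= norm d / k * norm v" for n d v
   by (rule order_trans[OF Cauchy_Schwarz_ineq2 mult_right_mono[OF sol_norm[OF adm_bmat[OF A]]]]) simp
  have b': "abs (T n q d \<bullet> v) <= norm v / k * norm d" for n d using b[of n d v] by (simp add: mult.commute)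
  have cd: "convergent (%n. T n q d \<bullet> v)" if "d : D" for d
   by (rule cvW[OF _ b cv(1)[OF q that] v]) (rule bounded_linear_inner_right)
  show "convergent (%n. T n q F \<bullet> v)"
   by (rule cvW[where f = "%n F. T n q F \<bullet> v", OF _ b' cd F]) (rule bounded_linear_compose[OF bounded_linear_inner_left sol_bounded_linear[OF A]])
  have bl: "bounded_linear (%F. MT n q F \<bullet> u)" for n
   by (intro bounded_linear_compose[OF bounded_linear_inner_left] bounded_linear_compose[OF opM_bounded_linear[OF adm_bmat(1)[OF A]]] sol_bounded_linear[OF A])
  assume u: "u : cells"
  have "abs (MT n q F \<bullet> u) <= K / k * Kt * norm F" for n F
  proof -
   have "abs (MT n q F \<bullet> u) <= (K * norm F / k) * Kt"
    by (rule order_trans[OF up_dn_le mult_mono[OF energy(2)[OF A] up_cell[OF u]]]) (use k in auto)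
   then show ?thesis by (simp add: mult_ac)
  qed
  then show "convergent (%n. MT n q F \<bullet> u)" by (rule cvW[where f = "%n F. MT n q F \<bullet> u", OF bl _ cv(2)[OF q _ u] F])
 qed
 \<comment> \<open>\<open>\<delta>\<close> is small enough for both perturbation estimates, and at
   most 1 so that the constants c and C of g serve the neighbouring rational q as well.\<close>
 have approx: "EX q:Qp. ALL n. norm (T n g F - T n q F) <= e & norm (dn n (MT n g F - MT n q F)) <= e" if e: "e > 0" for F e
 proof -
  define K where "K = 1 + norm F / (c * c) + (C / c + 1) * norm F / c"
  have K: "K >= 1" "norm F / (c * c) <= K" "(C / c + 1) * norm F / c <= K" using c by (auto simp: K_def)
  define \<delta> where "\<delta> = min 1 (e / K)"
  have \<delta>: "\<delta> > 0" "\<delta> <= 1" "\<delta> * K <= e" using e K(1) by (auto simp: \<delta>_def min_def field_simps)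
  obtain q where q: "q : Qp" "fst g <= fst q" "fst q <= fst g + \<delta>" "snd g <= snd q" "snd q <= snd g + \<delta>" by (rule Qp_dense[OF g \<delta>(1)]) (rule that)
  have Aq: "adm n (Mg n q) c C" for n by (rule mtx_adm) (use q \<delta> c in "auto simp: c_def C_def")
  have R: "norm (Mg n g x *v \<xi> - Mg n q x *v \<xi>) <= \<delta> * kap n x * norm \<xi>" for n x \<xi>
   unfolding mtx_vec scaleR_diff_left[symmetric] norm_scaleR
   by (rule mult_right_mono) (use q th(2)[of n] in "auto simp: kap_def divide_right_mono abs_le_iff simp flip: diff_divide_distrib")
  note P = sol_perturb[OF Ag Aq less_imp_le[OF \<delta>(1)] R]
  have "norm (T n g F - T n q F) <= e" for n
  proof -
   have "norm (T n g F - T n q F) <= \<delta> * (norm F / (c * c))" using order_trans[OF norm_up P(1)] by simp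
   then show ?thesis using mult_left_mono[OF K(2) less_imp_le[OF \<delta>(1)]] \<delta>(3) by linarith
  qed
  moreover have "norm (dn n (MT n g F - MT n q F)) <= e" for n
  proof -
   have "norm (dn n (MT n g F - MT n q F)) <= \<delta> * ((C / c + 1) * norm F / c)" using P(2)[of n F] by (simp add: mult.assoc)
   then show ?thesis using mult_left_mono[OF K(3) less_imp_le[OF \<delta>(1)]] \<delta>(3) by linarith
  qed
  ultimately show ?thesis using q(1) by blast
 qed
 have Tb: "abs (T n g u \<bullet> v) <= 1 / c * norm u * norm v" for n u v
  using order_trans[OF Cauchy_Schwarz_ineq2 mult_right_mono[OF sol_norm[OF adm_bmat[OF Ag]] norm_ge_zero]] by simp
 have TE: "MT n g u \<bullet> T n g u = u \<bullet> T n g u" for n u by (rule sol_eq[OF adm_bmat[OF Ag] sol_gsp[OF adm_bmat[OF Ag]]])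
 have WT: "T n g F : W" if F: "F : W" for n F
 proof -
  have "EX y:W. dist y (T n g F) < e" if "e > 0" for e
  proof -
   obtain q where "q : Qp" "norm (T n g F - T n q F) <= e / 2" using approx[of "e / 2" F] `e > 0` by auto
   then show ?thesis using Wq[OF _ F, of q n] `e > 0` by (intro bexI[of _ "T n q F"]) (auto simp: dist_norm norm_minus_commute)
  qed
  then show ?thesis using Wcl closure_approachable[of "T n g F" W] by simp
 qed
 have cg: "convergent (%n. T n g F \<bullet> v)" if F: "F : W" and v: "v : W" for F v
 proof (rule convergent_approx)
  fix e :: real assume e: "e > 0"
  obtain q where q: "q : Qp" "!!n. norm (T n g F - T n q F) <= e / (norm v + 1)"
   using approx[of "e / (norm v + 1)" F] e by (auto simp: add_nonneg_pos)
  have "abs (T n g F \<bullet> v - T n q F \<bullet> v) <= e" for n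
  proof -
   have "abs (T n g F \<bullet> v - T n q F \<bullet> v) <= e / (norm v + 1) * norm v"
    unfolding inner_diff_left[symmetric] by (rule order_trans[OF Cauchy_Schwarz_ineq2 mult_right_mono[OF q(2)]]) simp
   also have "... <= e" using e by (simp add: pos_divide_le_eq add_nonneg_pos)
   finally show ?thesis .
  qed
  then show "EX h. convergent h & (ALL n. abs (T n g F \<bullet> v - h n) <= e)" using cq(1)[OF q(1) F v] by blast
 qed
 have cgc: "convergent (%n. MT n g F \<bullet> v)" if F: "F : W" and v: "v : cells" for F v
 proof (rule convergent_approx)
  fix e :: real assume e: "e > 0"
  have Kt: "Kt > 0" by (simp add: add_nonneg_pos)
  obtain q where q: "q : Qp" "!!n. norm (dn n (MT n g F - MT n q F)) <= e / Kt"
   using approx[OF divide_pos_pos[OF e Kt], of F] by auto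
  have "abs (MT n g F \<bullet> v - MT n q F \<bullet> v) <= e" for n
  proof -
   have "abs (MT n g F \<bullet> v - MT n q F \<bullet> v) <= e / Kt * Kt"
    unfolding inner_diff_left[symmetric] by (rule order_trans[OF up_dn_le mult_mono[OF q(2) up_cell[OF v]]]) (use e Kt in auto)
   then show ?thesis using Kt by simp
  qed
  then show "EX h. convergent h & (ALL n. abs (MT n g F \<bullet> v - h n) <= e)" using cq(2)[OF q(1) F F v] by blast
 qed
 let ?b = "%u v. lim (%n. T n g u \<bullet> v)"
 have l: "(%n. T n g u \<bullet> v) ----> ?b u v" if "u : W" "v : W" for u v using cg[OF that] convergent_LIMSEQ_iff by blast
 define K where "K = C^2 / c * (1 + Ma)"
 have K: "K > 0" unfolding K_def using c g Ma_nonneg by (auto intro!: mult_pos_pos divide_pos_pos simp: C_def)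
 \<comment> \<open>Coercivity of the limit form. By the equation \<open>u \<bullet> grd m\<close> is
   the pairing of the flux of \<open>T n g u\<close> with \<open>grd m\<close>, so its square is at
   most C^2 / c times \<open>T n g u \<bullet> u\<close> times the squared energy norm of
   \<open>grd m\<close>. In the limit that norm costs a factor 1 + Ma; then \<open>grd m\<close>
   tends to u.\<close>
 have co: "1 / K * (norm u)^2 <= ?b u u" if u: "u : W" for u
 proof -
  have Tp: "0 <= T n g u \<bullet> u" for n
  proof -
   have "0 <= c * (norm (T n g u))^2" using c by simp
   also have "... <= T n g u \<bullet> u"
    using coercive_opM[OF adm_bmat[OF Ag[of n]], of "T n g u"] TE[of n u] by (simp add: inner_commute)
   finally show ?thesis .
  qed
  have bu: "0 <= ?b u u" using LIMSEQ_le_const[OF l[OF u u]] Tp by blast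
  have "(u \<bullet> grd m)^2 <= K * ?b u u * (norm (grd m))^2" if m: "m : Ccinf Om" for m
  proof -
   have e: "(u \<bullet> grd m)^2 <= C^2 / c * (T n g u \<bullet> u) * (norm (up n (grd m)))^2" for n
   proof -
    have "abs (u \<bullet> grd m) <= norm (dn n (MT n g u)) * norm (up n (grd m))"
     using up_dn_le[of "MT n g u" "grd m" n] sol_eq[OF adm_bmat[OF Ag] gsp_grd[OF m], of n u] by simp
    also have "... <= C * norm (up n (T n g u)) * norm (up n (grd m))"
     by (intro mult_right_mono dn_opM[OF adm_bmat(1)[OF Ag]]) (use Ag[of n] in "auto simp: adm_def")
    finally have "(u \<bullet> grd m)^2 <= (C * norm (up n (T n g u)) * norm (up n (grd m)))^2"
     using power_mono[of "abs (u \<bullet> grd m)" _ 2] by simp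
    also have "... = C^2 / c * (c * (norm (up n (T n g u)))^2) * (norm (up n (grd m)))^2" using c by (simp add: power_mult_distrib)
    also have "... <= C^2 / c * (T n g u \<bullet> u) * (norm (up n (grd m)))^2"
     using up_coercive[OF Ag[of n], of "T n g u"] TE[of n u] c
     by (intro mult_right_mono mult_left_mono) (auto simp: inner_commute)
    finally show ?thesis .
   qed
   show ?thesis
    using up_Ccv_limit[OF Ccv_grd[OF m], unfolded grd_def[symmetric], OF tendsto_const tendsto_mult_left[OF l[OF u u]] e] Tp c
    by (simp add: K_def mult_ac)
  qed
  moreover obtain m where m: "!!k::nat. m k : Ccinf Om" "(%k. grd (m k)) ----> u" by (rule gsp_seq[OF set_mp[OF Wg u]]) (rule that)
  ultimately have "(u \<bullet> u)^2 <= K * ?b u u * (norm u)^2"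
   by (intro LIMSEQ_le[OF tendsto_power[OF tendsto_inner[OF tendsto_const m(2)]] tendsto_mult_left[OF tendsto_power[OF tendsto_norm[OF m(2)]]]]) auto
  then have "(norm u)^2 * (norm u)^2 <= K * ?b u u * (norm u)^2" by (simp add: power2_norm_eq_inner power2_eq_square[of "u \<bullet> u"])
  then have "(norm u)^2 <= K * ?b u u" using bu K mult_right_le_imp_le[of "(norm u)^2" "(norm u)^2" "K * ?b u u"] by (cases "u = 0") simp_all
  then show ?thesis using K by (simp add: pos_divide_le_eq mult.commute)
 qed
 obtain F where F: "F : W" "!!v. v : W ==> ?b F v = p \<bullet> v"
 proof (rule lax_milgram[OF Wsub Wcl, where b = ?b and f = "%v. p \<bullet> v" and c = "1 / K" and C = "1 / c" and K = "norm p"])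
  have lin: "x *R u + y *R v : W" if "u : W" "v : W" for x y u v by (intro subspace_add[OF Wsub] subspace_scale[OF Wsub] that)
  fix u v z x y assume W: "u : W" "v : W" "z : W"
  show "?b (x *R u + y *R v) z = x * ?b u z + y * ?b v z"
   by (rule limI) (simp add: sol_lin[OF adm_bmat[OF Ag]] inner_add_left, intro tendsto_add tendsto_mult_left l W)
  show "?b z (x *R u + y *R v) = x * ?b z u + y * ?b z v"
   by (rule limI) (simp add: inner_add_right, intro tendsto_add tendsto_mult_left l W)
 next
  show "abs (?b u v) <= 1 / c * norm u * norm v" if "u : W" "v : W" for u v
   by (rule LIMSEQ_le_const2[OF tendsto_rabs[OF l[OF that]]]) (use Tb in blast)
 qed (use K co in "auto simp: inner_simps Cauchy_Schwarz_ineq2")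
 \<comment> \<open>All these solutions lie in \<open>W\<close>, so a test vector may be replaced by
   its projection onto \<open>W\<close>.\<close>
 have "weak_conv (%n. T n g F) p" unfolding weak_conv_def
 proof
  fix v
  obtain v' where v': "v' : W" "!!u. u : W ==> v \<bullet> u = v' \<bullet> u" by (rule projection_exists[OF Wsub Wcl]) (rule that)
  have "T n g F \<bullet> v = T n g F \<bullet> v'" for n using v'(2)[OF WT[OF F(1)]] by (simp add: inner_commute)
  moreover have "p \<bullet> v = p \<bullet> v'" using v'(2)[of p] p DW by (auto simp: inner_commute)
  ultimately show "(%n. T n g F \<bullet> v) ----> p \<bullet> v" using l[OF F(1) v'(1)] F(2)[OF v'(1)] by simp
 qed
 moreover obtain et where "wstar Om (%n. MT n g F) et"
  by (rule wstar_limit[OF energy(2)[OF Ag] cgc[OF F(1)]]) auto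
 ultimately show ?thesis using that F(1) Wg by blast
qed

text \<open>One subsequence must serve all real conductivities. It is extracted for the countably
  many rational ones and for a countable set of data closed under their solution operators.\<close>

theorem correctors_extraction:
 assumes P: "countable P" "P <= gsp Om"
 obtains r where "strict_mono (r :: nat => nat)"
  "!!g p. fst g > 0 ==> snd g > 0 ==> p : P ==>
   EX F et. F : gsp Om & weak_conv (%n. T (r n) g F) p & wstar Om (%n. MT (r n) g F) et"
proof -
 define Ti where "Ti = from_nat_into (Qp \<times> (UNIV :: nat set))"
 have "Qp ~= {}" using Qp_dense[of "(1, 1)" 1] by auto
 then have Ti: "range Ti = Qp \<times> UNIV" unfolding Ti_def using Qp_countable by (intro range_from_nat_into) auto
 obtain D0 where D0: "countable D0" "P <= D0" "!!k d. d : D0 ==> T (snd (Ti k)) (fst (Ti k)) d : D0"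
  by (rule countable_invariant_superset[OF P(1), of "%k d. T (snd (Ti k)) (fst (Ti k)) d"]) (rule that)
 define D where "D = D0 \<inter> gsp Om"
 have D: "countable D" "P <= D" "D <= gsp Om" using D0 P by (auto simp: D_def)
 have DT: "T n q d : D" if q: "q : Qp" and d: "d : D" for n q d
 proof -
  obtain k where "Ti k = (q, n)" using Ti q by (metis UNIV_I SigmaI rangeE)
  then show ?thesis using D0(3)[of d k] d sol_gsp[OF adm_bmat[OF mtx_adm']] Qp_pos[OF q] by (auto simp: D_def)
 qed
 \<comment> \<open>The tag separates gradients, tested against \<open>D\<close>, from fluxes, tested
   against \<open>cells\<close>.\<close>
 let ?I = "(Qp \<times> D \<times> D) \<times> {True} \<union> (Qp \<times> D \<times> cells) \<times> {False}"
 obtain r where r: "strict_mono (r :: nat => nat)" "!!i. i : ?I ==> convergent (%n. (case i of ((q, d, v), b) => (if b then T (r n) q d else MT (r n) q d) \<bullet> v))"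
 proof (rule diagonal_countable[of ?I "%i n. (case i of ((q, d, v), b) => (if b then T n q d else MT n q d) \<bullet> v)"])
  show "countable ?I" using D(1) Qp_countable countable_cells by auto
  fix i assume i: "i : ?I"
  obtain q d v b where i': "i = ((q, d, v), b)" by (metis surj_pair)
  have q: "q : Qp" using i i' by auto
  let ?c = "min (fst q) (snd q)" and ?C = "max (fst q) (snd q)"
  have A: "adm n (Mg n q) ?c ?C" for n using Qp_pos[OF q] by (intro mtx_adm') auto
  have k: "?c > 0" "?C >= 0" using A[of 0] by (auto simp: adm_def)
  have "abs ((if b then T n q d else MT n q d) \<bullet> v) <= (if b then norm d / ?c * norm v else ?C * norm d / ?c * Kt)" for n
  proof (cases b)
   case True
   then show ?thesis using order_trans[OF Cauchy_Schwarz_ineq2 mult_right_mono[OF sol_norm[OF adm_bmat[OF A]] norm_ge_zero]] by simp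
  next
   case False
   then have "v : cells" using i i' by auto
   then show ?thesis using False order_trans[OF up_dn_le mult_mono[OF energy(2)[OF A, where F = d] up_cell _ norm_ge_zero]] k by simp
  qed
  then show "EX C. ALL n. abs (case i of ((q, d, v), b) => (if b then T n q d else MT n q d) \<bullet> v) <= C" unfolding i' prod.case by blast
 qed (rule that)
 interpret I: incl Om "%n. w (r n)" "%n. th (r n)" a Ma by (rule incl_subseq[OF r(1)])
 show ?thesis
 proof (rule that[OF r(1)])
  fix g p assume g: "fst g > (0::real)" "snd g > (0::real)" and p: "p : P"
  obtain F et where "F : gsp Om" "weak_conv (%n. T (r n) g F) p" "wstar Om (%n. MT (r n) g F) et"
  proof (rule I.correctors[OF D(3) DT _ _ g])
   show "convergent (%n. T (r n) q d \<bullet> v)" if "q : Qp" "d : D" "v : D" for q d v using r(2)[of "((q, d, v), True)"] that by simp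
   show "convergent (%n. MT (r n) q d \<bullet> v)" if "q : Qp" "d : D" "v : cells" for q d v using r(2)[of "((q, d, v), False)"] that by simp
  qed (use p D(2) in auto)
  then show "EX F et. F : gsp Om & weak_conv (%n. T (r n) g F) p & wstar Om (%n. MT (r n) g F) et" by blast
 qed
qed

end

section \<open>The effective conductivity\<close>

text \<open>Constant gradients become admissible targets only after the coordinates are cut off,
  hence locally. The Lindelof property keeps the number of squares, and so of targets,
  countable.\<close>

lemma square_cover:
 assumes S: "open S" "S ~= {}"
 obtains c :: "nat => plane" and s :: "nat => real" and h :: "nat => plane => real"
 where "!!j. s j > 0" "!!j. sqr (c j) (s j) <= S" "!!j. h j : Ccinf S" "!!j x. x : osq (c j) (s j) ==> h j x = 1"
  "!!x. x : S ==> EX j. x : osq (c j) (s j)"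
proof -
 define Q where "Q = {(c, s, h). s > 0 & sqr c s <= S & h : Ccinf S & (ALL x:osq c s. h x = 1)}"
 have ex: "EX q:Q. x : osq (fst q) (fst (snd q))" if x: "x : S" for x
 proof -
  obtain r where r: "r > 0" "cball x r <= S" using S(1) x open_contains_cball by blast
  \<comment> \<open>Three radii: the square lies in the ball of radius e, the indicator to be
    mollified is that of radius 2 e, and the result is supported in radius 3 e = r.\<close>
  define e where "e = r / 3"
  have e: "e > 0" "cball x (3 * e) <= S" using r by (auto simp: e_def)
  let ?c = "x - (e / 2) *R 1" and ?I = "indicator (cball x (2 * e)) :: plane => real"
  have d: "dist x z <= e" if "z : sqr ?c e" for z
  proof -
   have "x $ i - e / 2 <= z $ i & z $ i <= x $ i - e / 2 + e" for i using that by (simp add: sqr_def)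
   then have "abs ((x - z) $ i) <= e / 2" for i unfolding vector_minus_component by (smt (verit, best) field_sum_of_halves)
   from this[of 1] this[of 2] show ?thesis using norm_le_l1_cart[of "x - z"] unfolding sum_2 dist_norm by linarith
  qed
  have "conv (mol e) ?I : Ccinf S"
  proof (rule CcinfI[OF _ compact_cball e(2)])
   show "Ck k (conv (mol e) ?I)" for k by (rule Ck_conv[OF mol_Ccinf[OF e(1)] integrable_indicator_bounded]) auto
   show "conv (mol e) ?I z = 0" if z: "z ~: cball x (3 * e)" for z
   proof (rule conv_mol_supp[OF e(1), of "cball x (2 * e)"])
    show "e <= dist z y" if "y : cball x (2 * e)" for y
     using dist_triangle2[of x z y] that z by (simp add: dist_commute)
   qed simp
  qed
  moreover have "conv (mol e) ?I z = 1" if z: "z : sqr ?c e" for z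
  proof -
   have m: "mol e (z - y) * ?I y = mol e (z - y)" for y
   proof (cases "y : cball x (2 * e)")
    case False
    then have "e <= norm (z - y)" using d[OF z] dist_triangle[of x y z] by (simp add: dist_norm)
    then show ?thesis using mol_zero[OF e(1)] by simp
   qed simp
   show ?thesis unfolding conv_def m by (rule mol_shift_integral[OF e(1)])
  qed
  moreover have "sqr ?c e <= S" using d e by fastforce
  ultimately have "(?c, e, conv (mol e) ?I) : Q" using e(1) osq_subset(2)[of ?c e] by (auto simp: Q_def)
  moreover have "x : osq ?c e" using e(1) by (auto simp: osq_def)
  ultimately show ?thesis by force
 qed
 let ?O = "%q. osq (fst q) (fst (snd q))"
 obtain F' where F': "F' <= ?O ` Q" "countable F'" "\<Union>F' = \<Union>(?O ` Q)"
  using Lindelof[of "?O ` Q"] open_osq by blast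
 obtain Q' where Q': "countable Q'" "Q' <= Q" "F' = ?O ` Q'" using F'(1,2) countable_subset_image[of F' ?O Q] by blast
 have cov: "EX q:Q'. x : ?O q" if "x : S" for x
 proof -
  have "x : \<Union>F'" unfolding F'(3) using ex[OF that] by blast
  then show ?thesis unfolding Q'(3) by blast
 qed
 then have ne: "Q' ~= {}" using S(2) by blast
 define q where "q = from_nat_into Q'"
 have q: "q j : Q" for j using from_nat_into[OF ne, of j] Q'(2) by (auto simp: q_def)
 show ?thesis
 proof (rule that[of "%j. fst (snd (q j))" "%j. fst (q j)" "%j. snd (snd (q j))"])
  show "EX j. x : ?O (q j)" if "x : S" for x
   using cov[OF that] from_nat_into_surj[OF Q'(1)] unfolding q_def by metis
 qed (use q in "auto simp: Q_def case_prod_beta")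
qed

lemma cutoff_gradient:
 assumes q: "q : Ccinf S" "!!x. x : osq c s ==> q x = 1" and x: "x : osq c s"
 shows "(%x. x $ i * q x) : Ccinf S" "cgrad (%x. x $ i * q x) x = axis i 1"
proof -
 show "(%x. x $ i * q x) : Ccinf S" by (rule Ccinf_mult_left[OF q(1)]) (rule Ck_coord)
 have "((%x. x $ i) has_derivative (%h. h $ i)) (at x)" by (rule bounded_linear_imp_has_derivative[OF bounded_linear_vec_nth])
 then have "((%x. x $ i * q x) has_derivative (%h. h $ i)) (at x)"
  by (rule has_derivative_transform_within_open[OF _ open_osq x]) (simp add: q(2))
 then show "cgrad (%x. x $ i * q x) x = axis i 1"
  by (simp add: vec_eq_iff cgrad_eq axis_def)
qed

text \<open>Inequalities known for each vector with its own null set are combined on a countable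
  dense set and extended by continuity.\<close>

lemma AE_forall_continuous:
 fixes f :: "plane => 'a::second_countable_topology => real"
 assumes f: "!!z. AE x in M. P x --> 0 <= f x z" and c: "!!x. continuous_on UNIV (f x)"
 shows "AE x in M. P x --> (ALL z. 0 <= f x z)"
proof -
 obtain B :: "'a set" where B: "countable B" "!!X. open X ==> X ~= {} ==> EX d:B. d : X" by (rule countable_dense_setE) (rule that)
 have "AE x in M. ALL z:B. P x --> 0 <= f x z" unfolding AE_ball_countable[OF B(1)] using f by blast
 then show ?thesis
 proof eventually_elim
  case (elim x)
  have "open (f x -` {..<0})" using c[of x] by (rule open_vimage[rotated]) simp
  then have "f x -` {..<0} = {}" if "P x" using B(2)[of "f x -` {..<0}"] elim that by force
  then show ?case by (force simp: not_less[symmetric])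
 qed
qed

text \<open>The second inequality, for all y, says |A z|^2 <= M (A z . z), as the choice y = A z / M
  shows. In the stated form both are affine in A for fixed z and y, so they can be obtained as
  limits.\<close>

definition good :: "real => real => mat2 => bool" where
 "good c M A = (ALL z y. c * (norm z)^2 <= (A *v z) \<bullet> z & 2 * ((A *v z) \<bullet> y) <= (A *v z) \<bullet> z + M * (norm y)^2)"

lemma good_scalar: assumes "c <= k" "0 <= k" "k <= M" shows "good c M (k *R mat 1)"
 unfolding good_def
proof (intro allI conjI)
 fix z y :: plane
 have k: "(k *R mat 1 :: mat2) *v z = k *R z" by (simp flip: scaleR_matrix_vector_assoc)
 show "c * (norm z)^2 <= ((k *R mat 1) *v z) \<bullet> z" using assms(1) by (simp add: k power2_norm_eq_inner mult_right_mono)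
 have "0 <= k * ((z - y) \<bullet> (z - y))" using assms(2) by simp
 moreover have "k * (y \<bullet> y) <= M * (y \<bullet> y)" by (rule mult_right_mono[OF assms(3)]) simp
 ultimately show "2 * (((k *R mat 1) *v z) \<bullet> y) <= ((k *R mat 1) *v z) \<bullet> z + M * (norm y)^2"
  by (simp add: k power2_norm_eq_inner inner_diff_left inner_diff_right inner_commute algebra_simps)
qed

lemma good_bound:
 assumes "good c M A" "M > 0"
 shows "(norm (A *v z))^2 <= M * ((A *v z) \<bullet> z)" "norm (A *v z) <= M * norm z"
proof -
 have "2 * ((A *v z) \<bullet> ((1 / M) *R (A *v z))) <= (A *v z) \<bullet> z + M * (norm ((1 / M) *R (A *v z)))^2" using assms(1) unfolding good_def by blast
 moreover have "M * (norm ((1 / M) *R (A *v z)))^2 = (norm (A *v z))^2 / M" using assms(2) by (simp add: power_mult_distrib power2_eq_square)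
 ultimately have "(norm (A *v z))^2 / M <= (A *v z) \<bullet> z" by (simp flip: power2_norm_eq_inner)
 then show s: "(norm (A *v z))^2 <= M * ((A *v z) \<bullet> z)" using assms(2) by (simp add: pos_divide_le_eq mult.commute)
 also have "... <= M * (norm (A *v z) * norm z)" using assms(2) by (intro mult_left_mono norm_cauchy_schwarz) auto
 finally show "norm (A *v z) <= M * norm z" using assms(2) by (cases "A *v z = 0") (auto simp: power2_eq_square)
qed

lemma weighted_young: assumes "0 <= c" shows "2 * (c * ((u::plane) \<bullet> v)) <= c * (u \<bullet> u) + c * (v \<bullet> v)"
proof -
 have "0 <= c * ((u - v) \<bullet> (u - v))" using assms by simp
 then show ?thesis by (simp add: inner_diff_left inner_diff_right inner_commute algebra_simps)
qed

context incl
begin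

text \<open>What the div-curl lemma asks of a sequence of fluxes, here with one fixed divergence and
  bounded energy, and of a sequence of gradients. The members of a \<open>prim\<close> sequence are
  merely curl-free and only the limit is in \<open>gsp Om\<close>, which admits the modified fields
  P.\<close>

definition dual :: "(nat => plane l2) => plane l2 => bool" where
 "dual D d = (wstar Om D d & (EX F E. ALL n. dfree Om (D n - F) & en n Om (D n - F) <= E))"
definition prim :: "(nat => plane l2) => plane l2 => bool" where
 "prim P p = (weak_conv P p & p : gsp Om & (EX M. ALL n. cfree Om (P n) & norm (P n) <= M))"

lemma dual_prim:
 "dual D d ==> prim P p ==> s > 0 ==> sqr c s <= Om ==> f : Ccinf (osq c s) ==> (%n. ip f (D n) (P n)) ----> ip f d p"
 unfolding dual_def prim_def by (elim conjE exE) (rule div_curl_limit; blast)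

lemma sol_dfree: assumes "adm n A c C" shows "dfree Om (opM A (sol Om A F) - F)"
 unfolding dfree_gsp using sol_eq[OF adm_bmat[OF assms]] by (auto simp: inner_diff_right inner_commute)

lemma sol_dual_prim:
 assumes A: "!!n. adm n (A n) c C"
 shows "wstar Om (%n. opM (A n) (sol Om (A n) F)) d ==> dual (%n. opM (A n) (sol Om (A n) F)) d"
  and "weak_conv (%n. sol Om (A n) F) p ==> prim (%n. sol Om (A n) F) p"
proof -
 have "norm (dn n (opM (A n) (sol Om (A n) F) - F)) <= C * norm F / c + norm F" for n
  using dn_lin[of n 1 "opM (A n) (sol Om (A n) F)" "- 1" F] norm_triangle_ineq4[of "dn n (opM (A n) (sol Om (A n) F))" "dn n F"] energy(2)[OF A, of n F] norm_dn[of n F] by simp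
 then have "en n Om (opM (A n) (sol Om (A n) F) - F) <= (C * norm F / c + norm F)^2" for n
  by (rule order_trans[OF en_dn power_mono]) simp
 then show "wstar Om (%n. opM (A n) (sol Om (A n) F)) d ==> dual (%n. opM (A n) (sol Om (A n) F)) d"
  unfolding dual_def using sol_dfree[OF A] by blast
 show "prim (%n. sol Om (A n) F) p" if "weak_conv (%n. sol Om (A n) F) p"
  unfolding prim_def using that gsp_weakly_closed[OF sol_gsp[OF adm_bmat[OF A]] that] gsp_cfree[OF sol_gsp[OF adm_bmat[OF A]]] sol_norm[OF adm_bmat[OF A]] by blast
qed

end

text \<open>A countable cover by squares with gradients \<open>px j i\<close> that equal the i-th
  unit vector on square j. \<open>Fc\<close> are corrector data and \<open>et\<close> the weak-star
  limits of the corrector fluxes, for all positive conductivities along the one sequence at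
  hand.\<close>

locale hom = incl +
 fixes c :: "nat => plane" and s :: "nat => real" and px :: "nat => 2 => plane l2"
  and Fc et :: "real \<times> real => nat => 2 => plane l2"
 assumes sq: "!!j. s j > 0" "!!j. sqr (c j) (s j) <= Om" "!!x. x : Om ==> EX j. x : osq (c j) (s j)"
  and px: "!!j i. AE x in lborel. x : osq (c j) (s j) --> fn (px j i) x = axis i 1"
  and cor: "!!g j i. fst g > 0 ==> snd g > 0 ==> weak_conv (%n. T n g (Fc g j i)) (px j i)"
   "!!g j i. fst g > 0 ==> snd g > 0 ==> wstar Om (%n. MT n g (Fc g j i)) (et g j i)"
begin

abbreviation "osj j == osq (c j) (s j)"

lemma osj_sub: "osj j <= Om" using osq_subset(2) sq(2) by blast

definition lc :: "plane => (2 => plane l2) => plane l2" where "lc v f = v $ 1 *R f 1 + v $ 2 *R f 2"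
text \<open>The candidate for the effective matrix on square j: its columns are the limit fluxes of
  the correctors whose gradients tend to the unit vectors.\<close>

definition H :: "real \<times> real => nat => plane => mat2" where "H g j x = (\<chi> k l. fn (et g j l) x $ k)"

lemma H_lc: "AE x in lborel. fn (lc z (et g j)) x = H g j x *v z"
 using fn_plus[of "z $ 1 *R et g j 1" "z $ 2 *R et g j 2"] fn_scaleR[of "z $ 1" "et g j 1"] fn_scaleR[of "z $ 2" "et g j 2"]
 unfolding lc_def by eventually_elim (simp add: H_def vec_eq_iff matrix_vector_mult_def sum_2 mult.commute)

lemma px_lc: "AE x in lborel. x : osj j --> fn (lc v (px j)) x = v"
 using fn_plus[of "v $ 1 *R px j 1" "v $ 2 *R px j 2"] fn_scaleR[of "v $ 1" "px j 1"] fn_scaleR[of "v $ 2" "px j 2"] px[of j 1] px[of j 2]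
 unfolding lc_def by eventually_elim (auto simp: vec_eq_iff forall_2 axis_def)

abbreviation "V n g j v == T n g (lc v (Fc g j))"
abbreviation "E n g j v == MT n g (lc v (Fc g j))"

lemma corrector:
 assumes g: "fst g > 0" "snd g > 0"
 shows "prim (%n. V n g j v) (lc v (px j))" "dual (%n. E n g j v) (lc v (et g j))"
proof -
 note A = mtx_adm'[OF g]
 have V: "V n g j v = v $ 1 *R T n g (Fc g j 1) + v $ 2 *R T n g (Fc g j 2)" for n
  unfolding lc_def by (rule sol_lin[OF adm_bmat[OF A]])
 have E: "E n g j v = v $ 1 *R MT n g (Fc g j 1) + v $ 2 *R MT n g (Fc g j 2)" for n
  unfolding V by (rule opM_lin[OF adm_bmat(1)[OF A]])
 have "weak_conv (%n. V n g j v) (lc v (px j))"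
  unfolding V unfolding lc_def by (intro weak_conv_add weak_conv_scaleR cor(1)[OF g])
 then show "prim (%n. V n g j v) (lc v (px j))" by (rule sol_dual_prim(2)[OF A])
 have "wstar Om (%n. E n g j v) (lc v (et g j))"
  using cor(2)[OF g] unfolding E unfolding lc_def wstar_iff by (auto simp: inner_add_left intro!: tendsto_add tendsto_mult_left)
 then show "dual (%n. E n g j v) (lc v (et g j))" by (rule sol_dual_prim(1)[OF A])
qed

lemma ip_px: assumes "f : Ccinf (osj j)" shows "ip f d (lc v (px j)) = (LBINT x. f x * (fn d x \<bullet> v))"
 unfolding ip_def
proof (rule integral_cong_AE)
 show "AE x in lborel. f x * (fn d x \<bullet> fn (lc v (px j)) x) = f x * (fn d x \<bullet> v)"
  using px_lc[of j v] by eventually_elim (use Ccinf_outside[OF assms] in auto)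
qed (use Ccinf_measurable[OF assms] in auto)

lemma ip_cor:
 assumes g: "fst g > 0" "snd g > 0" and g': "fst g' > 0" "snd g' > 0" and f: "f : Ccinf (osj j)"
 shows "(%n. ip f (E n g j v) (V n g' j z)) ----> (LBINT x. f x * (fn (lc v (et g j)) x \<bullet> z))"
 unfolding ip_px[OF f, symmetric] by (rule dual_prim[OF corrector(2)[OF g] corrector(1)[OF g'] sq(1,2) f])

lemma osj_Cc: "f : Ccinf (osj j) ==> f : Cc Om"
 using Ccinf_mono[OF _ osj_sub] Ccinf_subset_Cc by blast

lemma const_vec_Ccv: assumes "f : Cc Om" shows "(%x. f x *R (z :: plane)) : Ccv Om"
proof -
 have "(%x. f x * z $ i) : Cc Om" for i using Cc_lin[OF assms assms, of "z $ i" 0] by (simp add: mult.commute)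
 then show ?thesis by (simp add: Ccv_def)
qed

lemma inner_const_vec: "f : Cc Om ==> z \<bullet> L2of (%x. f x *R (y :: plane)) = (LBINT x. f x * (fn z x \<bullet> y))"
 by (subst inner_L2of_right[OF Ccv_sqint[OF const_vec_Ccv]]) auto

lemma const_vec_int: "f : Cc Om ==> integrable lborel (%x. f x * (fn z x \<bullet> (y :: plane)))"
 using sqint_inner_integrable[OF sqint_fn[of z] Ccv_sqint[OF const_vec_Ccv[of f y]]] by simp

lemma E_lim:
 assumes g: "fst g > 0" "snd g > 0" and f: "f : Cc Om"
 shows "(%n. LBINT x. f x * (fn (E n g j v) x \<bullet> z)) ----> (LBINT x. f x * (fn (lc v (et g j)) x \<bullet> z))"
 using corrector(2)[OF g, where j = j and v = v] const_vec_Ccv[OF f, of z] unfolding dual_def wstar_iff inner_const_vec[OF f, symmetric] by blast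

lemma V_lim:
 assumes g: "fst g > 0" "snd g > 0" and f: "f : Ccinf (osj j)"
 shows "(%n. LBINT x. f x * (fn (V n g j v) x \<bullet> z)) ----> (LBINT x. f x) * (v \<bullet> z)"
proof -
 have "(%n. V n g j v \<bullet> L2of (%x. f x *R z)) ----> lc v (px j) \<bullet> L2of (%x. f x *R z)"
  using corrector(1)[OF g, where j = j and v = v] by (simp add: prim_def weak_conv_def)
 moreover have "(LBINT x. f x * (fn (lc v (px j)) x \<bullet> z)) = (LBINT x. f x * (v \<bullet> z))"
  by (rule integral_cong_AE) (use px_lc[of j v] Ccinf_outside[OF f] Ccinf_measurable[OF f] in "auto elim!: eventually_mono")
 ultimately show ?thesis unfolding inner_const_vec[OF osj_Cc[OF f]] by simp
qed

lemma fn_E: "AE x in lborel. fn (E n g j v) x = (if x : w n then snd g / th n else fst g) *R fn (V n g j v) x" if "fst g > 0" "snd g > 0"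
 using fn_opM[OF adm_bmat(1)[OF mtx_adm'[OF that]], of n "V n g j v"] by (simp add: mtx_vec)

lemma test:
 fixes y z :: "plane l2"
 assumes t: "!!p. p : Ccinf (osj j) ==> (!!x. p x >= 0) ==>
   0 <= (LBINT x. p x * (fn y x \<bullet> m)) + (LBINT x. p x * (fn z x \<bullet> l)) + k * (LBINT x. p x)"
 shows "AE x in lborel. x : osj j --> 0 <= fn y x \<bullet> m + fn z x \<bullet> l + k"
proof -
 let ?f = "%x. fn y x \<bullet> m + fn z x \<bullet> l + k * indicator Om x"
 have si: "sqint (%x. fn u x \<bullet> v)" for u :: "plane l2" and v
  by (rule sqint_bound[of _ "fn u" "norm v"]) (auto simp: Cauchy_Schwarz_ineq2 mult.commute[of "norm v"])
 have so: "sqint (%x. k * indicator Om x)" by (rule sqint_bounded_indicator[of _ "abs k", OF _ _ bd]) (use op in "auto simp: indicator_def")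
 have "AE x in lborel. x : osj j --> ?f x >= 0"
 proof (rule AE_nonneg_if_conv_nonneg[OF _ open_osq])
  show "sqint ?f" by (intro sqint_add si so)
  fix x e assume e: "0 < e" "cball x e <= osj j"
  note p = Ccinf_affine_mol[OF e]
  have o: "mol e (x - y) * (k * indicator Om y) = k * mol e (x - y)" for y
   using Cc_outside[OF osj_Cc[OF p], of y] by (cases "y : Om") auto
  have "conv (mol e) ?f x = (LBINT u. mol e (x - u) * (fn y u \<bullet> m) + mol e (x - u) * (fn z u \<bullet> l) + k * mol e (x - u))"
   unfolding conv_def distrib_left o ..
  also have "... = (LBINT u. mol e (x - u) * (fn y u \<bullet> m)) + (LBINT u. mol e (x - u) * (fn z u \<bullet> l)) + k * (LBINT u. mol e (x - u))"
   using const_vec_int[OF osj_Cc[OF p]] Cc_int[OF osj_Cc[OF p]] by simp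
  finally show "0 <= conv (mol e) ?f x" using t[OF p] mol_nonneg by simp
 qed
 then show ?thesis by eventually_elim (use subsetD[OF osj_sub, of _ j] in auto)
qed

text \<open>The conductivity is at most \<open>fst g\<close> plus \<open>snd g\<close> times \<chi>
  / \<theta>, and the weak-star limit of this sum is bounded by this number.\<close>

definition MM :: "real \<times> real => real" where "MM g = fst g + snd g * Ma"

abbreviation "mm n g x == (if x : w n then snd g / th n else fst g)"

text \<open>A pointwise inequality for corrector gradients u, u' and their fluxes is integrated
  against a nonnegative test function. Products of fluxes and gradients, also mixed ones for
  different conductivities, converge by the div-curl lemma, the other terms weakly. The parameters
  cover the lower bound, the upper bound and the Lipschitz estimate at once.\<close>

lemma limit_form:
 assumes g: "fst g > 0" "snd g > 0" and g': "fst g' > 0" "snd g' > 0" and C: "0 <= C2"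
  and pw: "!!n x u u'. 0 <= mm n g x * (u \<bullet> (p *R u - q *R u' + \<mu>)) + mm n g' x * (u' \<bullet> (p *R u' + q *R u)) + u \<bullet> \<nu> + C1 + C2 * (indicator (w n) x / th n)"
 shows "AE x in lborel. x : osj j --> 0 <= (H g j x *v m) \<bullet> (p *R m - q *R \<zeta> + \<mu>) + (H g' j x *v \<zeta>) \<bullet> (p *R \<zeta> + q *R m) + (m \<bullet> \<nu> + C1 + C2 * Ma)"
proof -
 let ?h = "fn (lc m (et g j))" and ?h' = "fn (lc \<zeta> (et g' j))"
 have "AE x in lborel. x : osj j --> 0 <= ?h x \<bullet> (p *R m - q *R \<zeta> + \<mu>) + ?h' x \<bullet> (p *R \<zeta> + q *R m) + (m \<bullet> \<nu> + C1 + C2 * Ma)"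
 proof (rule test)
  fix f assume f: "f : Ccinf (osj j)" "!!x. f x >= 0"
  note fc = osj_Cc[OF f(1)]
  let ?v = "%n. V n g j m" and ?v' = "%n. V n g' j \<zeta>" and ?e = "%n. E n g j m" and ?e' = "%n. E n g' j \<zeta>"
  define X where "X n x = f x * (indicator (w n) x / th n)" for n x
  let ?i = "%y z x. f x * (fn y x \<bullet> fn z x)" and ?k = "%y z x. f x * (fn y x \<bullet> z)"
  have iX: "integrable lborel (X n)" for n unfolding X_def
   by (rule Cc_bounded_int[OF fc, of _ "1 / th n"]) (use th(2)[of n] in "auto simp: indicator_def")
  note int = ip_integrable[OF fc] const_vec_int[OF fc] Cc_int[OF fc] iX
  let ?Q = "%a1 a2 a3 a4 b c d e :: real. p * (a1 + a2) + q * (a3 - a4) + b + c + C1 * d + C2 * e"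
  let ?S = "%n. ?Q (ip f (?e n) (?v n)) (ip f (?e' n) (?v' n)) (ip f (?e' n) (?v n)) (ip f (?e n) (?v' n))
   (integral\<^sup>L lborel (?k (?e n) \<mu>)) (integral\<^sup>L lborel (?k (?v n) \<nu>)) (integral\<^sup>L lborel f) (integral\<^sup>L lborel (X n))"
  have "0 <= ?S n" for n
  proof -
   have "?S n = (LBINT x. ?Q (?i (?e n) (?v n) x) (?i (?e' n) (?v' n) x) (?i (?e' n) (?v n) x) (?i (?e n) (?v' n) x) (?k (?e n) \<mu> x) (?k (?v n) \<nu> x) (f x) (X n x))"
    by (simp add: ip_def int)
   also have "... >= 0"
   proof (rule integral_nonneg_AE)
    show "AE x in lborel. 0 <= ?Q (?i (?e n) (?v n) x) (?i (?e' n) (?v' n) x) (?i (?e' n) (?v n) x) (?i (?e n) (?v' n) x) (?k (?e n) \<mu> x) (?k (?v n) \<nu> x) (f x) (X n x)"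
     using fn_E[OF g, where n = n and j = j and v = m] fn_E[OF g', where n = n and j = j and v = \<zeta>]
    proof eventually_elim
     case (elim x)
     from mult_nonneg_nonneg[OF f(2)[of x] pw[where n = n and x = x and u = "fn (?v n) x" and u' = "fn (?v' n) x"]] show ?case
      unfolding elim inner_scaleR_left X_def by (simp only: inner_simps inner_commute algebra_simps)
    qed
   qed
   finally show ?thesis .
  qed
  moreover have "?S ----> ?Q (integral\<^sup>L lborel (?k (lc m (et g j)) m)) (integral\<^sup>L lborel (?k (lc \<zeta> (et g' j)) \<zeta>)) (integral\<^sup>L lborel (?k (lc \<zeta> (et g' j)) m))
   (integral\<^sup>L lborel (?k (lc m (et g j)) \<zeta>)) (integral\<^sup>L lborel (?k (lc m (et g j)) \<mu>)) (integral\<^sup>L lborel f * (m \<bullet> \<nu>)) (integral\<^sup>L lborel f) (LBINT x. f x * a x)"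
   by (intro tendsto_add tendsto_diff tendsto_mult_left tendsto_const ip_cor g g' f(1) V_lim[OF g f(1)] E_lim[OF g fc] conv[OF fc, folded X_def])
  ultimately have l: "0 <= ?Q (integral\<^sup>L lborel (?k (lc m (et g j)) m)) (integral\<^sup>L lborel (?k (lc \<zeta> (et g' j)) \<zeta>)) (integral\<^sup>L lborel (?k (lc \<zeta> (et g' j)) m))
   (integral\<^sup>L lborel (?k (lc m (et g j)) \<zeta>)) (integral\<^sup>L lborel (?k (lc m (et g j)) \<mu>)) (integral\<^sup>L lborel f * (m \<bullet> \<nu>)) (integral\<^sup>L lborel f) (LBINT x. f x * a x)"
   using LIMSEQ_le_const by blast
  have "(LBINT x. f x * a x) <= (LBINT x. f x * Ma)"
   by (rule integral_mono) (use Cc_bounded_int[OF fc a] Cc_int[OF fc] a(2) f(2) in "auto simp: abs_le_iff intro!: mult_left_mono")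
  from mult_left_mono[OF this C] have a: "C2 * (LBINT x. f x * a x) <= C2 * (integral\<^sup>L lborel f * Ma)" by simp
  have k: "integral\<^sup>L lborel (?k y (b1 *R z1 + b2 *R z2 + b3 *R z3)) = b1 * integral\<^sup>L lborel (?k y z1) + b2 * integral\<^sup>L lborel (?k y z2) + b3 * integral\<^sup>L lborel (?k y z3)" for y and z1 z2 z3 :: plane and b1 b2 b3
  proof -
   have "?k y (b1 *R z1 + b2 *R z2 + b3 *R z3) = (%x. b1 * ?k y z1 x + b2 * ?k y z2 x + b3 * ?k y z3 x)" by (simp add: inner_add_right algebra_simps)
   then show ?thesis by (simp add: int)
  qed
  show "0 <= integral\<^sup>L lborel (?k (lc m (et g j)) (p *R m - q *R \<zeta> + \<mu>)) + integral\<^sup>L lborel (?k (lc \<zeta> (et g' j)) (p *R \<zeta> + q *R m)) + (m \<bullet> \<nu> + C1 + C2 * Ma) * integral\<^sup>L lborel f"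
   using l a k[of "lc m (et g j)" p m "- q" \<zeta> 1 \<mu>] k[of "lc \<zeta> (et g' j)" p \<zeta> q m 0 0] by (simp add: algebra_simps)
 qed
 then show ?thesis using H_lc[of m g j] H_lc[of \<zeta> g' j] by eventually_elim simp
qed

text \<open>With c the smaller component of g, mm |u|^2 >= c |u|^2 >= 2 c u . z - c |z|^2. The right
  side is affine in the corrector gradient u, whose weak limit on the square is z.\<close>

lemma H_lower:
 assumes g: "fst g > 0" "snd g > 0"
 shows "AE x in lborel. x : osj j --> (ALL z. 0 <= (H g j x *v z) \<bullet> z - min (fst g) (snd g) * (norm z)^2)"
proof (rule AE_forall_continuous)
 fix z let ?c = "min (fst g) (snd g)"
 have "AE x in lborel. x : osj j --> 0 <= (H g j x *v z) \<bullet> (1 *R z - 0 *R 0 + 0) + (H g j x *v 0) \<bullet> (1 *R 0 + 0 *R z) + (z \<bullet> ((- 2 * ?c) *R z) + ?c * (z \<bullet> z) + 0 * Ma)"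
 proof (rule limit_form[OF g g order_refl])
  fix n x and u u' :: plane
  have "?c * th n <= snd g * 1" using g th(2,3)[of n] by (intro mult_mono) auto
  then have "?c <= mm n g x" using th(2)[of n] by (cases "x : w n") (simp_all add: pos_le_divide_eq)
  then have "?c * (u \<bullet> u) <= mm n g x * (u \<bullet> u)" "0 <= mm n g x * (u' \<bullet> u')" using g th(2)[of n] by (intro mult_right_mono mult_nonneg_nonneg; simp)+
  moreover have "2 * (?c * (u \<bullet> z)) <= ?c * (u \<bullet> u) + ?c * (z \<bullet> z)" using g by (intro weighted_young) auto
  ultimately show "0 <= mm n g x * (u \<bullet> (1 *R u - 0 *R u' + 0)) + mm n g x * (u' \<bullet> (1 *R u' + 0 *R u)) + u \<bullet> ((- 2 * ?c) *R z) + ?c * (z \<bullet> z) + 0 * (indicator (w n) x / th n)"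
   by simp
 qed
 then show "AE x in lborel. x : osj j --> 0 <= (H g j x *v z) \<bullet> z - ?c * (norm z)^2"
  by (simp add: power2_norm_eq_inner mult.commute)
qed (intro continuous_intros matrix_vector_mult_linear_continuous_on)

text \<open>Young's inequality 2 mm u . y <= mm |u|^2 + mm |y|^2 with a constant vector y: the left
  side is linear in the flux, the first product is covered by the div-curl lemma and the last term
  by the weak-star bound on the conductivity.\<close>

lemma H_upper:
 assumes g: "fst g > 0" "snd g > 0"
 shows "AE x in lborel. x : osj j --> (ALL z. 0 <= (H g j x *v fst z) \<bullet> fst z + MM g * (norm (snd z))^2 - 2 * ((H g j x *v fst z) \<bullet> snd z))"
proof (rule AE_forall_continuous)
 fix z :: "plane \<times> plane" obtain l y where z: "z = (l, y)" by (cases z)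
 have "AE x in lborel. x : osj j --> 0 <= (H g j x *v l) \<bullet> (1 *R l - 0 *R 0 + (-2) *R y) + (H g j x *v 0) \<bullet> (1 *R 0 + 0 *R l) + (l \<bullet> 0 + fst g * (y \<bullet> y) + (snd g * (y \<bullet> y)) * Ma)"
 proof (rule limit_form[OF g g])
  show "0 <= snd g * (y \<bullet> y)" using g by simp
  fix n x and u u' :: plane
  let ?k = "fst g + snd g * (indicator (w n) x / th n)"
  have "0 <= mm n g x" "mm n g x <= ?k" using g th(2)[of n] by auto
  then have "2 * (mm n g x * (u \<bullet> y)) <= mm n g x * (u \<bullet> u) + mm n g x * (y \<bullet> y)" "mm n g x * (y \<bullet> y) <= ?k * (y \<bullet> y)" "0 <= mm n g x * (u' \<bullet> u')"
   by (intro weighted_young mult_right_mono mult_nonneg_nonneg; simp)+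
  then show "0 <= mm n g x * (u \<bullet> (1 *R u - 0 *R u' + (-2) *R y)) + mm n g x * (u' \<bullet> (1 *R u' + 0 *R u)) + u \<bullet> 0 + fst g * (y \<bullet> y) + (snd g * (y \<bullet> y)) * (indicator (w n) x / th n)"
   by (simp add: inner_diff_right algebra_simps del: if_split)
 qed
 then show "AE x in lborel. x : osj j --> 0 <= (H g j x *v fst z) \<bullet> fst z + MM g * (norm (snd z))^2 - 2 * ((H g j x *v fst z) \<bullet> snd z)"
  by (simp add: z MM_def inner_diff_right power2_norm_eq_inner algebra_simps)
qed (intro continuous_intros matrix_vector_mult_linear_continuous_on continuous_on_compose2[OF matrix_vector_mult_linear_continuous_on], auto)

end

lemma Jmat_vec: "Jmat *v z = Jv z"
 by (simp add: Jmat_def vec_eq_iff forall_2 matrix_vector_mult_def sum_2 vector_def)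

definition rot :: "real => real => mat2" where "rot p q = p *R mat 1 + q *R Jmat"

lemma rot_vec: "rot p q *v z = p *R z + q *R Jv z"
 by (simp add: rot_def matrix_vector_mult_add_rdistrib Jmat_vec flip: scaleR_matrix_vector_assoc)

lemma rot_inner: "(rot p q *v z) \<bullet> z = p * (z \<bullet> z)"
 by (simp add: rot_vec plane_inner algebra_simps)

lemma rot_norm: "(norm (rot p q *v z))^2 = (p^2 + q^2) * (norm z)^2"
 unfolding rot_vec power2_norm_eq_inner plane_inner by (simp add: power2_eq_square algebra_simps)

lemma Jv_lin: "Jv (p *R v + q *R z) = p *R Jv v + q *R Jv z" "Jv (v - z) = Jv v - Jv z" "Jv (Jv v) = - v"
 by (simp_all add: vec_eq_iff forall_2)

lemma positive_limit_bounds: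
 fixes f :: "nat => real"
 assumes "!!n. f n > 0" "f ----> l" "l > 0"
 obtains k K where "k > 0" "!!n. k <= f n" "!!n. f n <= K"
proof -
 have "(%n. inverse (f n)) ----> inverse l" by (rule tendsto_inverse[OF assms(2)]) (use assms(3) in simp)
 then obtain A where A: "A > 0" "!!n. norm (inverse (f n)) <= A" by (meson BseqE convergentI convergent_imp_Bseq)
 obtain B where B: "B > 0" "!!n. norm (f n) <= B" using assms(2) by (meson BseqE convergentI convergent_imp_Bseq)
 have "1 / A <= f n" for n using A(1) A(2)[of n] assms(1)[of n] by (simp add: field_simps)
 then show ?thesis using that[of "1 / A" B] A(1) B(2) by (simp add: abs_le_iff)
qed

context hom
begin

text \<open>Relative to \<open>kap n\<close> the conductivities are at least k and differ by at most
  r, so 2 k |mm - mm'| |u . u'| <= r (mm |u|^2 + mm' |u'|^2). In the limit this bounds H z . y - H'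
  y . z, with H and H' the matrices of g and g'; g = g' and r = 0 give the symmetry of H.\<close>

lemma H_lip:
 assumes g: "fst g > 0" "snd g > 0" and g': "fst g' > 0" "snd g' > 0"
  and k: "0 < k" "k <= fst g" "k <= snd g" "k <= fst g'" "k <= snd g'" and r: "abs (fst g - fst g') <= r" "abs (snd g - snd g') <= r"
 shows "AE x in lborel. x : osj j --> (ALL z. 0 <= (H g j x *v fst z) \<bullet> (r *R fst z - (2 * k) *R snd z) + (H g' j x *v snd z) \<bullet> (r *R snd z + (2 * k) *R fst z))"
proof (rule AE_forall_continuous)
 fix z :: "plane \<times> plane" obtain l y where z: "z = (l, y)" by (cases z)
 have r0: "r >= 0" using r by linarith
 have "AE x in lborel. x : osj j --> 0 <= (H g j x *v l) \<bullet> (r *R l - (2 * k) *R y + 0) + (H g' j x *v y) \<bullet> (r *R y + (2 * k) *R l) + (l \<bullet> 0 + 0 + 0 * Ma)"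
 proof (rule limit_form[OF g g' order_refl])
  fix n x and u u' :: plane
  let ?m = "mm n g x" and ?m' = "mm n g' x" and ?s = "u \<bullet> u + u' \<bullet> u'"
  have m: "k * kap n x <= ?m" "k * kap n x <= ?m'" "abs (?m - ?m') <= r * kap n x"
   using k r th(2)[of n] by (auto simp: kap_def divide_right_mono simp flip: diff_divide_distrib)
  have "abs (2 * (u \<bullet> u')) <= ?s"
   using weighted_young[of 1 u u'] weighted_young[of 1 "- u" u'] by (simp add: abs_le_iff)
  then have "abs (?m - ?m') * abs (2 * (u \<bullet> u')) <= (r * kap n x) * ?s" using m(3) by (intro mult_mono) auto
  then have "(?m - ?m') * (2 * (u \<bullet> u')) <= (r * kap n x) * ?s" unfolding abs_mult[symmetric] by linarith
  then have "k * ((?m - ?m') * (2 * (u \<bullet> u'))) <= k * ((r * kap n x) * ?s)" using k(1) by (intro mult_left_mono) auto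
  also have "... = r * ((k * kap n x) * (u \<bullet> u) + (k * kap n x) * (u' \<bullet> u'))" by (simp add: algebra_simps)
  also have "... <= r * (?m * (u \<bullet> u) + ?m' * (u' \<bullet> u'))" by (intro mult_left_mono add_mono mult_right_mono m r0) auto
  finally show "0 <= ?m * (u \<bullet> (r *R u - (2 * k) *R u' + 0)) + ?m' * (u' \<bullet> (r *R u' + (2 * k) *R u)) + u \<bullet> 0 + 0 + 0 * (indicator (w n) x / th n)"
   by (simp add: inner_diff_right inner_add_right inner_commute[of u' u] algebra_simps del: if_split)
 qed
 then show "AE x in lborel. x : osj j --> 0 <= (H g j x *v fst z) \<bullet> (r *R fst z - (2 * k) *R snd z) + (H g' j x *v snd z) \<bullet> (r *R snd z + (2 * k) *R fst z)"
  by (simp add: z)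
qed (intro continuous_intros continuous_on_compose2[OF matrix_vector_mult_linear_continuous_on], auto)

definition symm :: "mat2 => bool" where "symm A = (ALL z y. (A *v z) \<bullet> y = (A *v y) \<bullet> z)"

abbreviation "gs g A == good (min (fst g) (snd g)) (MM g) A & symm A"

lemma AE_gs:
 assumes g: "fst g > 0" "snd g > 0"
 shows "AE x in lborel. ALL j. x : osj j --> gs g (H g j x)"
 unfolding AE_all_countable
proof
 fix j
 have "min (fst g) (snd g) > 0" using g by simp
 \<comment> \<open>The Lipschitz estimate between g and itself with r = 0 gives one half of the
   symmetry; exchanging z and y gives the other.\<close>
 from H_lower[OF g, of j] H_upper[OF g, of j] H_lip[OF g g this, of 0 j, simplified]
 show "AE x in lborel. x : osj j --> gs g (H g j x)"
 proof eventually_elim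
  case (elim x)
  show ?case
  proof
   assume x: "x : osj j"
   have "(H g j x *v z) \<bullet> y <= (H g j x *v y) \<bullet> z" for z y
    using elim(3) x `min (fst g) (snd g) > 0` by (auto dest!: spec[of _ z] spec[of _ y] simp: mult_le_cancel_left_pos simp flip: mult.assoc)
   then have "symm (H g j x)" unfolding symm_def by (meson order_antisym)
   moreover have "2 * ((H g j x *v z) \<bullet> y) <= (H g j x *v z) \<bullet> z + MM g * (norm y)^2" for z y
    using elim(2)[rule_format, OF x, of "(z, y)"] by simp
   ultimately show "gs g (H g j x)" using elim(1)[rule_format, OF x] unfolding good_def by simp
  qed
 qed
qed

text \<open>Off the null set \<open>NN g\<close> all bounds hold on every square. On it, and outside
  the square, a scalar matrix with the same bounds is substituted, so that \<open>bmat\<close> and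
  \<open>coercive\<close> hold at every point. \<open>B\<close> glues the pieces by taking the first
  square that contains the point.\<close>

definition NN :: "real \<times> real => plane set" where
 "NN g = (SOME N. N : null_sets lborel & (ALL x. x ~: N --> (ALL j. x : osj j --> gs g (H g j x))))"
definition Bj :: "real \<times> real => nat => plane => mat2" where
 "Bj g j x = (if x : osj j - NN g then H g j x else fst g *R mat 1)"
definition B :: "real \<times> real => plane => mat2" where "B g x = Bj g (LEAST j. x : osj j) x"

lemma NN:
 assumes g: "fst g > 0" "snd g > 0"
 shows "NN g : null_sets lborel" "!!x j. x ~: NN g ==> x : osj j ==> gs g (H g j x)"
proof -
 obtain N where "{x : space lborel. \<not> (ALL j. x : osj j --> gs g (H g j x))} <= N" "emeasure lborel N = 0" "N : sets lborel"
  by (rule AE_E[OF AE_gs[OF g]])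
 then have "N : null_sets lborel & (ALL x. x ~: N --> (ALL j. x : osj j --> gs g (H g j x)))" by (auto simp: null_sets_def)
 then have "NN g : null_sets lborel & (ALL x. x ~: NN g --> (ALL j. x : osj j --> gs g (H g j x)))" unfolding NN_def by (rule someI)
 then show "NN g : null_sets lborel" "!!x j. x ~: NN g ==> x : osj j ==> gs g (H g j x)" by auto
qed

lemma MM_pos: assumes "fst g > 0" "snd g > 0" shows "MM g > 0" "fst g <= MM g"
 using assms Ma_nonneg by (auto simp: MM_def add_pos_nonneg)

lemma Bj_gs: assumes g: "fst g > 0" "snd g > 0" shows "gs g (Bj g j x)"
proof (cases "x : osj j - NN g")
 case False
 have "symm (fst g *R mat 1)" by (simp add: symm_def inner_commute flip: scaleR_matrix_vector_assoc)
 then show ?thesis using False g MM_pos[OF g] good_scalar[of "min (fst g) (snd g)" "fst g" "MM g"] by (auto simp: Bj_def)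
qed (use NN(2)[OF g] in "simp add: Bj_def")

lemma H_meas: "H g j : borel_measurable borel"
 unfolding H_def[abs_def]
 by (intro borel_measurable_euclidean_space[THEN iffD2]) (auto simp: Basis_vec_def inner_axis intro!: nth_measurable)

lemma Bj_meas: assumes g: "fst g > 0" "snd g > 0" shows "Bj g j : borel_measurable borel"
proof -
 have "osj j - NN g : sets borel" using NN(1)[OF g] open_osq by (auto simp: null_sets_def)
 then show ?thesis unfolding Bj_def[abs_def] using H_meas by (intro measurable_If_set) auto
qed

lemma B_gs: "fst g > 0 ==> snd g > 0 ==> gs g (B g x)" unfolding B_def by (rule Bj_gs)

lemma B_meas: assumes g: "fst g > 0" "snd g > 0" shows "B g : borel_measurable borel"
 unfolding B_def[abs_def]
proof (rule measurable_compose_countable[OF Bj_meas[OF g]])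
 have [measurable]: "osj j : sets borel" for j using open_osq by (rule borel_open)
 show "(%x. LEAST j. x : osj j) : measurable borel (count_space UNIV)" by measurable
qed

lemma B_bmat: assumes g: "fst g > 0" "snd g > 0" shows "bmat (B g) (MM g)" "coercive (B g) (min (fst g) (snd g))"
 and Bj_bmat: "bmat (Bj g j) (MM g)"
 using B_meas[OF g] Bj_meas[OF g] MM_pos(1)[OF g] g B_gs[OF g]
  good_bound(2)[OF conjunct1[OF B_gs[OF g]] MM_pos(1)[OF g]] good_bound(2)[OF conjunct1[OF Bj_gs[OF g]] MM_pos(1)[OF g]]
 by (auto simp: bmat_def coercive_def good_def)

lemma B_cases: assumes "x : Om" obtains j where "x : osj j" "B g x = Bj g j x"
 by (rule that[OF LeastI_ex[OF sq(3)[OF assms]]]) (simp add: B_def)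

text \<open>The bilinear estimate becomes a norm estimate through the test vector y of length |u| in
  the direction of (B g - B g') u; the symmetry of \<open>B g'\<close> brings both terms into this
  difference.\<close>

lemma B_lip:
 assumes g: "fst g > 0" "snd g > 0" and g': "fst g' > 0" "snd g' > 0"
  and k: "0 < k" "k <= fst g" "k <= snd g" "k <= fst g'" "k <= snd g'" and r: "abs (fst g - fst g') <= r" "abs (snd g - snd g') <= r"
 shows "AE x in lborel. x : Om --> (ALL u. 2 * k * norm ((B g x - B g' x) *v u) <= r * (MM g + MM g') * norm u)"
proof -
 have "AE x in lborel. ALL j. x : osj j --> (ALL z. 0 <= (H g j x *v fst z) \<bullet> (r *R fst z - (2 * k) *R snd z) + (H g' j x *v snd z) \<bullet> (r *R snd z + (2 * k) *R fst z))"
  unfolding AE_all_countable using H_lip[OF assms] by blast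
 moreover have "AE x in lborel. x ~: NN g" "AE x in lborel. x ~: NN g'" using NN(1)[OF g] NN(1)[OF g'] by (auto intro: AE_not_in)
 ultimately show ?thesis
 proof eventually_elim
  case (elim x)
  show ?case
  proof (intro impI allI)
   fix u assume x: "x : Om"
   define j where "j = (LEAST j. x : osj j)"
   have j: "x : osj j" unfolding j_def using sq(3)[OF x] by (rule LeastI_ex)
   have B: "B g x = H g j x" "B g' x = H g' j x" using j elim(2,3) by (auto simp: B_def Bj_def simp flip: j_def)
   have r0: "r >= 0" using r by linarith
   define d where "d = (B g x - B g' x) *v u"
   have bd: "(B g x *v u) \<bullet> u <= MM g * norm u * norm u" if "fst g > 0" "snd g > 0" for g u
    using norm_cauchy_schwarz[of "B g x *v u" u] mult_right_mono[of "norm (B g x *v u)" "MM g * norm u" "norm u"] B_bmat(1)[OF that] by (auto simp: bmat_def)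
   show "2 * k * norm ((B g x - B g' x) *v u) <= r * (MM g + MM g') * norm u"
   proof (cases "d = 0 \<or> u = 0")
    case False
    then have pos: "norm d > 0" "norm u > 0" by auto
    define y where "y = (norm u / norm d) *R d"
    have n: "norm y = norm u" using pos by (simp add: y_def)
    have "0 <= (B g x *v u) \<bullet> (r *R u - (2 * k) *R y) + (B g' x *v y) \<bullet> (r *R y + (2 * k) *R u)"
     using elim(1)[rule_format, OF j, of "(u, y)"] unfolding B by simp
    also have "... = r * ((B g x *v u) \<bullet> u + (B g' x *v y) \<bullet> y) - 2 * k * ((B g x *v u) \<bullet> y - (B g' x *v y) \<bullet> u)" by (simp add: inner_diff_right inner_add_right algebra_simps)
    also have "(B g' x *v y) \<bullet> u = (B g' x *v u) \<bullet> y" using B_gs[OF g'] by (simp add: symm_def)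
    also have "(B g x *v u) \<bullet> y - (B g' x *v u) \<bullet> y = d \<bullet> y" by (simp add: d_def matrix_vector_mult_diff_rdistrib inner_diff_left)
    also have "d \<bullet> y = norm u * norm d" using pos by (simp add: y_def power2_norm_eq_inner[symmetric] power2_eq_square)
    finally have "2 * k * (norm u * norm d) <= r * ((B g x *v u) \<bullet> u + (B g' x *v y) \<bullet> y)" by simp
    also have "... <= r * (MM g * norm u * norm u + MM g' * norm u * norm u)" using bd[OF g, of u] bd[OF g', of y] n by (intro mult_left_mono r0) auto
    finally have "norm u * (2 * k * norm d) <= norm u * (r * (MM g + MM g') * norm u)" by (simp add: algebra_simps)
    then show ?thesis using pos by (simp add: d_def)
   qed (use r0 MM_pos(1)[OF g] MM_pos(1)[OF g'] in "auto simp: d_def")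
  qed
 qed
qed

end

section \<open>Identification of the limit\<close>

text \<open>The conductivity after removal of the constant antisymmetric part of the host phase: the
  host is the scalar p, the inclusions are q + b J.\<close>

definition phase :: "plane set => real => real => real => plane => mat2" where
 "phase W p q b x = (if x : W then rot q b else rot p 0)"

text \<open>Squaring costs the factor 3 of (p + q + r)^2 <= 3 (p^2 + q^2 + r^2), rounded up to 4 =
  2^2.\<close>

lemma norm_l2_mono3:
 fixes x y v z :: "'a::euclidean_space l2"
 assumes "AE t in lborel. norm (fn z t) <= d * (norm (fn x t) + norm (fn y t) + norm (fn v t))" "d >= 0"
 shows "norm z <= 2 * d * (norm x + norm y + norm v)"
proof (rule power2_le_imp_le)
 have s3: "(p + q + r)^2 <= 3 * (p^2 + q^2 + r^2)" for p q r :: real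
  using zero_le_power2[of "p - q"] zero_le_power2[of "q - r"] zero_le_power2[of "p - r"] by (simp add: power2_eq_square algebra_simps)
 have i: "integrable lborel (%t. (norm (fn u t))^2)" for u :: "'a l2" by (rule sqint_integrable_sq[OF sqint_fn])
 have "(norm z)^2 <= (LBINT t. 3 * d^2 * ((norm (fn x t))^2 + (norm (fn y t))^2 + (norm (fn v t))^2))" unfolding norm_sq_fn
 proof (rule integral_mono_AE)
  show "AE t in lborel. (norm (fn z t))^2 <= 3 * d^2 * ((norm (fn x t))^2 + (norm (fn y t))^2 + (norm (fn v t))^2)" using assms(1)
  proof eventually_elim
   case (elim t)
   have "(norm (fn z t))^2 <= d^2 * (norm (fn x t) + norm (fn y t) + norm (fn v t))^2" using power_mono[OF elim, of 2] by (simp add: power_mult_distrib)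
   also have "... <= d^2 * (3 * ((norm (fn x t))^2 + (norm (fn y t))^2 + (norm (fn v t))^2))" by (intro mult_left_mono s3) simp
   finally show ?case by (simp only: mult_ac)
  qed
 qed (use i in auto)
 also have "... = 3 * d^2 * ((norm x)^2 + (norm y)^2 + (norm v)^2)" using i by (simp add: norm_sq_fn)
 also have "... <= 4 * d^2 * (norm x + norm y + norm v)^2"
  by (intro mult_mono) (auto simp: power2_eq_square algebra_simps)
 finally show "(norm z)^2 <= (2 * d * (norm x + norm y + norm v))^2" by (simp add: power_mult_distrib)
qed (use assms(2) in simp)

context incl
begin

lemma phase_adm:
 assumes k: "0 < k" "k <= p" "k <= th n * q" and C: "p <= C" "th n * q + th n * abs b <= C"
 shows "adm n (phase (w n) p q b) k C"
 unfolding adm_def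
proof (intro conjI allI)
 show "phase (w n) p q b : borel_measurable borel" unfolding phase_def[abs_def] by measurable
 have th: "th n > 0" by (rule th)
 have q: "q > 0" using k th by (meson less_le_trans zero_less_mult_pos)
 have rn: "norm (rot p' q' *v z) <= (abs p' + abs q') * norm z" for p' q' z
  using norm_triangle_ineq[of "p' *R z" "q' *R Jv z"] by (simp add: rot_vec distrib_right)
 fix x z
 show "k * kap n x * (norm z)^2 <= (phase (w n) p q b x *v z) \<bullet> z"
  using k th mult_right_mono[OF k(3) inner_ge_zero[of z]]
  by (auto simp: phase_def rot_inner kap_def power2_norm_eq_inner pos_divide_le_eq mult_ac intro!: mult_right_mono)
 have "(abs q + abs b) * norm z <= C * (1 / th n) * norm z"
  using C(2) q th by (intro mult_right_mono) (auto simp: pos_le_divide_eq algebra_simps)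
 moreover have "(abs p + abs 0) * norm z <= C * 1 * norm z" using C k by (intro mult_right_mono) auto
 ultimately show "norm (phase (w n) p q b x *v z) <= C * kap n x * norm z"
  using rn[of q b z] rn[of p 0 z] by (auto simp: phase_def kap_def)
qed (use k C in auto)

text \<open>In the inclusions t^2 (q^2 + b^2) is at most 1, which equals \<theta> times
  \<open>kap n\<close> there; outside, the flux is p U. Hence t D is small in L^2 although D itself
  is controlled uniformly only in the dual norm.\<close>

lemma phase_small:
 assumes A: "bmat (phase (w n) p q b) K" and q: "q > 0" and t: "t = b / (q^2 + b^2)"
 shows "norm (t *R opM (phase (w n) p q b) U) <= sqrt (th n + t^2 * p^2) * norm (up n U)"
proof (rule norm_l2_mono)
 show "AE x in lborel. norm (fn (t *R opM (phase (w n) p q b) U) x) <= sqrt (th n + t^2 * p^2) * norm (fn (up n U) x)"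
  using fn_scaleR[of t "opM (phase (w n) p q b) U"] fn_opM[OF A, of U] fn_up[of n U]
 proof eventually_elim
  case (elim x)
  let ?u = "fn U x" let ?s = "if x : w n then q\<^sup>2 + b^2 else p\<^sup>2"
  have th: "th n > 0" by (rule th)
  have k: "kap n x > 0" by (rule ka_pos)
  have "t^2 * (q^2 + b^2) <= 1"
  proof -
   have "q^2 + b^2 > 0" using q by (simp add: add_pos_nonneg)
   then have "t^2 * (q^2 + b^2) = b^2 / (q^2 + b^2)" unfolding t by (simp add: power_divide power2_eq_square[of "q^2 + b^2"])
   then show ?thesis using `q\<^sup>2 + b^2 > 0` by simp
  qed
  then have "t^2 * ?s <= (th n + t^2 * p^2) * kap n x" using th by (auto simp: kap_def add_increasing2 add_divide_distrib)
  then have "(t^2 * ?s) * (norm ?u)^2 <= ((th n + t^2 * p^2) * kap n x) * (norm ?u)^2" by (rule mult_right_mono) simp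
  then have "(norm (fn (t *R opM (phase (w n) p q b) U) x))^2 <= (sqrt (th n + t^2 * p^2) * norm (fn (up n U) x))^2"
   using elim k th by (auto simp: phase_def power_mult_distrib rot_norm mult.assoc split: if_splits)
  then show ?case by (rule power2_le_imp_le) (use th in simp)
 qed
qed (use th(2)[of n] in simp)

text \<open>Let P = U + t J (D - F). In the inclusions the choice of t gives P = q / (q^2 + b^2) D -
  t J F, outside P = U + t p J U - t J F. The four assumptions on l make the defect D - mm P small
  in the dual norm in both phases; the factor sqrt \<theta> is the weight of \<open>dn\<close> in
  the inclusions.\<close>

lemma dual_field_defect:
 assumes A: "bmat (phase (w n) p q b) K" and q: "q > 0" and t: "t = b / (q^2 + b^2)" and g: "fst g > 0" "snd g > 0"
  and l: "abs (1 - snd g / th n * (q / (q^2 + b^2))) <= l" "abs (snd g / th n * t) * sqrt (th n) <= l"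
   "abs (p - fst g) + fst g * abs (t * p) <= l" "fst g * abs t <= l" and D: "D = opM (phase (w n) p q b) U"
 shows "norm (dn n (D - opM (Mg n g) (U + t *R jl (D - F)))) <= 2 * l * (norm (dn n D) + norm U + norm F)"
proof (rule norm_l2_mono3)
 let ?P = "U + t *R jl (D - F)" let ?Z = "D - opM (Mg n g) ?P"
 note M = adm_bmat(1)[OF mtx_adm'[OF g, of n]]
 show "AE x in lborel. norm (fn (dn n ?Z) x) <= l * (norm (fn (dn n D) x) + norm (fn U x) + norm (fn F x))"
  using fn_dn[of n ?Z] fn_dn[of n D] fn_minus[of D "opM (Mg n g) ?P"] fn_opM[OF M, of ?P] fn_plus[of U "t *R jl (D - F)"] fn_scaleR[of t "jl (D - F)"]
   fn_jl[of "D - F"] fn_minus[of D F] fn_opM[OF A, of U, folded D]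
 proof eventually_elim
  case (elim x)
  let ?u = "fn U x" and ?f = "fn F x" and ?d = "fn D x"
  have th: "th n > 0" by (rule th)
  have P: "fn ?P x = ?u + t *R (Jv ?d - Jv ?f)" using elim by (simp add: Jv_lin)
  show ?case
  proof (cases "x : w n")
   case True
   let ?S = "q^2 + b^2" and ?m = "snd g / th n"
   have S: "?S > 0" using q by (simp add: add_pos_nonneg)
   have d: "?d = q *R ?u + b *R Jv ?u" using elim True by (simp add: phase_def rot_vec)
   \<comment> \<open>With S = q^2 + b^2 this is the cancellation of the J-part: 1 - t b = q^2 / S
     and t q = q b / S, so q / S times D factors out.\<close>
   have "q / ?S * q + t * b = 1" using q by (simp add: t power2_eq_square flip: add_divide_distrib)
   then have c: "1 - t * b = q / ?S * q" "t * q = q / ?S * b" by (simp_all add: t)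
   have "fn ?P x = (1 - t * b) *R ?u + (t * q) *R Jv ?u - t *R Jv ?f"
    unfolding P d Jv_lin by (simp add: algebra_simps)
   also have "... = (q / ?S) *R ?d - t *R Jv ?f" unfolding c d scaleR_add_right scaleR_scaleR ..
   finally have P': "fn ?P x = (q / ?S) *R ?d - t *R Jv ?f" .
   have "fn ?Z x = ?d - ?m *R fn ?P x" unfolding elim(3) elim(4) mtx_vec using True by simp
   also have "... = (1 - ?m * (q / ?S)) *R ?d + (?m * t) *R Jv ?f" unfolding P' by (simp add: scaleR_diff_right scaleR_diff_left)
   finally have "norm (fn ?Z x) <= abs (1 - ?m * (q / ?S)) * norm ?d + abs (?m * t) * norm ?f"
    using norm_triangle_ineq[of "(1 - ?m * (q / ?S)) *R ?d" "(?m * t) *R Jv ?f"] by (simp)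
   then have "sqrt (th n) * norm (fn ?Z x) <= abs (1 - ?m * (q / ?S)) * (sqrt (th n) * norm ?d) + (abs (?m * t) * sqrt (th n)) * norm ?f"
    using mult_left_mono[of _ _ "sqrt (th n)"] th by (fastforce simp: algebra_simps)
   also have "... <= l * (sqrt (th n) * norm ?d) + l * norm ?f" using th by (intro add_mono mult_right_mono l) auto
   finally have "sqrt (th n) * norm (fn ?Z x) <= l * (sqrt (th n) * norm ?d + norm ?u + norm ?f)"
    using mult_nonneg_nonneg[OF order_trans[OF abs_ge_zero l(1)] norm_ge_zero[of ?u]] by (simp add: distrib_left)
   moreover have "1 / sqrt (kap n x) = sqrt (th n)" using True th by (simp add: kap_def real_sqrt_divide)
   ultimately show ?thesis using elim(1,2) th by simp
  next
   case False
   have d: "?d = p *R ?u" using elim False by (simp add: phase_def rot_vec)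
   have Z: "fn ?Z x = (p - fst g) *R ?u - (fst g * (t * p)) *R Jv ?u + (fst g * t) *R Jv ?f"
    using elim False Jv_lin(1)[of p ?u 0 ?u] by (simp add: mtx_vec d P algebra_simps)
   have "norm (fn ?Z x) <= abs (p - fst g) * norm ?u + fst g * abs (t * p) * norm ?u + fst g * abs t * norm ?f"
    unfolding Z using norm_triangle_ineq[of "(p - fst g) *R ?u - (fst g * (t * p)) *R Jv ?u" "(fst g * t) *R Jv ?f"]
     norm_triangle_ineq4[of "(p - fst g) *R ?u" "(fst g * (t * p)) *R Jv ?u"] g by (simp add: abs_mult mult.assoc)
   also have "... = (abs (p - fst g) + fst g * abs (t * p)) * norm ?u + (fst g * abs t) * norm ?f" by (simp add: distrib_right)
   also have "... <= l * norm ?u + l * norm ?f" by (intro add_mono mult_right_mono l) auto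
   finally have "norm (fn ?Z x) <= l * (norm ?d + norm ?u + norm ?f)" using mult_nonneg_nonneg[OF order_trans[OF abs_ge_zero l(1)] norm_ge_zero[of ?d]] by (simp add: distrib_left)
   then show ?thesis using elim(1,2) False by (simp add: kap_def)
  qed
 qed
qed (use l(1) in linarith)

lemma ip_up_dn: assumes "f : Cc Om" obtains K where "K >= 0" "!!n y z. abs (ip f y z) <= K * norm (dn n y) * norm (up n z)"
proof -
 obtain K where K: "K >= 0" "!!x. abs (f x) <= K" by (rule Cc_bounded[OF assms]) (rule that)
 have "abs (ip f y z) <= K * norm (dn n y) * norm (up n z)" for n y z
 proof -
  let ?y = "L2of (%x. f x *R fn y x)"
  have "norm (dn n ?y) <= K * norm (dn n y)"
  proof (rule norm_l2_mono[OF _ K(1)])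
   show "AE x in lborel. norm (fn (dn n ?y) x) <= K * norm (fn (dn n y) x)"
    using fn_dn[of n ?y] fn_dn[of n y] fn_L2of[OF sqint_mult_vec[OF assms, of y]]
    by eventually_elim (use ka_pos[of n] in "auto simp: abs_of_pos less_imp_le intro!: divide_right_mono mult_right_mono K(2)")
  qed
  then show ?thesis unfolding ip_inner[OF assms] using order_trans[OF up_dn_le mult_right_mono[OF _ norm_ge_zero]] by blast
 qed
 then show ?thesis using that K(1) by blast
qed

end

context hom
begin

text \<open>The fields \<open>P n\<close> are curl-free with the same weak limit u, and
  \<open>?D n\<close> is nearly the scalar flux of \<open>P n\<close> for the conductivity g.
  Pairing with a corrector of g in two ways, its gradient with \<open>?D n\<close> and its flux with
  \<open>P n\<close>, gives the same limit; this determines d on every square.\<close>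

lemma identification:
 fixes p q b :: "nat => real" and a1 a2 k :: real
 defines "A == %n. phase (w n) (p n) (q n) (b n)" and "g == (a1, a2 + k^2 / a2)"
 assumes pos: "!!n. p n > 0" "!!n. q n > 0" "a1 > 0" "a2 > 0"
  and lim: "p ----> a1" "(%n. th n * q n) ----> a2" "(%n. th n * b n) ----> k" and adm: "!!n. adm n (A n) cc CC"
  and u: "weak_conv (%n. sol Om (A n) F) u" and d: "wstar Om (%n. opM (A n) (sol Om (A n) F)) d"
 shows "u = sol Om (B g) F & wstar Om (%n. opM (A n) (sol Om (A n) F)) (opM (B g) u)"
proof -
 let ?k = "k / (a2\<^sup>2 + k^2)"
 let ?U = "%n. sol Om (A n) F" let ?D = "%n. opM (A n) (?U n)"
 have g: "fst g > 0" "snd g > 0" using pos by (auto simp: g_def add_pos_nonneg)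
 note bm = adm_bmat[OF adm] and dfr = sol_dfree[OF adm, of _ F]
 define t where "t n = b n / ((q n)^2 + (b n)^2)" for n
 \<comment> \<open>The quantity q^2 + b^2 rescaled by \<theta>^2, so that it has a positive limit;
   hence t = O(\<theta>).\<close>
 define S where "S n = (th n * q n)^2 + (th n * b n)^2" for n
 have S0: "a2\<^sup>2 + k^2 ~= 0" using pos(4) by (simp add: add_pos_nonneg less_imp_neq[symmetric])
 have Sl: "S ----> a2\<^sup>2 + k^2" unfolding S_def by (intro tendsto_intros lim)
 have th0: "th n ~= 0" for n using th(2)[of n] by simp
 have Sn: "S n = th n * th n * ((q n)^2 + (b n)^2)" for n by (simp add: S_def power2_eq_square algebra_simps)
 have te: "t n = th n * (th n * b n / S n)" for n using th0[of n] by (simp add: t_def Sn)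
 have t0: "t ----> 0 * ?k" unfolding te by (intro tendsto_intros th(4) lim Sl S0)
 define P where "P n = ?U n + t n *R jl (?D n - F)" for n
 define de1 de2 de3 de4 where "de1 n = abs (1 - snd g / th n * (q n / ((q n)^2 + (b n)^2)))" and "de2 n = abs (snd g / th n * t n) * sqrt (th n)"
  and "de3 n = abs (p n - fst g) + fst g * abs (t n * p n)" and "de4 n = fst g * abs (t n)" for n
 have d1: "de1 ----> (abs (1 - snd g * (a2 / (a2\<^sup>2 + k^2))))"
 proof -
  have e: "de1 = (%n. abs (1 - snd g * (th n * q n / S n)))" using th0 by (intro ext) (simp add: de1_def Sn)
  show ?thesis unfolding e by (intro tendsto_intros lim Sl S0)
 qed
 \<comment> \<open>This fixes the second component of g: it must be (a2^2 + k^2) / a2 for the first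
   defect to vanish.\<close>
 have g2: "snd g * (a2 / (a2\<^sup>2 + k^2)) = 1"
 proof -
  have "snd g = (a2\<^sup>2 + k^2) / a2" using pos(4) by (simp add: g_def power2_eq_square add_divide_distrib)
  then show ?thesis using S0 pos(4) by simp
 qed
 have d2: "de2 ----> (abs (snd g * ?k)) * sqrt 0"
 proof -
  have e: "de2 = (%n. abs (snd g * (th n * b n / S n)) * sqrt (th n))" using th0 by (intro ext) (simp add: de2_def te)
  show ?thesis unfolding e by (intro tendsto_intros lim Sl S0 th(4))
 qed
 have d3: "de3 ----> (abs (a1 - fst g)) + fst g * abs (0 * ?k * a1)" unfolding de3_def by (intro tendsto_intros lim t0)
 have d4: "de4 ----> fst g * abs (0 * ?k)" unfolding de4_def by (intro tendsto_intros t0)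
 define de where "de n = de1 n + de2 n + de3 n + de4 n" for n
 have de0: "de ----> 0" unfolding de_def using tendsto_add[OF tendsto_add[OF tendsto_add[OF d1 d2] d3] d4] unfolding g2 by (simp add: g_def)
 have den: "0 <= de1 n" "0 <= de2 n" "0 <= de3 n" "0 <= de4 n" for n using g th(2)[of n] by (auto simp: de1_def de2_def de3_def de4_def)
 have le: "de1 n <= de n" "de2 n <= de n" "de3 n <= de n" "de4 n <= de n" for n using den[of n] by (simp_all add: de_def)
 obtain cU CD where cU: "!!n. norm (up n (?U n)) <= cU" "!!n. norm (dn n (?D n)) <= CD" using energy[OF adm, of _ F] by blast
 let ?C = "CD + cU + norm F" and ?r = "%n. th n + (t n)^2 * (p n)^2"
 have nU: "norm (?U n) <= cU" for n using order_trans[OF norm_up cU(1)] .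
 have "(%n. norm (P n - ?U n)) ----> 0"
 proof (rule tendsto_sandwich[OF _ _ tendsto_const])
  have "(%n. sqrt (?r n) * cU + abs (t n) * norm F) ----> sqrt (0 + (0 * ?k)^2 * a1\<^sup>2) * cU + abs (0 * ?k) * norm F"
   by (intro tendsto_intros th(4) t0 lim)
  then show "(%n. sqrt (?r n) * cU + abs (t n) * norm F) ----> 0" by simp
  have "norm (P n - ?U n) <= sqrt (?r n) * cU + abs (t n) * norm F" for n
  proof -
   have "norm (P n - ?U n) = norm (t n *R ?D n - t n *R F)" by (simp add: P_def flip: scaleR_diff_right)
   also have "... <= norm (t n *R ?D n) + abs (t n) * norm F" using norm_triangle_ineq4[of "t n *R ?D n" "t n *R F"] by simp
   also have "norm (t n *R ?D n) <= sqrt (?r n) * norm (up n (?U n))"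
    using bm(1)[of n] unfolding A_def by (rule phase_small[OF _ pos(2)]) (simp add: t_def)
   also have "... <= sqrt (?r n) * cU" using th(2)[of n] by (intro mult_left_mono cU) simp
   finally show ?thesis by simp
  qed
  then show "\<forall>\<^sub>F n in sequentially. norm (P n - ?U n) <= sqrt (?r n) * cU + abs (t n) * norm F" by simp
 qed simp
 note PU = this
 have ug: "u : gsp Om" by (rule gsp_weakly_closed[OF sol_gsp[OF bm] u])
 have Pp: "prim P u" unfolding prim_def
 proof (intro conjI ug)
  show "weak_conv P u" by (rule weak_conv_strong[OF PU u])
  obtain K where K: "!!n. norm (norm (P n - ?U n)) <= K" by (rule BseqE[OF convergent_imp_Bseq[OF convergentI[OF PU]]]) blast
  have "norm (P n) <= K + cU" for n using norm_triangle_sub[of "P n" "?U n"] nU[of n] K[of n] by simp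
  moreover have "cfree Om (P n)" for n unfolding P_def
   by (intro cfree_add cfree_scaleR cfree_jl dfr gsp_cfree[OF sol_gsp[OF bm]])
  ultimately show "EX M. ALL n. cfree Om (P n) & norm (P n) <= M" by blast
 qed
 have Dd: "dual ?D d" by (rule sol_dual_prim(1)[OF adm d])
 have key: "(LBINT x. h x * (fn d x \<bullet> m)) = ip h (lc m (et g j)) u" if h: "h : Ccinf (osj j)" for h j m
 proof -
  note hc = osj_Cc[OF h]
  let ?V = "%n. V n g j m" and ?E = "%n. E n g j m"
  have 1: "(%n. ip h (?D n) (?V n)) ----> (LBINT x. h x * (fn d x \<bullet> m))"
   unfolding ip_px[OF h, symmetric] by (rule dual_prim[OF Dd corrector(1)[OF g] sq(1,2) h])
  have 2: "(%n. ip h (?E n) (P n)) ----> ip h (lc m (et g j)) u" by (rule dual_prim[OF corrector(2)[OF g] Pp sq(1,2) h])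
  obtain K where K: "K >= 0" "!!n y z. abs (ip h y z) <= K * norm (dn n y) * norm (up n z)" by (rule ip_up_dn[OF hc]) (rule that)
  let ?cV = "norm (lc m (Fc g j)) / min (fst g) (snd g)"
  have bnd: "norm (ip h (?D n) (?V n) - ip h (?E n) (P n)) <= K * (2 * de n * (?C)) * ?cV" for n
  proof -
   note M = adm_bmat(1)[OF mtx_adm'[OF g, of n]]
   \<comment> \<open>A scalar coefficient can be moved from the corrector to
     \<open>P n\<close>.\<close>
   have "ip h (?E n) (P n) = ip h (opM (Mg n g) (P n)) (?V n)" unfolding ip_def
   proof (rule integral_cong_AE)
    show "AE x in lborel. h x * (fn (?E n) x \<bullet> fn (P n) x) = h x * (fn (opM (Mg n g) (P n)) x \<bullet> fn (?V n) x)"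
     using fn_opM[OF M, of "?V n"] fn_opM[OF M, of "P n"] by eventually_elim (simp add: mtx_vec inner_commute)
   qed (use Ccinf_measurable[OF h] in auto)
   then have "abs (ip h (?D n) (?V n) - ip h (?E n) (P n)) <= K * norm (dn n (?D n - opM (Mg n g) (P n))) * norm (up n (?V n))"
    using K(2)[of "?D n - opM (Mg n g) (P n)" "?V n" n] by (simp add: ip_diff_left[OF hc])
   also have "... <= K * (2 * de n * (?C)) * ?cV"
   proof (intro mult_mono mult_left_mono K energy(1)[OF mtx_adm'[OF g]])
    have "norm (dn n (?D n - opM (Mg n g) (P n))) <= 2 * de n * (norm (dn n (?D n)) + norm (?U n) + norm F)"
     unfolding P_def A_def
     by (rule dual_field_defect[OF bm(1)[unfolded A_def] pos(2) t_def g le[unfolded de1_def de2_def de3_def de4_def] refl])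
    also have "... <= 2 * de n * (?C)" using den[of n] by (intro mult_left_mono add_mono cU nU) (auto simp: de_def)
    finally show "norm (dn n (?D n - opM (Mg n g) (P n))) <= 2 * de n * (?C)" .
    then show "0 <= K * (2 * de n * (?C))" by (intro mult_nonneg_nonneg[OF K(1)]) (rule order_trans[OF norm_ge_zero])
   qed simp_all
   finally show ?thesis by simp
  qed
  have "(%n. K * (2 * de n * (?C)) * ?cV) ----> K * (2 * 0 * (?C)) * ?cV" by (intro tendsto_intros de0)
  from tendsto_eq_rhs[OF this, of 0] have l0: "(%n. K * (2 * de n * (?C)) * ?cV) ----> 0" by simp
  have "(%n. ip h (?D n) (?V n) - ip h (?E n) (P n)) ----> 0"
   by (rule Lim_null_comparison[OF always_eventually l0]) (rule allI, rule bnd)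
  from LIMSEQ_unique[OF this tendsto_diff[OF 1 2]] show ?thesis by simp
 qed
 have dj: "AE x in lborel. x : osj j --> fn d x = Bj g j x *v fn u x" for j
 proof -
  let ?y = "d - opM (Bj g j) u"
  note bj = Bj_bmat[OF g, of j]
  have NNg: "AE x in lborel. x ~: NN g" using NN(1)[OF g] by (rule AE_not_in)
  have z: "(LBINT x. h x * (fn ?y x \<bullet> m)) = 0" if h: "h : Ccinf (osj j)" for h m
  proof -
   note hc = osj_Cc[OF h]
   have "ip h (lc m (et g j)) u = (LBINT x. h x * (fn (opM (Bj g j) u) x \<bullet> m))" unfolding ip_def
   proof (rule integral_cong_AE)
    show "AE x in lborel. h x * (fn (lc m (et g j)) x \<bullet> fn u x) = h x * (fn (opM (Bj g j) u) x \<bullet> m)"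
     using NNg H_lc[of m g j] fn_opM[OF bj, of u]
    proof eventually_elim
     case (elim x)
     show ?case
     proof (cases "x : osj j")
      case True
      then have "Bj g j x = H g j x" using elim by (simp add: Bj_def)
      moreover have "symm (Bj g j x)" using Bj_gs[OF g] by blast
      ultimately show ?thesis using elim unfolding symm_def by simp
     qed (use Ccinf_outside[OF h] in simp)
    qed
   qed (use Ccinf_measurable[OF h] in auto)
   then show ?thesis unfolding inner_const_vec[OF hc, symmetric] inner_diff_left using key[OF h, of m] unfolding inner_const_vec[OF hc, symmetric] by simp
  qed
  have "AE x in lborel. x : osj j --> 0 <= fn ?y x \<bullet> m + fn ?y x \<bullet> 0 + 0" for m by (rule test) (simp add: z)
  from this[of "axis 1 1"] this[of "- axis 1 1"] this[of "axis 2 1"] this[of "- axis 2 1"] fn_minus[of d "opM (Bj g j) u"] fn_opM[OF bj, of u]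
  show ?thesis by eventually_elim (auto simp: inner_axis vec_eq_iff forall_2)
 qed
 have dB: "AE x in lborel. x : Om --> fn d x = fn (opM (B g) u) x"
 proof -
  have "AE x in lborel. ALL j. x : osj j --> fn d x = Bj g j x *v fn u x" unfolding AE_all_countable using dj by blast
  then show ?thesis using fn_opM[OF B_bmat(1)[OF g], of u] by eventually_elim (metis B_cases)
 qed
 have e: "d \<bullet> L2of f = opM (B g) u \<bullet> L2of f" if f: "f : Ccv Om" for f
  unfolding inner_L2of_right[OF Ccv_sqint[OF f]]
 proof (rule integral_cong_AE)
  have "f x = 0" if "x ~: Om" for x unfolding vec_eq_iff using f Cc_outside[of "%x. f x $ _", OF _ that] by (auto simp: Ccv_def)
  then show "AE x in lborel. fn d x \<bullet> f x = fn (opM (B g) u) x \<bullet> f x" using dB by (auto elim!: eventually_mono)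
 qed (use Ccv_sqint[OF f] in auto)
 have w: "wstar Om ?D (opM (B g) u)" using d unfolding wstar_iff by (simp add: e)
 \<comment> \<open>Gradients of test functions are admissible in the weak-star limit, so the
   equation passes from the fluxes to their limit.\<close>
 have "dfree Om (opM (B g) u - F)" unfolding dfree_def
 proof
  fix l assume l: "l : Ccinf Om"
  have "(%n. ?D n \<bullet> grd l) ----> opM (B g) u \<bullet> grd l" using w Ccv_grd[OF l] unfolding wstar_iff grd_def by blast
  moreover have "?D n \<bullet> grd l = F \<bullet> grd l" for n by (rule sol_eq[OF bm gsp_grd[OF l]])
  ultimately show "grd l \<bullet> (opM (B g) u - F) = 0" by (simp add: LIMSEQ_const_iff inner_diff_right inner_commute)
 qed
 then have "is_sol Om (B g) F u" using ug unfolding is_sol_def dfree_gsp by (simp add: inner_diff_right inner_commute)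
 then show ?thesis using w is_sol_unique[OF B_bmat(1,2)[OF g] _ sol[OF B_bmat(1,2)[OF g]]] by blast
qed

end

section \<open>Homogenization\<close>

lemma LIMSEQ_subsequence_principle:
 fixes X :: "nat => 'a::metric_space"
 assumes "!!r :: nat => nat. strict_mono r ==> EX s. strict_mono s & (%n. X (r (s n))) ----> l"
 shows "X ----> l"
proof (rule ccontr)
 assume "\<not> X ----> l"
 then obtain e where e: "e > 0" "!!N. EX n>=N. e <= dist (X n) l" by (auto simp: LIMSEQ_def not_less)
 then have "infinite {n. e <= dist (X n) l}" unfolding infinite_nat_iff_unbounded_le by blast
 then obtain r :: "nat => nat" where r: "strict_mono r" "!!n. e <= dist (X (r n)) l" using infinite_enumerate by blast
 obtain s where s: "(%n. X (r (s n))) ----> l" using assms[OF r(1)] by blast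
 then obtain n where "dist (X (r (s n))) l < e" using metric_LIMSEQ_D[OF s e(1)] by blast
 then show False using r(2)[of "s n"] by simp
qed

lemma strict_mono_compose: "strict_mono (r :: nat => nat) ==> strict_mono s ==> strict_mono (%n. r (s n :: nat))"
 using strict_mono_o[of r s] by (simp add: o_def)

definition addJ :: "(plane => mat2) => real => plane => mat2" where "addJ A b x = A x + b *R Jmat"

lemma addJ_vec: "addJ A b x *v z = A x *v z + b *R Jv z"
 by (simp add: addJ_def matrix_vector_mult_add_rdistrib Jmat_vec flip: scaleR_matrix_vector_assoc)

lemma addJ_bmat: assumes A: "bmat A C" shows "bmat (addJ A b) (C + abs b)"
 unfolding bmat_def
proof (intro conjI allI)
 show "addJ A b : borel_measurable borel" using A unfolding addJ_def[abs_def] bmat_def by (intro borel_measurable_add) auto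
 show "norm (addJ A b t *v z) <= (C + abs b) * norm z" for t z
  using A norm_triangle_ineq[of "A t *v z" "b *R Jv z"] unfolding bmat_def addJ_vec by (auto simp: distrib_right intro: order_trans)
qed (use A in "auto simp: bmat_def")

lemma addJ_coercive: "coercive A c ==> coercive (addJ A b) c"
 by (simp add: coercive_def addJ_vec inner_add_left plane_inner[of "Jv _"])

lemma addJ_opM: assumes A: "bmat A C" shows "opM (addJ A b) z = opM A z + b *R jl z"
proof (rule l2_eqI)
 show "AE t in lborel. fn (opM (addJ A b) z) t = fn (opM A z + b *R jl z) t"
  using fn_opM[OF addJ_bmat[OF A], of b z] fn_opM[OF A, of z] fn_plus[of "opM A z" "b *R jl z"] fn_scaleR[of b "jl z"] fn_jl[of z]
  by eventually_elim (simp add: addJ_vec)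
qed

text \<open>The rotated gradient of one function is orthogonal to the gradients of all others.\<close>

lemma addJ_sol: assumes A: "bmat A C" "coercive A c" shows "sol S (addJ A b) F = sol S A F"
proof (rule is_sol_unique[OF addJ_bmat[OF A(1)] addJ_coercive[OF A(2)] sol[OF addJ_bmat[OF A(1)] addJ_coercive[OF A(2)]]])
 show "is_sol S (addJ A b) F (sol S A F)"
  unfolding is_sol_def addJ_opM[OF A(1)] using sol_gsp[OF A] sol_eq[OF A] by (auto simp: inner_add_left gsp_jl_ortho[OF sol_gsp[OF A]])
qed

context hom
begin

lemma hom_subseq: assumes r: "strict_mono r" shows "hom Om (%n. w (r n)) (%n. th (r n)) a Ma c s px Fc et"
proof (rule hom.intro[OF incl_subseq[OF r]], unfold_locales)
 show "weak_conv (%n. T (r n) g (Fc g j i)) (px j i)" "wstar Om (%n. MT (r n) g (Fc g j i)) (et g j i)"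
  if "fst g > 0" "snd g > 0" for g j i using cor[OF that] r by (auto intro: weak_conv_subseq wstar_subseq)
qed (use sq px in auto)

text \<open>Every subsequence has a further one along which gradients and fluxes converge, and the
  identification always gives the same limits; hence the whole sequence converges.\<close>

lemma convergence:
 fixes p q b :: "nat => real" and a1 a2 k :: real
 defines "A == %n. phase (w n) (p n) (q n) (b n)" and "g == (a1, a2 + k^2 / a2)"
 assumes pos: "!!n. p n > 0" "!!n. q n > 0" "a1 > 0" "a2 > 0"
  and lim: "p ----> a1" "(%n. th n * q n) ----> a2" "(%n. th n * b n) ----> k" and adm: "!!n. adm n (A n) cc CC"
 shows "weak_conv (%n. sol Om (A n) F) (sol Om (B g) F)" "wstar Om (%n. opM (A n) (sol Om (A n) F)) (opM (B g) (sol Om (B g) F))"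
proof -
 let ?U = "%n. sol Om (A n) F" let ?D = "%n. opM (A n) (?U n)" let ?u = "sol Om (B g) F"
 have ex: "EX r'. strict_mono r' & weak_conv (%n. ?U (r (r' n))) ?u & wstar Om (%n. ?D (r (r' n))) (opM (B g) ?u)" if r: "strict_mono (r :: nat => nat)" for r
 proof -
  obtain r1 u where r1: "strict_mono (r1 :: nat => nat)" "weak_conv (%n. ?U (r (r1 n))) u"
   by (rule weak_compactness[of "%n. ?U (r n)", OF sol_norm[OF adm_bmat[OF adm]]]) (rule that)
  interpret I: incl Om "%n. w (r (r1 n))" "%n. th (r (r1 n))" a Ma by (rule incl_subseq[OF strict_mono_compose[OF r r1(1)]])
  have "I.dn n = dn (r (r1 n))" for n by (simp add: I.dn_def dn_def I.kap_def kap_def)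
  then have bd: "norm (I.dn n (?D (r (r1 n)))) <= CC * norm F / cc" for n using energy(2)[OF adm] by simp
  obtain r2 d where r2: "strict_mono (r2 :: nat => nat)" "wstar Om (%n. ?D (r (r1 (r2 n)))) d"
   by (rule I.wstar_compact[of "%n. ?D (r (r1 n))", OF bd]) (rule that)
  let ?t = "%n. r1 (r2 n)"
  have ss: "strict_mono ?t" by (rule strict_mono_compose[OF r1(1) r2(1)])
  have rs: "strict_mono (%n. r (?t n))" by (rule strict_mono_compose[OF r ss])
  interpret J: hom Om "%n. w (r (?t n))" "%n. th (r (?t n))" a Ma c s px Fc et by (rule hom_subseq[OF rs])
  have ad: "J.adm n (A (r (?t n))) cc CC" for n using adm[of "r (?t n)"] unfolding adm_def J.adm_def kap_def J.kap_def .
  have "u = ?u & wstar Om (%n. ?D (r (?t n))) (opM (B g) u)"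
   unfolding g_def A_def
  proof (rule J.identification[where p = "%n. p (r (?t n))" and q = "%n. q (r (?t n))" and b = "%n. b (r (?t n))", OF pos(1) pos(2) pos(3) pos(4)])
   show "(%n. p (r (?t n))) ----> a1" "(%n. th (r (?t n)) * q (r (?t n))) ----> a2" "(%n. th (r (?t n)) * b (r (?t n))) ----> k"
    using lim[THEN LIMSEQ_subseq_LIMSEQ, OF rs] by (simp_all add: o_def)
  qed (use ad weak_conv_subseq[OF r1(2) r2(1)] r2(2) in "simp_all add: A_def")
  then show ?thesis using ss weak_conv_subseq[OF r1(2) r2(1)] by blast
 qed
 show "weak_conv ?U ?u" unfolding weak_conv_def
 proof
  fix v show "(%n. ?U n \<bullet> v) ----> ?u \<bullet> v"
   by (rule LIMSEQ_subsequence_principle) (use ex in "unfold weak_conv_def, blast")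
 qed
 show "wstar Om ?D (opM (B g) ?u)" unfolding wstar_iff
 proof
  fix f assume "f : Ccv Om"
  then show "(%n. ?D n \<bullet> L2of f) ----> opM (B g) ?u \<bullet> L2of f"
   by - (rule LIMSEQ_subsequence_principle, use ex in \<open>unfold wstar_iff, blast\<close>)
 qed
qed

text \<open>l J is the constant antisymmetric part of the host phase, put back at the end: it leaves
  the solutions unchanged and adds to the flux l times the rotated gradient, which converges weakly.
  With k = 0 and l = 0 this is the case without a magnetic field.\<close>

theorem H_convergence:
 fixes p q b :: "nat => real" and a1 a2 k l :: real
 assumes pos: "!!n. p n > 0" "!!n. q n > 0" "a1 > 0" "a2 > 0"
  and lim: "p ----> a1" "(%n. th n * q n) ----> a2" "(%n. th n * b n) ----> k"
 shows "H_converges Om (%n. addJ (phase (w n) (p n) (q n) (b n)) l) (addJ (B (a1, a2 + k^2 / a2)) l)"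
proof -
 let ?A = "%n. phase (w n) (p n) (q n) (b n)" let ?g = "(a1, a2 + k^2 / a2)"
 have g: "fst ?g > 0" "snd ?g > 0" using pos by (auto simp: add_pos_nonneg)
 obtain k1 K1 where 1: "k1 > 0" "!!n. k1 <= p n" "!!n. p n <= K1" by (rule positive_limit_bounds[OF pos(1) lim(1) pos(3)]) (rule that)
 have "!!n. th n * q n > 0" using th(2) pos(2) by simp
 then obtain k2 K2 where 2: "k2 > 0" "!!n. k2 <= th n * q n" "!!n. th n * q n <= K2" by (rule positive_limit_bounds[OF _ lim(2) pos(4)]) (rule that)
 obtain K3 where 3: "!!n. norm (th n * b n) <= K3" by (rule BseqE[OF convergent_imp_Bseq[OF convergentI[OF lim(3)]]]) blast
 have ad: "adm n (?A n) (min k1 k2) (max K1 (K2 + K3))" for n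
 proof (rule phase_adm)
  have "th n * abs (b n) <= K3" using 3[of n] th(2)[of n] by (simp add: abs_mult)
  then show "th n * q n + th n * abs (b n) <= max K1 (K2 + K3)" using 2(3)[of n] by simp
 qed (use 1 2 in "auto simp: min.coboundedI1 min.coboundedI2 max.coboundedI1")
 note bm = adm_bmat[OF ad] and bB = B_bmat(1,2)[OF g]
 show ?thesis
 proof (rule H_convergesI[OF op bd addJ_bmat[OF bm(1)] addJ_coercive[OF bm(2)] addJ_bmat[OF bB(1)] addJ_coercive[OF bB(2)]])
  fix F
  note cv = convergence[OF pos lim ad, of F]
  have "wstar Om (%n. opM (?A n) (sol Om (?A n) F) + l *R jl (sol Om (?A n) F)) (opM (B ?g) (sol Om (B ?g) F) + l *R jl (sol Om (B ?g) F))"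
   unfolding wstar_iff inner_add_left inner_scaleR_left jl_inner
   using cv unfolding wstar_iff weak_conv_def by (intro ballI tendsto_add tendsto_mult_left tendsto_minus) auto
  then show "weak_conv (%n. sol Om (addJ (?A n) l) F) (sol Om (addJ (B ?g) l) F) & 
    wstar Om (%n. opM (addJ (?A n) l) (sol Om (addJ (?A n) l) F)) (opM (addJ (B ?g) l) (sol Om (addJ (B ?g) l) F))"
   using cv(1) by (simp add: addJ_sol[OF bm] addJ_sol[OF bB] addJ_opM[OF bm(1)] addJ_opM[OF bB(1)])
 qed
qed

section \<open>Bounds and Lipschitz dependence of the effective conductivity\<close>

lemma B_M_class:
 assumes g: "fst g > 0" "snd g > 0" and b: "MM g <= b" shows "B g : M_class (min (fst g) (snd g)) b Om"
proof (rule M_classI[OF Om_borel B_meas[OF g]])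
 show "AE x in lborel. x : Om --> (ALL z. min (fst g) (snd g) * (norm z)^2 <= (B g x *v z) \<bullet> z)" using B_gs[OF g] by (auto simp: good_def)
 have "inverse b * (norm (B g x *v z))^2 <= (B g x *v z) \<bullet> z" for x z
 proof -
  have "b > 0" using MM_pos(1)[OF g] b by simp
  have "0 <= (B g x *v z) \<bullet> z" using B_gs[OF g, of x] g unfolding good_def by (meson less_imp_le min_less_iff_conj mult_nonneg_nonneg order_trans zero_le_power2)
  then have "(norm (B g x *v z))^2 <= b * ((B g x *v z) \<bullet> z)"
   using good_bound(1)[OF conjunct1[OF B_gs[OF g, of x]] MM_pos(1)[OF g], of z] mult_right_mono[OF b] by fastforce
  then show ?thesis using `b > 0` by (simp add: inverse_eq_divide pos_divide_le_eq mult.commute)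
 qed
 then show "AE x in lborel. x : Om --> (ALL z. inverse b * (norm (B g x *v z))^2 <= (B g x *v z) \<bullet> z)" by simp
qed (use g in simp)

lemma B_Lipschitz: "locally_Lipschitz_L1 Om B"
 unfolding locally_Lipschitz_L1_def
proof (intro conjI ballI)
 have fin: "integrable (lebesgue_on Om) (%x. k)" for k :: real
  by (subst lebesgue_on_integral(2)[OF Om_borel, of "%x. k * indicator Om x"]) (use Om_int in auto)
 show "integrable (lebesgue_on Om) (B p)" if p: "p : {0<..} \<times> {0<..}" for p
 proof (rule lint_bound[OF fin[of "4 * MM p"]])
  have g: "fst p > 0" "snd p > 0" using p by auto
  show "B p : borel_measurable (lebesgue_on Om)" using B_meas[OF g] by (intro measurable_restrict_space1 measurable_completion) simp
  have "norm (B p x) <= 4 * MM p" for x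
  proof -
   have e: "abs (B p x $ i $ l) <= MM p" for i l
   proof -
    have "abs (B p x $ i $ l) = abs ((B p x *v axis l 1) $ i)" by (simp add: matrix_vector_mul_component inner_axis)
    also have "... <= MM p * norm (axis l (1::real) :: plane)" using B_bmat(1)[OF g] component_le_norm_cart order_trans unfolding bmat_def by blast
    finally show ?thesis by simp
   qed
   have "norm (B p x) <= norm (B p x $ 1) + norm (B p x $ 2)"
    using L2_set_le_sum[of UNIV "%i. norm (B p x $ i)"] by (simp add: norm_vec_def[of "B p x"] sum_2)
   moreover have "norm (B p x $ i) <= MM p + MM p" for i
    using norm_le_l1_cart[of "B p x $ i"] e[of i 1] e[of i 2] unfolding sum_2 by linarith
   from calculation this[of 1] this[of 2] show ?thesis by linarith
  qed
  then show "AE x in lebesgue_on Om. norm (B p x) <= norm (4 * MM p)" using MM_pos(1)[OF g] by simp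
 qed
 let ?I = "%q q'. \<integral>x. mat_norm (B q x - B q' x) \<partial>lebesgue_on Om"
 fix p :: "real \<times> real" assume p: "p : {0<..} \<times> {0<..}"
 \<comment> \<open>The ball of this radius stays away from the axes, so the lower bound k on both
   components and the upper bound on \<open>MM\<close> are uniform on it.\<close>
 define k where "k = min (fst p) (snd p) / 2"
 \<comment> \<open>Chosen so that \<open>2 * k * L\<close> bounds \<open>MM q + MM q'\<close> on the
   ball.\<close>
 define L where "L = (2 * (fst p + k + (snd p + k) * Ma)) / (2 * k)"
 have k: "k > 0" using p by (auto simp: k_def)
 have kL: "2 * k * L = 2 * (fst p + k + (snd p + k) * Ma)" using k by (simp add: L_def)
 have b: "k <= fst q & k <= snd q & MM q <= (fst p + k) + (snd p + k) * Ma & fst q > 0 & snd q > 0" if "q : ball p k" for q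
 proof -
  have "abs (fst p - fst q) < k" "abs (snd p - snd q) < k"
   using that dist_fst_le[of p q] dist_snd_le[of p q] by (auto simp: dist_real_def)
  moreover have "2 * k <= fst p" "2 * k <= snd p" by (auto simp: k_def)
  ultimately have q: "k <= fst q" "k <= snd q" "fst q <= fst p + k" "snd q <= snd p + k" by linarith+
  then show ?thesis using k mult_right_mono[OF q(4) Ma_nonneg] by (auto simp: MM_def)
 qed
 have lip: "?I q q' <= (L * measure lborel Om) * dist q q'" if qq: "q : ball p k" "q' : ball p k" for q q'
 proof -
  have "MM q <= fst p + k + (snd p + k) * Ma" "MM q' <= fst p + k + (snd p + k) * Ma" using b[OF qq(1)] b[OF qq(2)] by blast+
  then have mm: "MM q + MM q' <= 2 * k * L" unfolding kL mult_2[of "_ + _"] by (rule add_mono)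
  have "AE x in lborel. x : Om --> mat_norm (B q x - B q' x) <= L * dist q q'"
   using B_lip[of q q' k "dist q q'"] b[OF qq(1)] b[OF qq(2)] k dist_fst_le[of q q'] dist_snd_le[of q q']
  proof (simp add: dist_real_def, elim eventually_mono, intro impI)
   fix x assume l: "x : Om --> (ALL z. 2 * k * norm ((B q x - B q' x) *v z) <= dist q q' * (MM q + MM q') * norm z)" and x: "x : Om"
   show "mat_norm (B q x - B q' x) <= L * dist q q'" unfolding mat_norm_def
   proof (rule onorm_le)
    fix z
    have "2 * k * norm ((B q x - B q' x) *v z) <= dist q q' * (MM q + MM q') * norm z" using l x by blast
    also have "... <= dist q q' * (2 * k * L) * norm z"
     by (intro mult_right_mono mult_left_mono mm) simp_all
    finally have "2 * k * norm ((B q x - B q' x) *v z) <= 2 * k * (L * dist q q' * norm z)" by (simp add: mult_ac)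
    then show "norm ((B q x - B q' x) *v z) <= L * dist q q' * norm z" using k by simp
   qed
  qed
  then have "AE x in lebesgue. x : Om --> mat_norm (B q x - B q' x) <= L * dist q q'" by (rule AE_completion)
  then have ae: "AE x in lebesgue_on Om. mat_norm (B q x - B q' x) <= L * dist q q'" using Om_borel by (subst AE_restrict_space_iff) auto
  have L0: "0 <= L" unfolding L_def using p k Ma_nonneg by (intro divide_nonneg_nonneg mult_nonneg_nonneg add_nonneg_nonneg) auto
  have "?I q q' <= (\<integral>x. L * dist q q' \<partial>lebesgue_on Om)"
   by (rule integral_mono_AE'[OF fin ae]) (use L0 in simp)
  also have "... = L * dist q q' * measure lborel Om"
   by (subst lebesgue_on_integral(1)[OF Om_borel, of "%x. L * dist q q' * indicator Om x"]) auto
  finally show ?thesis unfolding mult.assoc mult.commute[of "dist q q'"] .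
 qed
 show "EX r>0. EX L. ALL q:ball p r \<inter> {0<..} \<times> {0<..}. ALL q':ball p r \<inter> {0<..} \<times> {0<..}. ?I q q' <= L * dist q q'"
  by (intro exI[of _ k] conjI k exI[of _ "L * measure lborel Om"] ballI lip) (simp_all only: Int_iff)
qed

end

section \<open>From the abstract setting to the data of the theorem\<close>

lemma mat_norm_sigma: "p <= mat_norm (rot p q)"
proof -
 have "norm (rot p q *v (axis 1 1 :: plane)) <= mat_norm (rot p q) * norm (axis 1 (1::real) :: plane)"
  unfolding mat_norm_def by (rule onorm[OF matrix_vector_mul_bounded_linear])
 moreover have "p <= norm (rot p q *v (axis 1 1 :: plane))"
  by (rule power2_le_imp_le) (simp_all add: rot_norm)
 ultimately show ?thesis by simp
qed

lemma sigma_rot: "sigma_h h p q = rot p (h * q)"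
 by (simp add: sigma_h_def rot_def)

text \<open>A Borel version of a is truncated at plus and minus its norm, to be bounded at every
  point. The set W of positive measure rules out a negative norm, for which the truncation would
  fail.\<close>

lemma Linf_representative:
 assumes S: "S : sets borel" and a: "a : Linf S" and W: "W <= S" "W : sets borel" "measure lborel W > 0"
 obtains a' where "a' : borel_measurable borel" "!!x. abs (a' x) <= Linf_norm S a" "AE x in lborel. x : S --> a' x = a x"
proof -
 let ?M = "lebesgue_on S" and ?L = "Linf_norm S a"
 have am: "a : borel_measurable ?M" and fin: "esssup ?M (%x. ereal (abs (a x))) < \<infinity>" using a by (auto simp: Linf_def)
 have "AE x in ?M. abs (a x) <= ?L"
  using esssup_AE[of "%x. ereal (abs (a x))" ?M]
 proof eventually_elim
  case (elim x)
  then show ?case using fin unfolding Linf_norm_def by (cases "esssup ?M (%x. ereal (abs (a x)))") auto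
 qed
 then have ae: "AE x in lborel. x : S --> (abs (a x)) <= ?L"
  using S by (simp add: AE_restrict_space_iff AE_completion_iff)
 have L: "?L >= 0"
 proof (rule ccontr)
  assume "\<not> ?L >= 0"
  have "AE x in lborel. x ~: W" using ae
  proof eventually_elim
   case (elim x)
   then show ?case using `\<not> ?L >= 0` W(1) abs_ge_zero[of "a x"] by force
  qed
  then have "emeasure lborel W = 0" using W(2) AE_iff_null_sets[of W lborel] by (auto simp: null_sets_def)
  then show False using W(3) by (simp add: measure_def)
 qed
 obtain g where g: "g : borel_measurable borel" "AE x in lborel. g x = indicator S x *R a x" by (rule borel_representative[OF S am]) (rule that)
 show ?thesis
 proof (rule that[of "%x. max (- ?L) (min ?L (g x))"])
  show "AE x in lborel. x : S --> max (- ?L) (min ?L (g x)) = a x" using ae g(2) by eventually_elim auto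
 qed (use g(1) L in auto)
qed

theorem theorem2p2:
  fixes \<Omega> :: "(real^2) set" and \<omega> :: "nat \<Rightarrow> (real^2) set" and a :: "real^2 \<Rightarrow> real"
    and h \<alpha>\<^sub>1 \<alpha>\<^sub>2 \<beta>\<^sub>1 \<beta>\<^sub>2 :: real and \<theta> :: "nat \<Rightarrow> real"
  assumes "open \<Omega>" and "bounded \<Omega>" and "measure lebesgue (frontier \<Omega>) = 0"
    and "\<And>n. open (\<omega> n)" and "\<And>n. \<omega> n \<subseteq> \<Omega>"
    and "\<And>n. \<theta> n = measure lebesgue (\<omega> n)"
    and "\<And>n. 0 < \<theta> n" and "\<And>n. \<theta> n < 1" and "\<theta> \<longlonglongrightarrow> 0"
    and "a \<in> Linf \<Omega>"
    and "weakstar_conv_M \<Omega> (\<lambda>n x. indicator (\<omega> n) x / \<theta> n) a"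
    and "\<alpha>\<^sub>1 > 0" and "\<alpha>\<^sub>2 > 0" and "(\<beta>\<^sub>1, \<beta>\<^sub>2) \<noteq> (0, 0)"
  shows "\<exists>(r :: nat \<Rightarrow> nat) (\<sigma>0 :: real \<times> real \<Rightarrow> real^2 \<Rightarrow> real^2^2).
           strict_mono r \<and>
           locally_Lipschitz_L1 \<Omega> \<sigma>0 \<and>
           (\<forall>\<gamma>\<^sub>1 > 0. \<forall>\<gamma>\<^sub>2 > 0.
              \<sigma>0 (\<gamma>\<^sub>1, \<gamma>\<^sub>2) \<in> M_class (min \<gamma>\<^sub>1 \<gamma>\<^sub>2)
                (2 * (mat_norm (sigma_h h \<gamma>\<^sub>1 \<beta>\<^sub>1) + mat_norm (sigma_h h \<gamma>\<^sub>2 \<beta>\<^sub>2) * Linf_norm \<Omega> a)) \<Omega>) \<and>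
           homogenized_conductivity_0 \<Omega> (\<omega> \<circ> r) \<sigma>0 \<and>
           H_converges \<Omega>
             (\<lambda>k. two_phase (\<omega> (r k)) (sigma_h h \<alpha>\<^sub>1 \<beta>\<^sub>1) ((1 / \<theta> (r k)) *\<^sub>R sigma_h h \<alpha>\<^sub>2 \<beta>\<^sub>2))
             (\<lambda>x. \<sigma>0 (\<alpha>\<^sub>1, \<alpha>\<^sub>2 + inverse \<alpha>\<^sub>2 * \<beta>\<^sub>2\<^sup>2 * h\<^sup>2) x + (h * \<beta>\<^sub>1) *\<^sub>R Jmat)"
proof -
 note op = assms(1) and bd = assms(2) and \<omega> = assms(4,5) and \<theta> = assms(6-9) and ab = assms(12,13)
 have \<Omega>b: "\<Omega> : sets borel" and \<omega>b: "!!n. \<omega> n : sets borel" using op \<omega> by auto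
 have \<theta>': "\<theta> n = measure lborel (\<omega> n)" for n using \<theta>(1) \<omega>b by simp
 have p0: "0 < measure lborel (\<omega> 0)" using \<theta>(2)[of 0] \<theta>'[of 0] by simp
 let ?Ma = "Linf_norm \<Omega> a" and ?i = "%n x. indicator (\<omega> n) x / \<theta> n" and ?n = "%g b. mat_norm (sigma_h h g b)"
 obtain a' where a': "a' : borel_measurable borel" "!!x. abs (a' x) <= ?Ma" "AE x in lborel. x : \<Omega> --> a' x = a x"
  by (rule Linf_representative[OF \<Omega>b assms(10) \<omega>(2) \<omega>b p0]) (rule that)
 interpret I: incl \<Omega> \<omega> \<theta> a' ?Ma
 proof
  fix f assume f: "f : Cc \<Omega>"
  have m: "f : borel_measurable borel ==> f : borel_measurable (lebesgue_on \<Omega>)" for f :: "plane => real"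
   by (intro measurable_restrict_space1 measurable_completion) simp
  note fm = Cc_measurable[OF f] and f0 = Cc_outside[OF f]
  have 1: "(\<integral>x. f x *R ?i n x \<partial>lebesgue_on \<Omega>) = (LBINT x. f x * ?i n x)" for n
  proof (rule lebesgue_on_integral(1)[OF \<Omega>b])
   show "AE x in lborel. f x * ?i n x = indicator \<Omega> x *R f x *R ?i n x"
    by (rule AE_I2) (use f0 in "auto simp: indicator_def")
  qed (use fm \<omega>b[of n] in "auto intro!: m")
  have 2: "(\<integral>x. f x *R a x \<partial>lebesgue_on \<Omega>) = (LBINT x. f x * a' x)"
  proof (rule lebesgue_on_integral(1)[OF \<Omega>b])
   show "AE x in lborel. f x * a' x = indicator \<Omega> x *R f x *R a x"
    using a'(3) by eventually_elim (use f0 in "auto simp: indicator_def")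
   show "(%x. f x *R a x) : borel_measurable (lebesgue_on \<Omega>)" using m[OF fm] assms(10) by (intro borel_measurable_scaleR) (auto simp: Linf_def)
  qed (use fm a'(1) in auto)
  show "(%n. LBINT x. f x * ?i n x) ----> (LBINT x. f x * a' x)"
   using bspec[OF conjunct2[OF conjunct2[OF assms(11)[unfolded weakstar_conv_M_def]]] f] unfolding 1 2 .
 qed (fact op bd \<omega> \<theta>' \<theta>(2-4) a'(1,2))+
 have "\<omega> 0 ~= {}" using \<theta>(2)[of 0] \<theta>'[of 0] by auto
 then have "\<Omega> ~= {}" using \<omega>(2)[of 0] by auto
 then obtain c s \<psi> where cs: "!!j::nat. s j > 0" "!!j. sqr (c j) (s j) <= \<Omega>" "!!j. \<psi> j : Ccinf \<Omega>" "!!j x. x : osq (c j) (s j) ==> \<psi> j x = 1"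
   "!!x. x : \<Omega> ==> EX j. x : osq (c j) (s j)"
  by (rule square_cover[OF op]) (rule that)
 \<comment> \<open>The coordinate functions, cut off near the j-th square, provide countably many
   gradients that equal the unit vectors there.\<close>
 define px where "px j i = grd (%x. x $ i * \<psi> j x)" for j and i :: 2
 have xC: "(%x. x $ i * \<psi> j x) : Ccinf \<Omega>" for i j by (rule Ccinf_mult_left[OF cs(3)]) (rule Ck_coord)
 have px: "AE x in lborel. x : osq (c j) (s j) --> fn (px j i) x = axis i 1" for j i
  using fn_L2of[OF cgrad_sqint[OF xC[of i j]]] unfolding px_def grd_def
  by eventually_elim (use cutoff_gradient(2)[OF cs(3,4)] in auto)
 let ?P = "range (%(j, i). px j i)"
 have P: "countable ?P" "?P <= gsp \<Omega>" using gsp_grd[OF xC] by (auto simp: px_def)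
 obtain r where r: "strict_mono (r :: nat => nat)"
  "!!g p. fst g > 0 ==> snd g > 0 ==> p : ?P ==> EX F \<eta>. F : gsp \<Omega> & weak_conv (%n. I.T (r n) g F) p & wstar \<Omega> (%n. I.MT (r n) g F) \<eta>"
  by (rule I.correctors_extraction[OF P]) (rule that)
 \<comment> \<open>Corrector datum and limit flux are chosen together as a pair, so that they become
   functions of the conductivity, the square and the direction.\<close>
 define Q where "Q g j i z = (weak_conv (%n. I.T (r n) g (fst z)) (px j i) & wstar \<Omega> (%n. I.MT (r n) g (fst z)) (snd z))" for g j i z
 define z where "z g j i = (SOME z. Q g j i z)" for g j i
 have z: "Q g j i (z g j i)" if "fst g > 0" "snd g > 0" for g j i
  unfolding z_def by (rule someI_ex) (use r(2)[OF that, of "px j i"] in "auto simp: Q_def")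
 interpret H: hom \<Omega> "%n. \<omega> (r n)" "%n. \<theta> (r n)" a' ?Ma c s px "%g j i. fst (z g j i)" "%g j i. snd (z g j i)"
  by (rule hom.intro[OF I.incl_subseq[OF r(1)]], unfold_locales) (use cs px z in "auto simp: Q_def")
 have tr: "\<theta> (r n) = measure lborel (\<omega> (r n))" "\<theta> (r n) > 0" for n using \<theta>' \<theta>(2) by auto
 have "H.B (x, y) : M_class (min x y) (2 * (?n x \<beta>\<^sub>1 + ?n y \<beta>\<^sub>2 * ?Ma)) \<Omega>"
  if g: "x > 0" "y > 0" for x y
 proof -
  have n: "x <= ?n x \<beta>\<^sub>1" "y <= ?n y \<beta>\<^sub>2" by (simp_all add: sigma_rot mat_norm_sigma)
  have "H.MM (x, y) <= ?n x \<beta>\<^sub>1 + ?n y \<beta>\<^sub>2 * ?Ma"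
   unfolding H.MM_def using n mult_right_mono[OF n(2) I.Ma_nonneg] by simp
  \<comment> \<open>The bound obtained is half of the required one.\<close>
  also have "... <= 2 * ..." using n g I.Ma_nonneg by simp
  finally show ?thesis using H.B_M_class[of "(x, y)"] g by simp
 qed
 moreover have "homogenized_conductivity_0 \<Omega> (\<omega> \<circ> r) H.B"
  unfolding homogenized_conductivity_0_def
 proof (intro allI impI, elim conjE)
  fix x y :: real and X Y :: "nat => real"
  assume c: "0 < x" "0 < y" and g: "ALL n. 0 < X n & 0 < Y n" and l: "X ----> x" "(%n. measure lebesgue ((\<omega> \<circ> r) n) * Y n) ----> y"
  \<comment> \<open>Without a magnetic field b = 0, hence k = 0, and nothing is put back.\<close>
  have "H_converges \<Omega> (%n. addJ (phase (\<omega> (r n)) (X n) (Y n) 0) 0) (addJ (H.B (x, y + 0^2 / y)) 0)"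
   by (rule H.H_convergence) (use c g l \<omega>b in "simp_all add: tr(1)")
  moreover have "addJ (phase (\<omega> (r n)) (X n) (Y n) 0) 0 = two_phase ((\<omega> \<circ> r) n) (X n *R mat 1) (Y n *R mat 1)" for n
   by (auto simp: fun_eq_iff addJ_def phase_def rot_def two_phase_def)
  moreover have "addJ (H.B (x, y + 0^2 / y)) 0 = H.B (x, y)" by (simp add: fun_eq_iff addJ_def)
  ultimately show "H_converges \<Omega> (%n. two_phase ((\<omega> \<circ> r) n) (X n *R mat 1) (Y n *R mat 1)) (H.B (x, y))" by simp
 qed
 moreover have "H_converges \<Omega>
      (%k. two_phase (\<omega> (r k)) (sigma_h h \<alpha>\<^sub>1 \<beta>\<^sub>1) ((1 / \<theta> (r k)) *R sigma_h h \<alpha>\<^sub>2 \<beta>\<^sub>2))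
      (%x. H.B (\<alpha>\<^sub>1, \<alpha>\<^sub>2 + inverse \<alpha>\<^sub>2 * \<beta>\<^sub>2\<^sup>2 * h^2) x + (h * \<beta>\<^sub>1) *R Jmat)"
 proof -
  \<comment> \<open>Subtracting the constant h \<beta>1 J of the host phase everywhere leaves this
    coefficient of J in the inclusions; its product with \<theta> tends to h \<beta>2, the value of
    k.\<close>
  let ?b = "%n. h * \<beta>\<^sub>2 / \<theta> (r n) - h * \<beta>\<^sub>1"
  have \<theta>n: "\<theta> (r n) ~= 0" for n using tr(2)[of n] by simp
  have "H_converges \<Omega> (%n. addJ (phase (\<omega> (r n)) \<alpha>\<^sub>1 (\<alpha>\<^sub>2 / \<theta> (r n)) (?b n)) (h * \<beta>\<^sub>1)) (addJ (H.B (\<alpha>\<^sub>1, \<alpha>\<^sub>2 + (h * \<beta>\<^sub>2)^2 / \<alpha>\<^sub>2)) (h * \<beta>\<^sub>1))"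
  proof (rule H.H_convergence)
   have "(%n. h * \<beta>\<^sub>2 - \<theta> (r n) * (h * \<beta>\<^sub>1)) ----> h * \<beta>\<^sub>2 - 0 * (h * \<beta>\<^sub>1)" by (intro tendsto_intros H.th(4))
   then show "(%n. \<theta> (r n) * ?b n) ----> h * \<beta>\<^sub>2" using \<theta>n by (simp add: right_diff_distrib)
  qed (use ab tr(2) \<theta>n in auto)
  moreover have "addJ (phase (\<omega> (r n)) \<alpha>\<^sub>1 (\<alpha>\<^sub>2 / \<theta> (r n)) (?b n)) (h * \<beta>\<^sub>1) = two_phase (\<omega> (r n)) (sigma_h h \<alpha>\<^sub>1 \<beta>\<^sub>1) ((1 / \<theta> (r n)) *R sigma_h h \<alpha>\<^sub>2 \<beta>\<^sub>2)" for n
   by (auto simp: fun_eq_iff addJ_def phase_def rot_def two_phase_def sigma_h_def scaleR_add_right scaleR_diff_left)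
  moreover have "\<alpha>\<^sub>2 + (h * \<beta>\<^sub>2)^2 / \<alpha>\<^sub>2 = \<alpha>\<^sub>2 + inverse \<alpha>\<^sub>2 * \<beta>\<^sub>2\<^sup>2 * h^2" by (simp add: power_mult_distrib divide_inverse mult_ac)
  ultimately show ?thesis by (simp add: addJ_def[abs_def])
 qed
 ultimately show ?thesis using r(1) H.B_Lipschitz by (intro exI[of _ r] exI[of _ H.B]) blast
qed

end
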